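(* Let $n\geq 2$, and let $L$ be a Lie superalgebra over a field $\mathbb F$ of characteristic zero graded by the root system $\mathrm A(n,n)$. Then there is a unital associative superalgebra $A$ over $\mathbb F$ such that $L$ is centrally isogenous to $$\mathfrak{sl}_{n+1,n+1}(A)=[\mathfrak{gl}(n+1,n+1)\otimes A,\ \mathfrak{gl}(n+1,n+1)\otimes A].$$ Conversely, for any unital associative superalgebra $A$ over $\mathbb F$, any Lie superalgebra centrally isogenous to $\mathfrak{sl}_{n+1,n+1}(A)$ is $\mathrm A(n,n)$-graded.
   Context: Unital algebras are understood to be nonzero ($1\ne0$). Index rows and columns of $2(n+1)\times 2(n+1)$ matrices by $\mathcal I=\{1,\dots,n+1,\overline 1,\dots,\overline{n+1}\}$, with parities $|1|=\dots=|n+1|=0$, $|\overline 1|=\dots=|\overline{n+1}|=1$; the matrix unit $e_{ij}$ has parity $|i|+|j|$. $\mathfrak{gl}(n+1,n+1)$ is the Lie superalgebra of all such matrices over $\mathbb F$ under the supercommutator $[X,Y]=XY-(-1)^{|X||Y|}YX$; $\mathfrak{sl}(n+1,n+1)$ is its subsuperalgebra of supertrace-zero matrices, whose center is spanned by the identity matrix $z$; and $\mathfrak g=\mathfrak{psl}(n+1,n+1)=\mathfrak{sl}(n+1,n+1)/\mathbb Fz$. For an associative superalgebra $A$, $\mathfrak{gl}(n+1,n+1)\otimes A$ is the Lie superalgebra given by the supercommutator on the associative superalgebra with product $(X\otimes a)(Y\otimes b)=(-1)^{|a||Y|}XY\otimes ab$ for homogeneous elements (so $[e_{ij}\otimes a,e_{jk}\otimes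 b]=(-1)^{|a|(|j|+|k|)}e_{ik}\otimes ab$ for distinct $i,j,k$). Let $\mathfrak h$ be the Cartan subalgebra of $\mathfrak g$ of classes of diagonal matrices; each element of $\mathfrak h$ is uniquely the class of a diagonal matrix $\mathrm{diag}(a_1,\dots,a_{n+1},a_{\overline 1},\dots,a_{\overline{n+1}})$ with $a_1+\dots+a_{n+1}=0=a_{\overline 1}+\dots+a_{\overline{n+1}}$, and $\varepsilon_i\in\mathfrak h^*$ takes it to $a_i$. The root system of type $\mathrm A(n,n)$ is $\Delta=\{\varepsilon_i-\varepsilon_j\mid i\neq j,\ i,j\in\mathcal I\}$. A central extension of a Lie superalgebra $L$ is a surjective (parity-preserving) homomorphism $\pi:\widetilde L\to L$ with kernel in the center of $\widetilde L$; if $\widetilde L=[\widetilde L,\widetilde L]$ then it is called a (central) cover of $L$. Each perfect Lie superalgebra has a unique universal cover (universal central extension). Two perfect Lie superalgebras $L_1,L_2$ are centrally isogenous if their universal central extensions are isomorphic, equivalently if $L_1/Z(L_1)\cong L_2/Z(L_2)$, where $Z$ denotes the center. A Lie superalgebra $L$ over $\mathbb F$ is $\mathrm A(n,n)$-graded (graded by the root system $\mathrm A(n,n)$) if: (1) $L$ contains as a subsuperalgebra a central cover $\widetilde{\mathfrak g}$ of $\mathfrak g$ (the grading subsuperalgebra); (2) $L=\bigoplus_{\alpha\in\Delta\cup\{0\}}L_\alpha$, where $L_\alpha=\{x\in L\mid [h,x]=\alpha(h)x\ \ \forall h\in\overline{\mathfrak h}\}$; here $\overline{\mathfrak g}_{\bar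 0}$ is the unique subalgebra of $\widetilde{\mathfrak g}_{\bar 0}$ that projects isomorphically onto $\mathfrak g_{\bar 0}$ under the cover map, and $\overline{\mathfrak h}$ is the Cartan subalgebra of $\overline{\mathfrak g}_{\bar 0}$ that projects isomorphically onto $\mathfrak h$ (so $\Delta$ is viewed in $\overline{\mathfrak h}^*$); (3) $L_0=\sum_{\alpha\in\Delta}[L_\alpha,L_{-\alpha}]$. *)

theory Defs
  imports
    "HOL-Algebra.Module"
    "HOL-Algebra.QuotRing"
    "HOL-Library.Z2"
    "HOL-Library.Cardinality"
begin

section \<open>Superalgebras over a field\<close>

text \<open>
  The ground field is a type of class \<^class>\<open>field\<close>; parities are elements of \<^typ>\<open>bit\<close>.
  One record type serves for associative and for Lie superalgebras: the product
  \<open>\<otimes>\<close> is the associative product in the first case and the Lie bracket in the second, where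
  the entry \<open>\<one>\<close> of the record has no meaning and is never used.
\<close>

record ('f, 'v) superalgebra = "('f, 'v) module" +
  hcomp :: "bit \<Rightarrow> 'v set"

definition scalars :: "('f :: field) ring" where
  "scalars = \<lparr>carrier = UNIV, monoid.mult = (*), one = 1, zero = 0, add = (+)\<rparr>"

text \<open>The sign $(-1)^p$.\<close>

definition psign :: "bit \<Rightarrow> 'f :: field" where
  "psign p = (if p = 0 then 1 else - 1)"

locale superalgebra = module scalars A for A :: "('f :: field, 'v) superalgebra" (structure) +
  assumes hcomp_submodule: "submodule (hcomp A p) scalars A"
    and hcomp_disjoint: "hcomp A 0 \<inter> hcomp A 1 = {\<zero>}"
    and hcomp_sum: "hcomp A 0 <+> hcomp A 1 = carrier A"
    and mult_closed: "\<lbrakk>x \<in> carrier A; y \<in> carrier A\<rbrakk> \<Longrightarrow> x \<otimes> y \<in> carrier A"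
    and mult_add_left: "\<lbrakk>x \<in> carrier A; y \<in> carrier A; z \<in> carrier A\<rbrakk>
          \<Longrightarrow> (x \<oplus> y) \<otimes> z = x \<otimes> z \<oplus> y \<otimes> z"
    and mult_add_right: "\<lbrakk>x \<in> carrier A; y \<in> carrier A; z \<in> carrier A\<rbrakk>
          \<Longrightarrow> z \<otimes> (x \<oplus> y) = z \<otimes> x \<oplus> z \<otimes> y"
    and mult_smult_left: "\<lbrakk>x \<in> carrier A; y \<in> carrier A\<rbrakk> \<Longrightarrow> (c \<odot> x) \<otimes> y = c \<odot> (x \<otimes> y)"
    and mult_smult_right: "\<lbrakk>x \<in> carrier A; y \<in> carrier A\<rbrakk> \<Longrightarrow> x \<otimes> (c \<odot> y) = c \<odot> (x \<otimes> y)"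
    and mult_graded: "\<lbrakk>x \<in> hcomp A p; y \<in> hcomp A q\<rbrakk> \<Longrightarrow> x \<otimes> y \<in> hcomp A (p + q)"

locale unital_assoc_superalgebra = superalgebra +
  assumes mult_assoc: "\<lbrakk>x \<in> carrier A; y \<in> carrier A; z \<in> carrier A\<rbrakk>
          \<Longrightarrow> (x \<otimes> y) \<otimes> z = x \<otimes> (y \<otimes> z)"
    and one_in_carrier: "\<one> \<in> carrier A"
    and one_left: "x \<in> carrier A \<Longrightarrow> \<one> \<otimes> x = x"
    and one_right: "x \<in> carrier A \<Longrightarrow> x \<otimes> \<one> = x"
    and one_neq_zero: "\<one> \<noteq> \<zero>"

text \<open>
  In characteristic zero, super skew-symmetry and the super Jacobi identity are all that is needed.
\<close>

locale lie_superalgebra = superalgebra +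
  assumes super_skew: "\<lbrakk>x \<in> hcomp A p; y \<in> hcomp A q\<rbrakk>
          \<Longrightarrow> x \<otimes> y = \<ominus> (psign (p * q) \<odot> (y \<otimes> x))"
    and super_jacobi: "\<lbrakk>x \<in> hcomp A p; y \<in> hcomp A q; z \<in> hcomp A r\<rbrakk>
          \<Longrightarrow> x \<otimes> (y \<otimes> z) = (x \<otimes> y) \<otimes> z \<oplus> psign (p * q) \<odot> (y \<otimes> (x \<otimes> z))"

definition lspan :: "('f :: field, 'v) superalgebra \<Rightarrow> 'v set \<Rightarrow> 'v set" where
  "lspan L S = \<Inter> {H. submodule H scalars L \<and> S \<subseteq> H}"

definition super_restrict :: "('f, 'v) superalgebra \<Rightarrow> 'v set \<Rightarrow> ('f, 'v) superalgebra" where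
  "super_restrict L S = L\<lparr>carrier := S, hcomp := (\<lambda>p. hcomp L p \<inter> S)\<rparr>"

definition subsuperalgebra :: "'v set \<Rightarrow> ('f :: field, 'v) superalgebra \<Rightarrow> bool" where
  "subsuperalgebra S L \<longleftrightarrow> submodule S scalars L
     \<and> (\<forall>x\<in>S. \<forall>y\<in>S. x \<otimes>\<^bsub>L\<^esub> y \<in> S)
     \<and> (hcomp L 0 \<inter> S) <+>\<^bsub>L\<^esub> (hcomp L 1 \<inter> S) = S"

text \<open>The quotient by a graded two-sided ideal \<open>I\<close>, carried by the cosets of \<open>I\<close>.\<close>

definition super_quot :: "('f, 'v) superalgebra \<Rightarrow> 'v set \<Rightarrow> ('f, 'v set) superalgebra" where
  "super_quot L I =
     \<lparr>carrier = a_rcosets\<^bsub>L\<^esub> I, monoid.mult = rcoset_mult L I, one = I +>\<^bsub>L\<^esub> \<one>\<^bsub>L\<^esub>,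
      zero = I, add = set_add L,
      smult = (\<lambda>c X. \<Union>x\<in>X. I +>\<^bsub>L\<^esub> (c \<odot>\<^bsub>L\<^esub> x)),
      hcomp = (\<lambda>p. (\<lambda>x. I +>\<^bsub>L\<^esub> x) ` hcomp L p)\<rparr>"

text \<open>Parity-preserving homomorphisms (not required to respect \<open>\<one>\<close>).\<close>

definition super_hom ::
    "('f, 'v) superalgebra \<Rightarrow> ('f, 'w) superalgebra \<Rightarrow> ('v \<Rightarrow> 'w) set" where
  "super_hom L M = {f. f \<in> hom (add_monoid L) (add_monoid M) \<and> f \<in> hom L M
     \<and> (\<forall>c. \<forall>x\<in>carrier L. f (c \<odot>\<^bsub>L\<^esub> x) = c \<odot>\<^bsub>M\<^esub> f x)
     \<and> (\<forall>p. f ` hcomp L p \<subseteq> hcomp M p)}"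

definition super_isomorphic ::
    "('f, 'v) superalgebra \<Rightarrow> ('f, 'w) superalgebra \<Rightarrow> bool" where
  "super_isomorphic L M \<longleftrightarrow> (\<exists>f\<in>super_hom L M. bij_betw f (carrier L) (carrier M))"


section \<open>Central extensions and central isogeny\<close>

definition derived :: "('f :: field, 'v) superalgebra \<Rightarrow> 'v set" where
  "derived L = lspan L {x \<otimes>\<^bsub>L\<^esub> y | x y. x \<in> carrier L \<and> y \<in> carrier L}"

definition perfect :: "('f :: field, 'v) superalgebra \<Rightarrow> bool" where
  "perfect L \<longleftrightarrow> derived L = carrier L"

definition lie_center :: "('f, 'v) superalgebra \<Rightarrow> 'v set" where
  "lie_center L = {x \<in> carrier L. \<forall>y\<in>carrier L. x \<otimes>\<^bsub>L\<^esub> y = \<zero>\<^bsub>L\<^esub>}"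

definition central_extension ::
    "('f, 'v) superalgebra \<Rightarrow> ('f, 'w) superalgebra \<Rightarrow> ('v \<Rightarrow> 'w) \<Rightarrow> bool" where
  "central_extension M L \<pi> \<longleftrightarrow> \<pi> \<in> super_hom M L \<and> \<pi> ` carrier M = carrier L
     \<and> a_kernel M L \<pi> \<subseteq> lie_center M"

definition central_cover ::
    "('f :: field, 'v) superalgebra \<Rightarrow> ('f, 'w) superalgebra \<Rightarrow> ('v \<Rightarrow> 'w) \<Rightarrow> bool" where
  "central_cover M L \<pi> \<longleftrightarrow> central_extension M L \<pi> \<and> perfect M"

text \<open>
  Two perfect Lie superalgebras are centrally isogenous if their universal central extensions are
  isomorphic, equivalently if $L_1/Z(L_1) \cong L_2/Z(L_2)$. The second form is taken here, as the
  universal property of the first quantifies over Lie superalgebras on arbitrary types.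
\<close>

definition centrally_isogenous ::
    "('f :: field, 'v) superalgebra \<Rightarrow> ('f, 'w) superalgebra \<Rightarrow> bool" where
  "centrally_isogenous L\<^sub>1 L\<^sub>2 \<longleftrightarrow> perfect L\<^sub>1 \<and> perfect L\<^sub>2
     \<and> super_isomorphic (super_quot L\<^sub>1 (lie_center L\<^sub>1)) (super_quot L\<^sub>2 (lie_center L\<^sub>2))"


section \<open>Supercommutators and matrix superalgebras\<close>

definition hpart :: "('f, 'v) superalgebra \<Rightarrow> bit \<Rightarrow> 'v \<Rightarrow> 'v" where
  "hpart A p x = (THE y. y \<in> hcomp A p \<and> x \<ominus>\<^bsub>A\<^esub> y \<in> hcomp A (p + 1))"

definition supercommutator :: "('f :: field, 'v) superalgebra \<Rightarrow> 'v \<Rightarrow> 'v \<Rightarrow> 'v" where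
  "supercommutator A x y = (\<Oplus>\<^bsub>A\<^esub>p \<in> UNIV. \<Oplus>\<^bsub>A\<^esub>q \<in> UNIV.
     hpart A p x \<otimes>\<^bsub>A\<^esub> hpart A q y
       \<ominus>\<^bsub>A\<^esub> psign (p * q) \<odot>\<^bsub>A\<^esub> (hpart A q y \<otimes>\<^bsub>A\<^esub> hpart A p x))"

definition commutator_superalgebra ::
    "('f :: field, 'v) superalgebra \<Rightarrow> ('f, 'v) superalgebra" where
  "commutator_superalgebra A = A\<lparr>monoid.mult := supercommutator A\<rparr>"

text \<open>
  The index set $\{1,\dots,n+1,\overline 1,\dots,\overline{n+1}\}$ is the type \<open>'n + 'n\<close> with
  \<open>CARD('n) = n + 1\<close>; \<^const>\<open>Inl\<close> gives the unbarred (even) and \<^const>\<open>Inr\<close> the barred (odd)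
  indices.
\<close>

type_synonym ('n, 'a) smat = "'n + 'n \<Rightarrow> 'n + 'n \<Rightarrow> 'a"

definition ipar :: "'n + 'n \<Rightarrow> bit" where
  "ipar i = (case i of Inl _ \<Rightarrow> 0 | Inr _ \<Rightarrow> 1)"

text \<open>The linear map $a \mapsto (-1)^{p|a|} a$.\<close>

definition twist :: "('f :: field, 'a) superalgebra \<Rightarrow> bit \<Rightarrow> 'a \<Rightarrow> 'a" where
  "twist A p a = (\<Oplus>\<^bsub>A\<^esub>q \<in> UNIV. psign (p * q) \<odot>\<^bsub>A\<^esub> hpart A q a)"

text \<open>
  The associative superalgebra of matrices over the ground field, tensored with \<open>A\<close>, with product
  $(X \otimes a)(Y \otimes b) = (-1)^{|a||Y|} XY \otimes ab$. Its elements are written in the basis of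
  matrix units: the matrix \<open>M\<close> stands for $\sum_{i,j} e_{ij} \otimes M_{ij}$, so that $X \otimes a$ is
  the matrix with entries $X_{ij} a$. The product rule then reads
  $(MN)_{ik} = \sum_j (-1)^{|M_{ij}|(|j|+|k|)} M_{ij} N_{jk}$ for homogeneous entries.
\<close>

definition mat_superalgebra ::
    "('f :: field, 'a) superalgebra \<Rightarrow> ('f, ('n :: finite, 'a) smat) superalgebra" where
  "mat_superalgebra A =
     \<lparr>carrier = {M. \<forall>i j. M i j \<in> carrier A},
      monoid.mult = (\<lambda>M N i k. \<Oplus>\<^bsub>A\<^esub>j \<in> UNIV. twist A (ipar j + ipar k) (M i j) \<otimes>\<^bsub>A\<^esub> N j k),
      one = (\<lambda>i j. if i = j then \<one>\<^bsub>A\<^esub> else \<zero>\<^bsub>A\<^esub>),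
      zero = (\<lambda>i j. \<zero>\<^bsub>A\<^esub>),
      add = (\<lambda>M N i j. M i j \<oplus>\<^bsub>A\<^esub> N i j),
      smult = (\<lambda>c M i j. c \<odot>\<^bsub>A\<^esub> M i j),
      hcomp = (\<lambda>p. {M. \<forall>i j. M i j \<in> hcomp A (p + ipar i + ipar j)})\<rparr>"

definition gl_tensor ::
    "('f :: field, 'a) superalgebra \<Rightarrow> ('f, ('n :: finite, 'a) smat) superalgebra" where
  "gl_tensor A = commutator_superalgebra (mat_superalgebra A)"

definition sl_over ::
    "'n itself \<Rightarrow> ('f :: field, 'a) superalgebra \<Rightarrow> ('f, ('n :: finite, 'a) smat) superalgebra" where
  "sl_over _ A = super_restrict (gl_tensor A) (derived (gl_tensor A))"


section \<open>The Lie superalgebra psl(n+1,n+1) and its roots\<close>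

definition ground :: "('f :: field, 'f) superalgebra" where
  "ground = \<lparr>carrier = UNIV, monoid.mult = (*), one = 1, zero = 0, add = (+), smult = (*),
             hcomp = (\<lambda>p. if p = 0 then UNIV else {0})\<rparr>"

text \<open>For the ground field, \<^const>\<open>twist\<close> is the identity and the matrix product the usual one.\<close>

definition gl :: "('f :: field, ('n :: finite, 'f) smat) superalgebra" where
  "gl = gl_tensor ground"

definition supertrace :: "('n :: finite, 'f :: field) smat \<Rightarrow> 'f" where
  "supertrace M = (\<Sum>i\<in>UNIV. M (Inl i) (Inl i)) - (\<Sum>i\<in>UNIV. M (Inr i) (Inr i))"

definition sl :: "('f :: field, ('n :: finite, 'f) smat) superalgebra" where
  "sl = super_restrict gl {M. supertrace M = 0}"

definition scalar_matrices :: "('n, 'f :: field) smat set" where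
  "scalar_matrices = range (\<lambda>c i j. if i = j then c else 0)"

definition psl :: "('f :: field, ('n :: finite, 'f) smat set) superalgebra" where
  "psl = super_quot sl scalar_matrices"

definition diagonal :: "('n, 'f :: field) smat \<Rightarrow> bool" where
  "diagonal M \<longleftrightarrow> (\<forall>i j. i \<noteq> j \<longrightarrow> M i j = 0)"

definition cartan :: "('n :: finite, 'f :: field) smat set set" where
  "cartan = {C \<in> carrier psl. \<exists>M\<in>C. diagonal M}"

text \<open>
  The functional $\varepsilon_i$ on \<^const>\<open>cartan\<close>, via the unique diagonal representative whose two
  diagonal blocks have trace zero.
\<close>

definition eps :: "'n + 'n \<Rightarrow> ('n :: finite, 'f :: field) smat set \<Rightarrow> 'f" where
  "eps i C = (THE M. M \<in> C \<and> diagonal M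
      \<and> (\<Sum>k\<in>UNIV. M (Inl k) (Inl k)) = 0 \<and> (\<Sum>k\<in>UNIV. M (Inr k) (Inr k)) = 0) i i"

text \<open>
  Functionals on \<^const>\<open>cartan\<close> are represented by functions that are \<^const>\<open>undefined\<close> outside it,
  so that equal functionals are equal functions.
\<close>

definition roots :: "(('n :: finite, 'f :: field) smat set \<Rightarrow> 'f) set" where
  "roots = {(\<lambda>C\<in>cartan. eps i C - eps j C) | i j. i \<noteq> j}"

definition zero_weight :: "('n :: finite, 'f :: field) smat set \<Rightarrow> 'f" where
  "zero_weight = (\<lambda>C\<in>cartan. 0)"

definition neg_weight ::
    "(('n :: finite, 'f :: field) smat set \<Rightarrow> 'f) \<Rightarrow> ('n, 'f) smat set \<Rightarrow> 'f" where
  "neg_weight \<alpha> = (\<lambda>C\<in>cartan. - \<alpha> C)"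


section \<open>A(n,n)-graded Lie superalgebras\<close>

text \<open>
  \<open>H\<close> is a subalgebra of the even part of \<open>M\<close> that \<open>\<pi>\<close> maps isomorphically onto the even part of
  \<open>L\<close>.
\<close>

definition even_lift ::
    "('f :: field, 'v) superalgebra \<Rightarrow> ('f, 'w) superalgebra \<Rightarrow> ('v \<Rightarrow> 'w) \<Rightarrow> 'v set \<Rightarrow> bool" where
  "even_lift M L \<pi> H \<longleftrightarrow> submodule H scalars M \<and> H \<subseteq> hcomp M 0
     \<and> (\<forall>x\<in>H. \<forall>y\<in>H. x \<otimes>\<^bsub>M\<^esub> y \<in> H) \<and> bij_betw \<pi> H (hcomp L 0)"

text \<open>
  A functional \<open>\<alpha>\<close> on \<^const>\<open>cartan\<close> is viewed as one on its lift \<open>h\<close> by composition with \<open>\<pi>\<close>.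
\<close>

definition weight_space ::
    "('f :: field, 'v) superalgebra \<Rightarrow> ('v \<Rightarrow> ('n :: finite, 'f) smat set) \<Rightarrow> 'v set
       \<Rightarrow> (('n, 'f) smat set \<Rightarrow> 'f) \<Rightarrow> 'v set" where
  "weight_space L \<pi> h \<alpha> = {x \<in> carrier L. \<forall>t\<in>h. t \<otimes>\<^bsub>L\<^esub> x = \<alpha> (\<pi> t) \<odot>\<^bsub>L\<^esub> x}"

definition direct_sum ::
    "('f, 'v) superalgebra \<Rightarrow> 'i set \<Rightarrow> ('i \<Rightarrow> 'v set) \<Rightarrow> bool" where
  "direct_sum L J V \<longleftrightarrow> finite J \<and> (\<forall>j\<in>J. V j \<subseteq> carrier L)
     \<and> (\<forall>x\<in>carrier L. \<exists>!f. f \<in> Pi\<^sub>E J V \<and> x = (\<Oplus>\<^bsub>L\<^esub>j\<in>J. f j))"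

text \<open>
  \<open>G\<close> is the grading subsuperalgebra, \<open>\<pi>\<close> its cover map, \<open>g\<close> the lift of the even part of
  \<^const>\<open>psl\<close> (it is unique), and \<open>h\<close> the lift of \<^const>\<open>cartan\<close>. The type argument fixes
  $n+1$ as \<open>CARD('n)\<close>.
\<close>

definition A_graded :: "'n :: finite itself \<Rightarrow> ('f :: field, 'v) superalgebra \<Rightarrow> bool" where
  "A_graded _ L \<longleftrightarrow>
     (\<exists>G (\<pi> :: 'v \<Rightarrow> ('n, 'f) smat set) g h.
        subsuperalgebra G L \<and> central_cover (super_restrict L G) psl \<pi>
      \<and> even_lift (super_restrict L G) psl \<pi> g \<and> h = {t \<in> g. \<pi> t \<in> cartan}
      \<and> direct_sum L (insert zero_weight roots) (weight_space L \<pi> h)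
      \<and> weight_space L \<pi> h zero_weight
          = lspan L (\<Union>\<alpha>\<in>roots. {x \<otimes>\<^bsub>L\<^esub> y | x y.
              x \<in> weight_space L \<pi> h \<alpha> \<and> y \<in> weight_space L \<pi> h (neg_weight \<alpha>)}))"

end

theory Submission
  imports Defs
begin

text \<open>
  Both halves pass through one notion, the locale \<open>steinberg\<close>: linear maps \<open>\<phi>\<^sub>i\<^sub>j : A \<rightarrow> L\<close> for
  \<open>i \<noteq> j\<close> that are injective, multiply like matrix units with coefficients in \<open>A\<close> and commute when the
  matrix units do. The elements $e_{ij} \otimes (\pm a)$, with a sign that depends on the parities of \<open>a\<close>
  and \<open>j\<close>, are such coordinates on $\mathfrak{sl}_{n+1,n+1}(A)$; this choice of signs removes
  all signs from the relations between distinct indices. Call coordinates generating if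
  \<open>\<phi>\<^sub>i\<^sub>j(a)\<close> and \<open>[\<phi>\<^sub>i\<^sub>j(a), \<phi>\<^sub>j\<^sub>i(b)]\<close> span \<open>L\<close>.

  Generating coordinates over \<open>A\<close> determine a Lie superalgebra up to central isogeny
  (\<open>steinberg_central_quotient\<close>). Given two such superalgebras \<open>L\<close> and \<open>M\<close>, the pairs \<open>(\<phi>\<^sub>i\<^sub>j(a), \<psi>\<^sub>i\<^sub>j(a))\<close>
  are coordinates in the product and generate a correspondence between \<open>L\<close> and \<open>M\<close>. Since there are at
  least six indices, bracketing with three units isolates a single coordinate of a vector
  (\<open>probe_decomp\<close>), so the correspondence is a bijection modulo the centres. As quotients by the centre
  are compared, an isomorphism is replaced throughout by a homomorphism onto the quotient of the second
  superalgebra whose kernel is the centre of the first (\<open>isomorphic_quotients_iff\<close>).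

  From isogeny to grading (\<open>centrally_isogenous_imp_graded\<close>). The bracket of \<open>L\<close> depends only on the classes
  modulo the centre, so the coordinates of $\mathfrak{sl}_{n+1,n+1}(A)$ lift to \<open>L\<close> as brackets of arbitrary lifts of
  two coordinates \<open>i k\<close> and \<open>k j\<close>. The elements with scalar coefficients generate the grading
  subsuperalgebra, and its cover map is the correspondence above, for the coefficient algebra \<open>F\<close>. The root spaces are
  the ranges of the \<open>\<phi>\<^sub>i\<^sub>j\<close>, and the weight space of zero is the diagonal part.

  From grading to isogeny (\<open>graded_imp_centrally_isogenous\<close>). The root spaces \<open>V\<^sub>i\<^sub>j\<close> contain lifts \<open>e\<^sub>i\<^sub>j\<close> of the matrix
  units. If the elements \<open>e\<^sub>i\<^sub>j\<close> permute the spaces \<open>V\<^sub>i\<^sub>j\<close> as they should, then one of these spaces becomes an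
  associative algebra that serves as coefficients for all (locale \<open>matrix_units\<close>). Two facts do not
  follow from the weights alone. First, \<open>[e\<^sub>i\<^sub>j, e\<^sub>j\<^sub>i]\<close> is known to lie in the lifted Cartan subalgebra only if \<open>i\<close> and \<open>j\<close>
  have equal parity; if not, it may differ from what the matrices suggest by a central
  element of the grading subsuperalgebra, whose action on \<open>L\<close> has to be shown to vanish (\<open>H_own\<close>). Secondly, on the Cartan
  subalgebra of $\mathfrak{psl}(n+1,n+1)$ the \<open>\<epsilon>\<^sub>i\<close> sum to zero over each block; for \<open>n = 2\<close> this makes certain sums of
  two odd roots into roots although their matrix units commute, and \<open>[V\<^sub>i\<^sub>j, V\<^sub>k\<^sub>l] = 0\<close> needs an argument there (\<open>V_comm\<close>).
\<close>


(* The boolean form of bit arithmetic would hide the group structure of the parities. *)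
declare add_bit_eq_xor [simp del] mult_bit_eq_and [simp del]

section \<open>Linear algebra in superalgebras\<close>

lemma scalars_simps [simp]:
  "carrier scalars = UNIV" "\<one>\<^bsub>scalars\<^esub> = 1" "\<zero>\<^bsub>scalars\<^esub> = 0"
  "a \<oplus>\<^bsub>scalars\<^esub> b = a + b" "a \<otimes>\<^bsub>scalars\<^esub> b = a * b"
  by (simp_all add: scalars_def)

lemma cring_scalars: "cring (scalars :: ('f :: field) ring)"
proof (rule cringI)
  show "abelian_group (scalars :: 'f ring)"
    by (rule abelian_groupI) (auto simp: algebra_simps intro: exI[of _ "- _"])
  show "Group.comm_monoid (scalars :: 'f ring)"
    by (rule comm_monoidI) (auto simp: algebra_simps)
qed (auto simp: algebra_simps)

lemma uminus_scalars [simp]: "\<ominus>\<^bsub>scalars\<^esub> (a :: 'f :: field) = - a"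
proof -
  interpret cring "scalars :: 'f ring" by (rule cring_scalars)
  show ?thesis using minus_equality[of "- a" a] by simp
qed

lemma psign_simps [simp]: "psign 0 = 1" "psign 1 = - 1"
  by (simp_all add: psign_def)

lemma psign_square [simp]: "psign p * (psign p * c) = (c :: 'f :: field)" "psign p * psign p = (1 :: 'f)"
  by (cases p; simp)+

lemma psign_add: "psign (p + q) = psign p * (psign q :: 'f :: field)"
  by (cases p; cases q) simp_all

lemma bit_add_self [simp]: "(p :: bit) + p = 0" "p + (p + q) = q" "q + p + p = q"
  by (cases p; cases q; simp)+

lemma UNIV_bit: "(UNIV :: bit set) = {0, 1}"
  using bit.exhaust by auto

context superalgebra
begin

lemma smult_carrier [simp, intro]: "x \<in> carrier A \<Longrightarrow> c \<odot> x \<in> carrier A"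
  using smult_closed by simp

lemma smult_add_l: "x \<in> carrier A \<Longrightarrow> (c + d) \<odot> x = c \<odot> x \<oplus> d \<odot> x"
  using smult_l_distr[of c d x] by simp

lemma smult_add_r: "x \<in> carrier A \<Longrightarrow> y \<in> carrier A \<Longrightarrow> c \<odot> (x \<oplus> y) = c \<odot> x \<oplus> c \<odot> y"
  using smult_r_distr by simp

lemma smult_smult: "x \<in> carrier A \<Longrightarrow> c \<odot> (d \<odot> x) = (c * d) \<odot> x"
  using smult_assoc1[of c d x] by simp

lemma smult_1 [simp]: "x \<in> carrier A \<Longrightarrow> 1 \<odot> x = x"
  using smult_one[of x] by simp

lemma smult_0 [simp]: "x \<in> carrier A \<Longrightarrow> 0 \<odot> x = \<zero>" "c \<odot> \<zero> = \<zero>"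
  using smult_l_null[of x] smult_r_null[of c] by simp_all

lemma smult_neg: "x \<in> carrier A \<Longrightarrow> (- c) \<odot> x = \<ominus> (c \<odot> x)"
  using smult_l_minus[of c x] by simp

lemma smult_m1 [simp]: "x \<in> carrier A \<Longrightarrow> (- 1) \<odot> x = \<ominus> x"
  using smult_neg[of x 1] by simp

lemma smult_minus: "x \<in> carrier A \<Longrightarrow> c \<odot> (\<ominus> x) = \<ominus> (c \<odot> x)"
  using smult_r_minus[of c x] by simp

lemma smult_eq_0: "x \<in> carrier A \<Longrightarrow> c \<odot> x = \<zero> \<Longrightarrow> c = 0 \<or> x = \<zero>"
  by (metis left_inverse smult_0(2) smult_1 smult_smult)

lemma neg_zero [simp]: "\<ominus> \<zero> = \<zero>"
  by (rule M.minus_equality) simp_all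

lemma diff_eq_0: "x \<in> carrier A \<Longrightarrow> y \<in> carrier A \<Longrightarrow> x \<ominus> y = \<zero> \<longleftrightarrow> x = y"
  by (metis M.minus_equality M.minus_minus M.r_neg M.add.inv_closed a_minus_def M.a_comm)

lemma mult_carrier [simp, intro]: "x \<in> carrier A \<Longrightarrow> y \<in> carrier A \<Longrightarrow> x \<otimes> y \<in> carrier A"
  by (rule mult_closed)

lemma mult_0 [simp]: "x \<in> carrier A \<Longrightarrow> x \<otimes> \<zero> = \<zero>" "x \<in> carrier A \<Longrightarrow> \<zero> \<otimes> x = \<zero>"
  using mult_smult_right[of x "\<zero>" 0] mult_smult_left[of "\<zero>" x 0] by simp_all

lemma mult_minus: "x \<in> carrier A \<Longrightarrow> y \<in> carrier A \<Longrightarrow> x \<otimes> (\<ominus> y) = \<ominus> (x \<otimes> y)"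
    "x \<in> carrier A \<Longrightarrow> y \<in> carrier A \<Longrightarrow> (\<ominus> x) \<otimes> y = \<ominus> (x \<otimes> y)"
  using mult_smult_right[of x y "- 1"] mult_smult_left[of x y "- 1"] by simp_all

lemma mult_diff:
  "x \<in> carrier A \<Longrightarrow> y \<in> carrier A \<Longrightarrow> z \<in> carrier A \<Longrightarrow> x \<otimes> (y \<ominus> z) = x \<otimes> y \<ominus> x \<otimes> z"
  "x \<in> carrier A \<Longrightarrow> y \<in> carrier A \<Longrightarrow> z \<in> carrier A \<Longrightarrow> (y \<ominus> z) \<otimes> x = y \<otimes> x \<ominus> z \<otimes> x"
  by (simp_all add: a_minus_def mult_add_left mult_add_right mult_minus)

subsection \<open>Subspaces and spans\<close>

lemma submoduleI':
  assumes "H \<subseteq> carrier A" "\<zero> \<in> H" "\<And>a b. a \<in> H \<Longrightarrow> b \<in> H \<Longrightarrow> a \<oplus> b \<in> H"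
    and s: "\<And>c x. x \<in> H \<Longrightarrow> c \<odot> x \<in> H"
  shows "submodule H scalars A"
proof (rule submoduleI)
  fix a assume "a \<in> H"
  then show "\<ominus> a \<in> H" using s[of a "- 1"] assms(1) by auto
qed (use assms in auto)

context
  fixes H assumes H: "submodule H scalars A"
begin
lemma sub_carrier: "x \<in> H \<Longrightarrow> x \<in> carrier A"
  using submoduleE(1)[OF H] by auto
lemma sub_zero: "\<zero> \<in> H"
  using submoduleE(2,3,5)[OF H] by (metis ex_in_conv M.r_neg sub_carrier)
lemma sub_add: "x \<in> H \<Longrightarrow> y \<in> H \<Longrightarrow> x \<oplus> y \<in> H"
  using submoduleE(5)[OF H] by auto
lemma sub_smult: "x \<in> H \<Longrightarrow> c \<odot> x \<in> H"
  using submoduleE(4)[OF H] by auto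
lemma sub_minus: "x \<in> H \<Longrightarrow> \<ominus> x \<in> H"
  using submoduleE(3)[OF H] by auto
lemma sub_diff: "x \<in> H \<Longrightarrow> y \<in> H \<Longrightarrow> x \<ominus> y \<in> H"
  by (simp add: a_minus_def sub_add sub_minus)
lemma sub_finsum: "finite J \<Longrightarrow> (\<And>j. j \<in> J \<Longrightarrow> f j \<in> H) \<Longrightarrow> (\<Oplus>j\<in>J. f j) \<in> H"
proof (induction rule: finite_induct)
  case empty then show ?case by (simp add: sub_zero)
next
  case (insert x F)
  then have "f \<in> F \<rightarrow> carrier A" "f x \<in> carrier A" using sub_carrier by auto
  with insert show ?case by (simp add: sub_add)
qed
end

lemma sub_whole: "submodule (carrier A) scalars A"
  by (rule carrier_is_submodule)

lemma sub_null: "submodule {\<zero>} scalars A"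
  by (rule submoduleI') auto

lemma lspan_submodule:
  assumes "S \<subseteq> carrier A" shows "submodule (lspan A S) scalars A"
  unfolding lspan_def using assms
  by (intro submoduleI') (auto simp: sub_zero sub_add sub_smult intro!: sub_whole)

lemma lspan_base: "x \<in> S \<Longrightarrow> x \<in> lspan A S"
  by (auto simp: lspan_def)

lemma lspan_least: "submodule H scalars A \<Longrightarrow> S \<subseteq> H \<Longrightarrow> lspan A S \<subseteq> H"
  by (auto simp: lspan_def)

lemma lspan_carrier: "S \<subseteq> carrier A \<Longrightarrow> lspan A S \<subseteq> carrier A"
  by (rule lspan_least[OF sub_whole])

lemma lspan_mono: "S \<subseteq> T \<Longrightarrow> lspan A S \<subseteq> lspan A T"
  by (auto simp: lspan_def)

lemma lspan_induct [consumes 2, case_names base zero add smult]: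
  assumes "x \<in> lspan A S" "S \<subseteq> carrier A"
    and "\<And>x. x \<in> S \<Longrightarrow> P x" "P \<zero>"
    and "\<And>x y. x \<in> carrier A \<Longrightarrow> y \<in> carrier A \<Longrightarrow> P x \<Longrightarrow> P y \<Longrightarrow> P (x \<oplus> y)"
    and "\<And>c x. x \<in> carrier A \<Longrightarrow> P x \<Longrightarrow> P (c \<odot> x)"
  shows "P x"
proof -
  have "submodule {x \<in> carrier A. P x} scalars A"
    by (rule submoduleI') (use assms in auto)
  from lspan_least[OF this, of S] assms show ?thesis by auto
qed

subsection \<open>Homogeneous components\<close>

lemmas hc_carrier = sub_carrier[OF hcomp_submodule]
lemmas hc_zero [simp] = sub_zero[OF hcomp_submodule]
lemmas hc_add = sub_add[OF hcomp_submodule]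
lemmas hc_smult = sub_smult[OF hcomp_submodule]
lemmas hc_minus = sub_minus[OF hcomp_submodule]
lemmas hc_diff = sub_diff[OF hcomp_submodule]

lemma hcomp_disjoint': "x \<in> hcomp A p \<Longrightarrow> x \<in> hcomp A (p + 1) \<Longrightarrow> x = \<zero>"
  using hcomp_disjoint by (cases p) auto

lemma hcomp_decomp:
  assumes "x \<in> carrier A"
  obtains y z where "y \<in> hcomp A p" "z \<in> hcomp A (p + 1)" "x = y \<oplus> z"
proof -
  have "x \<in> hcomp A 0 <+> hcomp A 1" using assms hcomp_sum by simp
  then obtain y z where yz: "y \<in> hcomp A 0" "z \<in> hcomp A 1" "x = y \<oplus> z"
    by (auto simp: set_add_def set_mult_def)
  show thesis
  proof (cases p)
    case zero then show ?thesis using that yz by simp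
  next
    case one
    then show ?thesis using that[of z y] yz M.a_comm hc_carrier by simp
  qed
qed

lemma hcomp_decomp_0:
  assumes "y \<in> hcomp A p" "z \<in> hcomp A (p + 1)" "y \<oplus> z = \<zero>"
  shows "y = \<zero>" "z = \<zero>"
proof -
  have c: "y \<in> carrier A" "z \<in> carrier A" using assms hc_carrier by auto
  then have "y = \<ominus> z" using assms(3) M.minus_equality by metis
  then have "y \<in> hcomp A (p + 1)" using assms hc_minus by simp
  then show "y = \<zero>" using assms hcomp_disjoint' by simp
  then show "z = \<zero>" using assms c by simp
qed

lemma hcomp_decomp_eq:
  assumes "y \<in> hcomp A p" "z \<in> hcomp A (p + 1)" "y' \<in> hcomp A p" "z' \<in> hcomp A (p + 1)"
    and e: "y \<oplus> z = y' \<oplus> z'"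
  shows "y = y'" "z = z'"
proof -
  have c: "y \<in> carrier A" "z \<in> carrier A" "y' \<in> carrier A" "z' \<in> carrier A"
    using assms hc_carrier by auto
  have "(y \<ominus> y') \<oplus> (z \<ominus> z') = (y \<oplus> z) \<ominus> (y' \<oplus> z')"
    using c by (simp add: a_minus_def M.minus_add M.a_ac)
  also have "\<dots> = \<zero>" using e c by (simp add: diff_eq_0)
  finally have "y \<ominus> y' = \<zero>" "z \<ominus> z' = \<zero>"
    using hcomp_decomp_0[of "y \<ominus> y'" p "z \<ominus> z'"] assms hc_diff by auto
  then show "y = y'" "z = z'" using c by (auto simp: diff_eq_0)
qed

lemma homogeneous_induct [consumes 1, case_names hom add]:
  assumes "x \<in> carrier A" "\<And>p x. x \<in> hcomp A p \<Longrightarrow> P x"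
    "\<And>x y. x \<in> carrier A \<Longrightarrow> y \<in> carrier A \<Longrightarrow> P x \<Longrightarrow> P y \<Longrightarrow> P (x \<oplus> y)"
  shows "P x"
  using assms hcomp_decomp[OF assms(1), of 0] hc_carrier by metis

lemma hpart_eq:
  assumes "y \<in> hcomp A p" "z \<in> hcomp A (p + 1)"
  shows "hpart A p (y \<oplus> z) = y"
  unfolding hpart_def
proof (rule the_equality)
  have c: "y \<in> carrier A" "z \<in> carrier A" using assms hc_carrier by auto
  have "y \<oplus> z \<ominus> y = z" using c M.a_comm[of y z]
    by (simp add: a_minus_def M.a_assoc M.r_neg)
  then show "y \<in> hcomp A p \<and> y \<oplus> z \<ominus> y \<in> hcomp A (p + 1)" using assms by simp
  fix u assume u: "u \<in> hcomp A p \<and> y \<oplus> z \<ominus> u \<in> hcomp A (p + 1)"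
  then have uc: "u \<in> carrier A" using hc_carrier by auto
  have "u \<oplus> (y \<oplus> z \<ominus> u) = (y \<oplus> z) \<oplus> (u \<ominus> u)"
    using c uc unfolding a_minus_def by (simp add: M.a_ac)
  then have "u \<oplus> (y \<oplus> z \<ominus> u) = y \<oplus> z" using c uc by (simp add: a_minus_def M.r_neg)
  then show "u = y" using hcomp_decomp_eq(1)[of u p "y \<oplus> z \<ominus> u" y z] u assms by auto
qed

lemma hpart_hom [simp]: "x \<in> hcomp A p \<Longrightarrow> hpart A p x = x"
  using hpart_eq[of x p "\<zero>"] hc_carrier by simp

lemma hpart_hom' [simp]: "x \<in> hcomp A p \<Longrightarrow> hpart A (p + 1) x = \<zero>"
  using hpart_eq[of "\<zero>" "p + 1" x] hc_carrier by simp

lemma hpart_split: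
  assumes "x \<in> carrier A"
  shows "hpart A p x \<in> hcomp A p" "x = hpart A p x \<oplus> hpart A (p + 1) x"
proof -
  obtain y z where yz: "y \<in> hcomp A p" "z \<in> hcomp A (p + 1)" "x = y \<oplus> z"
    by (rule hcomp_decomp[OF assms])
  have 1: "hpart A p x = y" using hpart_eq yz by simp
  have "x = z \<oplus> y" using yz hc_carrier M.a_comm by metis
  then have 2: "hpart A (p + 1) x = z" using hpart_eq[of z "p+1" y] yz by simp
  show "hpart A p x \<in> hcomp A p" "x = hpart A p x \<oplus> hpart A (p + 1) x"
    using 1 2 yz by auto
qed

lemma hpart_hcomp [simp]: "x \<in> carrier A \<Longrightarrow> hpart A p x \<in> hcomp A p"
  by (rule hpart_split)

lemma hpart_carrier [simp]: "x \<in> carrier A \<Longrightarrow> hpart A p x \<in> carrier A"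
  using hpart_hcomp hc_carrier by blast

lemma hpart_add:
  assumes "x \<in> carrier A" "y \<in> carrier A"
  shows "hpart A p (x \<oplus> y) = hpart A p x \<oplus> hpart A p y"
proof -
  have "x \<oplus> y = (hpart A p x \<oplus> hpart A (p+1) x) \<oplus> (hpart A p y \<oplus> hpart A (p+1) y)"
    using hpart_split(2)[OF assms(1), of p] hpart_split(2)[OF assms(2), of p] by simp
  also have "\<dots> = (hpart A p x \<oplus> hpart A p y) \<oplus> (hpart A (p+1) x \<oplus> hpart A (p+1) y)"
    using assms by (simp add: M.a_ac)
  finally show ?thesis using hpart_eq assms hc_add by simp
qed

lemma hpart_smult:
  assumes "x \<in> carrier A" shows "hpart A p (c \<odot> x) = c \<odot> hpart A p x"
proof -
  have "c \<odot> x = c \<odot> hpart A p x \<oplus> c \<odot> hpart A (p+1) x"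
    using hpart_split(2)[OF assms, of p] assms by (metis smult_add_r hpart_carrier)
  then show ?thesis using hpart_eq assms hc_smult by simp
qed

lemma finsum_bit:
  "f 0 \<in> carrier A \<Longrightarrow> f 1 \<in> carrier A \<Longrightarrow> (\<Oplus>p\<in>(UNIV :: bit set). f p) = f 0 \<oplus> f 1"
  by (simp add: UNIV_bit)

lemma lspan_graded:
  assumes "x \<in> lspan A S" and S: "S \<subseteq> hcomp A 0 \<union> hcomp A 1"
  shows "hpart A p x \<in> lspan A S"
proof -
  have Sc: "S \<subseteq> carrier A" using S hc_carrier by auto
  note sm = lspan_submodule[OF Sc]
  show ?thesis using assms(1) Sc
  proof (induction x rule: lspan_induct)
    case (base x)
    then consider "x \<in> hcomp A p" | "x \<in> hcomp A (p + 1)" using S by (cases p) auto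
    then show ?case
    proof cases
      case 1 then show ?thesis using base lspan_base by simp
    next
      case 2 then show ?thesis using hpart_hom'[of x "p + 1"] sub_zero[OF sm] by simp
    qed
  next
    case zero then show ?case using sub_zero[OF sm] by simp
  next
    case (add x y) then show ?case by (simp add: hpart_add sub_add[OF sm])
  next
    case (smult c x) then show ?case by (simp add: hpart_smult sub_smult[OF sm])
  qed
qed

end


section \<open>Lie superalgebras: Jacobi identities, restriction and products\<close>

context superalgebra
begin

text \<open>Bilinearity reduces products of two spans to products of spanning vectors.\<close>

lemma mult_lspan:
  assumes "x \<in> lspan A S" "y \<in> lspan A T" and S: "S \<subseteq> carrier A" and T: "T \<subseteq> carrier A"
    and H: "submodule H scalars A" and b: "\<And>s t. s \<in> S \<Longrightarrow> t \<in> T \<Longrightarrow> s \<otimes> t \<in> H"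
  shows "x \<otimes> y \<in> H"
  using assms(1) S
proof (induction x rule: lspan_induct)
  case (base s)
  then have sc: "s \<in> carrier A" using S by auto
  show ?case using assms(2) T
  proof (induction y rule: lspan_induct)
    case (base t) then show ?case using b \<open>s \<in> S\<close> by simp
  qed (use sc in \<open>simp_all add: sub_zero[OF H] mult_add_right sub_add[OF H] mult_smult_right
        sub_smult[OF H]\<close>)
qed (use lspan_carrier[OF T] assms(2) in \<open>auto simp: sub_zero[OF H] mult_add_left sub_add[OF H]
        mult_smult_left sub_smult[OF H]\<close>)

text \<open>Whether two vectors have commuting homogeneous components does not depend on their parity, so
  that it can be used for vectors that are not homogeneous.\<close>

definition gcomm where "gcomm x z \<longleftrightarrow> (\<forall>p q. hpart A p x \<otimes> hpart A q z = \<zero>)"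

lemma hcomp_other: assumes "x \<in> hcomp A p" "q \<noteq> p" shows "hpart A q x = \<zero>"
proof -
  have "q = p + 1" using assms(2) by (cases p; cases q) auto
  then show ?thesis using hpart_hom'[OF assms(1)] by simp
qed

lemma gcomm_hom_left:
  assumes x: "x \<in> hcomp A p" and z: "z \<in> carrier A" and 0: "x \<otimes> z = \<zero>"
  shows "gcomm x z"
proof -
  have xc: "x \<in> carrier A" using x hc_carrier by auto
  have "x \<otimes> hpart A 0 z \<oplus> x \<otimes> hpart A (0 + 1) z = x \<otimes> (hpart A 0 z \<oplus> hpart A (0 + 1) z)"
    using xc z by (simp add: mult_add_right)
  also have "\<dots> = \<zero>" using 0 hpart_split(2)[OF z, of 0] by simp
  finally have "x \<otimes> hpart A 0 z \<oplus> x \<otimes> hpart A (0 + 1) z = \<zero>" .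
  moreover have "x \<otimes> hpart A 0 z \<in> hcomp A (p + 0)" "x \<otimes> hpart A (0 + 1) z \<in> hcomp A (p + 0 + 1)"
    using mult_graded[OF x hpart_hcomp[OF z, of 0]] mult_graded[OF x hpart_hcomp[OF z, of 1]] by auto
  ultimately have "x \<otimes> hpart A 0 z = \<zero>" "x \<otimes> hpart A 1 z = \<zero>"
    using hcomp_decomp_0[of "x \<otimes> hpart A 0 z" "p + 0"] by simp_all
  then have "x \<otimes> hpart A q z = \<zero>" for q by (cases q) auto
  moreover have "hpart A p' x = (if p' = p then x else \<zero>)" for p'
    using x hcomp_other[OF x, of p'] by simp
  ultimately show ?thesis using z by (simp add: gcomm_def)
qed

lemma gcomm_hom_right:
  assumes x: "x \<in> hcomp A p" and z: "z \<in> carrier A" and 0: "z \<otimes> x = \<zero>"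
  shows "gcomm z x"
proof -
  have xc: "x \<in> carrier A" using x hc_carrier by auto
  have "hpart A 0 z \<otimes> x \<oplus> hpart A (0 + 1) z \<otimes> x = (hpart A 0 z \<oplus> hpart A (0 + 1) z) \<otimes> x"
    using xc z by (simp add: mult_add_left)
  also have "\<dots> = \<zero>" using 0 hpart_split(2)[OF z, of 0] by simp
  finally have "hpart A 0 z \<otimes> x \<oplus> hpart A (0 + 1) z \<otimes> x = \<zero>" .
  moreover have "hpart A 0 z \<otimes> x \<in> hcomp A p" "hpart A (0 + 1) z \<otimes> x \<in> hcomp A (p + 1)"
    using mult_graded[OF hpart_hcomp[OF z, of 0] x] mult_graded[OF hpart_hcomp[OF z, of 1] x]
    by (auto simp: add.commute)
  ultimately have "hpart A 0 z \<otimes> x = \<zero>" "hpart A 1 z \<otimes> x = \<zero>"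
    using hcomp_decomp_0[of "hpart A 0 z \<otimes> x" p] by simp_all
  then have "hpart A q z \<otimes> x = \<zero>" for q by (cases q) auto
  moreover have "hpart A p' x = (if p' = p then x else \<zero>)" for p'
    using x hcomp_other[OF x, of p'] by simp
  ultimately show ?thesis using z by (simp add: gcomm_def)
qed

lemma gcomm_0:
  assumes x: "x \<in> carrier A" and z: "z \<in> carrier A" and g: "gcomm x z"
  shows "x \<otimes> z = \<zero>"
proof -
  have "x \<otimes> z = (hpart A 0 x \<oplus> hpart A 1 x) \<otimes> (hpart A 0 z \<oplus> hpart A 1 z)"
    using hpart_split(2)[OF x, of 0] hpart_split(2)[OF z, of 0] by simp
  then show ?thesis using x z g by (simp add: mult_add_left mult_add_right gcomm_def)
qed

text \<open>A subspace that contains the homogeneous parts of its elements is the sum of its homogeneous parts.\<close>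

lemma subsuperalgebraI:
  assumes S: "submodule S scalars A" and m: "\<And>x y. x \<in> S \<Longrightarrow> y \<in> S \<Longrightarrow> x \<otimes> y \<in> S"
    and h: "\<And>x p. x \<in> S \<Longrightarrow> hpart A p x \<in> S"
  shows "subsuperalgebra S A"
  unfolding subsuperalgebra_def
proof (intro conjI S ballI m)
  show "(hcomp A 0 \<inter> S) <+> (hcomp A 1 \<inter> S) = S"
  proof (intro equalityI subsetI)
    fix x assume "x \<in> (hcomp A 0 \<inter> S) <+>\<^bsub>A\<^esub> (hcomp A 1 \<inter> S)"
    then show "x \<in> S" by (auto simp: set_add_def set_mult_def intro: sub_add[OF S])
  next
    fix x assume x: "x \<in> S"
    then have xc: "x \<in> carrier A" using sub_carrier[OF S] by simp
    have "hpart A 0 x \<in> hcomp A 0 \<inter> S" "hpart A 1 x \<in> hcomp A 1 \<inter> S" using h x xc by auto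
    moreover have "x = hpart A 0 x \<oplus> hpart A 1 x" using hpart_split(2)[OF xc, of 0] by simp
    ultimately show "x \<in> (hcomp A 0 \<inter> S) <+>\<^bsub>A\<^esub> (hcomp A 1 \<inter> S)"
      by (auto simp: set_add_def set_mult_def)
  qed
qed

end

lemma super_restrict_simps [simp]:
  "carrier (super_restrict L S) = S" "monoid.mult (super_restrict L S) = monoid.mult L"
  "zero (super_restrict L S) = zero L" "add (super_restrict L S) = add L"
  "smult (super_restrict L S) = smult L" "hcomp (super_restrict L S) p = hcomp L p \<inter> S"
  "one (super_restrict L S) = one L"
  by (simp_all add: super_restrict_def)

lemma set_add_eq: "X <+>\<^bsub>L\<^esub> Y = {x \<oplus>\<^bsub>L\<^esub> y | x y. x \<in> X \<and> y \<in> Y}"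
  by (auto simp: set_add_def set_mult_def)

context superalgebra
begin

lemma superalgebra_restrict:
  assumes "subsuperalgebra S A" shows "superalgebra (super_restrict A S)"
proof -
  have S: "submodule S scalars A" and m: "\<And>x y. x \<in> S \<Longrightarrow> y \<in> S \<Longrightarrow> x \<otimes> y \<in> S"
    and h: "(hcomp A 0 \<inter> S) <+> (hcomp A 1 \<inter> S) = S"
    using assms by (auto simp: subsuperalgebra_def)
  note c = sub_carrier[OF S]
  have mo: "module scalars (super_restrict A S)"
  proof (rule moduleI)
    show "cring (scalars :: 'f ring)" by (rule cring_scalars)
    show "abelian_group (super_restrict A S)"
    proof (rule abelian_groupI)
      fix x assume x: "x \<in> carrier (super_restrict A S)"
      show "\<exists>y\<in>carrier (super_restrict A S). y \<oplus>\<^bsub>super_restrict A S\<^esub> x = \<zero>\<^bsub>super_restrict A S\<^esub>"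
        using x c sub_minus[OF S] by (intro bexI[of _ "\<ominus> x"]) (auto simp: M.l_neg)
    qed (use c in \<open>auto simp: sub_add[OF S] sub_zero[OF S] M.a_ac\<close>)
  qed (use c in \<open>auto simp: sub_smult[OF S] smult_add_l smult_add_r smult_smult\<close>)
  interpret r: module scalars "super_restrict A S" by (rule mo)
  show ?thesis
  proof (intro superalgebra.intro mo superalgebra_axioms.intro)
    fix p show "submodule (hcomp (super_restrict A S) p) scalars (super_restrict A S)"
    proof (rule r.submoduleI)
      fix a assume "a \<in> hcomp (super_restrict A S) p"
      then have a: "a \<in> hcomp A p" "a \<in> S" by auto
      then have "\<ominus>\<^bsub>super_restrict A S\<^esub> a = \<ominus> a"
        using r.M.minus_equality[of "\<ominus> a" a] c sub_minus[OF S] by (simp add: M.l_neg)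
      then show "\<ominus>\<^bsub>super_restrict A S\<^esub> a \<in> hcomp (super_restrict A S) p"
        using a hc_minus sub_minus[OF S] by simp
    qed (auto simp: sub_zero[OF S] sub_add[OF S] hc_add hc_smult sub_smult[OF S])
  next
    show "hcomp (super_restrict A S) 0 \<inter> hcomp (super_restrict A S) 1 = {\<zero>\<^bsub>super_restrict A S\<^esub>}"
      using hcomp_disjoint sub_zero[OF S] by auto
  next
    show "hcomp (super_restrict A S) 0 <+>\<^bsub>super_restrict A S\<^esub> hcomp (super_restrict A S) 1
        = carrier (super_restrict A S)"
      using h by (simp add: set_add_eq)
  qed (use c m in \<open>auto simp: mult_add_left mult_add_right mult_smult_left mult_smult_right
      intro: mult_graded\<close>)
qed

lemma restrict_facts:
  assumes "subsuperalgebra S A"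
  shows "x \<in> S \<Longrightarrow> \<ominus>\<^bsub>super_restrict A S\<^esub> x = \<ominus> x"
    and "T \<subseteq> S \<Longrightarrow> lspan (super_restrict A S) T = lspan A T"
    and "x \<in> S \<Longrightarrow> hpart (super_restrict A S) p x = hpart A p x"
    and "x \<in> S \<Longrightarrow> hpart A p x \<in> S"
    and "submodule H scalars (super_restrict A S) \<longleftrightarrow> submodule H scalars A \<and> H \<subseteq> S"
proof -
  interpret r: superalgebra "super_restrict A S" by (rule superalgebra_restrict[OF assms])
  have S: "submodule S scalars A" and h: "(hcomp A 0 \<inter> S) <+> (hcomp A 1 \<inter> S) = S"
    using assms by (auto simp: subsuperalgebra_def)
  note c = sub_carrier[OF S]
  show 1: "\<ominus>\<^bsub>super_restrict A S\<^esub> x = \<ominus> x" if "x \<in> S" for x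
    using r.M.minus_equality[of "\<ominus> x" x] c that sub_minus[OF S] by (simp add: M.l_neg)
  show sm: "submodule H scalars (super_restrict A S) \<longleftrightarrow> submodule H scalars A \<and> H \<subseteq> S" for H
  proof
    assume H: "submodule H scalars (super_restrict A S)"
    have HS: "H \<subseteq> S" using r.sub_carrier[OF H] by auto
    moreover have "submodule H scalars A"
      using HS c r.sub_zero[OF H] r.sub_add[OF H] r.sub_smult[OF H]
      by (intro submoduleI') auto
    ultimately show "submodule H scalars A \<and> H \<subseteq> S" by simp
  next
    assume "submodule H scalars A \<and> H \<subseteq> S"
    then have H: "submodule H scalars A" "H \<subseteq> S" by auto
    then show "submodule H scalars (super_restrict A S)"
      by (intro r.submoduleI') (auto simp: sub_zero sub_add sub_smult)
  qed
  show "lspan (super_restrict A S) T = lspan A T" if T: "T \<subseteq> S" for T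
  proof (intro equalityI)
    have Tc: "T \<subseteq> carrier A" using T c by auto
    show "lspan (super_restrict A S) T \<subseteq> lspan A T"
      using lspan_submodule[OF Tc] lspan_least[OF S T] lspan_base
      by (intro r.lspan_least) (auto simp: sm)
    have "submodule (lspan (super_restrict A S) T) scalars (super_restrict A S)"
      by (rule r.lspan_submodule) (use T in simp)
    then show "lspan A T \<subseteq> lspan (super_restrict A S) T"
      using r.lspan_base by (intro lspan_least) (auto simp: sm)
  qed
  have *: "hpart (super_restrict A S) p x = hpart A p x" if x: "x \<in> S" for x p
  proof -
    have xc: "x \<in> carrier (super_restrict A S)" using x by simp
    have "hpart (super_restrict A S) p x \<in> hcomp A p" "hpart (super_restrict A S) (p + 1) x \<in> hcomp A (p + 1)"
      using r.hpart_hcomp[OF xc] by auto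
    from hpart_eq[OF this] show ?thesis using r.hpart_split(2)[OF xc, of p] by simp
  qed
  then show "x \<in> S \<Longrightarrow> hpart (super_restrict A S) p x = hpart A p x" .
  show "x \<in> S \<Longrightarrow> hpart A p x \<in> S"
    using *[of x p] r.hpart_carrier[of x p] by simp
qed

end

context lie_superalgebra
begin

lemma skew: "x \<in> hcomp A p \<Longrightarrow> y \<in> hcomp A q \<Longrightarrow> x \<otimes> y = (- psign (p * q)) \<odot> (y \<otimes> x)"
  using super_skew[of x p y q] hc_carrier by (simp add: smult_neg)

lemma skew_even: assumes "x \<in> hcomp A 0" "y \<in> carrier A" shows "y \<otimes> x = \<ominus> (x \<otimes> y)"
  using assms(2)
proof (induction y rule: homogeneous_induct)
  case (hom p y) then show ?case using skew[of y p x 0] assms hc_carrier by simp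
next
  case (add u v) then show ?case
    using assms hc_carrier by (simp add: mult_add_left mult_add_right M.minus_add)
qed

lemma skew_in:
  "x \<in> hcomp A p \<Longrightarrow> y \<in> hcomp A q \<Longrightarrow> submodule H scalars A \<Longrightarrow> x \<otimes> y \<in> H \<Longrightarrow> y \<otimes> x \<in> H"
  using skew[of y q x p] sub_smult[of H "x \<otimes> y"] by simp

lemma gcomm_sym: assumes "gcomm x z" "x \<in> carrier A" "z \<in> carrier A" shows "gcomm z x"
  unfolding gcomm_def
proof (intro allI)
  fix p q
  show "hpart A p z \<otimes> hpart A q x = \<zero>"
    using skew[of "hpart A p z" p "hpart A q x" q] assms unfolding gcomm_def by simp
qed

text \<open>If the outer vectors commute, their cross term drops out of the Jacobi identity together with its sign. This is
  the form in which the identity is mostly used: it makes the bracket behave like an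
  associative product.\<close>

lemma jacobi_assoc:
  assumes x: "x \<in> carrier A" and y: "y \<in> carrier A" and z: "z \<in> carrier A" and g: "gcomm x z"
  shows "x \<otimes> (y \<otimes> z) = (x \<otimes> y) \<otimes> z"
proof -
  have 1: "u \<otimes> (y \<otimes> w) = (u \<otimes> y) \<otimes> w"
    if u: "u \<in> hcomp A p" and w: "w \<in> hcomp A q" and 0: "u \<otimes> w = \<zero>" for u w p q
    using y
  proof (induction y rule: homogeneous_induct)
    case (hom r y)
    then show ?case using super_jacobi[OF u hom w] 0 u w hc_carrier by simp
  next
    case (add y y')
    then show ?case using u w hc_carrier by (simp add: mult_add_left mult_add_right)
  qed
  let ?h = "hpart A"
  have g': "?h p x \<otimes> ?h q z = \<zero>" for p q using g by (simp add: gcomm_def)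
  have "x \<otimes> (y \<otimes> z) = (?h 0 x \<oplus> ?h 1 x) \<otimes> (y \<otimes> (?h 0 z \<oplus> ?h 1 z))"
    using hpart_split(2)[OF x, of 0] hpart_split(2)[OF z, of 0] by simp
  also have "\<dots> = (?h 0 x \<otimes> (y \<otimes> ?h 0 z) \<oplus> ?h 0 x \<otimes> (y \<otimes> ?h 1 z))
      \<oplus> (?h 1 x \<otimes> (y \<otimes> ?h 0 z) \<oplus> ?h 1 x \<otimes> (y \<otimes> ?h 1 z))"
    using x y z by (simp add: mult_add_left mult_add_right M.a_ac)
  also have "\<dots> = ((?h 0 x \<otimes> y) \<otimes> ?h 0 z \<oplus> (?h 0 x \<otimes> y) \<otimes> ?h 1 z)
      \<oplus> ((?h 1 x \<otimes> y) \<otimes> ?h 0 z \<oplus> (?h 1 x \<otimes> y) \<otimes> ?h 1 z)"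
    using 1[OF hpart_hcomp[OF x] hpart_hcomp[OF z] g'] by simp
  also have "\<dots> = ((?h 0 x \<oplus> ?h 1 x) \<otimes> y) \<otimes> (?h 0 z \<oplus> ?h 1 z)"
    using x y z by (simp add: mult_add_left mult_add_right M.a_ac)
  also have "\<dots> = (x \<otimes> y) \<otimes> z"
    using hpart_split(2)[OF x, of 0] hpart_split(2)[OF z, of 0] by simp
  finally show ?thesis .
qed

lemma jacobi_assoc_left:
  "\<lbrakk>x \<in> hcomp A p; y \<in> carrier A; z \<in> carrier A; x \<otimes> z = \<zero>\<rbrakk> \<Longrightarrow> x \<otimes> (y \<otimes> z) = (x \<otimes> y) \<otimes> z"
  by (rule jacobi_assoc) (auto intro: hc_carrier gcomm_hom_left)

lemma jacobi_assoc_right: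
  "\<lbrakk>z \<in> hcomp A p; y \<in> carrier A; x \<in> carrier A; x \<otimes> z = \<zero>\<rbrakk> \<Longrightarrow> x \<otimes> (y \<otimes> z) = (x \<otimes> y) \<otimes> z"
  by (rule jacobi_assoc) (auto intro: hc_carrier gcomm_hom_right)

lemma jacobi_even:
  assumes "x \<in> hcomp A 0" "y \<in> carrier A" "z \<in> carrier A"
  shows "x \<otimes> (y \<otimes> z) = (x \<otimes> y) \<otimes> z \<oplus> y \<otimes> (x \<otimes> z)"
proof -
  have xc: "x \<in> carrier A" using assms hc_carrier by auto
  show ?thesis using assms(2)
  proof (induction y rule: homogeneous_induct)
    case (hom q y)
    then have yc: "y \<in> carrier A" using hc_carrier by auto
    show ?case using assms(3)
    proof (induction z rule: homogeneous_induct)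
      case (hom r z) 
      then show ?case using super_jacobi[OF assms(1) \<open>y \<in> hcomp A q\<close> hom] xc yc hc_carrier by simp
    next
      case (add z z') then show ?case using xc yc by (simp add: mult_add_right M.a_ac)
    qed
  next
    case (add y y') then show ?case using xc assms(3) by (simp add: mult_add_left mult_add_right M.a_ac)
  qed
qed

text \<open>The sign is a scalar and does not matter for membership in a subspace.\<close>

lemma jacobi_in:
  assumes "x \<in> hcomp A p" "y \<in> hcomp A q" "z \<in> hcomp A r" and H: "submodule H scalars A"
    and "x \<otimes> (y \<otimes> z) \<in> H" "y \<otimes> (x \<otimes> z) \<in> H"
  shows "(x \<otimes> y) \<otimes> z \<in> H"
proof -
  have c: "x \<in> carrier A" "y \<in> carrier A" "z \<in> carrier A" using assms hc_carrier by auto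
  have "x \<otimes> (y \<otimes> z) \<ominus> psign (p * q) \<odot> (y \<otimes> (x \<otimes> z)) = (x \<otimes> y) \<otimes> z"
    unfolding super_jacobi[OF assms(1-3)] a_minus_def using c by (simp add: M.a_assoc M.r_neg)
  then show ?thesis
    using sub_diff[OF H assms(5) sub_smult[OF H assms(6), of "psign (p * q)"]] by simp
qed

lemma jacobi_in':
  assumes "x \<in> hcomp A p" "y \<in> hcomp A q" "z \<in> hcomp A r" and H: "submodule H scalars A"
    and "(x \<otimes> y) \<otimes> z \<in> H" "y \<otimes> (x \<otimes> z) \<in> H"
  shows "x \<otimes> (y \<otimes> z) \<in> H"
  unfolding super_jacobi[OF assms(1-3)] using assms sub_add[OF H] sub_smult[OF H] by simp

lemma center_sub: "submodule (lie_center A) scalars A"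
  by (rule submoduleI') (auto simp: lie_center_def mult_add_left mult_smult_left)

lemma center_carrier: "z \<in> lie_center A \<Longrightarrow> z \<in> carrier A"
  by (simp add: lie_center_def)

lemma center_left: "z \<in> lie_center A \<Longrightarrow> y \<in> carrier A \<Longrightarrow> z \<otimes> y = \<zero>"
  by (simp add: lie_center_def)

lemma center_gcomm: assumes z: "z \<in> lie_center A" and y: "y \<in> carrier A" shows "gcomm z y"
  unfolding gcomm_def
proof (intro allI)
  fix p q
  have "z \<otimes> hpart A q y = \<zero>" using z y center_left by simp
  then show "hpart A p z \<otimes> hpart A q y = \<zero>"
    using gcomm_hom_right[OF hpart_hcomp[OF y, of q] center_carrier[OF z]] z y
    unfolding gcomm_def by (metis hpart_hom[OF hpart_hcomp[OF y]])
qed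

lemma center_right: "z \<in> lie_center A \<Longrightarrow> y \<in> carrier A \<Longrightarrow> y \<otimes> z = \<zero>"
  using gcomm_0[of y z] gcomm_sym[of z y] center_gcomm center_carrier by blast

lemma center_hpart: assumes "z \<in> lie_center A" shows "hpart A p z \<in> lie_center A"
proof -
  have "hpart A p z \<otimes> y = \<zero>" if y: "y \<in> carrier A" for y
  proof -
    have zc: "z \<in> carrier A" using assms center_carrier by simp
    have "hpart A p' (hpart A p z) \<otimes> hpart A q y = \<zero>" for p' q
    proof (cases "p' = p")
      case True
      then show ?thesis using center_gcomm[OF assms y] zc by (simp add: gcomm_def)
    next
      case False
      then have "hpart A p' (hpart A p z) = \<zero>" using hcomp_other[OF hpart_hcomp[OF zc]] by simp
      then show ?thesis using y by simp
    qed
    then show ?thesis using gcomm_0[of "hpart A p z" y] zc y by (simp add: gcomm_def)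
  qed
  then show ?thesis using center_carrier[OF assms] by (simp add: lie_center_def)
qed

lemma lie_restrict: assumes "subsuperalgebra S A" shows "lie_superalgebra (super_restrict A S)"
proof -
  interpret r: superalgebra "super_restrict A S" by (rule superalgebra_restrict[OF assms])
  have S: "submodule S scalars A" and m: "\<And>x y. x \<in> S \<Longrightarrow> y \<in> S \<Longrightarrow> x \<otimes> y \<in> S"
    using assms by (auto simp: subsuperalgebra_def)
  show ?thesis
  proof unfold_locales
    fix x p y q assume "x \<in> hcomp (super_restrict A S) p" "y \<in> hcomp (super_restrict A S) q"
    then show "x \<otimes>\<^bsub>super_restrict A S\<^esub> y
        = \<ominus>\<^bsub>super_restrict A S\<^esub> (psign (p * q) \<odot>\<^bsub>super_restrict A S\<^esub> (y \<otimes>\<^bsub>super_restrict A S\<^esub> x))"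
      using super_skew[of x p y q] by (simp add: restrict_facts(1)[OF assms] m sub_smult[OF S])
  next
    fix x p y q z r
    assume "x \<in> hcomp (super_restrict A S) p" "y \<in> hcomp (super_restrict A S) q"
      "z \<in> hcomp (super_restrict A S) r"
    then show "x \<otimes>\<^bsub>super_restrict A S\<^esub> (y \<otimes>\<^bsub>super_restrict A S\<^esub> z) =
       x \<otimes>\<^bsub>super_restrict A S\<^esub> y \<otimes>\<^bsub>super_restrict A S\<^esub> z \<oplus>\<^bsub>super_restrict A S\<^esub>
       psign (p * q) \<odot>\<^bsub>super_restrict A S\<^esub> (y \<otimes>\<^bsub>super_restrict A S\<^esub> (x \<otimes>\<^bsub>super_restrict A S\<^esub> z))"
      using super_jacobi[of x p y q z r] by simp
  qed
qed

lemma derived_sub: "submodule (derived A) scalars A"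
  unfolding derived_def by (rule lspan_submodule) auto

lemma derived_base: "x \<in> carrier A \<Longrightarrow> y \<in> carrier A \<Longrightarrow> x \<otimes> y \<in> derived A"
  unfolding derived_def by (rule lspan_base) auto

end

subsection \<open>The direct product\<close>

definition super_prod ::
    "('f :: field, 'v) superalgebra \<Rightarrow> ('f, 'w) superalgebra \<Rightarrow> ('f, 'v \<times> 'w) superalgebra" where
  "super_prod L M = \<lparr>carrier = carrier L \<times> carrier M,
     monoid.mult = (\<lambda>x y. (fst x \<otimes>\<^bsub>L\<^esub> fst y, snd x \<otimes>\<^bsub>M\<^esub> snd y)),
     one = (\<one>\<^bsub>L\<^esub>, \<one>\<^bsub>M\<^esub>), zero = (\<zero>\<^bsub>L\<^esub>, \<zero>\<^bsub>M\<^esub>),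
     add = (\<lambda>x y. (fst x \<oplus>\<^bsub>L\<^esub> fst y, snd x \<oplus>\<^bsub>M\<^esub> snd y)),
     smult = (\<lambda>c x. (c \<odot>\<^bsub>L\<^esub> fst x, c \<odot>\<^bsub>M\<^esub> snd x)),
     hcomp = (\<lambda>p. hcomp L p \<times> hcomp M p)\<rparr>"

lemma super_prod_simps [simp]:
  "carrier (super_prod L M) = carrier L \<times> carrier M"
  "x \<otimes>\<^bsub>super_prod L M\<^esub> y = (fst x \<otimes>\<^bsub>L\<^esub> fst y, snd x \<otimes>\<^bsub>M\<^esub> snd y)"
  "\<zero>\<^bsub>super_prod L M\<^esub> = (\<zero>\<^bsub>L\<^esub>, \<zero>\<^bsub>M\<^esub>)"
  "x \<oplus>\<^bsub>super_prod L M\<^esub> y = (fst x \<oplus>\<^bsub>L\<^esub> fst y, snd x \<oplus>\<^bsub>M\<^esub> snd y)"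
  "c \<odot>\<^bsub>super_prod L M\<^esub> x = (c \<odot>\<^bsub>L\<^esub> fst x, c \<odot>\<^bsub>M\<^esub> snd x)"
  "hcomp (super_prod L M) p = hcomp L p \<times> hcomp M p"
  by (simp_all add: super_prod_def)

lemma lie_super_prod:
  fixes L :: "('f :: field, 'v) superalgebra" and M :: "('f, 'w) superalgebra"
  assumes "lie_superalgebra L" "lie_superalgebra M"
  shows "lie_superalgebra (super_prod L M)"
proof -
  interpret L: lie_superalgebra L by fact
  interpret M: lie_superalgebra M by fact
  have mo: "module scalars (super_prod L M)"
  proof (rule moduleI)
    show "cring (scalars :: 'f ring)" by (rule cring_scalars)
    show "abelian_group (super_prod L M)"
    proof (rule abelian_groupI)
      fix x assume x: "x \<in> carrier (super_prod L M)"
      show "\<exists>y\<in>carrier (super_prod L M). y \<oplus>\<^bsub>super_prod L M\<^esub> x = \<zero>\<^bsub>super_prod L M\<^esub>"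
        using x by (intro bexI[of _ "(\<ominus>\<^bsub>L\<^esub> fst x, \<ominus>\<^bsub>M\<^esub> snd x)"]) (auto simp: L.M.l_neg M.M.l_neg)
    qed (auto simp: L.M.a_ac M.M.a_ac)
  qed (auto simp: L.smult_add_l L.smult_add_r L.smult_smult M.smult_add_l M.smult_add_r M.smult_smult)
  interpret r: module scalars "super_prod L M" by (rule mo)
  have minus: "\<ominus>\<^bsub>super_prod L M\<^esub> x = (\<ominus>\<^bsub>L\<^esub> fst x, \<ominus>\<^bsub>M\<^esub> snd x)" if "x \<in> carrier (super_prod L M)" for x
    using r.M.minus_equality[of "(\<ominus>\<^bsub>L\<^esub> fst x, \<ominus>\<^bsub>M\<^esub> snd x)" x] that by (auto simp: L.M.l_neg M.M.l_neg)
  have "superalgebra (super_prod L M)"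
  proof (intro superalgebra.intro mo superalgebra_axioms.intro)
    fix p show "submodule (hcomp (super_prod L M) p) scalars (super_prod L M)"
    proof (rule r.submoduleI)
      fix a assume "a \<in> hcomp (super_prod L M) p"
      then show "\<ominus>\<^bsub>super_prod L M\<^esub> a \<in> hcomp (super_prod L M) p"
        using minus[of a] L.hc_carrier M.hc_carrier L.hc_minus M.hc_minus by auto
    qed (auto simp: L.hc_add L.hc_smult M.hc_add M.hc_smult intro: L.hc_carrier M.hc_carrier)
  next
    show "hcomp (super_prod L M) 0 \<inter> hcomp (super_prod L M) 1 = {\<zero>\<^bsub>super_prod L M\<^esub>}"
      using L.hcomp_disjoint M.hcomp_disjoint by auto
  next
    show "hcomp (super_prod L M) 0 <+>\<^bsub>super_prod L M\<^esub> hcomp (super_prod L M) 1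
        = carrier (super_prod L M)"
    proof (intro equalityI subsetI)
      fix x assume "x \<in> hcomp (super_prod L M) 0 <+>\<^bsub>super_prod L M\<^esub> hcomp (super_prod L M) 1"
      then show "x \<in> carrier (super_prod L M)" 
        using L.hc_carrier M.hc_carrier by (auto simp: set_add_eq)
    next
      fix x assume "x \<in> carrier (super_prod L M)"
      then have x: "fst x \<in> carrier L" "snd x \<in> carrier M" by auto
      have "x = (hpart L 0 (fst x), hpart M 0 (snd x)) \<oplus>\<^bsub>super_prod L M\<^esub> (hpart L 1 (fst x), hpart M 1 (snd x))"
        using L.hpart_split(2)[OF x(1), of 0] M.hpart_split(2)[OF x(2), of 0] by (simp add: prod_eq_iff)
      moreover have "(hpart L p (fst x), hpart M p (snd x)) \<in> hcomp (super_prod L M) p" for p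
        using x by simp
      ultimately show "x \<in> hcomp (super_prod L M) 0 <+>\<^bsub>super_prod L M\<^esub> hcomp (super_prod L M) 1"
        unfolding set_add_eq by blast
    qed
  qed (auto simp: L.mult_add_left L.mult_add_right L.mult_smult_left L.mult_smult_right
       M.mult_add_left M.mult_add_right M.mult_smult_left M.mult_smult_right
       intro: L.mult_graded M.mult_graded)
  then interpret r: superalgebra "super_prod L M" .
  show ?thesis
  proof unfold_locales
    fix x p y q assume "x \<in> hcomp (super_prod L M) p" "y \<in> hcomp (super_prod L M) q"
    then show "x \<otimes>\<^bsub>super_prod L M\<^esub> y
        = \<ominus>\<^bsub>super_prod L M\<^esub> (psign (p * q) \<odot>\<^bsub>super_prod L M\<^esub> (y \<otimes>\<^bsub>super_prod L M\<^esub> x))"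
      using L.super_skew[of "fst x" p "fst y" q] M.super_skew[of "snd x" p "snd y" q]
        L.hc_carrier M.hc_carrier by (subst minus) auto
  next
    fix x p y q z r
    assume "x \<in> hcomp (super_prod L M) p" "y \<in> hcomp (super_prod L M) q"
      "z \<in> hcomp (super_prod L M) r"
    then show "x \<otimes>\<^bsub>super_prod L M\<^esub> (y \<otimes>\<^bsub>super_prod L M\<^esub> z) =
       x \<otimes>\<^bsub>super_prod L M\<^esub> y \<otimes>\<^bsub>super_prod L M\<^esub> z \<oplus>\<^bsub>super_prod L M\<^esub>
       psign (p * q) \<odot>\<^bsub>super_prod L M\<^esub> (y \<otimes>\<^bsub>super_prod L M\<^esub> (x \<otimes>\<^bsub>super_prod L M\<^esub> z))"
      using L.super_jacobi[of "fst x" p "fst y" q "fst z" r] M.super_jacobi[of "snd x" p "snd y" q "snd z" r]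
      by (simp add: mem_Times_iff)
  qed
qed

subsection \<open>The supercommutator\<close>

text \<open>Identities between linear combinations of six vectors are checked on the coefficients.\<close>

definition (in superalgebra) lc where
  "lc u = (\<lambda>a b c d e f. a \<odot> u (0::nat) \<oplus> (b \<odot> u 1 \<oplus> (c \<odot> u 2 \<oplus> (d \<odot> u 3 \<oplus> (e \<odot> u 4 \<oplus> f \<odot> u 5)))))"

context superalgebra
begin

lemma lc_ops:
  assumes u: "\<And>i. u i \<in> carrier A"
  shows "lc u a b c d e f \<oplus> lc u a' b' c' d' e' f' = lc u (a + a') (b + b') (c + c') (d + d') (e + e') (f + f')"
    and "k \<odot> lc u a b c d e f = lc u (k * a) (k * b) (k * c) (k * d) (k * e) (k * f)"
    and "lc u a b c d e f \<ominus> lc u a' b' c' d' e' f' = lc u (a - a') (b - b') (c - c') (d - d') (e - e') (f - f')"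
    and "u 0 = lc u 1 0 0 0 0 0" "u 1 = lc u 0 1 0 0 0 0" "u 2 = lc u 0 0 1 0 0 0"
    and "u 3 = lc u 0 0 0 1 0 0" "u 4 = lc u 0 0 0 0 1 0" "u 5 = lc u 0 0 0 0 0 1"
    and "lc u a b c d e f \<in> carrier A"
proof -
  show add: "lc u a b c d e f \<oplus> lc u a' b' c' d' e' f' = lc u (a + a') (b + b') (c + c') (d + d') (e + e') (f + f')"
    for a b c d e f a' b' c' d' e' f'
    using u by (simp add: lc_def smult_add_l M.a_ac)
  show smult: "k \<odot> lc u a b c d e f = lc u (k * a) (k * b) (k * c) (k * d) (k * e) (k * f)"
    for k a b c d e f
    using u by (simp add: lc_def smult_add_r smult_smult)
  show car: "lc u a b c d e f \<in> carrier A" for a b c d e f using u by (simp add: lc_def)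
  have "\<ominus> lc u a' b' c' d' e' f' = lc u (- a') (- b') (- c') (- d') (- e') (- f')"
    using smult[of "- 1" a' b' c' d' e' f'] car by simp
  then show "lc u a b c d e f \<ominus> lc u a' b' c' d' e' f' = lc u (a - a') (b - b') (c - c') (d - d') (e - e') (f - f')"
    by (simp add: a_minus_def add)
qed (use u in \<open>simp_all add: lc_def\<close>)

text \<open>The contribution of one pair of parities to the supercommutator. Bilinearity is checked on these four terms.\<close>

definition sctm where "sctm p q x y = hpart A p x \<otimes> hpart A q y \<ominus> psign (p * q) \<odot> (hpart A q y \<otimes> hpart A p x)"

lemma sctm_carrier [simp]: "x \<in> carrier A \<Longrightarrow> y \<in> carrier A \<Longrightarrow> sctm p q x y \<in> carrier A"
  by (simp add: sctm_def)

lemma sctm_add: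
  assumes "x \<in> carrier A" "y \<in> carrier A" "z \<in> carrier A"
  shows "sctm p q (x \<oplus> y) z = sctm p q x z \<oplus> sctm p q y z" "sctm p q z (x \<oplus> y) = sctm p q z x \<oplus> sctm p q z y"
  using assms by (simp_all add: sctm_def hpart_add mult_add_left mult_add_right smult_add_r a_minus_def
      M.minus_add M.a_ac)

lemma sctm_smult:
  assumes "x \<in> carrier A" "y \<in> carrier A"
  shows "sctm p q (c \<odot> x) y = c \<odot> sctm p q x y" "sctm p q x (c \<odot> y) = c \<odot> sctm p q x y"
  using assms by (simp_all add: sctm_def hpart_smult mult_smult_left mult_smult_right smult_add_r a_minus_def
      smult_minus smult_smult mult.commute)

lemma supercommutator_sctm:
  assumes "x \<in> carrier A" "y \<in> carrier A"
  shows "supercommutator A x y = (sctm 0 0 x y \<oplus> sctm 0 1 x y) \<oplus> (sctm 1 0 x y \<oplus> sctm 1 1 x y)"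
proof -
  have "supercommutator A x y = (\<Oplus>p\<in>UNIV. \<Oplus>q\<in>UNIV. sctm p q x y)"
    by (simp add: supercommutator_def sctm_def)
  then show ?thesis using assms by (simp add: finsum_bit M.a_ac)
qed

lemma supercommutator_carrier [simp]:
  "x \<in> carrier A \<Longrightarrow> y \<in> carrier A \<Longrightarrow> supercommutator A x y \<in> carrier A"
  by (simp add: supercommutator_sctm)

lemma supercommutator_add:
  assumes "x \<in> carrier A" "y \<in> carrier A" "z \<in> carrier A"
  shows "supercommutator A (x \<oplus> y) z = supercommutator A x z \<oplus> supercommutator A y z"
    "supercommutator A z (x \<oplus> y) = supercommutator A z x \<oplus> supercommutator A z y"
  using assms by (simp_all add: supercommutator_sctm sctm_add M.a_ac)

lemma supercommutator_smult:
  assumes "x \<in> carrier A" "y \<in> carrier A"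
  shows "supercommutator A (c \<odot> x) y = c \<odot> supercommutator A x y"
    "supercommutator A x (c \<odot> y) = c \<odot> supercommutator A x y"
  using assms by (simp_all add: supercommutator_sctm sctm_smult smult_add_r)

lemma supercommutator_hom:
  assumes "x \<in> hcomp A p" "y \<in> hcomp A q"
  shows "supercommutator A x y = x \<otimes> y \<ominus> psign (p * q) \<odot> (y \<otimes> x)"
proof -
  have c: "x \<in> carrier A" "y \<in> carrier A" using assms hc_carrier by auto
  have "sctm p' q' x y = (if p' = p \<and> q' = q then x \<otimes> y \<ominus> psign (p * q) \<odot> (y \<otimes> x) else \<zero>)" for p' q'
    using assms hcomp_other[OF assms(1), of p'] hcomp_other[OF assms(2), of q'] c
    by (cases "p' = p"; cases "q' = q") (auto simp: sctm_def a_minus_def)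
  then show ?thesis unfolding supercommutator_sctm[OF c] using c by (cases p; cases q) simp_all
qed

lemma commutator_simps [simp]:
  "carrier (commutator_superalgebra A) = carrier A" "zero (commutator_superalgebra A) = zero A"
  "monoid.mult (commutator_superalgebra A) = supercommutator A"
  "add (commutator_superalgebra A) = add A" "smult (commutator_superalgebra A) = smult A"
  "hcomp (commutator_superalgebra A) = hcomp A"
  by (simp_all add: commutator_superalgebra_def)

lemma commutator_superalgebra: "superalgebra (commutator_superalgebra A)"
proof -
  have ab: "abelian_group (commutator_superalgebra A)"
  proof (rule abelian_groupI)
    fix x assume x: "x \<in> carrier (commutator_superalgebra A)"
    show "\<exists>y\<in>carrier (commutator_superalgebra A).
        y \<oplus>\<^bsub>commutator_superalgebra A\<^esub> x = \<zero>\<^bsub>commutator_superalgebra A\<^esub>"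
      using x by (intro bexI[of _ "\<ominus> x"]) (auto simp: M.l_neg)
  qed (auto simp: M.a_ac)
  have mo: "module scalars (commutator_superalgebra A)"
    by (rule moduleI) (auto simp: ab cring_scalars smult_add_l smult_add_r smult_smult)
  interpret r: module scalars "commutator_superalgebra A" by (rule mo)
  show ?thesis
  proof (intro superalgebra.intro mo superalgebra_axioms.intro)
    fix p show "submodule (hcomp (commutator_superalgebra A) p) scalars (commutator_superalgebra A)"
    proof (rule r.submoduleI)
      fix a assume "a \<in> hcomp (commutator_superalgebra A) p"
      then have a: "a \<in> hcomp A p" "a \<in> carrier A" using hc_carrier by auto
      then have "\<ominus>\<^bsub>commutator_superalgebra A\<^esub> a = \<ominus> a"
        using r.M.minus_equality[of "\<ominus> a" a] by (simp add: M.l_neg)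
      then show "\<ominus>\<^bsub>commutator_superalgebra A\<^esub> a \<in> hcomp (commutator_superalgebra A) p"
        using a hc_minus by simp
    qed (auto simp: hc_add hc_smult intro: hc_carrier)
  next
    show "hcomp (commutator_superalgebra A) 0 <+>\<^bsub>commutator_superalgebra A\<^esub> hcomp (commutator_superalgebra A) 1
        = carrier (commutator_superalgebra A)"
      using hcomp_sum by (simp add: set_add_eq)
  next
    fix x y p q assume "x \<in> hcomp (commutator_superalgebra A) p" "y \<in> hcomp (commutator_superalgebra A) q"
    then show "x \<otimes>\<^bsub>commutator_superalgebra A\<^esub> y \<in> hcomp (commutator_superalgebra A) (p + q)"
      using supercommutator_hom[of x p y q] mult_graded[of x p y q] mult_graded[of y q x p]
      by (simp add: hc_diff hc_smult add.commute)
  qed (use hcomp_disjoint in \<open>simp_all add: supercommutator_add supercommutator_smult\<close>)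
qed

end

lemma (in unital_assoc_superalgebra) lie_commutator: "lie_superalgebra (commutator_superalgebra A)"
proof -
  interpret r: superalgebra "commutator_superalgebra A" by (rule commutator_superalgebra)
  have minus: "\<ominus>\<^bsub>commutator_superalgebra A\<^esub> a = \<ominus> a" if "a \<in> carrier A" for a
    using r.M.minus_equality[of "\<ominus> a" a] that by (simp add: M.l_neg)
  show ?thesis
  proof unfold_locales
    fix x p y q assume "x \<in> hcomp (commutator_superalgebra A) p" "y \<in> hcomp (commutator_superalgebra A) q"
    then have h: "x \<in> hcomp A p" "y \<in> hcomp A q" and c: "x \<in> carrier A" "y \<in> carrier A"
      using hc_carrier by auto
    have "x \<otimes> y \<ominus> psign (p * q) \<odot> (y \<otimes> x) = \<ominus> (psign (p * q) \<odot> (y \<otimes> x \<ominus> psign (q * p) \<odot> (x \<otimes> y)))"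
      using c by (simp add: a_minus_def smult_add_r smult_minus smult_smult M.minus_add M.a_ac mult.commute[of q p])
    then show "x \<otimes>\<^bsub>commutator_superalgebra A\<^esub> y
        = \<ominus>\<^bsub>commutator_superalgebra A\<^esub> (psign (p * q) \<odot>\<^bsub>commutator_superalgebra A\<^esub> (y \<otimes>\<^bsub>commutator_superalgebra A\<^esub> x))"
      using supercommutator_hom[OF h] supercommutator_hom[OF h(2,1)] c by (simp add: minus)
  next
    fix x p y q z r
    assume "x \<in> hcomp (commutator_superalgebra A) p" "y \<in> hcomp (commutator_superalgebra A) q"
      "z \<in> hcomp (commutator_superalgebra A) r"
    then have h: "x \<in> hcomp A p" "y \<in> hcomp A q" "z \<in> hcomp A r"
      and c: "x \<in> carrier A" "y \<in> carrier A" "z \<in> carrier A" using hc_carrier by auto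
    define u where "u = (\<lambda>i::nat. if i = 0 then x \<otimes> (y \<otimes> z) else if i = 1 then x \<otimes> (z \<otimes> y)
       else if i = 2 then y \<otimes> (z \<otimes> x) else if i = 3 then z \<otimes> (y \<otimes> x)
       else if i = 4 then y \<otimes> (x \<otimes> z) else z \<otimes> (x \<otimes> y))"
    have u: "u i \<in> carrier A" for i using c by (simp add: u_def)
    have us: "x \<otimes> (y \<otimes> z) = lc u 1 0 0 0 0 0" "x \<otimes> (z \<otimes> y) = lc u 0 1 0 0 0 0"
      "y \<otimes> (z \<otimes> x) = lc u 0 0 1 0 0 0" "z \<otimes> (y \<otimes> x) = lc u 0 0 0 1 0 0"
      "y \<otimes> (x \<otimes> z) = lc u 0 0 0 0 1 0" "z \<otimes> (x \<otimes> y) = lc u 0 0 0 0 0 1"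
      using lc_ops(4-9)[of u] u by (simp_all add: u_def)
    note g = mult_graded[OF h(1,2)] mult_graded[OF h(2,1)] mult_graded[OF h(1,3)] mult_graded[OF h(3,1)]
      mult_graded[OF h(2,3)] mult_graded[OF h(3,2)]
    have 1: "supercommutator A a b \<in> hcomp A (p + q)" if "a \<in> hcomp A p" "b \<in> hcomp A q" for a b p q
      using r.mult_graded[of a p b q] that by simp
    note m = mult_carrier[OF c(2,3)] mult_carrier[OF c(1,2)] mult_carrier[OF c(1,3)]
      mult_carrier[OF c(3,2)] mult_carrier[OF c(2,1)] mult_carrier[OF c(3,1)]
    note sm = smult_carrier[OF m(4)] smult_carrier[OF m(5)] smult_carrier[OF m(6)]
    note ops = lc_ops(1-3)[of u, OF u]
    note exp = supercommutator_hom[OF h(1) 1[OF h(2,3)]] supercommutator_hom[OF 1[OF h(1,2)] h(3)]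
      supercommutator_hom[OF h(2) 1[OF h(1,3)]]
    note exp' = supercommutator_hom[OF h(1,2)] supercommutator_hom[OF h(2,3)] supercommutator_hom[OF h(1,3)]
    show "x \<otimes>\<^bsub>commutator_superalgebra A\<^esub> (y \<otimes>\<^bsub>commutator_superalgebra A\<^esub> z) =
       x \<otimes>\<^bsub>commutator_superalgebra A\<^esub> y \<otimes>\<^bsub>commutator_superalgebra A\<^esub> z \<oplus>\<^bsub>commutator_superalgebra A\<^esub>
       psign (p * q) \<odot>\<^bsub>commutator_superalgebra A\<^esub> (y \<otimes>\<^bsub>commutator_superalgebra A\<^esub> (x \<otimes>\<^bsub>commutator_superalgebra A\<^esub> z))"
      unfolding commutator_simps exp unfolding exp'
        mult_diff[OF c(1) m(1) sm(1)] mult_diff[OF c(3) m(2) sm(2)] mult_diff[OF c(2) m(3) sm(3)]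
      using c m by (simp only: mult_smult_left mult_smult_right mult_assoc us ops c m smult_carrier mult_carrier lc_ops(10)[of u, OF u] mult_diff)
        (cases p; cases q; cases r; simp)
  qed
qed


section \<open>Coordinates on a Lie superalgebra\<close>

text \<open>Comparing parities in \<open>1 \<cdot> x = x\<close> shows that the odd part of the unit annihilates the algebra.\<close>

lemma (in unital_assoc_superalgebra) one_even: "\<one> \<in> hcomp A 0"
proof -
  let ?e = "hpart A 0 \<one>" and ?f = "hpart A 1 \<one>"
  have c: "?e \<in> hcomp A 0" "?f \<in> hcomp A 1" "?e \<in> carrier A" "?f \<in> carrier A"
    using one_in_carrier by auto
  have s: "\<one> = ?e \<oplus> ?f" using hpart_split(2)[OF one_in_carrier, of 0] by simp
  have fx: "?f \<otimes> x = \<zero>" if x: "x \<in> hcomp A p" for x p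
  proof -
    have xc: "x \<in> carrier A" using x hc_carrier by auto
    have "x = ?e \<otimes> x \<oplus> ?f \<otimes> x" using s one_left[OF xc] c xc mult_add_left by metis
    moreover have "?e \<otimes> x \<in> hcomp A p" "?f \<otimes> x \<in> hcomp A (p + 1)"
      using mult_graded[OF c(1) x] mult_graded[OF c(2) x] by (auto simp: add.commute)
    ultimately show ?thesis
      using hcomp_decomp_eq(2)[of "?e \<otimes> x" p "?f \<otimes> x" x "\<zero>"] x xc by simp
  qed
  have "?f = ?f \<otimes> (?e \<oplus> ?f)" using s c one_right by metis
  also have "\<dots> = \<zero>" using fx[OF c(1)] fx[OF c(2)] c by (simp add: mult_add_right)
  finally show ?thesis using s c by simp
qed

text \<open>Off-diagonal coordinates with coefficients in \<open>A\<close>. The relations are those of the Steinberg Lie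
  superalgebra; nothing is required of the diagonal \<open>[\<phi>\<^sub>i\<^sub>j(a), \<phi>\<^sub>j\<^sub>i(b)]\<close>, which is where the central
  extensions of $\mathfrak{sl}_{n+1,n+1}(A)$ differ.\<close>

locale steinberg = lie: lie_superalgebra L + coef: unital_assoc_superalgebra A
  for L :: "('f :: field, 'v) superalgebra" and A :: "('f, 'a) superalgebra" +
  fixes \<phi> :: "'n :: finite + 'n \<Rightarrow> 'n + 'n \<Rightarrow> 'a \<Rightarrow> 'v"
  assumes card3: "3 \<le> CARD('n)"
    and phi_hom: "\<lbrakk>i \<noteq> j; a \<in> hcomp A p\<rbrakk> \<Longrightarrow> \<phi> i j a \<in> hcomp L (p + ipar i + ipar j)"
    and phi_add: "\<lbrakk>i \<noteq> j; a \<in> carrier A; b \<in> carrier A\<rbrakk> \<Longrightarrow> \<phi> i j (a \<oplus>\<^bsub>A\<^esub> b) = \<phi> i j a \<oplus>\<^bsub>L\<^esub> \<phi> i j b"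
    and phi_smult: "\<lbrakk>i \<noteq> j; a \<in> carrier A\<rbrakk> \<Longrightarrow> \<phi> i j (c \<odot>\<^bsub>A\<^esub> a) = c \<odot>\<^bsub>L\<^esub> \<phi> i j a"
    and phi_mult: "\<lbrakk>i \<noteq> j; j \<noteq> k; i \<noteq> k; a \<in> carrier A; b \<in> carrier A\<rbrakk>
          \<Longrightarrow> \<phi> i j a \<otimes>\<^bsub>L\<^esub> \<phi> j k b = \<phi> i k (a \<otimes>\<^bsub>A\<^esub> b)"
    and phi_comm: "\<lbrakk>i \<noteq> j; k \<noteq> l; j \<noteq> k; i \<noteq> l; a \<in> carrier A; b \<in> carrier A\<rbrakk>
          \<Longrightarrow> \<phi> i j a \<otimes>\<^bsub>L\<^esub> \<phi> k l b = \<zero>\<^bsub>L\<^esub>"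
    and phi_inj: "\<lbrakk>i \<noteq> j; a \<in> carrier A; \<phi> i j a = \<zero>\<^bsub>L\<^esub>\<rbrakk> \<Longrightarrow> a = \<zero>\<^bsub>A\<^esub>"

lemma ex_fresh_index:
  assumes "3 \<le> CARD('n :: finite)"
  obtains p :: "'n :: finite + 'n" where "p \<notin> {a, b, c, d, e}"
proof -
  have "card {a, b, c, d, e} \<le> 5" by (simp add: card_insert_if)
  also have "\<dots> < CARD('n + 'n)" using assms by simp
  finally have "{a, b, c, d, e} \<noteq> UNIV" by auto
  then show thesis using that by auto
qed

context steinberg
begin

abbreviation lbr (infixl \<open>\<star>\<close> 70) where "x \<star> y \<equiv> x \<otimes>\<^bsub>L\<^esub> y"

lemma fresh: obtains p :: "'n + 'n" where "p \<notin> {a, b, c, d, e}"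
  using ex_fresh_index[OF card3] by blast

lemma phi_carrier [simp]: "i \<noteq> j \<Longrightarrow> a \<in> carrier A \<Longrightarrow> \<phi> i j a \<in> carrier L"
proof -
  assume ij: "i \<noteq> j" and "a \<in> carrier A"
  from this(2) show ?thesis
  proof (induction a rule: coef.homogeneous_induct)
    case (hom p x) then show ?case using phi_hom[OF ij] lie.hc_carrier by blast
  next
    case (add x y) then show ?case using ij by (simp add: phi_add)
  qed
qed

lemma phi_zero [simp]: "i \<noteq> j \<Longrightarrow> \<phi> i j \<zero>\<^bsub>A\<^esub> = \<zero>\<^bsub>L\<^esub>"
  using phi_smult[of i j "\<zero>\<^bsub>A\<^esub>" 0] by simp

lemma phi_one [simp]: "i \<noteq> j \<Longrightarrow> \<phi> i j \<one>\<^bsub>A\<^esub> \<in> hcomp L (ipar i + ipar j)"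
  using phi_hom[OF _ coef.one_even, of i j] by (simp add: add.commute)

lemmas one_carrier [simp] = coef.one_in_carrier

definition "\<Phi> i j = \<phi> i j ` carrier A"

lemma Phi_sub: assumes "i \<noteq> j" shows "submodule (\<Phi> i j) scalars L"
proof (rule lie.submoduleI')
  show "\<zero>\<^bsub>L\<^esub> \<in> \<Phi> i j"
    using phi_zero[OF assms] coef.M.zero_closed unfolding \<Phi>_def by (metis image_eqI)
  show "a \<oplus>\<^bsub>L\<^esub> b \<in> \<Phi> i j" if "a \<in> \<Phi> i j" "b \<in> \<Phi> i j" for a b
    using that phi_add[OF assms] coef.M.a_closed unfolding \<Phi>_def by (smt (verit) image_iff)
  show "c \<odot>\<^bsub>L\<^esub> a \<in> \<Phi> i j" if "a \<in> \<Phi> i j" for c a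
    using that phi_smult[OF assms] coef.smult_carrier unfolding \<Phi>_def by (smt (verit) image_iff)
qed (use assms in \<open>auto simp: \<Phi>_def\<close>)

lemma PhiI: "a \<in> carrier A \<Longrightarrow> \<phi> i j a \<in> \<Phi> i j"
  by (auto simp: \<Phi>_def)

lemma PhiE: "x \<in> \<Phi> i j \<Longrightarrow> (\<And>a. a \<in> carrier A \<Longrightarrow> x = \<phi> i j a \<Longrightarrow> P) \<Longrightarrow> P"
  by (auto simp: \<Phi>_def)

lemma phi_mult_flip:
  assumes "i \<noteq> j" "k \<noteq> i" "k \<noteq> j" "a \<in> carrier A" "b \<in> carrier A"
  shows "\<phi> i j a \<star> \<phi> k i b \<in> \<Phi> k j"
proof -
  note sm = Phi_sub[OF assms(3)]
  show ?thesis using assms(4)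
  proof (induction a rule: coef.homogeneous_induct)
    case (hom p a)
    then have ac: "a \<in> carrier A" using coef.hc_carrier by auto
    show ?case using assms(5)
    proof (induction b rule: coef.homogeneous_induct)
      case (hom q b)
      then have bc: "b \<in> carrier A" using coef.hc_carrier by auto
      have "\<phi> k i b \<star> \<phi> i j a \<in> \<Phi> k j" using assms ac bc PhiI by (simp add: phi_mult)
      then show ?case
        using lie.skew_in[OF phi_hom[OF assms(2) hom] phi_hom[OF assms(1) \<open>a \<in> hcomp A p\<close>] sm] by simp
    next
      case (add b b') then show ?case
        using assms ac lie.sub_add[OF sm] by (simp add: phi_add lie.mult_add_right)
    qed
  next
    case (add a a') then show ?case
      using assms lie.sub_add[OF sm] by (simp add: phi_add lie.mult_add_left)
  qed
qed

lemma br_phi: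
  assumes "i \<noteq> j" "k \<noteq> l" "\<not> (k = j \<and> l = i)" "x \<in> \<Phi> i j" "y \<in> \<Phi> k l"
  shows "x \<star> y \<in> (if j = k then \<Phi> i l else if i = l then \<Phi> k j else {\<zero>\<^bsub>L\<^esub>})"
proof -
  obtain a b where ab: "a \<in> carrier A" "b \<in> carrier A" "x = \<phi> i j a" "y = \<phi> k l b"
    using assms(4,5) by (auto simp: \<Phi>_def)
  consider "j = k" "i \<noteq> l" | "j \<noteq> k" "i = l" | "j \<noteq> k" "i \<noteq> l" using assms by auto
  then show ?thesis
  proof cases
    case 1 then show ?thesis using ab assms PhiI by (simp add: phi_mult)
  next
    case 2 then show ?thesis using ab assms phi_mult_flip[of i j k a b] by auto
  next
    case 3 then show ?thesis using ab assms by (simp add: phi_comm)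
  qed
qed

text \<open>The diagonal part normalises each coordinate space. A third index reduces the two spaces that
  the Jacobi identity does not reach directly to the others.\<close>

lemma diag_phi_aux:
  assumes ij: "i \<noteq> j" and kl: "k \<noteq> l" and n: "\<not> (k = i \<and> l = j)" "\<not> (k = j \<and> l = i)"
    and a: "a \<in> hcomp A p" and b: "b \<in> hcomp A q" and c: "c \<in> hcomp A r"
  shows "(\<phi> i j a \<star> \<phi> j i b) \<star> \<phi> k l c \<in> \<Phi> k l"
proof -
  note sm = Phi_sub[OF kl] 
  have Pa: "\<phi> i j a \<in> \<Phi> i j" and Pb: "\<phi> j i b \<in> \<Phi> j i" and Pc: "\<phi> k l c \<in> \<Phi> k l"
    using a b c coef.hc_carrier by (auto simp: \<Phi>_def)
  have main: "x \<star> (y \<star> z) \<in> \<Phi> k l"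
    if "i \<noteq> j" "x \<in> \<Phi> i j" "y \<in> \<Phi> j i" "z \<in> \<Phi> k l" "\<not> (k = i \<and> l = j)" "\<not> (k = j \<and> l = i)" for i j x y z
  proof -
    have xc: "x \<in> carrier L" using that Phi_sub lie.sub_carrier by metis
    have yz: "y \<star> z \<in> (if i = k then \<Phi> j l else if j = l then \<Phi> k i else {\<zero>\<^bsub>L\<^esub>})"
      using br_phi[of j i k l y z] that kl by auto
    consider "i = k" | "i \<noteq> k" "j = l" | "i \<noteq> k" "j \<noteq> l" by auto
    then show ?thesis
    proof cases
      case 1
      then have "y \<star> z \<in> \<Phi> j l" "j \<noteq> l" using yz that kl by auto
      then show ?thesis using br_phi[of i j j l x "y \<star> z"] that 1 kl by auto
    next
      case 2
      then have "y \<star> z \<in> \<Phi> k i" using yz by simp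
      then show ?thesis using br_phi[of i j k i x "y \<star> z"] that 2 kl by auto
    next
      case 3
      then have "y \<star> z = \<zero>\<^bsub>L\<^esub>" using yz by simp
      then show ?thesis using xc lie.sub_zero[OF sm] by simp
    qed
  qed
  show ?thesis
    by (rule lie.jacobi_in[OF phi_hom[OF ij a] phi_hom[OF ij[symmetric] b] phi_hom[OF kl c] sm])
       (use main[OF ij Pa Pb Pc] main[OF ij[symmetric] Pb Pa Pc] n in auto)
qed

text \<open>In the two excluded cases \<open>\<phi>\<^sub>k\<^sub>l(c)\<close> is written as \<open>[\<phi>\<^sub>k\<^sub>h(c), \<phi>\<^sub>h\<^sub>l(1)]\<close>, whose factors are covered by
  the previous case.\<close>

lemma diag_phi_hom:
  assumes ij: "i \<noteq> j" and kl: "k \<noteq> l"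
    and a: "a \<in> hcomp A p" and b: "b \<in> hcomp A q" and c: "c \<in> hcomp A r"
  shows "(\<phi> i j a \<star> \<phi> j i b) \<star> \<phi> k l c \<in> \<Phi> k l"
proof (cases "(k = i \<and> l = j) \<or> (k = j \<and> l = i)")
  case False
  then show ?thesis using diag_phi_aux[OF ij kl _ _ a b c] by simp
next
  case True
  obtain h where h: "h \<notin> {i, j, k, l, l}" by (rule fresh)
  then have hk: "k \<noteq> h" "h \<noteq> l" by auto
  have cc: "c \<in> carrier A" using c coef.hc_carrier by auto
  let ?D = "\<phi> i j a \<star> \<phi> j i b"
  have D: "?D \<in> hcomp L (p + ipar i + ipar j + (q + ipar j + ipar i))"
    by (rule lie.mult_graded[OF phi_hom[OF ij a] phi_hom[OF ij[symmetric] b]])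
  have e: "\<phi> k l c = \<phi> k h c \<star> \<phi> h l \<one>\<^bsub>A\<^esub>"
    using hk kl cc by (simp add: phi_mult coef.one_right)
  have 1: "?D \<star> \<phi> k h c \<in> \<Phi> k h" by (rule diag_phi_aux[OF ij hk(1) _ _ a b c]) (use h in auto)
  have 2: "?D \<star> \<phi> h l \<one>\<^bsub>A\<^esub> \<in> \<Phi> h l"
    by (rule diag_phi_aux[OF ij hk(2) _ _ a b coef.one_even]) (use h in auto)
  show ?thesis unfolding e
  proof (rule lie.jacobi_in'[OF D phi_hom[OF hk(1) c] phi_hom[OF hk(2) coef.one_even] Phi_sub[OF kl]])
    show "(?D \<star> \<phi> k h c) \<star> \<phi> h l \<one>\<^bsub>A\<^esub> \<in> \<Phi> k l"
      using br_phi[of k h h l, OF hk _ 1 PhiI] kl by simp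
    show "\<phi> k h c \<star> (?D \<star> \<phi> h l \<one>\<^bsub>A\<^esub>) \<in> \<Phi> k l"
      using br_phi[of k h h l, OF hk _ PhiI[OF cc] 2] kl by simp
  qed
qed

lemma diag_graded: 
  assumes "i \<noteq> j" "a \<in> hcomp A p" "b \<in> hcomp A q"
  shows "\<phi> i j a \<star> \<phi> j i b \<in> hcomp L (p + q)"
proof -
  have "p + ipar i + ipar j + (q + ipar j + ipar i) = p + q"
    by (cases "ipar i"; cases "ipar j"; cases p; cases q) simp_all
  then show ?thesis
    using lie.mult_graded[OF phi_hom[OF assms(1,2)] phi_hom[OF assms(1)[symmetric] assms(3)]] by simp
qed

lemma diag_phi:
  assumes "i \<noteq> j" "k \<noteq> l" "a \<in> hcomp A p" "b \<in> hcomp A q" "z \<in> \<Phi> k l"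
  shows "(\<phi> i j a \<star> \<phi> j i b) \<star> z \<in> \<Phi> k l" "z \<star> (\<phi> i j a \<star> \<phi> j i b) \<in> \<Phi> k l"
proof -
  note sm = Phi_sub[OF assms(2)]
  let ?D = "\<phi> i j a \<star> \<phi> j i b"
  have D: "?D \<in> hcomp L (p + q)" "?D \<in> carrier L"
    using diag_graded[OF assms(1,3,4)] lie.hc_carrier by auto
  obtain c where c: "c \<in> carrier A" "z = \<phi> k l c" using assms(5) by (auto simp: \<Phi>_def)
  have "?D \<star> \<phi> k l c \<in> \<Phi> k l \<and> \<phi> k l c \<star> ?D \<in> \<Phi> k l" using c(1)
  proof (induction c rule: coef.homogeneous_induct)
    case (hom r c)
    then show ?case using diag_phi_hom[OF assms(1-4) hom] lie.skew_in[OF D(1) phi_hom[OF assms(2) hom] sm]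
      by simp
  next
    case (add c c') then show ?case
      using assms(2) D lie.sub_add[OF sm] by (simp add: phi_add lie.mult_add_right lie.mult_add_left)
  qed
  then show "?D \<star> z \<in> \<Phi> k l" "z \<star> ?D \<in> \<Phi> k l" using c by auto
qed

text \<open>The relation \<open>E\<close> on the indices makes it possible to treat the whole superalgebra (all pairs) and the even part of
  the grading subsuperalgebra (pairs of equal parity) at once: the span of the coordinate spaces whose indices are
  related, and of the diagonal elements that these spaces generate.\<close>

definition "diag_gens E = {\<phi> i j a \<star> \<phi> j i b | i j a b.
   i \<noteq> j \<and> E i j \<and> (\<exists>p. a \<in> hcomp A p) \<and> (\<exists>q. b \<in> hcomp A q)}"
definition "phi_gens E = {\<phi> i j a | i j a. i \<noteq> j \<and> E i j \<and> (\<exists>p. a \<in> hcomp A p)}"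
definition "diag_span E = lspan L (diag_gens E)"
definition "gen_span E = lspan L (phi_gens E \<union> diag_gens E)"

lemma gens_hom: "phi_gens E \<union> diag_gens E \<subseteq> hcomp L 0 \<union> hcomp L 1"
proof
  fix x assume "x \<in> phi_gens E \<union> diag_gens E"
  then have "\<exists>p. x \<in> hcomp L p"
    using phi_hom diag_graded unfolding phi_gens_def diag_gens_def by blast
  then obtain p where "x \<in> hcomp L p" ..
  then show "x \<in> hcomp L 0 \<union> hcomp L 1" by (cases p) auto
qed

lemma gens_carrier: "phi_gens E \<union> diag_gens E \<subseteq> carrier L" "diag_gens E \<subseteq> carrier L"
  using gens_hom[of E] lie.hc_carrier by blast+

lemma gen_sub: "submodule (gen_span E) scalars L"
  unfolding gen_span_def by (rule lie.lspan_submodule[OF gens_carrier(1)])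

lemma diag_sub: "submodule (diag_span E) scalars L"
  unfolding diag_span_def by (rule lie.lspan_submodule[OF gens_carrier(2)])

lemma diag_le_gen: "diag_span E \<subseteq> gen_span E"
  unfolding diag_span_def gen_span_def by (rule lie.lspan_mono) auto

lemma phi_in_gen: assumes "i \<noteq> j" "E i j" "a \<in> carrier A" shows "\<phi> i j a \<in> gen_span E"
  using assms(3)
proof (induction a rule: coef.homogeneous_induct)
  case (hom p a)
  then show ?case unfolding gen_span_def phi_gens_def using assms by (intro lie.lspan_base) auto
next
  case (add a b) then show ?case using assms lie.sub_add[OF gen_sub] by (simp add: phi_add)
qed

lemma Phi_in_gen: "i \<noteq> j \<Longrightarrow> E i j \<Longrightarrow> x \<in> \<Phi> i j \<Longrightarrow> x \<in> gen_span E"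
  using phi_in_gen by (auto simp: \<Phi>_def)

lemma diag_in: assumes "i \<noteq> j" "E i j" "a \<in> carrier A" "b \<in> carrier A"
  shows "\<phi> i j a \<star> \<phi> j i b \<in> diag_span E"
  using assms(3)
proof (induction a rule: coef.homogeneous_induct)
  case (hom p a)
  then have ac: "a \<in> carrier A" using coef.hc_carrier by auto
  show ?case using assms(4)
  proof (induction b rule: coef.homogeneous_induct)
    case (hom q b)
    then show ?case unfolding diag_span_def diag_gens_def using assms \<open>a \<in> hcomp A p\<close>
      by (intro lie.lspan_base) blast
  next
    case (add b b') then show ?case
      using assms ac lie.sub_add[OF diag_sub] by (simp add: phi_add lie.mult_add_right)
  qed
next
  case (add a a') then show ?case
    using assms lie.sub_add[OF diag_sub] by (simp add: phi_add lie.mult_add_left)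
qed

text \<open>Brackets of coordinate spaces stay in the span by transitivity, and diagonal elements normalise the
  coordinate spaces and, by the Jacobi identity, the diagonal part.\<close>

lemma gen_mult:
  assumes sym: "\<And>i j. E i j \<Longrightarrow> E j i" and tr: "\<And>i j k. E i j \<Longrightarrow> E j k \<Longrightarrow> E i k"
    and xy: "x \<in> gen_span E" "y \<in> gen_span E"
  shows "x \<star> y \<in> gen_span E"
proof (rule lie.mult_lspan[OF xy[unfolded gen_span_def] gens_carrier(1) gens_carrier(1) gen_sub])
  fix s t assume s: "s \<in> phi_gens E \<union> diag_gens E" and t: "t \<in> phi_gens E \<union> diag_gens E"
  have phi: "\<exists>i j. i \<noteq> j \<and> E i j \<and> x \<in> \<Phi> i j" if "x \<in> phi_gens E" for x
    using that coef.hc_carrier unfolding phi_gens_def \<Phi>_def by blast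
  show "s \<star> t \<in> gen_span E"
  proof (cases "s \<in> phi_gens E")
    case True
    then obtain i j where ij: "i \<noteq> j" "E i j" "s \<in> \<Phi> i j" using phi by blast
    show ?thesis
    proof (cases "t \<in> phi_gens E")
      case True
      then obtain k l where kl: "k \<noteq> l" "E k l" "t \<in> \<Phi> k l" using phi by blast
      show ?thesis
      proof (cases "k = j \<and> l = i")
        case True
        then show ?thesis using ij kl diag_in[of i j E] diag_le_gen[of E] by (auto simp: \<Phi>_def)
      next
        case False
        then show ?thesis using br_phi[OF ij(1) kl(1) False ij(3) kl(3)]
            Phi_in_gen[of i l E "s \<star> t"] Phi_in_gen[of k j E "s \<star> t"]
            lie.sub_zero[OF gen_sub] tr[of i j l] tr[of k i j] ij kl by (auto split: if_splits)
      qed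
    next
      case False
      with t obtain k l a b p q where kl: "k \<noteq> l" "a \<in> hcomp A p" "b \<in> hcomp A q"
        "t = \<phi> k l a \<star> \<phi> l k b" by (auto simp: diag_gens_def)
      then show ?thesis using diag_phi(2)[OF kl(1) ij(1) kl(2,3) ij(3)] Phi_in_gen[of i j E] ij by simp
    qed
  next
    case False
    with s obtain i j a b p q where ij: "i \<noteq> j" "a \<in> hcomp A p" "b \<in> hcomp A q"
      "s = \<phi> i j a \<star> \<phi> j i b" by (auto simp: diag_gens_def)
    show ?thesis
    proof (cases "t \<in> phi_gens E")
      case True
      then obtain k l where kl: "k \<noteq> l" "E k l" "t \<in> \<Phi> k l" using phi by blast
      then show ?thesis using diag_phi(1)[OF ij(1) kl(1) ij(2,3) kl(3)] Phi_in_gen[of k l E] ij by simp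
    next
      case False
      with t obtain k l c d r u where kl: "k \<noteq> l" "E k l" "c \<in> hcomp A r" "d \<in> hcomp A u"
        "t = \<phi> k l c \<star> \<phi> l k d" by (auto simp: diag_gens_def)
      have S: "s \<in> hcomp L (p + q)" using diag_graded ij by simp
      have c: "\<phi> k l c \<in> \<Phi> k l" "\<phi> l k d \<in> \<Phi> l k" using kl coef.hc_carrier by (auto simp: \<Phi>_def)
      have 1: "s \<star> \<phi> k l c \<in> \<Phi> k l" "s \<star> \<phi> l k d \<in> \<Phi> l k"
        using diag_phi(1)[OF ij(1) kl(1) ij(2,3) c(1)] diag_phi(1)[OF ij(1) kl(1)[symmetric] ij(2,3) c(2)] ij
        by auto
      have 2: "x \<star> y \<in> gen_span E" if "x \<in> \<Phi> k l" "y \<in> \<Phi> l k" for x y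
        using that diag_in[of k l E, OF kl(1,2)] diag_le_gen[of E] by (auto simp: \<Phi>_def)
      show ?thesis unfolding kl(5)
        by (rule lie.jacobi_in'[OF S phi_hom[OF kl(1,3)] phi_hom[OF kl(1)[symmetric] kl(4)] gen_sub])
          (use 1 2 c in auto)
    qed
  qed
qed

lemma gen_subsuperalgebra:
  assumes "\<And>i j. E i j \<Longrightarrow> E j i" "\<And>i j k. E i j \<Longrightarrow> E j k \<Longrightarrow> E i k"
  shows "subsuperalgebra (gen_span E) L"
proof (rule lie.subsuperalgebraI[OF gen_sub])
  show "x \<star> y \<in> gen_span E" if "x \<in> gen_span E" "y \<in> gen_span E" for x y
    using gen_mult[of E x y] assms that by blast
  show "hpart L p x \<in> gen_span E" if "x \<in> gen_span E" for x p
    using lie.lspan_graded[OF _ gens_hom] that unfolding gen_span_def by blast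
qed

lemma diag_span_phi:
  assumes "d \<in> diag_span E" "i \<noteq> j" "a \<in> carrier A"
  shows "d \<star> \<phi> i j a \<in> \<Phi> i j" "\<phi> i j a \<star> d \<in> \<Phi> i j"
proof -
  note sm = Phi_sub[OF assms(2)]
  have "d \<star> \<phi> i j a \<in> \<Phi> i j \<and> \<phi> i j a \<star> d \<in> \<Phi> i j"
    using assms(1)[unfolded diag_span_def] gens_carrier(2)
  proof (induction d rule: lie.lspan_induct)
    case (base x)
    then obtain k l c d r u where "k \<noteq> l" "c \<in> hcomp A r" "d \<in> hcomp A u"
        "x = \<phi> k l c \<star> \<phi> l k d" by (auto simp: diag_gens_def)
    then show ?case using diag_phi[of k l i j c r d u] assms PhiI by simp
  qed (use assms in \<open>simp_all add: lie.sub_zero[OF sm] lie.sub_add[OF sm] lie.sub_smult[OF sm]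
        lie.mult_add_left lie.mult_add_right lie.mult_smult_left lie.mult_smult_right\<close>)
  then show "d \<star> \<phi> i j a \<in> \<Phi> i j" "\<phi> i j a \<star> d \<in> \<Phi> i j" by auto
qed

text \<open>A vector that commutes with the coordinate spaces commutes with all that they generate.\<close>

lemma commute_gen:
  assumes x: "x \<in> carrier L" and y: "y \<in> gen_span E"
    and c: "\<And>i j a p. i \<noteq> j \<Longrightarrow> a \<in> hcomp A p \<Longrightarrow> x \<star> \<phi> i j a = \<zero>\<^bsub>L\<^esub>"
  shows "x \<star> y = \<zero>\<^bsub>L\<^esub>"
  using y[unfolded gen_span_def] gens_carrier(1)
proof (induction y rule: lie.lspan_induct)
  case (base y)
  show ?case
  proof (cases "y \<in> phi_gens E")
    case True then show ?thesis using c by (auto simp: phi_gens_def)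
  next
    case False
    with base obtain k l a b p q where kl: "k \<noteq> l" "a \<in> hcomp A p" "b \<in> hcomp A q"
        "y = \<phi> k l a \<star> \<phi> l k b" by (auto simp: diag_gens_def)
    have ab: "a \<in> carrier A" "b \<in> carrier A" using kl coef.hc_carrier by auto
    have "x \<star> (\<phi> k l a \<star> \<phi> l k b) = (x \<star> \<phi> k l a) \<star> \<phi> l k b"
      by (rule lie.jacobi_assoc_right[OF phi_hom[OF kl(1)[symmetric] kl(3)]]) (use kl ab x c in auto)
    then show ?thesis using kl c ab by simp
  qed
qed (use x in \<open>auto simp: lie.mult_add_right lie.mult_smult_right\<close>)

subsection \<open>Reading off the coordinates\<close>

text \<open>With five distinct indices, bracketing with three units isolates one coordinate and kills the
  diagonal part. This shows that the coordinates of a vector are unique.\<close>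

definition "probe k i j l p x = ((\<phi> k i \<one>\<^bsub>A\<^esub> \<star> x) \<star> \<phi> j l \<one>\<^bsub>A\<^esub>) \<star> \<phi> l p \<one>\<^bsub>A\<^esub>"

context
  fixes i j k l p :: "'n + 'n" assumes d: "distinct [i, j, k, l, p]"
begin

lemma distinct_indices:
  "i \<noteq> j" "i \<noteq> k" "i \<noteq> l" "i \<noteq> p" "j \<noteq> k" "j \<noteq> l" "j \<noteq> p" "k \<noteq> l" "k \<noteq> p" "l \<noteq> p"
  "j \<noteq> i" "k \<noteq> i" "l \<noteq> i" "p \<noteq> i" "k \<noteq> j" "l \<noteq> j" "p \<noteq> j" "l \<noteq> k" "p \<noteq> k" "p \<noteq> l"
  using d by auto

lemma probe_carrier: "x \<in> carrier L \<Longrightarrow> probe k i j l p x \<in> carrier L"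
  using distinct_indices by (simp add: probe_def)

lemma probe_add: "x \<in> carrier L \<Longrightarrow> y \<in> carrier L \<Longrightarrow>
    probe k i j l p (x \<oplus>\<^bsub>L\<^esub> y) = probe k i j l p x \<oplus>\<^bsub>L\<^esub> probe k i j l p y"
  using distinct_indices by (simp add: probe_def lie.mult_add_left lie.mult_add_right)

lemma probe_zero: "probe k i j l p \<zero>\<^bsub>L\<^esub> = \<zero>\<^bsub>L\<^esub>"
  using distinct_indices by (simp add: probe_def)

lemma probe_finsum:
  "finite J \<Longrightarrow> (\<And>j. j \<in> J \<Longrightarrow> f j \<in> carrier L) \<Longrightarrow>
    probe k i j l p (\<Oplus>\<^bsub>L\<^esub>j\<in>J. f j) = (\<Oplus>\<^bsub>L\<^esub>h\<in>J. probe k i j l p (f h))"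
proof (induction rule: finite_induct)
  case empty then show ?case by (simp add: probe_zero)
next
  case (insert x F)
  then have "f \<in> F \<rightarrow> carrier L" by auto
  with insert show ?case by (simp add: probe_add probe_carrier Pi_def)
qed

lemma probe_diag: assumes "x \<in> diag_span E" shows "probe k i j l p x = \<zero>\<^bsub>L\<^esub>"
proof -
  have "\<phi> k i \<one>\<^bsub>A\<^esub> \<star> x \<in> \<Phi> k i" using diag_span_phi(2)[OF assms, of k i "\<one>\<^bsub>A\<^esub>"] distinct_indices by simp
  then obtain c where c: "c \<in> carrier A" "\<phi> k i \<one>\<^bsub>A\<^esub> \<star> x = \<phi> k i c" by (rule PhiE)
  then show ?thesis using distinct_indices by (simp add: probe_def phi_comm)
qed

lemma probe_phi:
  assumes rs: "r \<noteq> s" and a: "a \<in> carrier A"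
  shows "probe k i j l p (\<phi> r s a) = (if r = i \<and> s = j then \<phi> k p a else \<zero>\<^bsub>L\<^esub>)"
proof -
  note di' = distinct_indices
  consider "r = i" "s = k" | "r = i" "s = j" | "r = i" "s \<noteq> j" "s \<noteq> k" | "r \<noteq> i" "s = k" | "r \<noteq> i" "s \<noteq> k" by auto
  then show ?thesis
  proof cases
    case 1
    have "(\<phi> k i \<one>\<^bsub>A\<^esub> \<star> \<phi> i k a) \<star> \<phi> j l \<one>\<^bsub>A\<^esub> = \<phi> k i \<one>\<^bsub>A\<^esub> \<star> (\<phi> i k a \<star> \<phi> j l \<one>\<^bsub>A\<^esub>)"
      by (rule lie.jacobi_assoc_right[OF phi_one, symmetric]) (use a di' in \<open>auto simp: phi_comm\<close>)
    also have "\<dots> = \<zero>\<^bsub>L\<^esub>" using di' a by (simp add: phi_comm)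
    finally show ?thesis using 1 di' by (simp add: probe_def)
  next
    case 2 then show ?thesis using di' a by (simp add: probe_def phi_mult coef.one_left coef.one_right)
  next
    case 3 then show ?thesis using di' a rs by (simp add: probe_def phi_mult coef.one_left phi_comm)
  next
    case 4
    have "\<phi> k i \<one>\<^bsub>A\<^esub> \<star> \<phi> r s a \<in> \<Phi> r i"
      using phi_mult_flip[of k i r "\<one>\<^bsub>A\<^esub>" a] 4 di' a rs by simp
    then obtain c where c: "c \<in> carrier A" "\<phi> k i \<one>\<^bsub>A\<^esub> \<star> \<phi> r s a = \<phi> r i c" by (rule PhiE)
    show ?thesis
    proof (cases "r = l")
      case False
      then show ?thesis using c 4 di' rs by (simp add: probe_def phi_comm)
    next
      case True
      have "\<phi> l i c \<star> \<phi> j l \<one>\<^bsub>A\<^esub> \<in> \<Phi> j i" using phi_mult_flip[of l i j c "\<one>\<^bsub>A\<^esub>"] di' c by simp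
      then obtain c' where "c' \<in> carrier A" "\<phi> l i c \<star> \<phi> j l \<one>\<^bsub>A\<^esub> = \<phi> j i c'" by (rule PhiE)
      then show ?thesis using c 4 di' True by (simp add: probe_def phi_comm)
    qed
  next
    case 5 then show ?thesis using di' a rs by (simp add: probe_def phi_comm)
  qed
qed

end

definition offdiag :: "('n + 'n \<Rightarrow> 'n + 'n \<Rightarrow> bool) \<Rightarrow> (('n + 'n) \<times> ('n + 'n)) set" where
  "offdiag E = {(i, j). i \<noteq> j \<and> E i j}"

lemma offdiag_neq: "ij \<in> offdiag E \<Longrightarrow> fst ij \<noteq> snd ij"
  by (auto simp: offdiag_def)

lemma offdiag_finite [simp]: "finite (offdiag E)" by simp

definition "phi_sum E f = (\<Oplus>\<^bsub>L\<^esub>ij\<in>offdiag E. \<phi> (fst ij) (snd ij) (f ij))"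

lemma phi_sum_Pi: "(\<And>ij. f ij \<in> carrier A) \<Longrightarrow> (\<lambda>ij. \<phi> (fst ij) (snd ij) (f ij)) \<in> offdiag E \<rightarrow> carrier L"
proof (rule Pi_I)
  fix ij assume f: "\<And>ij. f ij \<in> carrier A" and "ij \<in> offdiag E"
  then show "\<phi> (fst ij) (snd ij) (f ij) \<in> carrier L"
    using phi_carrier[of "fst ij" "snd ij" "f ij"] offdiag_neq by blast
qed

lemma phi_sum_carrier [simp]: "(\<And>ij. f ij \<in> carrier A) \<Longrightarrow> phi_sum E f \<in> carrier L"
  unfolding phi_sum_def by (rule lie.M.finsum_closed[OF phi_sum_Pi])

lemma phi_sum_add:
  assumes "\<And>ij. f ij \<in> carrier A" "\<And>ij. g ij \<in> carrier A"
  shows "phi_sum E (\<lambda>ij. f ij \<oplus>\<^bsub>A\<^esub> g ij) = phi_sum E f \<oplus>\<^bsub>L\<^esub> phi_sum E g"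
  unfolding phi_sum_def lie.M.finsum_addf[OF phi_sum_Pi[of f E, OF assms(1)] phi_sum_Pi[of g E, OF assms(2)], symmetric]
  using phi_add[OF offdiag_neq] assms phi_sum_Pi[of f E] phi_sum_Pi[of g E]
  by (intro lie.M.finsum_cong') (simp_all add: Pi_iff)

lemma phi_sum_smult:
  assumes "\<And>ij. f ij \<in> carrier A"
  shows "phi_sum E (\<lambda>ij. c \<odot>\<^bsub>A\<^esub> f ij) = c \<odot>\<^bsub>L\<^esub> phi_sum E f"
proof -
  have "c \<odot>\<^bsub>L\<^esub> phi_sum E f = (\<Oplus>\<^bsub>L\<^esub>ij\<in>offdiag E. c \<odot>\<^bsub>L\<^esub> \<phi> (fst ij) (snd ij) (f ij))"
    unfolding phi_sum_def by (rule lie.finsum_smult_ldistr) (use phi_sum_Pi assms in auto)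
  also have "\<dots> = phi_sum E (\<lambda>ij. c \<odot>\<^bsub>A\<^esub> f ij)"
    unfolding phi_sum_def using phi_smult[OF offdiag_neq] assms phi_sum_Pi[of f E]
    by (intro lie.M.finsum_cong') (simp_all add: Pi_iff)
  finally show ?thesis by simp
qed

lemma phi_sum_single:
  assumes "i \<noteq> j" "E i j" "a \<in> carrier A"
  shows "phi_sum E (\<lambda>ij. if ij = (i, j) then a else \<zero>\<^bsub>A\<^esub>) = \<phi> i j a"
proof -
  have "phi_sum E (\<lambda>ij. if ij = (i, j) then a else \<zero>\<^bsub>A\<^esub>) =
      (\<Oplus>\<^bsub>L\<^esub>ij\<in>offdiag E. if (i, j) = ij then \<phi> (fst ij) (snd ij) a else \<zero>\<^bsub>L\<^esub>)"
    unfolding phi_sum_def using assms phi_zero[OF offdiag_neq] phi_carrier[OF offdiag_neq]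
    by (intro lie.M.finsum_cong') (auto simp: Pi_iff)
  also have "\<dots> = \<phi> i j a"
    using lie.M.finsum_singleton[of "(i, j)" "offdiag E" "\<lambda>ij. \<phi> (fst ij) (snd ij) a"] assms
      phi_sum_Pi[of "\<lambda>_. a" E] by (simp add: offdiag_def)
  finally show ?thesis .
qed

lemma gen_decomp:
  assumes "x \<in> gen_span E"
  obtains d f where "d \<in> diag_span E" "\<And>ij. f ij \<in> carrier A" "x = d \<oplus>\<^bsub>L\<^esub> phi_sum E f"
proof -
  have "\<exists>d f. d \<in> diag_span E \<and> (\<forall>ij. f ij \<in> carrier A) \<and> x = d \<oplus>\<^bsub>L\<^esub> phi_sum E f"
    using assms[unfolded gen_span_def] gens_carrier(1)
  proof (induction x rule: lie.lspan_induct)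
    case (base x)
    have z: "phi_sum E (\<lambda>ij. \<zero>\<^bsub>A\<^esub>) = \<zero>\<^bsub>L\<^esub>"
      unfolding phi_sum_def using phi_zero[OF offdiag_neq] by (intro lie.M.add.finprod_one_eqI) simp
    show ?case
    proof (cases "x \<in> phi_gens E")
      case True
      then obtain i j a p where ij: "i \<noteq> j" "E i j" "a \<in> hcomp A p" "x = \<phi> i j a"
        by (auto simp: phi_gens_def)
      then have "a \<in> carrier A" using coef.hc_carrier by auto
      then show ?thesis using ij phi_sum_single[of i j E a] lie.sub_zero[OF diag_sub]
        by (intro exI[of _ "\<zero>\<^bsub>L\<^esub>"] exI[of _ "\<lambda>ij. if ij = (i, j) then a else \<zero>\<^bsub>A\<^esub>"]) auto
    next
      case False
      then have "x \<in> diag_span E" using base unfolding diag_span_def by (auto intro: lie.lspan_base)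
      then show ?thesis using z lie.sub_carrier[OF diag_sub]
        by (intro exI[of _ x] exI[of _ "\<lambda>ij. \<zero>\<^bsub>A\<^esub>"]) auto
    qed
  next
    case zero
    have z: "phi_sum E (\<lambda>ij. \<zero>\<^bsub>A\<^esub>) = \<zero>\<^bsub>L\<^esub>"
      unfolding phi_sum_def using phi_zero[OF offdiag_neq] by (intro lie.M.add.finprod_one_eqI) simp
    then show ?case using lie.sub_zero[OF diag_sub]
      by (intro exI[of _ "\<zero>\<^bsub>L\<^esub>"] exI[of _ "\<lambda>ij. \<zero>\<^bsub>A\<^esub>"]) auto
  next
    case (add x y)
    then obtain d f e g where df: "d \<in> diag_span E" "\<And>ij. f ij \<in> carrier A" "x = d \<oplus>\<^bsub>L\<^esub> phi_sum E f"
      and eg: "e \<in> diag_span E" "\<And>ij. g ij \<in> carrier A" "y = e \<oplus>\<^bsub>L\<^esub> phi_sum E g" by blast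
    have c: "d \<in> carrier L" "e \<in> carrier L" using df eg lie.sub_carrier[OF diag_sub] by auto
    have "x \<oplus>\<^bsub>L\<^esub> y = (d \<oplus>\<^bsub>L\<^esub> e) \<oplus>\<^bsub>L\<^esub> phi_sum E (\<lambda>ij. f ij \<oplus>\<^bsub>A\<^esub> g ij)"
      unfolding phi_sum_add[OF df(2) eg(2)] df(3) eg(3)
      using c phi_sum_carrier[of f E] phi_sum_carrier[of g E] df(2) eg(2) by (simp add: lie.M.a_ac)
    moreover have "d \<oplus>\<^bsub>L\<^esub> e \<in> diag_span E" using df eg lie.sub_add[OF diag_sub] by simp
    moreover have "\<forall>ij. f ij \<oplus>\<^bsub>A\<^esub> g ij \<in> carrier A" using df eg by simp
    ultimately show ?case
      by (intro exI[of _ "d \<oplus>\<^bsub>L\<^esub> e"] exI[of _ "\<lambda>ij. f ij \<oplus>\<^bsub>A\<^esub> g ij"] conjI)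
  next
    case (smult c x)
    then obtain d f where df: "d \<in> diag_span E" "\<And>ij. f ij \<in> carrier A" "x = d \<oplus>\<^bsub>L\<^esub> phi_sum E f" by blast
    have "d \<in> carrier L" using df lie.sub_carrier[OF diag_sub] by auto
    then have "c \<odot>\<^bsub>L\<^esub> x = c \<odot>\<^bsub>L\<^esub> d \<oplus>\<^bsub>L\<^esub> phi_sum E (\<lambda>ij. c \<odot>\<^bsub>A\<^esub> f ij)"
      unfolding phi_sum_smult[OF df(2)] df(3) using df(2) by (simp add: lie.smult_add_r)
    moreover have "c \<odot>\<^bsub>L\<^esub> d \<in> diag_span E" using df lie.sub_smult[OF diag_sub] by simp
    moreover have "\<forall>ij. c \<odot>\<^bsub>A\<^esub> f ij \<in> carrier A" using df by simp
    ultimately show ?case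
      by (intro exI[of _ "c \<odot>\<^bsub>L\<^esub> d"] exI[of _ "\<lambda>ij. c \<odot>\<^bsub>A\<^esub> f ij"] conjI)
  qed
  then show thesis using that by blast
qed

lemma probe_decomp:
  assumes "d \<in> diag_span E" "\<And>ij. f ij \<in> carrier A" and dd: "distinct [i, j, k, l, p]" and ij: "E i j"
  shows "probe k i j l p (d \<oplus>\<^bsub>L\<^esub> phi_sum E f) = \<phi> k p (f (i, j))"
proof -
  have dc: "d \<in> carrier L" using assms(1) lie.sub_carrier[OF diag_sub] by auto
  have "probe k i j l p (d \<oplus>\<^bsub>L\<^esub> phi_sum E f) = probe k i j l p (phi_sum E f)"
    using probe_add[OF dd dc] probe_diag[OF dd assms(1)] probe_carrier[OF dd] assms(2) by simp
  also have "\<dots> = (\<Oplus>\<^bsub>L\<^esub>h\<in>offdiag E. probe k i j l p (\<phi> (fst h) (snd h) (f h)))"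
    unfolding phi_sum_def by (rule probe_finsum[OF dd]) (use phi_sum_Pi[of f E] assms(2) in \<open>auto simp: Pi_iff\<close>)
  also have "\<dots> = (\<Oplus>\<^bsub>L\<^esub>h\<in>offdiag E. if (i, j) = h then \<phi> k p (f h) else \<zero>\<^bsub>L\<^esub>)"
  proof (rule lie.M.finsum_cong')
    fix h assume "h \<in> offdiag E"
    then have "fst h \<noteq> snd h" by (auto simp: offdiag_def)
    then show "probe k i j l p (\<phi> (fst h) (snd h) (f h)) = (if (i, j) = h then \<phi> k p (f h) else \<zero>\<^bsub>L\<^esub>)"
      using probe_phi[OF dd, of "fst h" "snd h" "f h"] assms(2) by (cases h) auto
  qed (use assms(2) dd in auto)
  also have "\<dots> = \<phi> k p (f (i, j))"
    by (rule lie.M.finsum_singleton) (use assms(2) ij dd in \<open>auto simp: offdiag_def\<close>)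
  finally show ?thesis .
qed

lemma gen_decomp_zero:
  assumes "d \<in> diag_span E" "\<And>ij. f ij \<in> carrier A" "d \<oplus>\<^bsub>L\<^esub> phi_sum E f = \<zero>\<^bsub>L\<^esub>"
    and ij: "i \<noteq> j" "E i j"
  shows "f (i, j) = \<zero>\<^bsub>A\<^esub>"
proof -
  obtain k where k: "k \<notin> {i, j, i, j, j}" by (rule fresh)
  obtain l where l: "l \<notin> {i, j, k, j, j}" by (rule fresh)
  obtain p where p: "p \<notin> {i, j, k, l, j}" by (rule fresh)
  have dd: "distinct [i, j, k, l, p]" using k l p ij by auto
  show ?thesis
    using probe_decomp[OF assms(1), of f, OF assms(2) dd ij(2)] assms(3) probe_zero[OF dd] phi_inj[of k p "f (i, j)"]
      assms(2) dd by simp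
qed

definition "generated \<longleftrightarrow> carrier L = gen_span (\<lambda>_ _. True)"

text \<open>A third index writes each coordinate vector as a bracket.\<close>

lemma gen_le_derived: "gen_span (\<lambda>_ _. True) \<subseteq> derived L"
  unfolding gen_span_def
proof (rule lie.lspan_least[OF lie.derived_sub], rule subsetI)
    fix x assume "x \<in> phi_gens (\<lambda>_ _. True) \<union> diag_gens (\<lambda>_ _. True)"
    then consider i j a p where "i \<noteq> j" "a \<in> hcomp A p" "x = \<phi> i j a"
      | i j a b p q where "i \<noteq> j" "a \<in> hcomp A p" "b \<in> hcomp A q" "x = \<phi> i j a \<star> \<phi> j i b"
      by (auto simp: phi_gens_def diag_gens_def)
    then show "x \<in> derived L"
    proof cases
      case 1
      then have a: "a \<in> carrier A" using coef.hc_carrier by blast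
      obtain k where k: "k \<notin> {i, j, i, j, j}" by (rule fresh)
      have "x = \<phi> i k a \<star> \<phi> k j \<one>\<^bsub>A\<^esub>" using 1 k a phi_mult[of i k j a "\<one>\<^bsub>A\<^esub>"] by (auto simp: coef.one_right)
      moreover have "\<phi> i k a \<in> carrier L" "\<phi> k j \<one>\<^bsub>A\<^esub> \<in> carrier L" using k a by auto
      ultimately show ?thesis using lie.derived_base by simp
    next
      case 2
      then have "a \<in> carrier A" "b \<in> carrier A" using coef.hc_carrier by blast+
      then show ?thesis using 2 lie.derived_base by simp
    qed
  qed

lemma generated_perfect: "generated \<Longrightarrow> perfect L"
  using gen_le_derived lie.sub_carrier[OF lie.derived_sub] by (auto simp: perfect_def generated_def)

lemma restrict_generated:
  defines "G \<equiv> gen_span (\<lambda>_ _. True)"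
  shows "subsuperalgebra G L" "steinberg (super_restrict L G) A \<phi>" "steinberg.generated (super_restrict L G) A \<phi>"
proof -
  show G: "subsuperalgebra G L" unfolding G_def by (rule gen_subsuperalgebra) auto
  have inG: "\<phi> i j a \<in> G" if "i \<noteq> j" "a \<in> carrier A"
    for i j :: "'n + 'n" and a unfolding G_def using that by (simp add: phi_in_gen)
  interpret G: lie_superalgebra "super_restrict L G" by (rule lie.lie_restrict[OF G])
  show st: "steinberg (super_restrict L G) A \<phi>"
  proof unfold_locales
    fix i j :: "'n + 'n" and a p assume "i \<noteq> j" "a \<in> hcomp A p"
    then show "\<phi> i j a \<in> hcomp (super_restrict L G) (p + ipar i + ipar j)"
      using phi_hom inG coef.hc_carrier[of a p] by simp
  qed (simp_all add: card3 phi_add phi_smult phi_mult phi_comm phi_inj)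
  interpret s: steinberg "super_restrict L G" A \<phi> by (rule st)
  have "s.phi_gens E \<union> s.diag_gens E = phi_gens E \<union> diag_gens E" for E
    by (simp add: s.phi_gens_def s.diag_gens_def phi_gens_def diag_gens_def)
  moreover have "phi_gens (\<lambda>_ _. True) \<union> diag_gens (\<lambda>_ _. True) \<subseteq> G"
    unfolding G_def gen_span_def by (auto intro: lie.lspan_base)
  ultimately show "s.generated"
    unfolding s.generated_def s.gen_span_def using lie.restrict_facts(2)[OF G] by (simp add: G_def gen_span_def)
qed

end


section \<open>Quotients and central isogeny\<close>

lemma a_r_coset_eq: "I +>\<^bsub>M\<^esub> x = {i \<oplus>\<^bsub>M\<^esub> x | i. i \<in> I}"
  by (auto simp: a_r_coset_def r_coset_def)

lemma super_quot_simps [simp]: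
  "carrier (super_quot L I) = a_rcosets\<^bsub>L\<^esub> I" "monoid.mult (super_quot L I) = rcoset_mult L I"
  "zero (super_quot L I) = I" "add (super_quot L I) = set_add L"
  "smult (super_quot L I) = (\<lambda>c X. \<Union>x\<in>X. I +>\<^bsub>L\<^esub> (c \<odot>\<^bsub>L\<^esub> x))"
  "hcomp (super_quot L I) = (\<lambda>p. (\<lambda>x. I +>\<^bsub>L\<^esub> x) ` hcomp L p)"
  by (simp_all add: super_quot_def)

lemma a_rcosets_eq: "a_rcosets\<^bsub>M\<^esub> I = (\<lambda>x. I +>\<^bsub>M\<^esub> x) ` carrier M"
  by (auto simp: A_RCOSETS_def RCOSETS_def a_r_coset_def)

locale super_ideal = superalgebra A for A :: "('f :: field, 'v) superalgebra" (structure) +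
  fixes I :: "'v set"
  assumes I: "submodule I scalars A"
    and ideal: "x \<in> carrier A \<Longrightarrow> i \<in> I \<Longrightarrow> x \<otimes> i \<in> I" "x \<in> carrier A \<Longrightarrow> i \<in> I \<Longrightarrow> i \<otimes> x \<in> I"
begin

lemma coset_mem: assumes "x \<in> carrier A" shows "y \<in> I +> x \<longleftrightarrow> y \<in> carrier A \<and> y \<ominus> x \<in> I"
proof
  assume "y \<in> I +> x"
  then obtain i where i: "i \<in> I" "y = i \<oplus> x" by (auto simp: a_r_coset_eq)
  then have "i \<in> carrier A" using sub_carrier[OF I] by auto
  then show "y \<in> carrier A \<and> y \<ominus> x \<in> I" using i assms by (simp add: a_minus_def M.a_assoc M.r_neg)
next
  assume y: "y \<in> carrier A \<and> y \<ominus> x \<in> I"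
  then have "y = (y \<ominus> x) \<oplus> x" using assms by (simp add: a_minus_def M.a_assoc M.l_neg)
  then show "y \<in> I +> x" using y by (auto simp: a_r_coset_eq)
qed

lemma coset_self: "x \<in> carrier A \<Longrightarrow> x \<in> I +> x"
  using coset_mem sub_zero[OF I] by (simp add: a_minus_def M.r_neg)

lemma coset_eq: assumes "x \<in> carrier A" "y \<in> carrier A" shows "I +> x = I +> y \<longleftrightarrow> x \<ominus> y \<in> I"
proof
  assume "I +> x = I +> y" then show "x \<ominus> y \<in> I" using coset_self[OF assms(1)] coset_mem[OF assms(2)] by auto
next
  assume xy: "x \<ominus> y \<in> I"
  have 1: "I +> u \<subseteq> I +> v" if "u \<ominus> v \<in> I" "u \<in> carrier A" "v \<in> carrier A" for u v
  proof
    fix z assume "z \<in> I +> u"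
    then have z: "z \<in> carrier A" "z \<ominus> u \<in> I" using coset_mem that by auto
    have "(z \<ominus> u) \<oplus> (u \<ominus> v) = z \<oplus> ((\<ominus> u \<oplus> u) \<oplus> \<ominus> v)"
      unfolding a_minus_def using z that by (simp add: M.a_assoc del: M.l_neg)
    then have "(z \<ominus> u) \<oplus> (u \<ominus> v) = z \<ominus> v" using z that by (simp add: a_minus_def M.l_neg)
    then show "z \<in> I +> v" using z that coset_mem sub_add[OF I] by metis
  qed
  have "\<ominus> (x \<ominus> y) = y \<ominus> x" using assms by (simp add: a_minus_def M.minus_add M.a_comm)
  then have "y \<ominus> x \<in> I" using sub_minus[OF I xy] by simp
  then show "I +> x = I +> y" using 1[of x y] 1[of y x] xy assms by auto
qed

lemma coset_zero: "x \<in> carrier A \<Longrightarrow> I +> x = I \<longleftrightarrow> x \<in> I"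
proof -
  assume x: "x \<in> carrier A"
  have "I +> \<zero> = I" using sub_carrier[OF I] by (force simp: a_r_coset_eq)
  then show ?thesis using coset_eq[OF x, of "\<zero>"] x by (simp add: a_minus_def)
qed

lemma coset_add: 
  assumes "x \<in> carrier A" "y \<in> carrier A" shows "(I +> x) <+>\<^bsub>A\<^esub> (I +> y) = I +> (x \<oplus> y)"
proof (intro equalityI subsetI)
  fix z assume "z \<in> (I +> x) <+>\<^bsub>A\<^esub> (I +> y)"
  then obtain i j where ij: "i \<in> I" "j \<in> I" "z = (i \<oplus> x) \<oplus> (j \<oplus> y)"
    by (auto simp: set_add_eq a_r_coset_eq)
  then have "z = (i \<oplus> j) \<oplus> (x \<oplus> y)" using assms sub_carrier[OF I] by (simp add: M.a_ac)
  then show "z \<in> I +> (x \<oplus> y)" using ij sub_add[OF I] by (auto simp: a_r_coset_eq)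
next
  fix z assume "z \<in> I +> (x \<oplus> y)"
  then obtain i where i: "i \<in> I" "z = i \<oplus> (x \<oplus> y)" by (auto simp: a_r_coset_eq)
  then have "z = (i \<oplus> x) \<oplus> (\<zero> \<oplus> y)" using assms sub_carrier[OF I] by (simp add: M.a_ac)
  then show "z \<in> (I +> x) <+>\<^bsub>A\<^esub> (I +> y)"
    using i sub_zero[OF I] unfolding set_add_eq a_r_coset_eq by blast
qed

text \<open>The product of cosets is by definition the union of the cosets of all products, which agree since \<open>I\<close> is an ideal.\<close>

lemma coset_mult:
  assumes x: "x \<in> carrier A" and y: "y \<in> carrier A"
  shows "rcoset_mult A I (I +> x) (I +> y) = I +> (x \<otimes> y)"
proof -
  have "I +> (a \<otimes> b) = I +> (x \<otimes> y)" if ab: "a \<in> I +> x" "b \<in> I +> y" for a b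
  proof -
    obtain i j where ij: "i \<in> I" "j \<in> I" "a = i \<oplus> x" "b = j \<oplus> y" using ab by (auto simp: a_r_coset_eq)
    then have c: "i \<in> carrier A" "j \<in> carrier A" using sub_carrier[OF I] by auto
    have m: "i \<otimes> (j \<oplus> y) \<oplus> x \<otimes> j \<in> I" using ij c x y ideal sub_add[OF I] by simp
    have "a \<otimes> b = (i \<otimes> (j \<oplus> y) \<oplus> x \<otimes> j) \<oplus> x \<otimes> y"
      using ij c x y by (simp add: mult_add_left mult_add_right M.a_ac)
    then have "a \<otimes> b \<in> I +> (x \<otimes> y)" using m by (auto simp: a_r_coset_eq)
    then have "a \<otimes> b \<ominus> x \<otimes> y \<in> I" using coset_mem[of "x \<otimes> y"] x y by simp
    then show ?thesis using coset_eq[of "a \<otimes> b" "x \<otimes> y"] x y c ij by simp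
  qed
  then show ?thesis unfolding rcoset_mult_def using coset_self[OF x] coset_self[OF y] by blast
qed

lemma coset_smult:
  assumes x: "x \<in> carrier A"
  shows "(\<Union>u\<in>I +> x. I +> (c \<odot> u)) = I +> (c \<odot> x)"
proof -
  have "I +> (c \<odot> a) = I +> (c \<odot> x)" if "a \<in> I +> x" for a
  proof -
    have a: "a \<in> carrier A" "a \<ominus> x \<in> I" using coset_mem[OF x] that by auto
    have "c \<odot> a \<ominus> c \<odot> x = c \<odot> (a \<ominus> x)" using a x by (simp add: a_minus_def smult_add_r smult_minus)
    then show ?thesis using coset_eq[of "c \<odot> a" "c \<odot> x"] a x sub_smult[OF I] by simp
  qed
  then show ?thesis using coset_self[OF x] by blast
qed

end

lemma (in lie_superalgebra) center_ideal: "super_ideal A (lie_center A)"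
proof (intro super_ideal.intro super_ideal_axioms.intro superalgebra_axioms)
  show "submodule (lie_center A) scalars A" by (rule center_sub)
  show "x \<otimes> i \<in> lie_center A" if "x \<in> carrier A" "i \<in> lie_center A" for x i
    unfolding center_right[OF that(2,1)] by (rule sub_zero[OF center_sub])
  show "i \<otimes> x \<in> lie_center A" if "x \<in> carrier A" "i \<in> lie_center A" for x i
    unfolding center_left[OF that(2,1)] by (rule sub_zero[OF center_sub])
qed

text \<open>A multiplicative relation that is a function up to an ideal induces a homomorphism to the
  quotient.\<close>

lemma hom_of_relation:
  fixes L :: "('f :: field, 'v) superalgebra" and M :: "('f, 'w) superalgebra"
  assumes L: "superalgebra L" and M: "super_ideal M I"
    and car: "\<And>x y. R x y \<Longrightarrow> x \<in> carrier L \<and> y \<in> carrier M"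
    and tot: "\<And>x. x \<in> carrier L \<Longrightarrow> \<exists>y. R x y"
    and hom: "\<And>x p. x \<in> hcomp L p \<Longrightarrow> \<exists>y\<in>hcomp M p. R x y"
    and add: "\<And>x y x' y'. R x y \<Longrightarrow> R x' y' \<Longrightarrow> R (x \<oplus>\<^bsub>L\<^esub> x') (y \<oplus>\<^bsub>M\<^esub> y')"
    and mult: "\<And>x y x' y'. R x y \<Longrightarrow> R x' y' \<Longrightarrow> R (x \<otimes>\<^bsub>L\<^esub> x') (y \<otimes>\<^bsub>M\<^esub> y')"
    and smult: "\<And>c x y. R x y \<Longrightarrow> R (c \<odot>\<^bsub>L\<^esub> x) (c \<odot>\<^bsub>M\<^esub> y)"
    and ker: "\<And>y. R \<zero>\<^bsub>L\<^esub> y \<Longrightarrow> y \<in> I"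
  shows "\<exists>\<pi>\<in>super_hom L (super_quot M I). \<forall>x y. R x y \<longrightarrow> \<pi> x = I +>\<^bsub>M\<^esub> y"
proof -
  interpret L: superalgebra L by fact
  interpret M: super_ideal M I by fact
  define \<pi> where "\<pi> x = I +>\<^bsub>M\<^esub> (SOME y. R x y)" for x
  have \<pi>: "\<pi> x = I +>\<^bsub>M\<^esub> y" if xy: "R x y" for x y
  proof -
    let ?z = "SOME y. R x y"
    have z: "R x ?z" using xy by (rule someI)
    have c: "x \<in> carrier L" "y \<in> carrier M" "?z \<in> carrier M" using car[OF xy] car[OF z] by auto
    have "R (x \<oplus>\<^bsub>L\<^esub> (- 1) \<odot>\<^bsub>L\<^esub> x) (?z \<oplus>\<^bsub>M\<^esub> (- 1) \<odot>\<^bsub>M\<^esub> y)" by (rule add[OF z smult[OF xy]])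
    then have "R \<zero>\<^bsub>L\<^esub> (?z \<ominus>\<^bsub>M\<^esub> y)" using c by (simp add: L.M.r_neg a_minus_def)
    then have "?z \<ominus>\<^bsub>M\<^esub> y \<in> I" by (rule ker)
    then show ?thesis unfolding \<pi>_def using M.coset_eq c by simp
  qed
  have "\<pi> \<in> super_hom L (super_quot M I)"
    unfolding super_hom_def
  proof (intro CollectI conjI allI ballI)
    show "\<pi> \<in> hom (add_monoid L) (add_monoid (super_quot M I))"
    proof (rule homI)
      fix x assume "x \<in> carrier (add_monoid L)"
      then obtain y where "R x y" using tot by auto
      then show "\<pi> x \<in> carrier (add_monoid (super_quot M I))" using \<pi> car by (auto simp: a_rcosets_eq)
    next
      fix x x' assume "x \<in> carrier (add_monoid L)" "x' \<in> carrier (add_monoid L)"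
      then obtain y y' where y: "R x y" "R x' y'" using tot by force
      then show "\<pi> (x \<otimes>\<^bsub>add_monoid L\<^esub> x') = \<pi> x \<otimes>\<^bsub>add_monoid (super_quot M I)\<^esub> \<pi> x'"
        using \<pi>[OF y(1)] \<pi>[OF y(2)] \<pi>[OF add[OF y]] car[OF y(1)] car[OF y(2)] M.coset_add by simp
    qed
    show "\<pi> \<in> hom L (super_quot M I)"
    proof (rule homI)
      fix x assume "x \<in> carrier L"
      then obtain y where "R x y" using tot by auto
      then show "\<pi> x \<in> carrier (super_quot M I)" using \<pi> car by (auto simp: a_rcosets_eq)
    next
      fix x x' assume "x \<in> carrier L" "x' \<in> carrier L"
      then obtain y y' where y: "R x y" "R x' y'" using tot by force
      then show "\<pi> (x \<otimes>\<^bsub>L\<^esub> x') = \<pi> x \<otimes>\<^bsub>super_quot M I\<^esub> \<pi> x'"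
        using \<pi>[OF y(1)] \<pi>[OF y(2)] \<pi>[OF mult[OF y]] car[OF y(1)] car[OF y(2)] M.coset_mult by simp
    qed
    show "\<pi> (c \<odot>\<^bsub>L\<^esub> x) = c \<odot>\<^bsub>super_quot M I\<^esub> \<pi> x" if "x \<in> carrier L" for c x
    proof -
      obtain y where y: "R x y" using tot \<open>x \<in> carrier L\<close> by auto
      then show ?thesis using \<pi>[OF y] \<pi>[OF smult[OF y]] car[OF y] M.coset_smult by simp
    qed
    show "\<pi> ` hcomp L p \<subseteq> hcomp (super_quot M I) p" for p
      using hom \<pi> by fastforce
  qed
  then show ?thesis using \<pi> by blast
qed

text \<open>These rules let a homomorphism to a quotient be computed on representatives.\<close>

lemma hom_quot:
  fixes L :: "('f :: field, 'v) superalgebra" and M :: "('f, 'w) superalgebra"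
  assumes L: "superalgebra L" and M: "super_ideal M I" and \<pi>: "\<pi> \<in> super_hom L (super_quot M I)"
  shows "x \<in> carrier L \<Longrightarrow> \<exists>y\<in>carrier M. \<pi> x = I +>\<^bsub>M\<^esub> y"
    and "x \<in> hcomp L p \<Longrightarrow> \<exists>y\<in>hcomp M p. \<pi> x = I +>\<^bsub>M\<^esub> y"
    and "\<lbrakk>x \<in> carrier L; x' \<in> carrier L; y \<in> carrier M; y' \<in> carrier M; \<pi> x = I +>\<^bsub>M\<^esub> y; \<pi> x' = I +>\<^bsub>M\<^esub> y'\<rbrakk>
       \<Longrightarrow> \<pi> (x \<oplus>\<^bsub>L\<^esub> x') = I +>\<^bsub>M\<^esub> (y \<oplus>\<^bsub>M\<^esub> y')"
    and "\<lbrakk>x \<in> carrier L; x' \<in> carrier L; y \<in> carrier M; y' \<in> carrier M; \<pi> x = I +>\<^bsub>M\<^esub> y; \<pi> x' = I +>\<^bsub>M\<^esub> y'\<rbrakk>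
       \<Longrightarrow> \<pi> (x \<otimes>\<^bsub>L\<^esub> x') = I +>\<^bsub>M\<^esub> (y \<otimes>\<^bsub>M\<^esub> y')"
    and "\<lbrakk>x \<in> carrier L; y \<in> carrier M; \<pi> x = I +>\<^bsub>M\<^esub> y\<rbrakk> \<Longrightarrow> \<pi> (c \<odot>\<^bsub>L\<^esub> x) = I +>\<^bsub>M\<^esub> (c \<odot>\<^bsub>M\<^esub> y)"
    and "\<pi> \<zero>\<^bsub>L\<^esub> = I"
proof -
  interpret L: superalgebra L by fact
  interpret M: super_ideal M I by fact
  have p: "\<pi> \<in> hom (add_monoid L) (add_monoid (super_quot M I))" "\<pi> \<in> hom L (super_quot M I)"
    "\<forall>c. \<forall>x\<in>carrier L. \<pi> (c \<odot>\<^bsub>L\<^esub> x) = c \<odot>\<^bsub>super_quot M I\<^esub> \<pi> x" "\<And>p. \<pi> ` hcomp L p \<subseteq> hcomp (super_quot M I) p"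
    using \<pi> by (auto simp: super_hom_def)
  show 1: "\<exists>y\<in>carrier M. \<pi> x = I +>\<^bsub>M\<^esub> y" if "x \<in> carrier L" for x
    using hom_in_carrier[OF p(2) that] by (auto simp: a_rcosets_eq)
  show "x \<in> hcomp L p \<Longrightarrow> \<exists>y\<in>hcomp M p. \<pi> x = I +>\<^bsub>M\<^esub> y"
    using p(4)[of p] by auto
  show "\<pi> (x \<oplus>\<^bsub>L\<^esub> x') = I +>\<^bsub>M\<^esub> (y \<oplus>\<^bsub>M\<^esub> y')"
    if "x \<in> carrier L" "x' \<in> carrier L" "y \<in> carrier M" "y' \<in> carrier M" "\<pi> x = I +>\<^bsub>M\<^esub> y" "\<pi> x' = I +>\<^bsub>M\<^esub> y'"
    using hom_mult[OF p(1), of x x'] that M.coset_add by simp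
  show "\<pi> (x \<otimes>\<^bsub>L\<^esub> x') = I +>\<^bsub>M\<^esub> (y \<otimes>\<^bsub>M\<^esub> y')"
    if "x \<in> carrier L" "x' \<in> carrier L" "y \<in> carrier M" "y' \<in> carrier M" "\<pi> x = I +>\<^bsub>M\<^esub> y" "\<pi> x' = I +>\<^bsub>M\<^esub> y'"
    using hom_mult[OF p(2), of x x'] that M.coset_mult by simp
  show s: "\<pi> (c \<odot>\<^bsub>L\<^esub> x) = I +>\<^bsub>M\<^esub> (c \<odot>\<^bsub>M\<^esub> y)"
    if "x \<in> carrier L" "y \<in> carrier M" "\<pi> x = I +>\<^bsub>M\<^esub> y" for c x y
    using p(3) that M.coset_smult by simp
  obtain y where y: "y \<in> carrier M" "\<pi> \<zero>\<^bsub>L\<^esub> = I +>\<^bsub>M\<^esub> y" using 1[of "\<zero>\<^bsub>L\<^esub>"] by auto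
  have "\<pi> \<zero>\<^bsub>L\<^esub> = I +>\<^bsub>M\<^esub> \<zero>\<^bsub>M\<^esub>" using s[of "\<zero>\<^bsub>L\<^esub>" y 0] y by simp
  also have "\<dots> = I" using M.coset_zero[of "\<zero>\<^bsub>M\<^esub>"] M.sub_zero[OF M.I] by simp
  finally show "\<pi> \<zero>\<^bsub>L\<^esub> = I" .
qed

definition central_quotient_map ::
    "('f :: field, 'v) superalgebra \<Rightarrow> ('f, 'w) superalgebra \<Rightarrow> ('v \<Rightarrow> 'w set) \<Rightarrow> bool" where
  "central_quotient_map L M \<pi> \<longleftrightarrow> \<pi> \<in> super_hom L (super_quot M (lie_center M))
     \<and> \<pi> ` carrier L = carrier (super_quot M (lie_center M))
     \<and> (\<forall>x\<in>carrier L. \<pi> x = lie_center M \<longleftrightarrow> x \<in> lie_center L)"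

text \<open>An isomorphism of the central quotients is the same thing as a homomorphism onto the central
  quotient whose kernel is the centre.\<close>

lemma isomorphic_quotients_iff:
  fixes L :: "('f :: field, 'v) superalgebra" and M :: "('f, 'w) superalgebra"
  assumes L: "lie_superalgebra L" and M: "lie_superalgebra M"
  shows "super_isomorphic (super_quot L (lie_center L)) (super_quot M (lie_center M))
     \<longleftrightarrow> (\<exists>\<pi>. central_quotient_map L M \<pi>)"
proof
  interpret L: lie_superalgebra L by fact
  interpret M: lie_superalgebra M by fact
  interpret LI: super_ideal L "lie_center L" by (rule L.center_ideal)
  interpret MI: super_ideal M "lie_center M" by (rule M.center_ideal)
  let ?I = "lie_center L" and ?J = "lie_center M"
  let ?LQ = "super_quot L ?I" and ?MQ = "super_quot M ?J"
  {
    assume "super_isomorphic ?LQ ?MQ"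
    then obtain f where f: "f \<in> super_hom ?LQ ?MQ" and b: "bij_betw f (carrier ?LQ) (carrier ?MQ)"
      by (auto simp: super_isomorphic_def)
    have p: "f \<in> hom (add_monoid ?LQ) (add_monoid ?MQ)" "f \<in> hom ?LQ ?MQ"
      "\<And>c x. x \<in> carrier ?LQ \<Longrightarrow> f (c \<odot>\<^bsub>?LQ\<^esub> x) = c \<odot>\<^bsub>?MQ\<^esub> f x" "\<And>p. f ` hcomp ?LQ p \<subseteq> hcomp ?MQ p"
      using f by (auto simp: super_hom_def)
    define \<pi> where "\<pi> x = f (?I +>\<^bsub>L\<^esub> x)" for x
    have c: "?I +>\<^bsub>L\<^esub> x \<in> carrier ?LQ" if "x \<in> carrier L" for x using that by (auto simp: a_rcosets_eq)
    have "\<pi> \<in> super_hom L ?MQ"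
      unfolding super_hom_def
    proof (intro CollectI conjI allI ballI)
      show "\<pi> \<in> hom (add_monoid L) (add_monoid ?MQ)"
      proof (rule homI)
        show "x \<in> carrier (add_monoid L) \<Longrightarrow> \<pi> x \<in> carrier (add_monoid ?MQ)" for x
          using hom_in_carrier[OF p(2) c] by (simp add: \<pi>_def)
        show "\<pi> (x \<otimes>\<^bsub>add_monoid L\<^esub> x') = \<pi> x \<otimes>\<^bsub>add_monoid ?MQ\<^esub> \<pi> x'"
          if "x \<in> carrier (add_monoid L)" "x' \<in> carrier (add_monoid L)" for x x'
          using hom_mult[OF p(1), of "?I +>\<^bsub>L\<^esub> x" "?I +>\<^bsub>L\<^esub> x'"] c that LI.coset_add[of x x'] by (simp add: \<pi>_def)
      qed
      show "\<pi> \<in> hom L ?MQ"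
      proof (rule homI)
        show "x \<in> carrier L \<Longrightarrow> \<pi> x \<in> carrier ?MQ" for x
          using hom_in_carrier[OF p(2) c] by (simp add: \<pi>_def)
        show "\<pi> (x \<otimes>\<^bsub>L\<^esub> x') = \<pi> x \<otimes>\<^bsub>?MQ\<^esub> \<pi> x'" if "x \<in> carrier L" "x' \<in> carrier L" for x x'
          using hom_mult[OF p(2), of "?I +>\<^bsub>L\<^esub> x" "?I +>\<^bsub>L\<^esub> x'"] c that LI.coset_mult[of x x'] by (simp add: \<pi>_def)
      qed
      show "\<pi> (c \<odot>\<^bsub>L\<^esub> x) = c \<odot>\<^bsub>?MQ\<^esub> \<pi> x" if "x \<in> carrier L" for c x
        using p(3)[OF c[OF that]] LI.coset_smult[OF that] by (simp add: \<pi>_def)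
      show "\<pi> ` hcomp L p \<subseteq> hcomp ?MQ p" for p using p(4)[of p] by (auto simp: \<pi>_def)
    qed
    moreover have "\<pi> ` carrier L = carrier ?MQ"
    proof -
      have "\<pi> ` carrier L = f ` carrier ?LQ" by (auto simp: \<pi>_def a_rcosets_eq)
      then show ?thesis using b by (simp add: bij_betw_def)
    qed
    moreover have "\<pi> x = ?J \<longleftrightarrow> x \<in> ?I" if x: "x \<in> carrier L" for x
    proof -
      have "\<pi> \<zero>\<^bsub>L\<^esub> = ?J" by (rule hom_quot(6)[OF L.superalgebra_axioms M.center_ideal \<open>\<pi> \<in> super_hom L ?MQ\<close>])
      moreover have "\<pi> x = \<pi> \<zero>\<^bsub>L\<^esub> \<longleftrightarrow> ?I +>\<^bsub>L\<^esub> x = ?I +>\<^bsub>L\<^esub> \<zero>\<^bsub>L\<^esub>"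
        unfolding \<pi>_def using inj_on_eq_iff[OF bij_betw_imp_inj_on[OF b] c[OF x] c[OF L.M.zero_closed]] .
      ultimately show ?thesis using LI.coset_eq[OF x, of "\<zero>\<^bsub>L\<^esub>"] x by (simp add: a_minus_def)
    qed
    ultimately show "\<exists>\<pi>. central_quotient_map L M \<pi>" unfolding central_quotient_map_def by blast
  next
    assume "\<exists>\<pi>. central_quotient_map L M \<pi>"
    then obtain \<pi> where \<pi>: "\<pi> \<in> super_hom L ?MQ" and sur: "\<pi> ` carrier L = carrier ?MQ"
      and ker: "\<And>x. x \<in> carrier L \<Longrightarrow> \<pi> x = ?J \<longleftrightarrow> x \<in> ?I" by (auto simp: central_quotient_map_def)
    note hq = hom_quot[OF L.superalgebra_axioms M.center_ideal \<pi>]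
    have eq: "\<pi> x = \<pi> x' \<longleftrightarrow> ?I +>\<^bsub>L\<^esub> x = ?I +>\<^bsub>L\<^esub> x'" if x: "x \<in> carrier L" "x' \<in> carrier L" for x x'
    proof -
      obtain y where y: "y \<in> carrier M" "\<pi> x = ?J +>\<^bsub>M\<^esub> y" using hq(1)[OF x(1)] by auto
      obtain y' where y': "y' \<in> carrier M" "\<pi> x' = ?J +>\<^bsub>M\<^esub> y'" using hq(1)[OF x(2)] by auto
      have "\<pi> ((- 1) \<odot>\<^bsub>L\<^esub> x') = ?J +>\<^bsub>M\<^esub> ((- 1) \<odot>\<^bsub>M\<^esub> y')" by (rule hq(5)[OF x(2) y'])
      then have "\<pi> (x \<oplus>\<^bsub>L\<^esub> (- 1) \<odot>\<^bsub>L\<^esub> x') = ?J +>\<^bsub>M\<^esub> (y \<oplus>\<^bsub>M\<^esub> (- 1) \<odot>\<^bsub>M\<^esub> y')"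
        by (intro hq(3)) (use x y y' in auto)
      then have "\<pi> (x \<ominus>\<^bsub>L\<^esub> x') = ?J +>\<^bsub>M\<^esub> (y \<ominus>\<^bsub>M\<^esub> y')" using x y y' by (simp add: a_minus_def)
      then have "x \<ominus>\<^bsub>L\<^esub> x' \<in> ?I \<longleftrightarrow> y \<ominus>\<^bsub>M\<^esub> y' \<in> ?J"
        using ker[of "x \<ominus>\<^bsub>L\<^esub> x'"] MI.coset_zero[of "y \<ominus>\<^bsub>M\<^esub> y'"] x y y' by simp
      then show ?thesis using LI.coset_eq[OF x] MI.coset_eq[OF y(1) y'(1)] y y' by simp
    qed
    define f where "f C = \<pi> (SOME x. x \<in> C)" for C
    have f: "f (?I +>\<^bsub>L\<^esub> x) = \<pi> x" if x: "x \<in> carrier L" for x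
    proof -
      let ?s = "SOME y. y \<in> ?I +>\<^bsub>L\<^esub> x"
      have "?s \<in> ?I +>\<^bsub>L\<^esub> x" using LI.coset_self[OF x] by (rule someI)
      then have "?s \<in> carrier L" "?s \<ominus>\<^bsub>L\<^esub> x \<in> ?I" using LI.coset_mem[OF x] by auto
      then show ?thesis unfolding f_def using eq x LI.coset_eq by simp
    qed
    have c: "X \<in> carrier ?LQ \<Longrightarrow> \<exists>x\<in>carrier L. X = ?I +>\<^bsub>L\<^esub> x" for X by (auto simp: a_rcosets_eq)
    have pic: "\<pi> x \<in> carrier ?MQ" if "x \<in> carrier L" for x using sur that by blast
    have p: "\<pi> \<in> hom (add_monoid L) (add_monoid ?MQ)" "\<pi> \<in> hom L ?MQ"
      "\<And>c x. x \<in> carrier L \<Longrightarrow> \<pi> (c \<odot>\<^bsub>L\<^esub> x) = c \<odot>\<^bsub>?MQ\<^esub> \<pi> x" "\<And>p. \<pi> ` hcomp L p \<subseteq> hcomp ?MQ p"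
      using \<pi> by (auto simp: super_hom_def)
    have "f \<in> super_hom ?LQ ?MQ"
      unfolding super_hom_def
    proof (intro CollectI conjI allI ballI)
      show "f \<in> hom (add_monoid ?LQ) (add_monoid ?MQ)"
      proof (rule homI)
        fix X assume "X \<in> carrier (add_monoid ?LQ)"
        then obtain x where "x \<in> carrier L" "X = ?I +>\<^bsub>L\<^esub> x" using c[of X] by auto
        then show "f X \<in> carrier (add_monoid ?MQ)" using f pic by simp
      next
        fix X Y assume "X \<in> carrier (add_monoid ?LQ)" "Y \<in> carrier (add_monoid ?LQ)"
        then obtain x y where "x \<in> carrier L" "X = ?I +>\<^bsub>L\<^esub> x" "y \<in> carrier L" "Y = ?I +>\<^bsub>L\<^esub> y"
          using c[of X] c[of Y] by auto
        then show "f (X \<otimes>\<^bsub>add_monoid ?LQ\<^esub> Y) = f X \<otimes>\<^bsub>add_monoid ?MQ\<^esub> f Y"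
          using f LI.coset_add[of x y] hom_mult[OF p(1), of x y] by simp
      qed
      show "f \<in> hom ?LQ ?MQ"
      proof (rule homI)
        fix X assume "X \<in> carrier ?LQ"
        then obtain x where "x \<in> carrier L" "X = ?I +>\<^bsub>L\<^esub> x" using c[of X] by auto
        then show "f X \<in> carrier ?MQ" using f pic by simp
      next
        fix X Y assume "X \<in> carrier ?LQ" "Y \<in> carrier ?LQ"
        then obtain x y where "x \<in> carrier L" "X = ?I +>\<^bsub>L\<^esub> x" "y \<in> carrier L" "Y = ?I +>\<^bsub>L\<^esub> y"
          using c[of X] c[of Y] by auto
        then show "f (X \<otimes>\<^bsub>?LQ\<^esub> Y) = f X \<otimes>\<^bsub>?MQ\<^esub> f Y"
          using f LI.coset_mult[of x y] hom_mult[OF p(2), of x y] by simp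
      qed
      show "f (k \<odot>\<^bsub>?LQ\<^esub> X) = k \<odot>\<^bsub>?MQ\<^esub> f X" if "X \<in> carrier ?LQ" for k X
      proof -
        obtain x where x: "x \<in> carrier L" "X = ?I +>\<^bsub>L\<^esub> x" using c[OF \<open>X \<in> carrier ?LQ\<close>] by auto
        then show ?thesis using f[OF x(1)] f[of "k \<odot>\<^bsub>L\<^esub> x"] p(3)[OF x(1)] LI.coset_smult[OF x(1)] by simp
      qed
      show "f ` hcomp ?LQ p \<subseteq> hcomp ?MQ p" for p
      proof
        fix Y assume "Y \<in> f ` hcomp ?LQ p"
        then obtain x where x: "x \<in> hcomp L p" "Y = f (?I +>\<^bsub>L\<^esub> x)" by auto
        then have "Y = \<pi> x" using f L.hc_carrier by simp
        then show "Y \<in> hcomp ?MQ p" using p(4)[of p] x by blast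
      qed
    qed
    moreover have "bij_betw f (carrier ?LQ) (carrier ?MQ)"
      unfolding bij_betw_def
    proof
      show "inj_on f (carrier ?LQ)"
      proof (rule inj_onI)
        fix X Y assume "X \<in> carrier ?LQ" "Y \<in> carrier ?LQ" and e: "f X = f Y"
        then obtain x y where "x \<in> carrier L" "X = ?I +>\<^bsub>L\<^esub> x" "y \<in> carrier L" "Y = ?I +>\<^bsub>L\<^esub> y"
          using c[of X] c[of Y] by auto
        then show "X = Y" using f e eq by simp
      qed
      have "f ` carrier ?LQ = \<pi> ` carrier L" using f by (auto simp: a_rcosets_eq image_image)
      then show "f ` carrier ?LQ = carrier ?MQ" using sur by simp
    qed
    ultimately show "super_isomorphic ?LQ ?MQ" unfolding super_isomorphic_def by blast
  }
qed


subsection \<open>Lie superalgebras with the same coordinates\<close>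

lemma fst_snd_super_prod [simp]:
  "fst (x \<otimes>\<^bsub>super_prod L M\<^esub> y) = fst x \<otimes>\<^bsub>L\<^esub> fst y" "snd (x \<otimes>\<^bsub>super_prod L M\<^esub> y) = snd x \<otimes>\<^bsub>M\<^esub> snd y"
  by simp_all

text \<open>Two superalgebras with generating coordinates over the same coefficients. Pairs of coordinates with equal coefficients
  are coordinates on the product, and the span \<open>N\<close> that they generate is the correspondence
  that yields the isogeny.\<close>

locale steinberg_pair = l: steinberg L A \<phi> + m: steinberg M A \<psi>
  for L :: "('f :: field, 'v) superalgebra" and M :: "('f, 'w) superalgebra"
    and A :: "('f, 'a) superalgebra" 
    and \<phi> :: "'n :: finite + 'n \<Rightarrow> 'n + 'n \<Rightarrow> 'a \<Rightarrow> 'v" and \<psi> :: "'n + 'n \<Rightarrow> 'n + 'n \<Rightarrow> 'a \<Rightarrow> 'w" +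
  assumes lgen: "l.generated" and mgen: "m.generated"
begin

abbreviation "P \<equiv> super_prod L M"
definition "\<chi> i j a = (\<phi> i j a, \<psi> i j a)"

lemma prod_steinberg: "steinberg P A \<chi>"
proof -
  interpret p: lie_superalgebra P
    by (rule lie_super_prod[OF l.lie.lie_superalgebra_axioms m.lie.lie_superalgebra_axioms])
  show ?thesis
  proof unfold_locales
    show "3 \<le> CARD('n)" by (rule l.card3)
    fix i j :: "'n + 'n" and a assume "i \<noteq> j" "a \<in> carrier A" "\<chi> i j a = \<zero>\<^bsub>P\<^esub>"
    then show "a = \<zero>\<^bsub>A\<^esub>" using l.phi_inj[of i j a] by (simp add: \<chi>_def)
  qed (simp_all add: \<chi>_def l.phi_hom m.phi_hom l.phi_add m.phi_add l.phi_smult m.phi_smult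
      l.phi_mult m.phi_mult l.phi_comm m.phi_comm)
qed

sublocale p: steinberg P A \<chi> by (rule prod_steinberg)

definition "N = p.gen_span (\<lambda>_ _. True)"

lemma N_sub: "submodule N scalars P" unfolding N_def by (rule p.gen_sub)

lemma N_mult: "x \<in> N \<Longrightarrow> y \<in> N \<Longrightarrow> x \<otimes>\<^bsub>P\<^esub> y \<in> N"
  unfolding N_def by (rule p.gen_mult) auto

lemma N_hpart: "x \<in> N \<Longrightarrow> hpart P q x \<in> N"
  unfolding N_def p.gen_span_def by (rule p.lie.lspan_graded[OF _ p.gens_hom])

lemma N_chi: "i \<noteq> j \<Longrightarrow> a \<in> carrier A \<Longrightarrow> (\<phi> i j a, \<psi> i j a) \<in> N"
  using p.phi_in_gen[of i j "\<lambda>_ _. True" a] by (simp add: N_def \<chi>_def)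

lemma N_diag: "i \<noteq> j \<Longrightarrow> a \<in> carrier A \<Longrightarrow> b \<in> carrier A
    \<Longrightarrow> (\<phi> i j a \<otimes>\<^bsub>L\<^esub> \<phi> j i b, \<psi> i j a \<otimes>\<^bsub>M\<^esub> \<psi> j i b) \<in> N"
  using N_mult[OF N_chi N_chi, of i j a j i b] by simp

lemma N_carrier: "(x, y) \<in> N \<Longrightarrow> x \<in> carrier L \<and> y \<in> carrier M"
  using p.lie.sub_carrier[OF N_sub] by force

lemma N_add: "(x, y) \<in> N \<Longrightarrow> (x', y') \<in> N \<Longrightarrow> (x \<oplus>\<^bsub>L\<^esub> x', y \<oplus>\<^bsub>M\<^esub> y') \<in> N"
  using p.lie.sub_add[OF N_sub, of "(x, y)" "(x', y')"] by simp

lemma N_smult: "(x, y) \<in> N \<Longrightarrow> (c \<odot>\<^bsub>L\<^esub> x, c \<odot>\<^bsub>M\<^esub> y) \<in> N"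
  using p.lie.sub_smult[OF N_sub, of "(x, y)" c] by simp

lemma N_zero: "(\<zero>\<^bsub>L\<^esub>, \<zero>\<^bsub>M\<^esub>) \<in> N"
  using p.lie.sub_zero[OF N_sub] by simp

lemma N_total: assumes "x \<in> carrier L" shows "\<exists>y. (x, y) \<in> N"
proof -
  have "x \<in> l.gen_span (\<lambda>_ _. True)" using assms lgen by (simp add: l.generated_def)
  then show ?thesis unfolding l.gen_span_def using l.gens_carrier(1)
  proof (induction x rule: l.lie.lspan_induct)
    case (base x)
    then consider i j a q where "i \<noteq> j" "a \<in> hcomp A q" "x = \<phi> i j a"
      | i j a b q r where "i \<noteq> j" "a \<in> hcomp A q" "b \<in> hcomp A r" "x = \<phi> i j a \<otimes>\<^bsub>L\<^esub> \<phi> j i b"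
      by (auto simp: l.phi_gens_def l.diag_gens_def)
    then show ?case
    proof cases
      case 1 then show ?thesis using N_chi[OF 1(1) l.coef.hc_carrier[OF 1(2)]] by blast
    next
      case 2 then show ?thesis
        using N_diag[OF 2(1) l.coef.hc_carrier[OF 2(2)] l.coef.hc_carrier[OF 2(3)]] by blast
    qed
  next
    case zero show ?case using N_zero by blast
  next
    case add then show ?case using N_add by blast
  next
    case smult then show ?case using N_smult by blast
  qed
qed

lemma hpart_prod: assumes "x \<in> carrier L" "y \<in> carrier M"
  shows "hpart P q (x, y) = (hpart L q x, hpart M q y)"
proof -
  have e: "(x, y) = (hpart L q x, hpart M q y) \<oplus>\<^bsub>P\<^esub> (hpart L (q + 1) x, hpart M (q + 1) y)"
    using l.lie.hpart_split(2)[OF assms(1), of q] m.lie.hpart_split(2)[OF assms(2), of q] by simp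
  show ?thesis by (subst e, rule p.lie.hpart_eq) (use assms in auto)
qed

lemma N_hom: assumes "x \<in> hcomp L q" shows "\<exists>y\<in>hcomp M q. (x, y) \<in> N"
proof -
  have xc: "x \<in> carrier L" using assms l.lie.hc_carrier by blast
  obtain y where y: "(x, y) \<in> N" using N_total[OF xc] by blast
  then have yc: "y \<in> carrier M" using N_carrier by blast
  have "(x, hpart M q y) \<in> N" using N_hpart[OF y, of q] hpart_prod[OF xc yc] assms by simp
  then show ?thesis using yc by auto
qed

text \<open>An element of the correspondence with vanishing first component has, probed in the first
  factor, no coordinates. So it is diagonal, and then it commutes with all coordinates.\<close>

lemma N_zero_left:
  assumes "(\<zero>\<^bsub>L\<^esub>, y) \<in> N" shows "y \<in> lie_center M"
proof -
  have yc: "y \<in> carrier M" using N_carrier assms by blast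
  obtain d f where d: "d \<in> p.diag_span (\<lambda>_ _. True)" and f: "\<And>ij. f ij \<in> carrier A"
    and e: "(\<zero>\<^bsub>L\<^esub>, y) = d \<oplus>\<^bsub>P\<^esub> p.phi_sum (\<lambda>_ _. True) f"
    using p.gen_decomp assms unfolding N_def by blast
  have f0: "f (i, j) = \<zero>\<^bsub>A\<^esub>" if "i \<noteq> j" for i j
  proof -
    obtain k where k: "k \<notin> {i, j, i, j, j}" by (rule l.fresh)
    obtain h where h: "h \<notin> {i, j, k, j, j}" by (rule l.fresh)
    obtain r where r: "r \<notin> {i, j, k, h, j}" by (rule l.fresh)
    have dd: "distinct [i, j, k, h, r]" using k h r that by auto
    have "p.probe k i j h r (\<zero>\<^bsub>L\<^esub>, y) = \<chi> k r (f (i, j))"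
      unfolding e by (rule p.probe_decomp[OF d f dd]) simp
    moreover have "fst (p.probe k i j h r (\<zero>\<^bsub>L\<^esub>, y)) = l.probe k i j h r \<zero>\<^bsub>L\<^esub>"
      by (simp add: p.probe_def l.probe_def \<chi>_def)
    ultimately have "\<phi> k r (f (i, j)) = \<zero>\<^bsub>L\<^esub>" using l.probe_zero[OF dd] by (simp add: \<chi>_def)
    then show ?thesis using l.phi_inj[of k r "f (i, j)"] f dd by simp
  qed
  have "p.phi_sum (\<lambda>_ _. True) f = \<zero>\<^bsub>P\<^esub>"
    unfolding p.phi_sum_def
  proof (rule p.lie.M.add.finprod_one_eqI)
    fix ij assume ij: "ij \<in> p.offdiag (\<lambda>_ _. True)"
    then show "\<chi> (fst ij) (snd ij) (f ij) = \<zero>\<^bsub>P\<^esub>"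
      using f0[OF p.offdiag_neq[OF ij]] p.phi_zero[OF p.offdiag_neq[OF ij]] by simp
  qed
  then have dy: "d = (\<zero>\<^bsub>L\<^esub>, y)" using e p.lie.sub_carrier[OF p.diag_sub d] by (cases d) simp
  have "y \<otimes>\<^bsub>M\<^esub> \<psi> i j a = \<zero>\<^bsub>M\<^esub>" if ij: "i \<noteq> j" and a: "a \<in> hcomp A q" for i j a q
  proof -
    have ac: "a \<in> carrier A" using a l.coef.hc_carrier by blast
    have "d \<otimes>\<^bsub>P\<^esub> \<chi> i j a \<in> p.\<Phi> i j" by (rule p.diag_span_phi(1)[OF d ij ac])
    then obtain c where c: "c \<in> carrier A" "d \<otimes>\<^bsub>P\<^esub> \<chi> i j a = \<chi> i j c" by (rule p.PhiE)
    then have "\<phi> i j c = \<zero>\<^bsub>L\<^esub>" and y: "y \<otimes>\<^bsub>M\<^esub> \<psi> i j a = \<psi> i j c"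
      using dy ij ac by (simp_all add: \<chi>_def)
    then have "c = \<zero>\<^bsub>A\<^esub>" using l.phi_inj ij c by blast
    then show ?thesis using y ij by simp
  qed
  then have "y \<otimes>\<^bsub>M\<^esub> z = \<zero>\<^bsub>M\<^esub>" if "z \<in> carrier M" for z
    using m.commute_gen[OF yc, of z "\<lambda>_ _. True"] that mgen by (simp add: m.generated_def)
  then show ?thesis using yc by (simp add: lie_center_def)
qed

text \<open>If \<open>(u, v)\<close> corresponds and \<open>u\<close> is central, then \<open>[v, \<psi>\<^sub>i\<^sub>j(a)]\<close> corresponds to zero, hence is central. As
  \<open>\<psi>\<^sub>i\<^sub>j(a) = [\<psi>\<^sub>i\<^sub>k(a), \<psi>\<^sub>k\<^sub>j(1)]\<close>, the Jacobi identity turns this into \<open>[v, \<psi>\<^sub>i\<^sub>j(a)] = 0\<close>.\<close>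

lemma N_center:
  assumes xy: "(x, y) \<in> N" and x: "x \<in> lie_center L" shows "y \<in> lie_center M"
proof -
  have c: "x \<in> carrier L" "y \<in> carrier M" using N_carrier[OF xy] by auto
  have hom: "v \<in> lie_center M" if uv: "(u, v) \<in> N" and u: "u \<in> lie_center L" and v: "v \<in> hcomp M q" for u v q
  proof -
    have vc: "v \<in> carrier M" using N_carrier[OF uv] by simp
    have z: "v \<otimes>\<^bsub>M\<^esub> \<psi> i j a \<in> lie_center M" if "i \<noteq> j" "a \<in> carrier A" for i j a
    proof -
      have "(u \<otimes>\<^bsub>L\<^esub> \<phi> i j a, v \<otimes>\<^bsub>M\<^esub> \<psi> i j a) \<in> N" using N_mult[OF uv N_chi[OF that]] by simp
      then show ?thesis using l.lie.center_left[OF u] that N_zero_left by simp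
    qed
    have "v \<otimes>\<^bsub>M\<^esub> \<psi> i j a = \<zero>\<^bsub>M\<^esub>" if ij: "i \<noteq> j" and a: "a \<in> hcomp A r" for i j a r
    proof -
      have ac: "a \<in> carrier A" using a l.coef.hc_carrier by blast
      obtain k where k: "k \<notin> {i, j, i, j, j}" by (rule l.fresh)
      then have k': "i \<noteq> k" "k \<noteq> j" by auto
      have e: "\<psi> i j a = \<psi> i k a \<otimes>\<^bsub>M\<^esub> \<psi> k j \<one>\<^bsub>A\<^esub>"
        using k' ij ac by (simp add: m.phi_mult l.coef.one_right)
      have "v \<otimes>\<^bsub>M\<^esub> (\<psi> i k a \<otimes>\<^bsub>M\<^esub> \<psi> k j \<one>\<^bsub>A\<^esub>) \<in> {\<zero>\<^bsub>M\<^esub>}"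
        by (rule m.lie.jacobi_in'[OF v m.phi_hom[OF k'(1) a] m.phi_hom[OF k'(2) l.coef.one_even] m.lie.sub_null])
          (use k' ac m.lie.center_left[OF z] m.lie.center_right[OF z] in auto)
      then show ?thesis using e by simp
    qed
    then have "v \<otimes>\<^bsub>M\<^esub> z = \<zero>\<^bsub>M\<^esub>" if "z \<in> carrier M" for z
      using m.commute_gen[OF vc, of z "\<lambda>_ _. True"] that mgen by (simp add: m.generated_def)
    then show ?thesis using vc by (simp add: lie_center_def)
  qed
  have "hpart M q y \<in> lie_center M" for q
  proof (rule hom)
    show "(hpart L q x, hpart M q y) \<in> N" using N_hpart[OF xy, of q] hpart_prod[OF c] by simp
    show "hpart L q x \<in> lie_center L" by (rule l.lie.center_hpart[OF x])
    show "hpart M q y \<in> hcomp M q" using c by simp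
  qed
  then show ?thesis
    using m.lie.hpart_split(2)[OF c(2), of 0] m.lie.sub_add[OF m.lie.center_sub] by metis
qed

lemma exists_quotient_map:
  assumes conv: "\<And>x y. (x, y) \<in> N \<Longrightarrow> y \<in> lie_center M \<Longrightarrow> x \<in> lie_center L"
    and tot: "\<And>y. y \<in> carrier M \<Longrightarrow> \<exists>x. (x, y) \<in> N"
  shows "\<exists>\<pi>. central_quotient_map L M \<pi> \<and> (\<forall>x y. (x, y) \<in> N \<longrightarrow> \<pi> x = lie_center M +>\<^bsub>M\<^esub> y)"
proof -
  interpret mi: super_ideal M "lie_center M" by (rule m.lie.center_ideal)
  have "\<exists>\<pi>\<in>super_hom L (super_quot M (lie_center M)). \<forall>x y. (x, y) \<in> N \<longrightarrow> \<pi> x = lie_center M +>\<^bsub>M\<^esub> y"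
  proof (rule hom_of_relation)
    show "superalgebra L" by (rule l.lie.superalgebra_axioms)
    show "super_ideal M (lie_center M)" by (rule m.lie.center_ideal)
    show "x \<in> carrier L \<and> y \<in> carrier M" if "(x, y) \<in> N" for x y using N_carrier[OF that] .
    show "\<exists>y. (x, y) \<in> N" if "x \<in> carrier L" for x by (rule N_total[OF that])
    show "\<exists>y\<in>hcomp M p. (x, y) \<in> N" if "x \<in> hcomp L p" for x p by (rule N_hom[OF that])
    show "(x \<oplus>\<^bsub>L\<^esub> x', y \<oplus>\<^bsub>M\<^esub> y') \<in> N" if "(x, y) \<in> N" "(x', y') \<in> N" for x y x' y' by (rule N_add[OF that])
    show "(x \<otimes>\<^bsub>L\<^esub> x', y \<otimes>\<^bsub>M\<^esub> y') \<in> N" if "(x, y) \<in> N" "(x', y') \<in> N" for x y x' y' 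
      using N_mult[OF that] by simp
    show "(c \<odot>\<^bsub>L\<^esub> x, c \<odot>\<^bsub>M\<^esub> y) \<in> N" if "(x, y) \<in> N" for c x y by (rule N_smult[OF that])
    show "y \<in> lie_center M" if "(\<zero>\<^bsub>L\<^esub>, y) \<in> N" for y by (rule N_zero_left[OF that])
  qed
  then obtain \<pi> where h: "\<pi> \<in> super_hom L (super_quot M (lie_center M))"
    and \<pi>: "\<And>x y. (x, y) \<in> N \<Longrightarrow> \<pi> x = lie_center M +>\<^bsub>M\<^esub> y" by blast
  have "\<pi> ` carrier L = carrier (super_quot M (lie_center M))"
  proof (intro equalityI subsetI)
    fix X assume "X \<in> \<pi> ` carrier L"
    then obtain x where x: "x \<in> carrier L" "X = \<pi> x" by blast
    obtain y where y: "(x, y) \<in> N" using N_total[OF x(1)] by blast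
    then show "X \<in> carrier (super_quot M (lie_center M))" using \<pi>[OF y] x N_carrier[OF y] by (simp add: a_rcosets_eq)
  next
    fix X assume "X \<in> carrier (super_quot M (lie_center M))"
    then obtain y where y: "y \<in> carrier M" "X = lie_center M +>\<^bsub>M\<^esub> y" by (auto simp: a_rcosets_eq)
    obtain x where x: "(x, y) \<in> N" using tot[OF y(1)] by blast
    show "X \<in> \<pi> ` carrier L" using \<pi>[OF x] y N_carrier[OF x] by blast
  qed
  moreover have "\<pi> x = lie_center M \<longleftrightarrow> x \<in> lie_center L" if x: "x \<in> carrier L" for x
  proof -
    obtain y where y: "(x, y) \<in> N" using N_total[OF x] by blast
    have "\<pi> x = lie_center M \<longleftrightarrow> y \<in> lie_center M" using \<pi>[OF y] mi.coset_zero N_carrier[OF y] by simp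
    then show ?thesis using N_center[OF y] conv[OF y] by blast
  qed
  ultimately show ?thesis using h \<pi> unfolding central_quotient_map_def by blast
qed

end

lemma steinberg_pair_swap: "steinberg_pair L M A \<phi> \<psi> \<Longrightarrow> steinberg_pair M L A \<psi> \<phi>"
  by (simp add: steinberg_pair_def steinberg_pair_axioms_def)

lemma steinberg_pair_N_swap:
  assumes "steinberg_pair L M A \<phi> \<psi>" "(x, y) \<in> steinberg_pair.N L M A \<phi> \<psi>"
  shows "(y, x) \<in> steinberg_pair.N M L A \<psi> \<phi>"
proof -
  interpret a: steinberg_pair L M A \<phi> \<psi> by fact
  interpret b: steinberg_pair M L A \<psi> \<phi> by (rule steinberg_pair_swap) fact
  have "prod.swap z \<in> b.N" if "z \<in> a.N" for z
    using that[unfolded a.N_def a.p.gen_span_def] a.p.gens_carrier(1)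
  proof (induction z rule: a.p.lie.lspan_induct)
    case (base z)
    then consider i j c q where "i \<noteq> j" "c \<in> hcomp A q" "z = a.\<chi> i j c"
      | i j c d q r where "i \<noteq> j" "c \<in> hcomp A q" "d \<in> hcomp A r" "z = a.\<chi> i j c \<otimes>\<^bsub>a.P\<^esub> a.\<chi> j i d"
      by (auto simp: a.p.phi_gens_def a.p.diag_gens_def)
    then show ?case
    proof cases
      case 1 then show ?thesis using b.N_chi[OF 1(1) a.l.coef.hc_carrier[OF 1(2)]] by (simp add: a.\<chi>_def)
    next
      case 2 then show ?thesis
        using b.N_diag[OF 2(1) a.l.coef.hc_carrier[OF 2(2)] a.l.coef.hc_carrier[OF 2(3)]] by (simp add: a.\<chi>_def)
    qed
  next
    case zero show ?case using b.N_zero by simp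
  next
    case (add x y) then show ?case using b.N_add[of "snd x" "fst x" "snd y" "fst y"]
      by (simp add: prod.swap_def)
  next
    case (smult c x) then show ?case using b.N_smult[of "snd x" "fst x" c] by (simp add: prod.swap_def)
  qed
  then show ?thesis using assms(2) by fastforce
qed

theorem steinberg_central_quotient:
  assumes "steinberg_pair L M A \<phi> \<psi>"
  shows "\<exists>\<pi>. central_quotient_map L M \<pi>
     \<and> (\<forall>x y. (x, y) \<in> steinberg_pair.N L M A \<phi> \<psi> \<longrightarrow> \<pi> x = lie_center M +>\<^bsub>M\<^esub> y)"
proof -
  interpret a: steinberg_pair L M A \<phi> \<psi> by fact
  have ba: "steinberg_pair M L A \<psi> \<phi>" by (rule steinberg_pair_swap) fact
  interpret b: steinberg_pair M L A \<psi> \<phi> by (rule ba)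
  show ?thesis
  proof (rule a.exists_quotient_map)
    fix x y assume "(x, y) \<in> a.N" "y \<in> lie_center M"
    then show "x \<in> lie_center L" using b.N_center[OF steinberg_pair_N_swap[OF assms]] by blast
  next
    fix y assume "y \<in> carrier M"
    then obtain x where "(y, x) \<in> b.N" using b.N_total by blast
    then show "\<exists>x. (x, y) \<in> a.N" using steinberg_pair_N_swap[OF ba] by blast
  qed
qed


section \<open>Matrix superalgebras\<close>

lemma (in abelian_monoid) finsum_swap:
  assumes "finite S" "finite T" "\<And>i j. i \<in> S \<Longrightarrow> j \<in> T \<Longrightarrow> f i j \<in> carrier G"
  shows "(\<Oplus>i\<in>S. \<Oplus>j\<in>T. f i j) = (\<Oplus>j\<in>T. \<Oplus>i\<in>S. f i j)"
  using assms(1,3)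
proof (induction rule: finite_induct)
  case empty then show ?case by simp
next
  case (insert x F)
  have "(\<Oplus>i\<in>insert x F. \<Oplus>j\<in>T. f i j) = (\<Oplus>j\<in>T. f x j) \<oplus> (\<Oplus>i\<in>F. \<Oplus>j\<in>T. f i j)"
    using insert by (intro finsum_insert) (auto intro!: finsum_closed)
  also have "\<dots> = (\<Oplus>j\<in>T. f x j) \<oplus> (\<Oplus>j\<in>T. \<Oplus>i\<in>F. f i j)" using insert by simp
  also have "\<dots> = (\<Oplus>j\<in>T. f x j \<oplus> (\<Oplus>i\<in>F. f i j))"
    by (rule finsum_addf[symmetric]) (use insert in \<open>auto intro!: finsum_closed\<close>)
  also have "\<dots> = (\<Oplus>j\<in>T. \<Oplus>i\<in>insert x F. f i j)"
    by (rule finsum_cong') (use insert in \<open>auto intro!: finsum_insert[symmetric] finsum_closed\<close>)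
  finally show ?case .
qed

context superalgebra
begin

lemma additive_finsum:
  assumes "finite J" "\<And>j. j \<in> J \<Longrightarrow> f j \<in> carrier A" "g \<zero> = \<zero>"
    "\<And>x y. x \<in> carrier A \<Longrightarrow> y \<in> carrier A \<Longrightarrow> g (x \<oplus> y) = g x \<oplus> g y" "\<And>x. x \<in> carrier A \<Longrightarrow> g x \<in> carrier A"
  shows "g (\<Oplus>j\<in>J. f j) = (\<Oplus>j\<in>J. g (f j))"
  using assms(1,2)
proof (induction rule: finite_induct)
  case empty then show ?case using assms(3) by simp
next
  case (insert x F)
  then have "f \<in> F \<rightarrow> carrier A" "(\<lambda>j. g (f j)) \<in> F \<rightarrow> carrier A" using assms(5) by auto
  then show ?case using insert assms(4,5) by simp
qed

lemma mult_finsum: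
  assumes "finite J" "\<And>j. j \<in> J \<Longrightarrow> f j \<in> carrier A" "x \<in> carrier A"
  shows "x \<otimes> (\<Oplus>j\<in>J. f j) = (\<Oplus>j\<in>J. x \<otimes> f j)" "(\<Oplus>j\<in>J. f j) \<otimes> x = (\<Oplus>j\<in>J. f j \<otimes> x)"
  by (rule additive_finsum; use assms in \<open>simp add: mult_add_left mult_add_right\<close>)+

lemma finsum_single:
  assumes "finite J" "i \<in> J" "x \<in> carrier A" "\<And>j. j \<in> J \<Longrightarrow> f j = (if j = i then x else \<zero>)"
  shows "(\<Oplus>j\<in>J. f j) = x"
proof -
  have "(\<Oplus>j\<in>J. f j) = (\<Oplus>j\<in>J. if i = j then x else \<zero>)"
    by (rule M.finsum_cong') (use assms in auto)
  also have "\<dots> = x" using assms by (intro M.finsum_singleton) auto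
  finally show ?thesis .
qed

subsection \<open>The sign twist\<close>

lemma twist_eq: "a \<in> carrier A \<Longrightarrow> twist A p a = hpart A 0 a \<oplus> psign p \<odot> hpart A 1 a"
  by (simp add: twist_def finsum_bit)

lemma twist_hom: assumes "a \<in> hcomp A q" shows "twist A p a = psign (p * q) \<odot> a"
proof -
  have c: "a \<in> carrier A" using assms hc_carrier by blast
  then show ?thesis using assms hcomp_other[OF assms, of 0] hcomp_other[OF assms, of 1]
    by (cases q) (simp_all add: twist_eq)
qed

lemma twist_carrier [simp]: "a \<in> carrier A \<Longrightarrow> twist A p a \<in> carrier A"
  by (simp add: twist_eq)

lemma twist_add: "a \<in> carrier A \<Longrightarrow> b \<in> carrier A \<Longrightarrow> twist A p (a \<oplus> b) = twist A p a \<oplus> twist A p b"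
  by (simp add: twist_eq hpart_add smult_add_r M.a_ac)

lemma twist_smult: "a \<in> carrier A \<Longrightarrow> twist A p (c \<odot> a) = c \<odot> twist A p a"
  by (simp add: twist_eq hpart_smult smult_add_r smult_smult mult.commute)

lemma twist_zero [simp]: "twist A p \<zero> = \<zero>"
  using twist_smult[of "\<zero>" p 0] by simp

lemma twist_0 [simp]: "a \<in> carrier A \<Longrightarrow> twist A 0 a = a"
  using hpart_split(2)[of a 0] by (simp add: twist_eq)

lemma twist_hcomp: "a \<in> hcomp A q \<Longrightarrow> twist A p a \<in> hcomp A q"
  by (simp add: twist_hom hc_smult)

lemma twist_twist: assumes "a \<in> carrier A" shows "twist A p (twist A q a) = twist A (p + q) a"
  using assms
proof (induction a rule: homogeneous_induct)
  case (hom r a)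
  have "psign (p * r) * psign (q * r) = (psign ((p + q) * r) :: 'f)"
    by (simp add: distrib_right psign_add)
  then show ?case using twist_hom[OF hom] twist_hom[OF twist_hcomp[OF hom, of q]] hc_carrier[OF hom]
    by (simp add: smult_smult)
next
  case (add a b) then show ?case by (simp add: twist_add)
qed

text \<open>Since the twist is multiplicative, it reconciles the sign in the matrix product with associativity.\<close>

lemma twist_mult: assumes "a \<in> carrier A" "b \<in> carrier A"
  shows "twist A p (a \<otimes> b) = twist A p a \<otimes> twist A p b"
  using assms(1)
proof (induction a rule: homogeneous_induct)
  case (hom q a)
  then have ac: "a \<in> carrier A" by (rule hc_carrier)
  show ?case using assms(2)
  proof (induction b rule: homogeneous_induct)
    case (hom r b)
    have "psign (p * (q + r)) = (psign (p * q) * psign (p * r) :: 'f)"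
      by (simp add: distrib_left psign_add)
    then show ?case using twist_hom[OF \<open>a \<in> hcomp A q\<close>] twist_hom[OF hom] hc_carrier[OF hom] ac
        twist_hom[OF mult_graded[OF \<open>a \<in> hcomp A q\<close> hom]]
      by (simp add: mult_smult_left mult_smult_right smult_smult mult.commute)
  next
    case (add b b') then show ?case using ac by (simp add: twist_add mult_add_right)
  qed
next
  case (add a a') then show ?case using assms(2) by (simp add: twist_add mult_add_left)
qed

end

lemma mat_simps [simp]:
  "carrier (mat_superalgebra A) = {M. \<forall>i j. M i j \<in> carrier A}"
  "monoid.mult (mat_superalgebra A) M N = (\<lambda>i k. \<Oplus>\<^bsub>A\<^esub>j \<in> UNIV. twist A (ipar j + ipar k) (M i j) \<otimes>\<^bsub>A\<^esub> N j k)"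
  "one (mat_superalgebra A) = (\<lambda>i j. if i = j then \<one>\<^bsub>A\<^esub> else \<zero>\<^bsub>A\<^esub>)"
  "zero (mat_superalgebra A) = (\<lambda>i j. \<zero>\<^bsub>A\<^esub>)"
  "add (mat_superalgebra A) M N = (\<lambda>i j. M i j \<oplus>\<^bsub>A\<^esub> N i j)"
  "smult (mat_superalgebra A) c M = (\<lambda>i j. c \<odot>\<^bsub>A\<^esub> M i j)"
  "hcomp (mat_superalgebra A) p = {M. \<forall>i j. M i j \<in> hcomp A (p + ipar i + ipar j)}"
  by (simp_all add: mat_superalgebra_def)

lemma (in superalgebra) mat_superalgebra:
  "superalgebra (mat_superalgebra A :: ('f, ('n :: finite, 'v) smat) superalgebra)" (is "superalgebra ?M")
proof -
  have ab: "abelian_group ?M"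
  proof (rule abelian_groupI)
    fix x assume x: "x \<in> carrier ?M"
    show "\<exists>y\<in>carrier ?M. y \<oplus>\<^bsub>?M\<^esub> x = \<zero>\<^bsub>?M\<^esub>"
      using x by (intro bexI[of _ "\<lambda>i j. \<ominus> x i j"]) (auto simp: M.l_neg)
  qed (auto simp: M.a_ac)
  have mo: "module scalars ?M"
    by (rule moduleI) (auto simp: ab cring_scalars smult_add_l smult_add_r smult_smult)
  interpret r: module scalars ?M by (rule mo)
  have neg: "\<ominus>\<^bsub>?M\<^esub> x = (\<lambda>i j. \<ominus> x i j)" if "x \<in> carrier ?M" for x
    by (rule r.M.minus_equality) (use that in \<open>auto simp: M.l_neg\<close>)
  show ?thesis
  proof (intro superalgebra.intro mo superalgebra_axioms.intro)
    fix p show "submodule (hcomp ?M p) scalars ?M"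
    proof (rule r.submoduleI)
      show s: "hcomp ?M p \<subseteq> carrier ?M" by (auto intro: hc_carrier)
      fix a assume a: "a \<in> hcomp ?M p"
      then have "\<ominus>\<^bsub>?M\<^esub> a = (\<lambda>i j. \<ominus> a i j)" using s by (intro neg) blast
      then show "\<ominus>\<^bsub>?M\<^esub> a \<in> hcomp ?M p" using a by (simp add: hc_minus)
    qed (auto simp: hc_add hc_smult)
  next
    have "M = \<zero>\<^bsub>?M\<^esub>" if "M \<in> hcomp ?M 0" "M \<in> hcomp ?M 1" for M
    proof (intro ext)
      fix i j
      have "M i j \<in> hcomp A (0 + ipar i + ipar j)" "M i j \<in> hcomp A (1 + ipar i + ipar j)"
        using that by auto
      then show "M i j = \<zero>\<^bsub>?M\<^esub> i j" using hcomp_disjoint'[of "M i j" "0 + ipar i + ipar j"]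
        by (simp add: add.commute add.left_commute)
    qed
    then show "hcomp ?M 0 \<inter> hcomp ?M 1 = {\<zero>\<^bsub>?M\<^esub>}" by auto
  next
    show "hcomp ?M 0 <+>\<^bsub>?M\<^esub> hcomp ?M 1 = carrier ?M"
    proof (intro equalityI subsetI)
      fix x assume "x \<in> hcomp ?M 0 <+>\<^bsub>?M\<^esub> hcomp ?M 1"
      then obtain u v where uv: "u \<in> hcomp ?M 0" "v \<in> hcomp ?M 1" "x = u \<oplus>\<^bsub>?M\<^esub> v"
        unfolding set_add_eq by blast
      have "u i j \<in> carrier A" "v i j \<in> carrier A" for i j
        using hc_carrier[of "u i j" "0 + ipar i + ipar j"] hc_carrier[of "v i j" "1 + ipar i + ipar j"] uv(1,2)
        by simp_all
      then show "x \<in> carrier ?M" using uv(3) by simp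
    next
      fix x :: "('n, 'v) smat" assume x: "x \<in> carrier ?M"
      let ?h = "\<lambda>p i j. hpart A (p + ipar i + ipar j) (x i j)"
      have "x = ?h 0 \<oplus>\<^bsub>?M\<^esub> ?h 1"
      proof (intro ext)
        fix i j
        show "x i j = (?h 0 \<oplus>\<^bsub>?M\<^esub> ?h 1) i j"
          using x hpart_split(2)[of "x i j" "0 + ipar i + ipar j"] by (simp add: add.commute add.left_commute)
      qed
      moreover have "?h p \<in> hcomp ?M p" for p using x by simp
      ultimately show "x \<in> hcomp ?M 0 <+>\<^bsub>?M\<^esub> hcomp ?M 1" unfolding set_add_eq by blast
    qed
  next
    fix x y p q assume x: "x \<in> hcomp ?M p" and y: "y \<in> hcomp ?M q"
    have "twist A (ipar j + ipar k) (x i j) \<otimes> y j k \<in> hcomp A (p + q + ipar i + ipar k)" for i j k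
    proof -
      have e: "(p + ipar i + ipar j) + (q + ipar j + ipar k) = p + q + ipar i + ipar k"
        by (cases "ipar i"; cases "ipar j"; cases "ipar k"; cases p; cases q) simp_all
      have "twist A (ipar j + ipar k) (x i j) \<otimes> y j k \<in> hcomp A ((p + ipar i + ipar j) + (q + ipar j + ipar k))"
        by (rule mult_graded[OF twist_hcomp]) (use x y in auto)
      then show ?thesis unfolding e .
    qed
    then show "x \<otimes>\<^bsub>?M\<^esub> y \<in> hcomp ?M (p + q)"
      by (simp add: sub_finsum[OF hcomp_submodule])
  next
    fix x y assume x: "x \<in> carrier ?M" and y: "y \<in> carrier ?M"
    show "x \<otimes>\<^bsub>?M\<^esub> y \<in> carrier ?M" using x y by (auto intro!: M.finsum_closed)
    show "(c \<odot>\<^bsub>?M\<^esub> x) \<otimes>\<^bsub>?M\<^esub> y = c \<odot>\<^bsub>?M\<^esub> (x \<otimes>\<^bsub>?M\<^esub> y)" for c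
      using x y by (simp add: twist_smult mult_smult_left)
        (intro ext finsum_smult_ldistr[symmetric]; simp)
    show "x \<otimes>\<^bsub>?M\<^esub> (c \<odot>\<^bsub>?M\<^esub> y) = c \<odot>\<^bsub>?M\<^esub> (x \<otimes>\<^bsub>?M\<^esub> y)" for c
      using x y by (simp add: mult_smult_right)
        (intro ext finsum_smult_ldistr[symmetric]; simp)
    fix z assume z: "z \<in> carrier ?M"
    show "(x \<oplus>\<^bsub>?M\<^esub> y) \<otimes>\<^bsub>?M\<^esub> z = x \<otimes>\<^bsub>?M\<^esub> z \<oplus>\<^bsub>?M\<^esub> y \<otimes>\<^bsub>?M\<^esub> z"
      using x y z by (simp add: twist_add mult_add_left)
    show "z \<otimes>\<^bsub>?M\<^esub> (x \<oplus>\<^bsub>?M\<^esub> y) = z \<otimes>\<^bsub>?M\<^esub> x \<oplus>\<^bsub>?M\<^esub> z \<otimes>\<^bsub>?M\<^esub> y"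
      using x y z by (simp add: mult_add_right)
  qed
qed

lemma (in unital_assoc_superalgebra) twist_one [simp]: "twist A p \<one> = \<one>"
  using twist_hom[OF one_even, of p] one_in_carrier by simp

lemma (in unital_assoc_superalgebra) mat_unital_assoc:
  "unital_assoc_superalgebra (mat_superalgebra A :: ('b, ('n :: finite, 'a) smat) superalgebra)"
    (is "unital_assoc_superalgebra ?M")
proof -
  interpret m: superalgebra ?M by (rule mat_superalgebra)
  show ?thesis
  proof unfold_locales
    fix x y z :: "('n, 'a) smat"
    assume "x \<in> carrier ?M" "y \<in> carrier ?M" "z \<in> carrier ?M"
    then have c: "x i j \<in> carrier A" "y i j \<in> carrier A" "z i j \<in> carrier A" for i j by auto
    show "x \<otimes>\<^bsub>?M\<^esub> y \<otimes>\<^bsub>?M\<^esub> z = x \<otimes>\<^bsub>?M\<^esub> (y \<otimes>\<^bsub>?M\<^esub> z)"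
    proof (intro ext)
      fix i l :: "'n + 'n"
      let ?t = "\<lambda>(k :: 'n + 'n) j. twist A (ipar j + ipar l) (x i j) \<otimes> (twist A (ipar k + ipar l) (y j k) \<otimes> z k l)"
      have 1: "twist A (ipar k + ipar l) (\<Oplus>j\<in>UNIV. twist A (ipar j + ipar k) (x i j) \<otimes> y j k) \<otimes> z k l
          = (\<Oplus>j\<in>UNIV. ?t k j)" for k :: "'n + 'n"
      proof -
        have "twist A (ipar k + ipar l) (\<Oplus>j\<in>UNIV. twist A (ipar j + ipar k) (x i j) \<otimes> y j k)
          = (\<Oplus>j\<in>UNIV. twist A (ipar k + ipar l) (twist A (ipar j + ipar k) (x i j) \<otimes> y j k))"
          by (rule additive_finsum) (use c in \<open>auto simp: twist_add\<close>)
        also have "\<dots> = (\<Oplus>j\<in>UNIV. twist A (ipar j + ipar l) (x i j) \<otimes> twist A (ipar k + ipar l) (y j k))"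
        proof (rule M.finsum_cong')
          fix j :: "'n + 'n"
          have "ipar k + ipar l + (ipar j + ipar k) = ipar j + ipar l"
            by (cases "ipar k"; cases "ipar l"; cases "ipar j") simp_all
          then show "twist A (ipar k + ipar l) (twist A (ipar j + ipar k) (x i j) \<otimes> y j k) =
              twist A (ipar j + ipar l) (x i j) \<otimes> twist A (ipar k + ipar l) (y j k)"
            using c by (simp only: twist_mult twist_twist twist_carrier)
        qed (use c in auto)
        finally show ?thesis using c by (simp add: mult_finsum mult_assoc)
      qed
      have "(x \<otimes>\<^bsub>?M\<^esub> y \<otimes>\<^bsub>?M\<^esub> z) i l = (\<Oplus>k\<in>UNIV. \<Oplus>j\<in>UNIV. ?t k j)" by (simp add: 1)
      also have "\<dots> = (\<Oplus>j\<in>UNIV. \<Oplus>k\<in>UNIV. ?t k j)" by (rule M.finsum_swap) (use c in auto)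
      also have "\<dots> = (x \<otimes>\<^bsub>?M\<^esub> (y \<otimes>\<^bsub>?M\<^esub> z)) i l" using c by (simp add: mult_finsum)
      finally show "(x \<otimes>\<^bsub>?M\<^esub> y \<otimes>\<^bsub>?M\<^esub> z) i l = (x \<otimes>\<^bsub>?M\<^esub> (y \<otimes>\<^bsub>?M\<^esub> z)) i l" .
    qed
  next
    fix x :: "('n, 'a) smat" assume "x \<in> carrier ?M"
    then have c: "x i j \<in> carrier A" for i j by auto
    show "\<one>\<^bsub>?M\<^esub> \<otimes>\<^bsub>?M\<^esub> x = x"
    proof (intro ext)
      fix i k
      show "(\<one>\<^bsub>?M\<^esub> \<otimes>\<^bsub>?M\<^esub> x) i k = x i k"
        unfolding mat_simps by (rule finsum_single[of _ i]) (use c in \<open>auto simp: one_left\<close>)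
    qed
    show "x \<otimes>\<^bsub>?M\<^esub> \<one>\<^bsub>?M\<^esub> = x"
    proof (intro ext)
      fix i k
      show "(x \<otimes>\<^bsub>?M\<^esub> \<one>\<^bsub>?M\<^esub>) i k = x i k"
        unfolding mat_simps by (rule finsum_single[of _ k]) (use c in \<open>auto simp: one_right\<close>)
    qed
  next
    show "\<one>\<^bsub>?M\<^esub> \<in> carrier ?M" using one_in_carrier by simp
    show "\<one>\<^bsub>?M\<^esub> \<noteq> \<zero>\<^bsub>?M\<^esub>" 
    proof
      assume "\<one>\<^bsub>?M\<^esub> = \<zero>\<^bsub>?M\<^esub>"
      then have "\<one>\<^bsub>?M\<^esub> (Inl undefined) (Inl undefined) = \<zero>\<^bsub>?M\<^esub> (Inl undefined) (Inl undefined)" by simp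
      then show False using one_neq_zero by simp
    qed
  qed
qed

subsection \<open>Normalised matrix units\<close>

text \<open>The sign makes the products of these units the usual ones, so that it disappears from all
  commutation relations between distinct indices.\<close>

definition munit :: "('f :: field, 'a) superalgebra \<Rightarrow> 'n + 'n \<Rightarrow> 'n + 'n \<Rightarrow> 'a \<Rightarrow> ('n, 'a) smat" where
  "munit A i j a = (\<lambda>r s. if r = i \<and> s = j then twist A (ipar j) a else \<zero>\<^bsub>A\<^esub>)"

text \<open>The three indices in a block leave one of any prescribed parity that avoids two given ones.\<close>

lemma ex_same_block:
  assumes "3 \<le> CARD('n :: finite)"
  obtains j :: "'n :: finite + 'n" where "j \<noteq> i" "j \<noteq> i'" "ipar j = p"
proof -
  define f :: "'n \<Rightarrow> 'n + 'n" where "f = (if p = 0 then Inl else Inr)"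
  have "card {i, i'} \<le> 2" by (simp add: card_insert_if)
  moreover have "inj f" by (auto simp: f_def inj_def)
  then have "card (range f) = CARD('n)" by (rule card_image)
  ultimately have "\<not> range f \<subseteq> {i, i'}" using assms card_mono[of "{i, i'}" "range f"] by auto
  then obtain x where "f x \<noteq> i" "f x \<noteq> i'" by auto
  moreover have "ipar (f x) = p" by (cases p) (simp_all add: f_def ipar_def)
  ultimately show thesis using that by blast
qed

context unital_assoc_superalgebra
begin

lemma munit_carrier [simp]: "a \<in> carrier A \<Longrightarrow> munit A i j a \<in> carrier (mat_superalgebra A)"
  by (simp add: munit_def)

lemma munit_hom: "a \<in> hcomp A p \<Longrightarrow> munit A i j a \<in> hcomp (mat_superalgebra A) (p + ipar i + ipar j)"
proof -
  assume a: "a \<in> hcomp A p"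
  have "p + ipar i + ipar j + ipar i + ipar j = p" by (cases p; cases "ipar i"; cases "ipar j") simp_all
  then show ?thesis using twist_hcomp[OF a] by (auto simp: munit_def)
qed

lemma munit_add: "a \<in> carrier A \<Longrightarrow> b \<in> carrier A
    \<Longrightarrow> munit A i j (a \<oplus> b) = munit A i j a \<oplus>\<^bsub>mat_superalgebra A\<^esub> munit A i j b"
  by (auto simp: munit_def fun_eq_iff twist_add)

lemma munit_smult: "a \<in> carrier A \<Longrightarrow> munit A i j (c \<odot> a) = c \<odot>\<^bsub>mat_superalgebra A\<^esub> munit A i j a"
  by (auto simp: munit_def fun_eq_iff twist_smult)

lemma munit_eq_0: assumes "a \<in> carrier A" "munit A i j a = \<zero>\<^bsub>mat_superalgebra A\<^esub>" shows "a = \<zero>"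
proof -
  have "munit A i j a i j = \<zero>" using assms(2) by simp
  then have "twist A (ipar j) (twist A (ipar j) a) = \<zero>" by (simp add: munit_def)
  then show ?thesis using assms(1) by (simp add: twist_twist)
qed

lemma munit_mult:
  assumes "a \<in> carrier A" "b \<in> carrier A"
  shows "munit A i j a \<otimes>\<^bsub>mat_superalgebra A\<^esub> munit A k l b
      = (if j = k then munit A i l (a \<otimes> b) else \<zero>\<^bsub>mat_superalgebra A\<^esub>)"
proof (intro ext)
  fix r s
  let ?v = "if j = k \<and> r = i \<and> s = l then twist A (ipar l) (a \<otimes> b) else \<zero>"
  have "(munit A i j a \<otimes>\<^bsub>mat_superalgebra A\<^esub> munit A k l b) r s
     = (\<Oplus>h\<in>UNIV. twist A (ipar h + ipar s) (munit A i j a r h) \<otimes> munit A k l b h s)" by simp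
  also have "\<dots> = ?v"
  proof (rule finsum_single[of _ j])
    fix h
    have "ipar j + ipar l + ipar j = ipar l" by (cases "ipar j"; cases "ipar l") simp_all
    then show "twist A (ipar h + ipar s) (munit A i j a r h) \<otimes> munit A k l b h s = (if h = j then ?v else \<zero>)"
      using assms by (auto simp: munit_def twist_twist twist_mult)
  qed (use assms in auto)
  also have "\<dots> = (if j = k then munit A i l (a \<otimes> b) else \<zero>\<^bsub>mat_superalgebra A\<^esub>) r s"
    by (simp add: munit_def)
  finally show "(munit A i j a \<otimes>\<^bsub>mat_superalgebra A\<^esub> munit A k l b) r s
      = (if j = k then munit A i l (a \<otimes> b) else \<zero>\<^bsub>mat_superalgebra A\<^esub>) r s" .
qed

lemma mat_in_span:
  fixes H :: "('n :: finite, 'a) smat set"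
  assumes z: "\<zero>\<^bsub>mat_superalgebra A\<^esub> \<in> H"
    and ad: "\<And>x y. x \<in> H \<Longrightarrow> y \<in> H \<Longrightarrow> x \<oplus>\<^bsub>mat_superalgebra A\<^esub> y \<in> H"
    and u: "\<And>i j a. a \<in> carrier A \<Longrightarrow> munit A i j a \<in> H"
    and M: "M \<in> carrier (mat_superalgebra A)"
  shows "M \<in> H"
proof -
  have "\<forall>M. M \<in> carrier (mat_superalgebra A) \<longrightarrow> (\<forall>i j. (i, j) \<notin> F \<longrightarrow> M i j = \<zero>) \<longrightarrow> M \<in> H"
    if "finite F" for F :: "(('n + 'n) \<times> ('n + 'n)) set"
    using that
  proof (induction rule: finite_induct)
    case empty
    show ?case
    proof (intro allI impI)
      fix M :: "('n, 'a) smat" assume "\<forall>i j. (i, j) \<notin> {} \<longrightarrow> M i j = \<zero>"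
      then have "M = \<zero>\<^bsub>mat_superalgebra A\<^esub>" by (simp add: fun_eq_iff)
      then show "M \<in> H" using z by simp
    qed
  next
    case (insert x F)
    obtain i j where x: "x = (i, j)" by fastforce
    show ?case
    proof (intro allI impI)
      fix M :: "('n, 'a) smat" 
      assume M: "M \<in> carrier (mat_superalgebra A)" and s: "\<forall>i j. (i, j) \<notin> insert x F \<longrightarrow> M i j = \<zero>"
      define M' where "M' = (\<lambda>r s. if r = i \<and> s = j then \<zero> else M r s)"
      have "M' \<in> H" using insert.IH M s x by (auto simp: M'_def)
      moreover have "M = M' \<oplus>\<^bsub>mat_superalgebra A\<^esub> munit A i j (twist A (ipar j) (M i j))"
        using M by (auto simp: M'_def munit_def fun_eq_iff twist_twist)
      moreover have "munit A i j (twist A (ipar j) (M i j)) \<in> H" using u M by simp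
      ultimately show "M \<in> H" using ad by metis
    qed
  qed
  from this[of UNIV] M show ?thesis by simp
qed

lemma munit_supercommutator:
  assumes a: "a \<in> hcomp A p" and b: "b \<in> hcomp A q"
  shows "supercommutator (mat_superalgebra A) (munit A i j a) (munit A k l b)
     = (if j = k then munit A i l (a \<otimes> b) else \<zero>\<^bsub>mat_superalgebra A\<^esub>) \<ominus>\<^bsub>mat_superalgebra A\<^esub>
       psign ((p + ipar i + ipar j) * (q + ipar k + ipar l)) \<odot>\<^bsub>mat_superalgebra A\<^esub>
         (if l = i then munit A k j (b \<otimes> a) else \<zero>\<^bsub>mat_superalgebra A\<^esub>)"
  using superalgebra.supercommutator_hom[OF mat_superalgebra munit_hom[OF a, of i j] munit_hom[OF b, of k l]]
    munit_mult[OF hc_carrier[OF a] hc_carrier[OF b], of i j k l]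
    munit_mult[OF hc_carrier[OF b] hc_carrier[OF a], of k l i j] by (simp only:)

lemma gl_lie: "lie_superalgebra (gl_tensor A :: ('b, ('n :: finite, 'a) smat) superalgebra)"
  unfolding gl_tensor_def by (rule unital_assoc_superalgebra.lie_commutator[OF mat_unital_assoc])

lemma gl_simps:
  "carrier (gl_tensor A) = carrier (mat_superalgebra A)" "zero (gl_tensor A) = zero (mat_superalgebra A)"
  "monoid.mult (gl_tensor A) = supercommutator (mat_superalgebra A)"
  "add (gl_tensor A) = add (mat_superalgebra A)" "smult (gl_tensor A) = smult (mat_superalgebra A)"
  "hcomp (gl_tensor A) = hcomp (mat_superalgebra A)"
  by (simp_all add: gl_tensor_def commutator_superalgebra_def)

lemma gl_steinberg:
  assumes card: "3 \<le> CARD('n :: finite)"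
  shows "steinberg (gl_tensor A :: ('b, ('n, 'a) smat) superalgebra) A (munit A)"
proof -
  let ?M = "mat_superalgebra A :: ('b, ('n, 'a) smat) superalgebra"
  interpret m: unital_assoc_superalgebra ?M by (rule mat_unital_assoc)
  interpret g: lie_superalgebra "gl_tensor A :: ('b, ('n, 'a) smat) superalgebra" by (rule gl_lie)
  have zc: "\<zero>\<^bsub>?M\<^esub> \<in> carrier ?M" by (rule m.M.zero_closed)
  have red: "supercommutator ?M (munit A i j a) (munit A k l b) = (if j = k then munit A i l (a \<otimes> b) else \<zero>\<^bsub>?M\<^esub>)"
    if il: "i \<noteq> l" and a: "a \<in> carrier A" and b: "b \<in> carrier A" for i j k l :: "'n + 'n" and a b
    using a
  proof (induction a rule: homogeneous_induct)
    case (hom p a)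
    then have ac: "a \<in> carrier A" by (rule hc_carrier)
    show ?case using b
    proof (induction b rule: homogeneous_induct)
      case (hom q b)
      then have bc: "b \<in> carrier A" by (rule hc_carrier)
      let ?X = "if j = k then munit A i l (a \<otimes> b) else \<zero>\<^bsub>?M\<^esub>"
      have X: "?X \<in> carrier ?M" using ac bc zc by (simp del: mat_simps)
      show ?case unfolding munit_supercommutator[OF \<open>a \<in> hcomp A p\<close> hom] using il X
        by (simp add: a_minus_def del: mat_simps)
    next
      case (add b b')
      then show ?case using ac m.supercommutator_add(2)[of "munit A k l b" "munit A k l b'" "munit A i j a"] zc
        by (cases "j = k") (simp_all add: munit_add mult_add_right del: mat_simps)
    qed
  next
    case (add a a')
    then show ?case using b m.supercommutator_add(1)[of "munit A i j a" "munit A i j a'" "munit A k l b"] zc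
      by (cases "j = k") (simp_all add: munit_add mult_add_left del: mat_simps)
  qed
  show ?thesis
  proof unfold_locales
    show "3 \<le> CARD('n)" by (rule card)
    fix i j :: "'n + 'n" and a p assume "a \<in> hcomp A p"
    then show "munit A i j a \<in> hcomp (gl_tensor A) (p + ipar i + ipar j)" unfolding gl_simps by (rule munit_hom)
  next
    fix i j :: "'n + 'n" and a assume "a \<in> carrier A" "munit A i j a = \<zero>\<^bsub>gl_tensor A\<^esub>"
    then show "a = \<zero>" unfolding gl_simps by (rule munit_eq_0)
  qed (simp_all add: gl_simps munit_add munit_smult red del: mat_simps)
qed

end


context unital_assoc_superalgebra
begin

text \<open>The only brackets of matrix units that are not visibly in the span are those of two diagonal
  units \<open>e\<^sub>i\<^sub>i\<close>, \<open>e\<^sub>i\<^sub>i\<close>, which produce \<open>ab \<plusminus> ba\<close> at a single place. With an index \<open>h\<close> in the same block this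
  is the difference of two brackets of off-diagonal units, in which the entries at \<open>h\<close> cancel.\<close>

lemma derived_gl:
  assumes card: "3 \<le> CARD('n :: finite)"
  shows "derived (gl_tensor A :: ('b, ('n, 'a) smat) superalgebra)
       = steinberg.gen_span (gl_tensor A :: ('b, ('n, 'a) smat) superalgebra) A (munit A) (\<lambda>_ _. True)"
proof -
  let ?g = "gl_tensor A :: ('b, ('n, 'a) smat) superalgebra"
  let ?M = "mat_superalgebra A :: ('b, ('n, 'a) smat) superalgebra"
  interpret m: unital_assoc_superalgebra ?M by (rule mat_unital_assoc)
  interpret g: steinberg ?g A "munit A" by (rule gl_steinberg[OF card])
  let ?N = "g.gen_span (\<lambda>_ _. True)"
  note sm = g.gen_sub[of "\<lambda>_ _. True"]
  have inv: "a_inv ?g = a_inv ?M" by (simp add: a_inv_def gl_simps)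
  have off: "munit A i j a \<in> ?N" if "i \<noteq> j" "a \<in> carrier A" for i j a
    by (rule g.phi_in_gen) (use that in auto)
  have gm: "x \<otimes>\<^bsub>?g\<^esub> y \<in> ?N" if "x \<in> ?N" "y \<in> ?N" for x y
    by (rule g.gen_mult) (use that in auto)
  have units_hom: "munit A i j a \<otimes>\<^bsub>?g\<^esub> munit A k l b \<in> ?N" if a: "a \<in> hcomp A p" and b: "b \<in> hcomp A q"
    for i j k l a b p q
  proof -
    have c: "a \<in> carrier A" "b \<in> carrier A" "a \<otimes> b \<in> carrier A" "b \<otimes> a \<in> carrier A"
      using a b hc_carrier by auto
    consider "i \<noteq> j" "k \<noteq> l" | "i = j \<or> k = l" "\<not> (i = j \<and> j = k \<and> k = l)" | "i = j \<and> j = k \<and> k = l" by auto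
    then show ?thesis
    proof cases
      case 1
      then show ?thesis using gm off c by simp
    next
      case 2
      let ?X = "if j = k then munit A i l (a \<otimes> b) else \<zero>\<^bsub>?g\<^esub>"
      let ?Y = "if l = i then munit A k j (b \<otimes> a) else \<zero>\<^bsub>?g\<^esub>"
      have "munit A i j a \<otimes>\<^bsub>?g\<^esub> munit A k l b =
          ?X \<ominus>\<^bsub>?g\<^esub> psign ((p + ipar i + ipar j) * (q + ipar k + ipar l)) \<odot>\<^bsub>?g\<^esub> ?Y"
        unfolding gl_simps a_minus_def inv munit_supercommutator[OF a b] ..
      moreover have "?X \<in> ?N" "?Y \<in> ?N" using 2 off c g.lie.sub_zero[OF sm] by auto
      ultimately show ?thesis using g.lie.sub_diff[OF sm] g.lie.sub_smult[OF sm] by simp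
    next
      case 3
      obtain h where h: "h \<noteq> i" "ipar h = ipar i" using ex_same_block[OF card, of i i "ipar i"] by blast
      let ?s = "psign (p * q) :: 'b"
      have pp: "p + ipar i + ipar i = p" for p :: bit by simp
      have 1: "munit A i h a \<otimes>\<^bsub>?g\<^esub> munit A h i b = munit A i i (a \<otimes> b) \<ominus>\<^bsub>?g\<^esub> ?s \<odot>\<^bsub>?g\<^esub> munit A h h (b \<otimes> a)"
        unfolding gl_simps a_minus_def inv munit_supercommutator[OF a b] h(2) pp by simp
      have 2: "munit A i h \<one> \<otimes>\<^bsub>?g\<^esub> munit A h i (b \<otimes> a) = munit A i i (b \<otimes> a) \<ominus>\<^bsub>?g\<^esub> munit A h h (b \<otimes> a)"
        unfolding gl_simps a_minus_def inv munit_supercommutator[OF one_even mult_graded[OF b a]] h(2) pp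
        using one_left[OF c(4)] one_right[OF c(4)] m.smult_1[OF munit_carrier[OF c(4)], of h h] 
        by (simp del: mat_simps)
      have 3: "munit A i i a \<otimes>\<^bsub>?g\<^esub> munit A i i b = munit A i i (a \<otimes> b) \<ominus>\<^bsub>?g\<^esub> ?s \<odot>\<^bsub>?g\<^esub> munit A i i (b \<otimes> a)"
        unfolding gl_simps a_minus_def inv munit_supercommutator[OF a b] h(2) pp by simp
      have uc: "munit A r t x \<in> carrier ?g" if "x \<in> carrier A" for r t x
        unfolding gl_simps by (rule munit_carrier[OF that])
      have 4: "munit A i i a \<otimes>\<^bsub>?g\<^esub> munit A i i b
          = munit A i h a \<otimes>\<^bsub>?g\<^esub> munit A h i b \<ominus>\<^bsub>?g\<^esub> ?s \<odot>\<^bsub>?g\<^esub> (munit A i h \<one> \<otimes>\<^bsub>?g\<^esub> munit A h i (b \<otimes> a))"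
        unfolding 1 2 3 using uc c
        by (simp add: a_minus_def g.lie.smult_add_r g.lie.smult_minus g.lie.M.minus_add g.lie.M.a_ac
            g.lie.M.r_neg g.lie.M.r_neg1 g.lie.M.r_neg2)
      have "munit A i h a \<otimes>\<^bsub>?g\<^esub> munit A h i b \<in> ?N" "munit A i h \<one> \<otimes>\<^bsub>?g\<^esub> munit A h i (b \<otimes> a) \<in> ?N"
        by (rule gm; rule off; use h c one_in_carrier in simp)+
      then have "munit A i i a \<otimes>\<^bsub>?g\<^esub> munit A i i b \<in> ?N"
        unfolding 4 by (intro g.lie.sub_diff[OF sm] g.lie.sub_smult[OF sm])
      then show ?thesis using \<open>i = j \<and> j = k \<and> k = l\<close> by simp
    qed
  qed
  have gen: "munit A i j a \<otimes>\<^bsub>?g\<^esub> munit A k l b \<in> ?N" if a: "a \<in> carrier A" and b: "b \<in> carrier A" for i j k l a b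
  proof -
    have uc: "munit A r t x \<in> carrier ?g" if "x \<in> carrier A" for r t x
      unfolding gl_simps by (rule munit_carrier[OF that])
    have ua: "munit A r t (x \<oplus> y) = munit A r t x \<oplus>\<^bsub>?g\<^esub> munit A r t y" if "x \<in> carrier A" "y \<in> carrier A" for r t x y
      unfolding gl_simps by (rule munit_add[OF that])
    show ?thesis using a
    proof (induction a rule: homogeneous_induct)
      case (hom p a)
      then have ac: "a \<in> carrier A" by (rule hc_carrier)
      show ?case using b
      proof (induction b rule: homogeneous_induct)
        case (hom q b) then show ?case using units_hom[OF \<open>a \<in> hcomp A p\<close>] by blast
      next
        case (add b b') then show ?case using ac by (simp add: ua uc g.lie.mult_add_right g.lie.sub_add[OF sm])
      qed
    next
      case (add a a') then show ?case using b by (simp add: ua uc g.lie.mult_add_left g.lie.sub_add[OF sm])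
    qed
  qed
  have uc: "munit A r t x \<in> carrier ?g" if "x \<in> carrier A" for r t x
    unfolding gl_simps by (rule munit_carrier[OF that])
  have all1: "x \<otimes>\<^bsub>?g\<^esub> munit A k l b \<in> ?N" if x: "x \<in> carrier ?g" and b: "b \<in> carrier A" for x k l b
  proof -
    have "x \<in> {x \<in> carrier ?g. x \<otimes>\<^bsub>?g\<^esub> munit A k l b \<in> ?N}"
    proof (rule mat_in_span)
      show "\<zero>\<^bsub>?M\<^esub> \<in> {x \<in> carrier ?g. x \<otimes>\<^bsub>?g\<^esub> munit A k l b \<in> ?N}"
        using g.lie.mult_0(2)[OF uc[OF b]] g.lie.sub_zero[OF sm] g.lie.M.zero_closed 
        unfolding gl_simps(2)[symmetric] by simp
    next
      fix u v assume "u \<in> {x \<in> carrier ?g. x \<otimes>\<^bsub>?g\<^esub> munit A k l b \<in> ?N}" "v \<in> {x \<in> carrier ?g. x \<otimes>\<^bsub>?g\<^esub> munit A k l b \<in> ?N}"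
      then show "u \<oplus>\<^bsub>?M\<^esub> v \<in> {x \<in> carrier ?g. x \<otimes>\<^bsub>?g\<^esub> munit A k l b \<in> ?N}"
        unfolding gl_simps(4)[symmetric] using uc[OF b] by (simp add: g.lie.mult_add_left g.lie.sub_add[OF sm])
    next
      show "x \<in> carrier ?M" using x by (simp only: gl_simps)
    qed (use gen uc b in simp)
    then show ?thesis by simp
  qed
  have all: "x \<otimes>\<^bsub>?g\<^esub> y \<in> ?N" if x: "x \<in> carrier ?g" and y: "y \<in> carrier ?g" for x y
  proof -
    have "y \<in> {y \<in> carrier ?g. x \<otimes>\<^bsub>?g\<^esub> y \<in> ?N}"
    proof (rule mat_in_span)
      show "\<zero>\<^bsub>?M\<^esub> \<in> {y \<in> carrier ?g. x \<otimes>\<^bsub>?g\<^esub> y \<in> ?N}"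
        using g.lie.mult_0(1)[OF x] g.lie.sub_zero[OF sm] g.lie.M.zero_closed 
        unfolding gl_simps(2)[symmetric] by simp
    next
      fix u v assume "u \<in> {y \<in> carrier ?g. x \<otimes>\<^bsub>?g\<^esub> y \<in> ?N}" "v \<in> {y \<in> carrier ?g. x \<otimes>\<^bsub>?g\<^esub> y \<in> ?N}"
      then show "u \<oplus>\<^bsub>?M\<^esub> v \<in> {y \<in> carrier ?g. x \<otimes>\<^bsub>?g\<^esub> y \<in> ?N}"
        unfolding gl_simps(4)[symmetric] using x by (simp add: g.lie.mult_add_right g.lie.sub_add[OF sm])
    next
      show "y \<in> carrier ?M" using y by (simp only: gl_simps)
    qed (use all1 uc x in simp)
    then show ?thesis by simp
  qed
  have "derived ?g \<subseteq> ?N"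
    unfolding derived_def by (rule g.lie.lspan_least[OF sm]) (use all in blast)
  then show ?thesis using g.gen_le_derived by blast
qed

lemma sl_over_steinberg:
  assumes card: "3 \<le> CARD('n :: finite)"
  shows "steinberg (sl_over TYPE('n) A) A (munit A)" "steinberg.generated (sl_over TYPE('n) A) A (munit A)"
  unfolding sl_over_def derived_gl[OF card]
  by (rule steinberg.restrict_generated[OF gl_steinberg[OF card]])+

end

section \<open>The ground field case\<close>

lemma ground_simps [simp]:
  "carrier ground = UNIV" "\<one>\<^bsub>ground\<^esub> = 1" "\<zero>\<^bsub>ground\<^esub> = 0" "a \<oplus>\<^bsub>ground\<^esub> b = a + b"
  "a \<otimes>\<^bsub>ground\<^esub> b = a * b" "c \<odot>\<^bsub>ground\<^esub> b = c * b" "hcomp ground p = (if p = 0 then UNIV else {0})"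
  by (simp_all add: ground_def)

lemma ground_unital_assoc: "unital_assoc_superalgebra (ground :: ('f :: field, 'f) superalgebra)"
proof -
  let ?G = "ground :: ('f, 'f) superalgebra"
  have ab: "abelian_group ?G"
    by (rule abelian_groupI) (auto simp: algebra_simps intro: exI[of _ "- _"])
  have mo: "module scalars ?G"
    by (rule moduleI) (auto simp: ab cring_scalars algebra_simps)
  interpret r: module scalars ?G by (rule mo)
  have neg: "\<ominus>\<^bsub>?G\<^esub> a = - a" for a
    using r.M.minus_equality[of "- a" a] by simp
  have "superalgebra ?G"
  proof (intro superalgebra.intro mo superalgebra_axioms.intro)
    show "submodule (hcomp ?G p) scalars ?G" for p
      by (rule r.submoduleI) (auto simp: neg split: if_splits)
    show "hcomp ?G 0 <+>\<^bsub>?G\<^esub> hcomp ?G 1 = carrier ?G"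
    proof -
      have "\<exists>u v. x = u + v \<and> v = 0" for x :: 'f by auto
      then show ?thesis by (auto simp: set_add_eq)
    qed
    fix x y p q assume xy: "x \<in> hcomp ?G p" "y \<in> hcomp ?G q"
    then show "x \<otimes>\<^bsub>?G\<^esub> y \<in> hcomp ?G (p + q)" by (cases p; cases q) auto
  qed (auto simp: algebra_simps)
  then interpret s: superalgebra ?G .
  show ?thesis by unfold_locales (auto simp: algebra_simps)
qed

interpretation ground: unital_assoc_superalgebra ground
  by (rule ground_unital_assoc)

lemma ground_neg [simp]: "\<ominus>\<^bsub>ground\<^esub> a = - a"
  using ground.M.minus_equality[of "- a" a] by simp

lemma twist_ground [simp]: "twist ground p a = a"
  using ground.twist_hom[of a 0 p] by simp

lemma munit_ground: "munit ground i j a = (\<lambda>r s. if r = i \<and> s = j then a else 0)"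
  by (auto simp: munit_def fun_eq_iff)

lemma mat_ground_add: "M \<oplus>\<^bsub>mat_superalgebra ground\<^esub> N = (\<lambda>i j. M i j + N i j)"
  and mat_ground_smult: "c \<odot>\<^bsub>mat_superalgebra ground\<^esub> N = (\<lambda>i j. c * N i j)"
  and mat_ground_zero: "\<zero>\<^bsub>mat_superalgebra ground\<^esub> = (\<lambda>i j. 0)"
  by simp_all

lemma finsum_ground: "finite S \<Longrightarrow> finsum ground f S = sum f S"
  by (induction rule: finite_induct) simp_all

lemma mat_ground_mult: "M \<otimes>\<^bsub>mat_superalgebra ground\<^esub> N = (\<lambda>i k. \<Sum>j\<in>UNIV. M i j * N j k)"
  by (simp add: finsum_ground)

interpretation matg: unital_assoc_superalgebra "mat_superalgebra ground :: ('f :: field, ('n :: finite, 'f) smat) superalgebra"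
  by (rule ground.mat_unital_assoc)

lemma mat_ground_neg: "\<ominus>\<^bsub>mat_superalgebra ground\<^esub> M = (\<lambda>i j. - M i j)"
  using matg.M.minus_equality[of "\<lambda>i j. - M i j" M] by simp

lemma mat_ground_diff: "M \<ominus>\<^bsub>mat_superalgebra ground\<^esub> N = (\<lambda>i j. M i j - N i j)"
  by (simp add: a_minus_def mat_ground_neg)

lemma supertrace_add: "supertrace (\<lambda>i j. M i j + N i j) = supertrace M + supertrace N"
  by (simp add: supertrace_def sum.distrib)

lemma supertrace_smult: "supertrace (\<lambda>i j. c * M i j) = c * supertrace M"
  by (simp add: supertrace_def sum_distrib_left right_diff_distrib)

lemma supertrace_diff: "supertrace (\<lambda>i j. M i j - N i j) = supertrace M - supertrace N"
  by (simp add: supertrace_def sum_subtractf)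

lemma supertrace_munit: "supertrace (munit ground i j a :: ('n :: finite, 'f :: field) smat)
    = (if i = j then psign (ipar i) * a else 0)"
proof (cases i)
  case (Inl k)
  have "(\<Sum>x\<in>UNIV. if Inl x = i \<and> Inl x = j then a else 0) = (\<Sum>x\<in>UNIV. if x = k then (if i = j then a else 0) else 0)"
    by (rule sum.cong) (auto simp: Inl)
  then show ?thesis by (cases "i = j") (auto simp: supertrace_def munit_ground Inl ipar_def)
next
  case (Inr k)
  have "(\<Sum>x\<in>UNIV. if Inr x = i \<and> Inr x = j then a else 0) = (\<Sum>x\<in>UNIV. if x = k then (if i = j then a else 0) else 0)"
    by (rule sum.cong) (auto simp: Inr)
  then show ?thesis by (cases "i = j") (auto simp: supertrace_def munit_ground Inr ipar_def)
qed

lemma ground_diag: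
  assumes "i \<noteq> j"
  shows "supercommutator (mat_superalgebra ground) (munit ground i j a) (munit ground j i b)
      = (\<lambda>r s. munit ground i i (a * b) r s - psign (ipar i + ipar j) * munit ground j j (a * b) r s)"
proof -
  have h: "a \<in> hcomp ground 0" "b \<in> hcomp ground 0" by simp_all
  have "(0 + ipar i + ipar j) * (0 + ipar j + ipar i) = ipar i + ipar j"
    by (cases "ipar i"; cases "ipar j") simp_all
  then show ?thesis unfolding ground.munit_supercommutator[OF h]
    by (simp only: mat_ground_diff mat_ground_smult mat_ground_zero ground_simps if_True) (simp add: mult.commute)
qed

text \<open>Off-diagonal units and the elements \<open>[e\<^sub>i\<^sub>j, e\<^sub>j\<^sub>i]\<close> have supertrace zero, and they span the matrices of supertrace zero.\<close>

lemma derived_gl_ground: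
  assumes card: "3 \<le> CARD('n :: finite)"
  shows "derived (gl :: ('f :: field, ('n, 'f) smat) superalgebra) = {M. supertrace M = 0}"
proof -
  let ?g = "gl_tensor ground :: ('f, ('n, 'f) smat) superalgebra"
  interpret g: steinberg ?g "ground :: ('f, 'f) superalgebra" "munit ground" by (rule ground.gl_steinberg[OF card])
  let ?N = "g.gen_span (\<lambda>_ _. True)"
  note sm = g.gen_sub[of "\<lambda>_ _. True"]
  have "submodule {M. supertrace M = 0} scalars ?g"
    by (rule g.lie.submoduleI') (auto simp: ground.gl_simps supertrace_add supertrace_smult, simp add: supertrace_def)
  moreover have "g.phi_gens (\<lambda>_ _. True) \<union> g.diag_gens (\<lambda>_ _. True) \<subseteq> {M. supertrace M = 0}"
  proof
    fix x assume "x \<in> g.phi_gens (\<lambda>_ _. True) \<union> g.diag_gens (\<lambda>_ _. True)"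
    then consider i j a where "i \<noteq> j" "x = munit ground i j a"
      | i j a b where "i \<noteq> j" "x = munit ground i j a \<otimes>\<^bsub>?g\<^esub> munit ground j i b"
      by (auto simp: g.phi_gens_def g.diag_gens_def)
    then show "x \<in> {M. supertrace M = 0}"
    proof cases
      case 1 then show ?thesis by (simp add: supertrace_munit)
    next
      case 2
      have "supertrace x = psign (ipar i) * (a * b) - psign (ipar i + ipar j) * (psign (ipar j) * (a * b))"
        unfolding 2 ground.gl_simps ground_diag[OF 2(1)]
        by (simp add: supertrace_diff supertrace_smult supertrace_munit)
      then show ?thesis by (simp add: psign_add mult.assoc)
    qed
  qed
  ultimately have 1: "?N \<subseteq> {M. supertrace M = 0}" unfolding g.gen_span_def by (rule g.lie.lspan_least)
  define o' :: "'n + 'n" where "o' = Inl undefined"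
  have o': "ipar o' = 0" by (simp add: o'_def ipar_def)
  let ?H = "{M. (\<lambda>i j. M i j - supertrace M * munit ground o' o' 1 i j) \<in> ?N}"
  have mem: "M \<in> ?H" for M :: "('n, 'f) smat"
  proof (rule ground.mat_in_span)
    show "\<zero>\<^bsub>mat_superalgebra ground\<^esub> \<in> ?H"
      using g.lie.sub_zero[OF sm] by (simp add: ground.gl_simps supertrace_def)
  next
    fix x y assume xy: "x \<in> ?H" "y \<in> ?H"
    have "(\<lambda>i j. (x i j - supertrace x * munit ground o' o' 1 i j) + (y i j - supertrace y * munit ground o' o' 1 i j)) \<in> ?N"
      using g.lie.sub_add[OF sm, of "\<lambda>i j. x i j - supertrace x * munit ground o' o' 1 i j"
          "\<lambda>i j. y i j - supertrace y * munit ground o' o' 1 i j"] xy by (simp add: ground.gl_simps)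
    then show "x \<oplus>\<^bsub>mat_superalgebra ground\<^esub> y \<in> ?H"
      by (simp add: supertrace_add algebra_simps)
  next
    fix i j :: "'n + 'n" and a :: 'f
    show "munit ground i j a \<in> ?H"
    proof (cases "i = j")
      case False
      then show ?thesis using g.phi_in_gen[of i j "\<lambda>_ _. True" a] by (simp add: supertrace_munit)
    next
      case True
      show ?thesis
      proof (cases "i = o'")
        case True
        then have "(\<lambda>r s. munit ground i j a r s - supertrace (munit ground i j a) * munit ground o' o' 1 r s) = \<zero>\<^bsub>?g\<^esub>"
          unfolding supertrace_munit using \<open>i = j\<close> o' by (auto simp: ground.gl_simps munit_ground fun_eq_iff)
        then show ?thesis using g.lie.sub_zero[OF sm] by simp
      next
        case False
        have "munit ground i o' a \<otimes>\<^bsub>?g\<^esub> munit ground o' i 1 \<in> ?N"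
          by (rule g.gen_mult) (use False g.phi_in_gen in auto)
        moreover have "munit ground i o' a \<otimes>\<^bsub>?g\<^esub> munit ground o' i 1
          = (\<lambda>r s. munit ground i j a r s - supertrace (munit ground i j a) * munit ground o' o' 1 r s)"
          unfolding ground.gl_simps ground_diag[OF False] supertrace_munit using \<open>i = j\<close> o'
          by (auto simp: munit_ground fun_eq_iff)
        ultimately show ?thesis by simp
      qed
    qed
  qed simp
  have "M \<in> ?N" if "supertrace M = 0" for M using mem[of M] that by simp
  then have "{M. supertrace M = 0} \<subseteq> ?N" by blast
  then show ?thesis using 1 unital_assoc_superalgebra.derived_gl[OF ground_unital_assoc[where 'f='f] card] unfolding gl_def by auto
qed

text \<open>Over the ground field the derived superalgebra is described by the supertrace, so that all that is known about
  \<open>sl_over\<close> applies to \<open>sl\<close>.\<close>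

lemma sl_eq:
  assumes card: "3 \<le> CARD('n :: finite)"
  shows "(sl :: ('f :: field, ('n, 'f) smat) superalgebra) = sl_over TYPE('n) ground"
  using derived_gl_ground[OF card, where 'f='f] unfolding sl_def sl_over_def gl_def by simp

lemma sl_steinberg:
  assumes card: "3 \<le> CARD('n :: finite)"
  shows "steinberg (sl :: ('f :: field, ('n, 'f) smat) superalgebra) ground (munit ground)"
    "steinberg.generated (sl :: ('f :: field, ('n, 'f) smat) superalgebra) ground (munit ground)"
  unfolding sl_eq[OF card] by (rule ground.sl_over_steinberg[OF card])+

lemma sl_simps [simp]:
  "carrier sl = {M. supertrace M = 0}" "monoid.mult sl = supercommutator (mat_superalgebra ground)"
  "\<zero>\<^bsub>sl\<^esub> = (\<lambda>i j. 0)" "M \<oplus>\<^bsub>sl\<^esub> N = (\<lambda>i j. M i j + N i j)" "c \<odot>\<^bsub>sl\<^esub> N = (\<lambda>i j. c * N i j)"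
  "hcomp sl p = {M. (\<forall>i j. p + ipar i + ipar j = 1 \<longrightarrow> M i j = 0) \<and> supertrace M = 0}"
proof -
  show "hcomp sl p = {M. (\<forall>i j. p + ipar i + ipar j = 1 \<longrightarrow> M i j = 0) \<and> supertrace M = 0}"
    unfolding sl_def gl_def by (auto simp: ground.gl_simps)
qed (simp_all add: sl_def gl_def ground.gl_simps)

definition dg :: "('n + 'n \<Rightarrow> 'f :: field) \<Rightarrow> ('n, 'f) smat" where
  "dg d = (\<lambda>i j. if i = j then d i else 0)"

lemma scalar_matrices_eq: "scalar_matrices = range (\<lambda>c. dg (\<lambda>_. c))"
  by (auto simp: scalar_matrices_def dg_def)

lemma dg_mult_left: "dg d \<otimes>\<^bsub>mat_superalgebra ground\<^esub> M = (\<lambda>i j. d i * M i j)"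
proof -
  have "(\<Sum>h\<in>UNIV. dg d i h * M h j) = (\<Sum>h\<in>UNIV. if h = i then d i * M i j else 0)" for i j
    by (rule sum.cong) (auto simp: dg_def)
  then show ?thesis unfolding mat_ground_mult by simp
qed

lemma dg_mult_right: "M \<otimes>\<^bsub>mat_superalgebra ground\<^esub> dg d = (\<lambda>i j. M i j * d j)"
proof -
  have "(\<Sum>h\<in>UNIV. M i h * dg d h j) = (\<Sum>h\<in>UNIV. if h = j then M i j * d j else 0)" for i j
    by (rule sum.cong) (auto simp: dg_def)
  then show ?thesis unfolding mat_ground_mult by simp
qed

lemma dg_hom: "dg d \<in> hcomp (mat_superalgebra ground) 0"
  by (auto simp: dg_def)

lemma dg_supercommutator:
  fixes M :: "('n :: finite, 'f :: field) smat"
  shows "supercommutator (mat_superalgebra ground) (dg d) M = (\<lambda>i j. (d i - d j) * M i j)"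
proof -
  have "M \<in> carrier (mat_superalgebra ground)" by simp
  then show ?thesis
  proof (induction M rule: matg.homogeneous_induct)
    case (hom p M)
    show ?case unfolding matg.supercommutator_hom[OF dg_hom hom] mat_ground_diff mat_ground_smult dg_mult_left dg_mult_right
      by (simp add: algebra_simps)
  next
    case (add M N)
    have "dg d \<in> carrier (mat_superalgebra ground)" by simp
    note e = matg.supercommutator_add(2)[OF add(1,2) this]
    show ?case unfolding e add(3,4) by (simp add: algebra_simps)
  qed
qed

text \<open>A homogeneous matrix that supercommutes with all \<open>e\<^sub>i\<^sub>j\<close> is diagonal, and its diagonal entries are equal if it is
  even and vanish if it is odd.\<close>

lemma center_sl:
  assumes card: "3 \<le> CARD('n :: finite)"
  shows "lie_center (sl :: ('f :: field, ('n, 'f) smat) superalgebra) = scalar_matrices"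
proof -
  let ?sl = "sl :: ('f, ('n, 'f) smat) superalgebra"
  interpret s: steinberg ?sl ground "munit ground" by (rule sl_steinberg[OF card])
  have "dg (\<lambda>_. c) \<in> lie_center ?sl" for c
    by (simp add: lie_center_def dg_supercommutator) (simp add: supertrace_def dg_def)
  moreover have "x \<in> scalar_matrices" if x: "x \<in> lie_center ?sl" for x
  proof -
    have xc: "x \<in> carrier ?sl" using x by (rule s.lie.center_carrier)
    have hom: "(\<forall>r i. r \<noteq> i \<longrightarrow> y r i = 0) \<and> (\<forall>i j. y i i = y j j)"
      if y: "y \<in> lie_center ?sl" and yq: "y \<in> hcomp ?sl q" for y q
    proof -
      have yh: "y \<in> hcomp (mat_superalgebra ground) q"
        using yq unfolding sl_def gl_def by (simp add: ground.gl_simps)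
      have e: "y r i * (if s = j then 1 else 0) = psign (q * (ipar i + ipar j)) * ((if r = i then 1 else 0) * y j s)"
        if ij: "i \<noteq> j" for i j r s
      proof -
        have "munit ground i j 1 \<in> carrier ?sl" using s.phi_carrier[OF ij, of 1] by simp
        then have "supercommutator (mat_superalgebra ground) y (munit ground i j 1) = (\<lambda>i j. 0)"
          using s.lie.center_left[OF y] by simp
        moreover have "munit ground i j (1 :: 'f) \<in> hcomp (mat_superalgebra ground) (0 + ipar i + ipar j)"
          by (rule ground.munit_hom) simp
        moreover have "(\<Sum>h\<in>UNIV. y r h * munit ground i j 1 h s) = (\<Sum>h\<in>UNIV. if h = i then y r i * (if s = j then 1 else 0) else 0)"
          by (rule sum.cong) (auto simp: munit_ground)
        moreover have "(\<Sum>h\<in>UNIV. munit ground i j 1 r h * y h s) = (\<Sum>h\<in>UNIV. if h = j then (if r = i then 1 else 0) * y j s else 0)"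
          by (rule sum.cong) (auto simp: munit_ground)
        ultimately show ?thesis
          using matg.supercommutator_hom[OF yh, of "munit ground i j 1" "0 + ipar i + ipar j"]
          unfolding mat_ground_diff mat_ground_smult mat_ground_mult by (simp add: fun_eq_iff)
      qed
      have 1: "y r i = 0" if "r \<noteq> i" for r i
      proof -
        obtain j where "j \<noteq> i" using ex_same_block[OF card, of i i 0] by blast
        then show ?thesis using e[of i j r j] that by auto
      qed
      have 2: "y i i = y j j" for i j
      proof (cases q)
        case zero then show ?thesis using e[of i j i j] by (cases "i = j") auto
      next
        case one
        then have "y h h = 0" for h using yq by simp
        then show ?thesis by simp
      qed
      show ?thesis using 1 2 by blast
    qed
    let ?y = "\<lambda>q. hpart ?sl q x"
    have h: "(\<forall>r i. r \<noteq> i \<longrightarrow> ?y q r i = 0) \<and> (\<forall>i j. ?y q i i = ?y q j j)" for q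
      by (rule hom[OF s.lie.center_hpart[OF x] s.lie.hpart_hcomp[OF xc]])
    have "x = (\<lambda>i j. ?y 0 i j + ?y 1 i j)" using s.lie.hpart_split(2)[OF xc, of 0] by simp
    then have xe: "x i j = ?y 0 i j + ?y 1 i j" for i j by (rule fun_cong[OF fun_cong])
    have "x i j = 0" if "i \<noteq> j" for i j using h[of 0] h[of 1] that unfolding xe[of i j] by simp
    moreover have "x i i = x j j" for i j using h[of 0] h[of 1] unfolding xe[of i i] xe[of j j] by metis
    ultimately have "x i j = dg (\<lambda>_. x undefined undefined) i j" for i j
      by (cases "i = j") (simp_all add: dg_def)
    then have "x = dg (\<lambda>_. x undefined undefined)" by blast
    then show ?thesis unfolding scalar_matrices_eq by blast
  qed
  ultimately show ?thesis unfolding scalar_matrices_eq by blast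
qed

lemma psl_eq:
  assumes card: "3 \<le> CARD('n :: finite)"
  shows "(psl :: ('f :: field, ('n, 'f) smat set) superalgebra) = super_quot sl (lie_center sl)"
  by (simp add: psl_def center_sl[OF card])


section \<open>The Cartan subalgebra and the roots\<close>

text \<open>\<open>cls\<close> is the projection to \<open>psl\<close>, \<open>torus\<close> the diagonals of the normalised representatives of
  the elements of the Cartan subalgebra, and \<open>rt i j\<close> the root \<open>\<epsilon>\<^sub>i - \<epsilon>\<^sub>j\<close>.\<close>

definition cls :: "('n :: finite, 'f :: field) smat \<Rightarrow> ('n, 'f) smat set" where
  "cls X = scalar_matrices +>\<^bsub>sl\<^esub> X"

definition torus :: "('n :: finite + 'n \<Rightarrow> 'f :: field) set" where
  "torus = {d. (\<Sum>k\<in>UNIV. d (Inl k)) = 0 \<and> (\<Sum>k\<in>UNIV. d (Inr k)) = 0}"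

definition rt :: "'n + 'n \<Rightarrow> 'n + 'n \<Rightarrow> ('n :: finite, 'f :: field) smat set \<Rightarrow> 'f" where
  "rt i j = (\<lambda>C\<in>cartan. eps i C - eps j C)"

lemma cls_eq: "cls X = {(\<lambda>i j. dg (\<lambda>_. c) i j + X i j) | c. True}"
  by (auto simp: cls_def a_r_coset_eq scalar_matrices_eq)

lemma cls_shift: "cls (\<lambda>i j. dg (\<lambda>_. c) i j + X i j) = cls X"
proof -
  have 1: "cls (\<lambda>i j. dg (\<lambda>_. c) i j + X i j) \<subseteq> cls X" for c X
  proof
    fix M assume "M \<in> cls (\<lambda>i j. dg (\<lambda>_. c) i j + X i j)"
    then obtain e where "M = (\<lambda>i j. dg (\<lambda>_. e) i j + (dg (\<lambda>_. c) i j + X i j))" unfolding cls_eq by blast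
    then have "M = (\<lambda>i j. dg (\<lambda>_. e + c) i j + X i j)" by (auto simp: dg_def fun_eq_iff)
    then show "M \<in> cls X" unfolding cls_eq by blast
  qed
  have "(\<lambda>i j. dg (\<lambda>_. - c) i j + (dg (\<lambda>_. c) i j + X i j)) = X" by (auto simp: dg_def fun_eq_iff)
  then show ?thesis using 1[of c X] 1[of "- c" "\<lambda>i j. dg (\<lambda>_. c) i j + X i j"] by auto
qed

lemma supertrace_dg: "supertrace (dg d) = (\<Sum>k\<in>UNIV. d (Inl k)) - (\<Sum>k\<in>UNIV. d (Inr k))"
  by (simp add: supertrace_def dg_def)

lemma torus_sl: "d \<in> torus \<Longrightarrow> dg d \<in> carrier sl"
  by (simp add: torus_def supertrace_dg)

lemma diagonal_iff: "diagonal M \<longleftrightarrow> (\<exists>d. M = dg d)"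
proof
  assume "diagonal M"
  then have "M = dg (\<lambda>i. M i i)" by (auto simp: diagonal_def dg_def fun_eq_iff)
  then show "\<exists>d. M = dg d" by blast
qed (auto simp: diagonal_def dg_def)

lemma carrier_psl: "carrier psl = cls ` {M. supertrace M = 0}"
  by (simp add: psl_def a_rcosets_eq cls_def[abs_def])

lemma hcomp_psl: "hcomp psl p = cls ` hcomp sl p"
  by (simp add: psl_def cls_def[abs_def] del: sl_simps)

lemma zero_psl: "\<zero>\<^bsub>psl\<^esub> = scalar_matrices"
  by (simp add: psl_def)

text \<open>Subtracting a scalar makes both block traces of a matrix of supertrace zero vanish.\<close>

lemma normalise_traces:
  fixes M :: "('n :: finite, 'f :: field_char_0) smat"
  assumes "supertrace M = 0"
  obtains N where "cls N = cls M" "(\<lambda>i. N i i) \<in> torus" "\<And>i j. i \<noteq> j \<Longrightarrow> N i j = M i j"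
proof -
  let ?s = "(\<Sum>k\<in>UNIV. M (Inl k) (Inl k)) / of_nat CARD('n)"
  let ?N = "\<lambda>i j. dg (\<lambda>_. - ?s) i j + M i j"
  have z: "of_nat CARD('n) \<noteq> (0 :: 'f)" by simp
  show thesis
  proof (rule that)
    show "cls ?N = cls M" by (rule cls_shift)
    have "(\<Sum>k\<in>UNIV. M (Inr k) (Inr k)) = (\<Sum>k\<in>UNIV. M (Inl k) (Inl k))"
      using assms by (simp add: supertrace_def)
    then show "(\<lambda>i. ?N i i) \<in> torus"
      using z by (simp add: torus_def dg_def sum.distrib sum_negf sum_subtractf)
    show "?N i j = M i j" if "i \<noteq> j" for i j using that by (simp add: dg_def)
  qed
qed

text \<open>Two normalised diagonal matrices in a class differ by a scalar of trace zero in each block, hence, in characteristic zero, not at all.\<close>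

lemma cls_torus_inj:
  fixes d e :: "'n :: finite + 'n \<Rightarrow> 'f :: field_char_0"
  assumes "d \<in> torus" "e \<in> torus" "dg e \<in> cls (dg d)" shows "e = d"
proof -
  obtain c where c: "dg e = (\<lambda>i j. dg (\<lambda>_. c) i j + dg d i j)" using assms(3) unfolding cls_eq by blast
  have ed: "e i = c + d i" for i using fun_cong[OF fun_cong[OF c, of i], of i] by (simp add: dg_def)
  have "(\<Sum>k\<in>UNIV. e (Inl k)) = of_nat CARD('n) * c + (\<Sum>k\<in>UNIV. d (Inl k))"
    by (simp add: ed sum.distrib)
  then have "c = 0" using assms(1,2) by (simp add: torus_def)
  then show ?thesis using ed by auto
qed

lemma eps_cls:
  fixes d :: "'n :: finite + 'n \<Rightarrow> 'f :: field_char_0"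
  assumes d: "d \<in> torus" shows "eps i (cls (dg d)) = d i"
proof -
  have "(THE M. M \<in> cls (dg d) \<and> diagonal M \<and> (\<Sum>k\<in>UNIV. M (Inl k) (Inl k)) = 0
       \<and> (\<Sum>k\<in>UNIV. M (Inr k) (Inr k)) = 0) = dg d"
  proof (rule the_equality)
    have "dg d \<in> cls (dg d)" unfolding cls_eq by (auto intro!: exI[of _ 0] simp: dg_def fun_eq_iff)
    then show "dg d \<in> cls (dg d) \<and> diagonal (dg d) \<and> (\<Sum>k\<in>UNIV. dg d (Inl k) (Inl k)) = 0
       \<and> (\<Sum>k\<in>UNIV. dg d (Inr k) (Inr k)) = 0"
      using d by (auto simp: diagonal_iff torus_def dg_def)
    fix M assume M: "M \<in> cls (dg d) \<and> diagonal M \<and> (\<Sum>k\<in>UNIV. M (Inl k) (Inl k)) = 0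
       \<and> (\<Sum>k\<in>UNIV. M (Inr k) (Inr k)) = 0"
    then obtain e where e: "M = dg e" unfolding diagonal_iff by auto
    then have "e \<in> torus" using M by (simp add: torus_def dg_def)
    then show "M = dg d" using cls_torus_inj[OF d, of e] M e by simp
  qed
  then show ?thesis by (simp add: eps_def dg_def)
qed

lemma cartan_eq: "cartan = (\<lambda>d. cls (dg d)) ` (torus :: ('n :: finite + 'n \<Rightarrow> 'f :: field_char_0) set)"
proof (intro equalityI subsetI)
  fix C :: "('n, 'f) smat set" assume "C \<in> cartan"
  then obtain Y M where Y: "supertrace Y = 0" "C = cls Y" and M: "M \<in> cls Y" "diagonal M"
    unfolding cartan_def carrier_psl by auto
  obtain c where c: "M = (\<lambda>i j. dg (\<lambda>_. c) i j + Y i j)" using M(1) unfolding cls_eq by blast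
  have "C = cls M" unfolding c cls_shift Y(2) ..
  have "supertrace M = 0" unfolding c supertrace_add Y(1) supertrace_dg by simp
  from normalise_traces[OF this] obtain N where N: "cls N = cls M" "(\<lambda>i. N i i) \<in> torus"
    "\<And>i j. i \<noteq> j \<Longrightarrow> N i j = M i j" by metis
  have "N = dg (\<lambda>i. N i i)" using N(3) M(2) by (auto simp: dg_def diagonal_def fun_eq_iff)
  then show "C \<in> (\<lambda>d. cls (dg d)) ` torus" using N(1,2) \<open>C = cls M\<close> by (intro image_eqI[of _ _ "\<lambda>i. N i i"]) auto
next
  fix C :: "('n, 'f) smat set" assume "C \<in> (\<lambda>d. cls (dg d)) ` torus"
  then obtain d where d: "d \<in> torus" "C = cls (dg d)" by blast
  have "dg d \<in> cls (dg d)" unfolding cls_eq by (auto intro!: exI[of _ 0] simp: dg_def fun_eq_iff)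
  then show "C \<in> cartan" unfolding cartan_def carrier_psl using d torus_sl[OF d(1)] by (auto simp: diagonal_iff)
qed

lemma rt_cls: "d \<in> torus \<Longrightarrow> rt i j (cls (dg d)) = (d i - d j :: 'f :: field_char_0)"
  by (simp add: rt_def cartan_eq eps_cls)

lemma zero_weight_cls: "d \<in> torus \<Longrightarrow> zero_weight (cls (dg d)) = (0 :: 'f :: field_char_0)"
  by (simp add: zero_weight_def cartan_eq)

lemma roots_eq: "roots = {rt i j | i j. i \<noteq> j}"
  by (simp add: roots_def rt_def)

lemma neg_weight_rt: "neg_weight (rt i j) = rt j i"
  by (auto simp: neg_weight_def rt_def)

lemma finite_roots [simp]: "finite (roots :: (('n :: finite, 'f :: field) smat set \<Rightarrow> 'f) set)"
proof -
  have "roots \<subseteq> (\<lambda>(i, j). rt i j) ` (UNIV :: (('n + 'n) \<times> ('n + 'n)) set)" by (auto simp: roots_eq)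
  then show ?thesis by (rule finite_subset) simp
qed

subsection \<open>Linear relations between roots\<close>

text \<open>Coefficients of the \<open>\<epsilon>\<^sub>p\<close> are kept as integers, so that relations between roots are decided by integer arithmetic.\<close>

definition ind :: "'n + 'n \<Rightarrow> 'n + 'n \<Rightarrow> int" where
  "ind i p = (if p = i then 1 else 0)"

lemma torus_diff:
  assumes "ipar p = ipar q"
  shows "(\<lambda>i. of_int (ind p i - ind q i)) \<in> (torus :: ('n :: finite + 'n \<Rightarrow> 'f :: field_char_0) set)"
proof (cases p; cases q)
  fix a b assume "p = Inl a" "q = Inl b"
  then show ?thesis by (simp add: torus_def ind_def sum_subtractf of_int_sum[symmetric])
next
  fix a b assume "p = Inr a" "q = Inr b"
  then show ?thesis by (simp add: torus_def ind_def sum_subtractf of_int_sum[symmetric])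
qed (use assms in \<open>auto simp: ipar_def\<close>)

lemma ipar_simps [simp]: "ipar (Inl x) = 0" "ipar (Inr x) = 1"
  by (simp_all add: ipar_def)

lemma sum_ind:
  "(\<Sum>x\<in>UNIV. ind i (Inl x :: 'n :: finite + 'n)) = (if ipar i = 0 then 1 else 0)"
  "(\<Sum>x\<in>UNIV. ind i (Inr x :: 'n :: finite + 'n)) = (if ipar i = 1 then 1 else 0)"
  by (cases i; simp add: ind_def)+

text \<open>A combination of the \<open>\<epsilon>\<^sub>i\<close> that vanishes is constant on each block, and the constant times
  the size of the block is the sum of the coefficients.\<close>

lemma blockwise_constant:
  fixes c :: "'n :: finite + 'n \<Rightarrow> int"
  assumes "\<And>p q. ipar p = ipar q \<Longrightarrow> c p = c q"
  shows "(\<Sum>x\<in>UNIV. c (Inl x)) = int CARD('n) * c (Inl y)" "(\<Sum>x\<in>UNIV. c (Inr x)) = int CARD('n) * c (Inr y)"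
proof -
  have "(\<Sum>x\<in>UNIV. c (Inl x)) = (\<Sum>x\<in>(UNIV :: 'n set). c (Inl y))" by (rule sum.cong) (auto intro: assms)
  then show "(\<Sum>x\<in>UNIV. c (Inl x)) = int CARD('n) * c (Inl y)" by simp
  have "(\<Sum>x\<in>UNIV. c (Inr x)) = (\<Sum>x\<in>(UNIV :: 'n set). c (Inr y))" by (rule sum.cong) (auto intro: assms)
  then show "(\<Sum>x\<in>UNIV. c (Inr x)) = int CARD('n) * c (Inr y)" by simp
qed

text \<open>A relation between roots has coefficients \<open>c\<close> that are constant on each block, and \<open>CARD('n)\<close> times that constant is a
  sum of at most three signs. So the constants are \<open>0\<close> or \<open>\<plusminus>1\<close>, and \<open>\<plusminus>1\<close> only if a
  block has three elements and three of the terms lie in it with the same sign. This leaves the sums of two odd roots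
  that have four distinct indices. Allowing \<open>r = s\<close> covers sums that vanish.\<close>

lemma root_relation_four:
  fixes i j k l r s :: "'n :: finite + 'n"
  assumes card: "3 \<le> CARD('n)" and ij: "i \<noteq> j" and kl: "k \<noteq> l" and jk: "j \<noteq> k" and il: "i \<noteq> l"
    and rel: "\<And>d. d \<in> torus \<Longrightarrow> d i - d j + d k - d l = d r - (d s :: 'f :: field_char_0)"
  shows "i \<noteq> k \<and> j \<noteq> l \<and> ipar i = ipar k \<and> ipar j = ipar l \<and> ipar i \<noteq> ipar j"
proof -
  define c where "c p = ind i p - ind j p + ind k p - ind l p - ind r p + ind s p" for p
  have sym: "ind x y = ind y x" for x y :: "'n + 'n" by (auto simp: ind_def)
  have c: "c p = c q" if "ipar p = ipar q" for p q
  proof -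
    have "of_int (c p - c q) = (0 :: 'f)"
      using rel[OF torus_diff[OF that]] unfolding c_def sym[of _ p] sym[of _ q] by (simp add: algebra_simps)
    then show ?thesis by (simp only: of_int_eq_0_iff)
  qed
  define m where "m = int CARD('n)"
  have m3: "m \<ge> 3" using card by (simp add: m_def)
  obtain y :: 'n where True by simp
  have s1: "m * c (Inl y) = (if ipar i = 0 then 1 else 0) - (if ipar j = 0 then 1 else 0) + (if ipar k = 0 then 1 else 0)
      - (if ipar l = 0 then 1 else 0) - (if ipar r = 0 then 1 else 0) + (if ipar s = 0 then 1 else 0)"
  proof -
    have "m * c (Inl y) = (\<Sum>x\<in>UNIV. c (Inl x))" using blockwise_constant(1)[of c y] c unfolding m_def by metis
    then show ?thesis by (simp only: c_def sum.distrib sum_subtractf sum_ind m_def)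
  qed
  have s2: "m * c (Inr y) = (if ipar i = 1 then 1 else 0) - (if ipar j = 1 then 1 else 0) + (if ipar k = 1 then 1 else 0)
      - (if ipar l = 1 then 1 else 0) - (if ipar r = 1 then 1 else 0) + (if ipar s = 1 then 1 else 0)"
  proof -
    have "m * c (Inr y) = (\<Sum>x\<in>UNIV. c (Inr x))" using blockwise_constant(2)[of c y] c unfolding m_def by metis
    then show ?thesis by (simp only: c_def sum.distrib sum_subtractf sum_ind m_def)
  qed
  have ci: "c i = 1 + ind k i - ind r i + ind s i" using ij il by (simp add: c_def ind_def)
  have ck: "c k = ind i k + 1 - ind r k + ind s k" using jk kl by (simp add: c_def ind_def)
  have cj: "c j = - 1 - ind l j - ind r j + ind s j" using ij jk by (simp add: c_def ind_def)
  have bound: "\<bar>m * c (Inl y)\<bar> \<le> 3" "\<bar>m * c (Inr y)\<bar> \<le> 3" unfolding s1 s2 by auto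
  have cy: "\<bar>x\<bar> \<le> 1" if "\<bar>m * x\<bar> \<le> 3" for x :: int
  proof (rule ccontr)
    assume "\<not> \<bar>x\<bar> \<le> 1"
    then have "3 * 2 \<le> m * \<bar>x\<bar>" using m3 by (intro mult_mono) auto
    then show False using that m3 by (simp add: abs_mult)
  qed
  have val: "c p = c (Inl y)" if "ipar p = 0" for p using c[of p "Inl y"] that by simp
  have val': "c p = c (Inr y)" if "ipar p = 1" for p using c[of p "Inr y"] that by simp
  have "c i \<noteq> 0"
  proof
    assume i0: "c i = 0"
    have ri: "r = i" "i \<noteq> k" "s \<noteq> i" using ci i0 by (auto simp: ind_def split: if_splits)
    have "ipar k = ipar i \<Longrightarrow> False" using c[of k i] ck i0 ri by (auto simp: ind_def split: if_splits)
    then have kb: "ipar k \<noteq> ipar i" by auto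
    have "c k \<noteq> 0" using ck ri by (auto simp: ind_def split: if_splits)
    have nz: "m * c k \<ge> 3 \<or> m * c k \<le> - 3"
    proof -
      have "c k \<ge> 1 \<or> c k \<le> - 1" using \<open>c k \<noteq> 0\<close> by linarith
      then show ?thesis
      proof
        assume "c k \<ge> 1" then have "3 * 1 \<le> m * c k" using m3 by (intro mult_mono) auto
        then show ?thesis by simp
      next
        assume "c k \<le> - 1" then have "3 * 1 \<le> m * (- c k)" using m3 by (intro mult_mono) auto
        then show ?thesis by simp
      qed
    qed
    show False
    proof (cases "ipar i = 0")
      case True
      then have "ipar k = 1" using kb by simp
      have "m * c (Inr y) \<ge> 3 \<or> m * c (Inr y) \<le> - 3" using nz val'[OF \<open>ipar k = 1\<close>] by simp
      then show False using True \<open>ipar k = 1\<close> unfolding s2 \<open>r = i\<close>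
        by (cases "ipar j"; cases "ipar l"; cases "ipar s"; simp)
    next
      case False
      then have b: "ipar i = 1" "ipar k = 0" using kb by auto
      have "m * c (Inl y) \<ge> 3 \<or> m * c (Inl y) \<le> - 3" using nz val[OF b(2)] by simp
      then show False using b unfolding s1 \<open>r = i\<close>
        by (cases "ipar j"; cases "ipar l"; cases "ipar s"; simp)
    qed
  qed
  have pm: "c i = 1 \<or> c i = - 1" using cy[OF bound(1)] cy[OF bound(2)] val[of i] val'[of i] \<open>c i \<noteq> 0\<close>
    by (cases "ipar i") auto
  show ?thesis
  proof (cases "ipar i = 0")
    case True
    then have y: "c (Inl y) = 1 \<or> c (Inl y) = - 1" using val[of i] pm by auto
    have "ipar k = 0 \<and> ipar j = 1 \<and> ipar l = 1 \<and> ipar r = 1 \<and> ipar s = 0 \<and> c (Inl y) = 1 \<and> m = 3"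
      using y
    proof
      assume y: "c (Inl y) = 1"
      show ?thesis using s1 m3 True unfolding y
        by (cases "ipar k"; cases "ipar j"; cases "ipar l"; cases "ipar r"; cases "ipar s"; simp)
    next
      assume y: "c (Inl y) = - 1"
      show ?thesis using s1 m3 True unfolding y
        by (cases "ipar k"; cases "ipar j"; cases "ipar l"; cases "ipar r"; cases "ipar s"; simp)
    qed
    then have h: "ipar k = 0" "ipar j = 1" "ipar l = 1" "ipar r = 1" "ipar s = 0" "c (Inl y) = 1" "m = 3" by auto
    have "r \<noteq> i" "s \<noteq> j" using h True by auto
    then have "i \<noteq> k" using ci val[OF True] h by (auto simp: ind_def split: if_splits)
    moreover have "c j = - 1"
      using s2 val'[of j] True unfolding h by simp
    then have "j \<noteq> l" using cj \<open>s \<noteq> j\<close> by (auto simp: ind_def split: if_splits)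
    ultimately show ?thesis using h True by simp
  next
    case False
    then have T: "ipar i = 1" by simp
    then have y: "c (Inr y) = 1 \<or> c (Inr y) = - 1" using val'[of i] pm by auto
    have "ipar k = 1 \<and> ipar j = 0 \<and> ipar l = 0 \<and> ipar r = 0 \<and> ipar s = 1 \<and> c (Inr y) = 1 \<and> m = 3"
      using y
    proof
      assume y: "c (Inr y) = 1"
      show ?thesis using s2 m3 T unfolding y
        by (cases "ipar k"; cases "ipar j"; cases "ipar l"; cases "ipar r"; cases "ipar s"; simp)
    next
      assume y: "c (Inr y) = - 1"
      show ?thesis using s2 m3 T unfolding y
        by (cases "ipar k"; cases "ipar j"; cases "ipar l"; cases "ipar r"; cases "ipar s"; simp)
    qed
    then have h: "ipar k = 1" "ipar j = 0" "ipar l = 0" "ipar r = 0" "ipar s = 1" "c (Inr y) = 1" "m = 3" by auto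
    have "r \<noteq> i" "s \<noteq> j" using h T by auto
    then have "i \<noteq> k" using ci val'[OF T] h by (auto simp: ind_def split: if_splits)
    moreover have "c j = - 1"
      using s1 val[of j] T unfolding h by simp
    then have "j \<noteq> l" using cj \<open>s \<noteq> j\<close> by (auto simp: ind_def split: if_splits)
    ultimately show ?thesis using h T by simp
  qed
qed

text \<open>Here the sums over a block are at most \<open>2\<close> in absolute value, too small for a nonzero multiple of the block size.\<close>

lemma root_relation_two:
  fixes i j r s :: "'n :: finite + 'n"
  assumes card: "3 \<le> CARD('n)" and ij: "i \<noteq> j"
    and rel: "\<And>d. d \<in> torus \<Longrightarrow> d i - d j = d r - (d s :: 'f :: field_char_0)"
  shows "r = i \<and> s = j"
proof -
  define c where "c p = ind i p - ind j p - ind r p + ind s p" for p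
  have sym: "ind x y = ind y x" for x y :: "'n + 'n" by (auto simp: ind_def)
  have c: "c p = c q" if "ipar p = ipar q" for p q
  proof -
    have "of_int (c p - c q) = (0 :: 'f)"
      using rel[OF torus_diff[OF that]] unfolding c_def sym[of _ p] sym[of _ q] by (simp add: algebra_simps)
    then show ?thesis by (simp only: of_int_eq_0_iff)
  qed
  define m where "m = int CARD('n)"
  have m3: "m \<ge> 3" using card by (simp add: m_def)
  obtain y :: 'n where True by simp
  have s1: "m * c (Inl y) = (if ipar i = 0 then 1 else 0) - (if ipar j = 0 then 1 else 0)
     - (if ipar r = 0 then 1 else 0) + (if ipar s = 0 then 1 else 0)"
  proof -
    have "m * c (Inl y) = (\<Sum>x\<in>UNIV. c (Inl x))" using blockwise_constant(1)[of c y] c unfolding m_def by metis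
    then show ?thesis by (simp only: c_def sum.distrib sum_subtractf sum_ind m_def)
  qed
  have s2: "m * c (Inr y) = (if ipar i = 1 then 1 else 0) - (if ipar j = 1 then 1 else 0)
     - (if ipar r = 1 then 1 else 0) + (if ipar s = 1 then 1 else 0)"
  proof -
    have "m * c (Inr y) = (\<Sum>x\<in>UNIV. c (Inr x))" using blockwise_constant(2)[of c y] c unfolding m_def by metis
    then show ?thesis by (simp only: c_def sum.distrib sum_subtractf sum_ind m_def)
  qed
  have zero: "x = 0" if "\<bar>m * x\<bar> \<le> 2" for x :: int
  proof (rule ccontr)
    assume "x \<noteq> 0"
    then have "3 * 1 \<le> m * \<bar>x\<bar>" using m3 by (intro mult_mono) auto
    then show False using that m3 by (simp add: abs_mult)
  qed
  have "c (Inl y) = 0" "c (Inr y) = 0" by (rule zero; unfold s1 s2; simp)+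
  then have "c p = 0" for p using c[of p "Inl y"] c[of p "Inr y"] by (cases "ipar p") auto
  from this[of i] this[of j] show ?thesis using ij by (auto simp: c_def ind_def split: if_splits)
qed

lemma rt_inj:
  assumes card: "3 \<le> CARD('n)" and "i \<noteq> j"
    and "rt i j = (rt r s :: ('n :: finite, 'f :: field_char_0) smat set \<Rightarrow> 'f)"
  shows "r = i \<and> s = j"
proof (rule root_relation_two[OF card assms(2)])
  fix d :: "'n + 'n \<Rightarrow> 'f" assume "d \<in> torus"
  then show "d i - d j = d r - d s" using rt_cls[of d] assms(3) by metis
qed

lemma rt_nonzero:
  assumes card: "3 \<le> CARD('n)" and "i \<noteq> j"
  shows "rt i j \<noteq> (zero_weight :: ('n :: finite, 'f :: field_char_0) smat set \<Rightarrow> 'f)"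
proof
  assume e: "rt i j = (zero_weight :: ('n, 'f) smat set \<Rightarrow> 'f)"
  have "i = i \<and> i = j"
  proof (rule root_relation_two[OF card assms(2)])
    fix d :: "'n + 'n \<Rightarrow> 'f" assume "d \<in> torus"
    then show "d i - d j = d i - d i" using rt_cls[of d i j] zero_weight_cls[of d] e by simp
  qed
  then show False using assms(2) by simp
qed


section \<open>Lifting coordinates through a central extension\<close>

text \<open>Since \<open>\<pi>\<close> is only known modulo the centre of \<open>M\<close>, lifting is a relation \<open>R\<close> between \<open>L\<close> and \<open>M\<close>. Brackets of lifts are nevertheless determined by
  the elements that they lift.\<close>

locale central_lift = l: lie_superalgebra L + m: steinberg M A \<psi>
  for L :: "('f :: field, 'v) superalgebra" and M :: "('f, 'w) superalgebra"
    and A :: "('f, 'a) superalgebra" and \<psi> :: "'n :: finite + 'n \<Rightarrow> 'n + 'n \<Rightarrow> 'a \<Rightarrow> 'w" +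
  fixes \<pi> :: "'v \<Rightarrow> 'w set"
  assumes mgen: "m.generated" and perf: "perfect L" and quot: "central_quotient_map L M \<pi>"
begin

abbreviation lbr (infixl \<open>\<diamondop>\<close> 70) where "x \<diamondop> y \<equiv> x \<otimes>\<^bsub>L\<^esub> y"
abbreviation mbr (infixl \<open>\<bullet>\<close> 70) where "x \<bullet> y \<equiv> x \<otimes>\<^bsub>M\<^esub> y"

sublocale mi: super_ideal M "lie_center M" by (rule m.lie.center_ideal)

definition "R x y \<longleftrightarrow> x \<in> carrier L \<and> y \<in> carrier M \<and> \<pi> x = lie_center M +>\<^bsub>M\<^esub> y"

lemma pi_hom: "\<pi> \<in> super_hom L (super_quot M (lie_center M))"
  and pi_surj: "\<pi> ` carrier L = carrier (super_quot M (lie_center M))"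
  and pi_ker: "x \<in> carrier L \<Longrightarrow> \<pi> x = lie_center M \<longleftrightarrow> x \<in> lie_center L"
  using quot by (auto simp: central_quotient_map_def)

lemmas hq = hom_quot[OF l.superalgebra_axioms m.lie.center_ideal pi_hom]

lemma R_add: "R x y \<Longrightarrow> R x' y' \<Longrightarrow> R (x \<oplus>\<^bsub>L\<^esub> x') (y \<oplus>\<^bsub>M\<^esub> y')"
  and R_mult: "R x y \<Longrightarrow> R x' y' \<Longrightarrow> R (x \<diamondop> x') (y \<bullet> y')"
  and R_smult: "R x y \<Longrightarrow> R (c \<odot>\<^bsub>L\<^esub> x) (c \<odot>\<^bsub>M\<^esub> y)"
  by (simp_all add: R_def hq(3,4,5))

lemma R_carrier: "R x y \<Longrightarrow> x \<in> carrier L" "R x y \<Longrightarrow> y \<in> carrier M"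
  by (auto simp: R_def)

lemma R_total: "x \<in> carrier L \<Longrightarrow> \<exists>y. R x y"
  using hq(1) by (auto simp: R_def)

lemma R_onto: "y \<in> carrier M \<Longrightarrow> \<exists>x. R x y"
proof -
  assume y: "y \<in> carrier M"
  then have "lie_center M +>\<^bsub>M\<^esub> y \<in> \<pi> ` carrier L" unfolding pi_surj by (simp add: a_rcosets_eq)
  then show ?thesis using y by (auto simp: R_def)
qed

lemma R_zero: "R x \<zero>\<^bsub>M\<^esub> \<Longrightarrow> x \<in> lie_center L"
  using pi_ker[of x] mi.coset_zero[of "\<zero>\<^bsub>M\<^esub>"] m.lie.sub_zero[OF mi.I] by (auto simp: R_def)

lemma R_zero': "R \<zero>\<^bsub>L\<^esub> y \<Longrightarrow> y \<in> lie_center M"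
  using mi.coset_zero[of y] hq(6) by (auto simp: R_def)

lemma R_diff: assumes "R x y" "R x' y" shows "x \<ominus>\<^bsub>L\<^esub> x' \<in> lie_center L"
proof (rule R_zero)
  have "R (x \<oplus>\<^bsub>L\<^esub> (- 1) \<odot>\<^bsub>L\<^esub> x') (y \<oplus>\<^bsub>M\<^esub> (- 1) \<odot>\<^bsub>M\<^esub> y)" by (rule R_add[OF assms(1) R_smult[OF assms(2)]])
  then show "R (x \<ominus>\<^bsub>L\<^esub> x') \<zero>\<^bsub>M\<^esub>"
    using R_carrier[OF assms(1)] R_carrier[OF assms(2)] by (simp add: a_minus_def m.lie.M.r_neg)
qed

lemma R_hom_onto: assumes y: "y \<in> hcomp M q" shows "\<exists>x\<in>hcomp L q. R x y"
proof -
  have yc: "y \<in> carrier M" using y m.lie.hc_carrier by blast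
  obtain x where x: "R x y" using R_onto[OF yc] by blast
  have xc: "x \<in> carrier L" using R_carrier[OF x] by blast
  let ?u = "hpart L q x" and ?v = "hpart L (q + 1) x"
  obtain u where u: "u \<in> hcomp M q" "\<pi> ?u = lie_center M +>\<^bsub>M\<^esub> u" using hq(2)[OF l.hpart_hcomp[OF xc]] by blast
  obtain v where v: "v \<in> hcomp M (q + 1)" "\<pi> ?v = lie_center M +>\<^bsub>M\<^esub> v" using hq(2)[OF l.hpart_hcomp[OF xc]] by blast
  have c: "u \<in> carrier M" "v \<in> carrier M" using u v m.lie.hc_carrier by blast+
  have "R ?u u" "R ?v v" using u v c xc by (auto simp: R_def)
  then have "R (?u \<oplus>\<^bsub>L\<^esub> ?v) (u \<oplus>\<^bsub>M\<^esub> v)" by (rule R_add)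
  then have "R x (u \<oplus>\<^bsub>M\<^esub> v)" using l.hpart_split(2)[OF xc, of q] by simp
  then have "lie_center M +>\<^bsub>M\<^esub> y = lie_center M +>\<^bsub>M\<^esub> (u \<oplus>\<^bsub>M\<^esub> v)" using x by (simp add: R_def)
  then have z: "y \<ominus>\<^bsub>M\<^esub> (u \<oplus>\<^bsub>M\<^esub> v) \<in> lie_center M" using mi.coset_eq[of y "u \<oplus>\<^bsub>M\<^esub> v"] yc c by simp
  have "y \<ominus>\<^bsub>M\<^esub> (u \<oplus>\<^bsub>M\<^esub> v) = (y \<ominus>\<^bsub>M\<^esub> u) \<oplus>\<^bsub>M\<^esub> (\<ominus>\<^bsub>M\<^esub> v)"
    using yc c by (simp add: a_minus_def m.lie.M.minus_add m.lie.M.a_assoc)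
  moreover have "hpart M q ((y \<ominus>\<^bsub>M\<^esub> u) \<oplus>\<^bsub>M\<^esub> (\<ominus>\<^bsub>M\<^esub> v)) = y \<ominus>\<^bsub>M\<^esub> u"
    by (rule m.lie.hpart_eq[OF m.lie.hc_diff[OF y u(1)] m.lie.hc_minus[OF v(1)]])
  ultimately have "y \<ominus>\<^bsub>M\<^esub> u \<in> lie_center M" using m.lie.center_hpart[OF z, of q] by simp
  then have "lie_center M +>\<^bsub>M\<^esub> y = lie_center M +>\<^bsub>M\<^esub> u" using mi.coset_eq yc c by simp
  then have "R ?u y" using u yc xc by (simp add: R_def)
  then show ?thesis using xc by auto
qed

text \<open>Since the kernel is central, the bracket of \<open>L\<close> descends to a bilinear map on \<open>M\<close>.\<close>

definition "\<beta> y y' = (SOME x. R x y) \<diamondop> (SOME x. R x y')"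

lemma beta_eq: assumes "R x y" "R x' y'" shows "x \<diamondop> x' = \<beta> y y'"
proof -
  let ?x = "SOME x. R x y" and ?x' = "SOME x. R x y'"
  have s: "R ?x y" "R ?x' y'" using assms by (auto intro: someI)
  note c = R_carrier(1)[OF assms(1)] R_carrier(1)[OF assms(2)] R_carrier(1)[OF s(1)] R_carrier(1)[OF s(2)]
  have "(x \<ominus>\<^bsub>L\<^esub> ?x) \<diamondop> x' = \<zero>\<^bsub>L\<^esub>" "?x \<diamondop> (x' \<ominus>\<^bsub>L\<^esub> ?x') = \<zero>\<^bsub>L\<^esub>"
    using l.center_left[OF R_diff[OF assms(1) s(1)]] l.center_right[OF R_diff[OF assms(2) s(2)]] c by auto
  then have "x \<diamondop> x' = ?x \<diamondop> x'" "?x \<diamondop> x' = ?x \<diamondop> ?x'"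
    using c l.diff_eq_0 by (simp_all add: l.mult_diff)
  then show ?thesis by (simp add: \<beta>_def)
qed

lemma beta_R: "y \<in> carrier M \<Longrightarrow> y' \<in> carrier M \<Longrightarrow> R (\<beta> y y') (y \<bullet> y')"
  using R_onto R_mult beta_eq by metis

lemma beta_carrier [simp]: "y \<in> carrier M \<Longrightarrow> y' \<in> carrier M \<Longrightarrow> \<beta> y y' \<in> carrier L"
  using beta_R R_carrier by blast

lemma beta_add:
  assumes c: "y \<in> carrier M" "y' \<in> carrier M" "z \<in> carrier M"
  shows "\<beta> (y \<oplus>\<^bsub>M\<^esub> y') z = \<beta> y z \<oplus>\<^bsub>L\<^esub> \<beta> y' z" "\<beta> z (y \<oplus>\<^bsub>M\<^esub> y') = \<beta> z y \<oplus>\<^bsub>L\<^esub> \<beta> z y'"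
proof -
  obtain x x' w where x: "R x y" "R x' y'" "R w z" using R_onto c by metis
  note xc = R_carrier(1)[OF x(1)] R_carrier(1)[OF x(2)] R_carrier(1)[OF x(3)]
  show "\<beta> (y \<oplus>\<^bsub>M\<^esub> y') z = \<beta> y z \<oplus>\<^bsub>L\<^esub> \<beta> y' z"
    using beta_eq[OF R_add[OF x(1,2)] x(3)] beta_eq[OF x(1,3)] beta_eq[OF x(2,3)] xc by (simp add: l.mult_add_left)
  show "\<beta> z (y \<oplus>\<^bsub>M\<^esub> y') = \<beta> z y \<oplus>\<^bsub>L\<^esub> \<beta> z y'"
    using beta_eq[OF x(3) R_add[OF x(1,2)]] beta_eq[OF x(3,1)] beta_eq[OF x(3,2)] xc by (simp add: l.mult_add_right)
qed

lemma beta_smult: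
  assumes c: "y \<in> carrier M" "z \<in> carrier M"
  shows "\<beta> (k \<odot>\<^bsub>M\<^esub> y) z = k \<odot>\<^bsub>L\<^esub> \<beta> y z"
proof -
  obtain x w where x: "R x y" "R w z" using R_onto c by metis
  show ?thesis
    using beta_eq[OF R_smult[OF x(1)] x(2)] beta_eq[OF x] R_carrier(1)[OF x(1)] R_carrier(1)[OF x(2)]
    by (simp add: l.mult_smult_left)
qed

lemma beta_hom: assumes "y \<in> hcomp M p" "y' \<in> hcomp M q" shows "\<beta> y y' \<in> hcomp L (p + q)"
proof -
  obtain x x' where "x \<in> hcomp L p" "R x y" "x' \<in> hcomp L q" "R x' y'" using R_hom_onto assms by metis
  then show ?thesis using beta_eq l.mult_graded by metis
qed

lemma beta_zero: "y \<in> carrier M \<Longrightarrow> \<beta> y \<zero>\<^bsub>M\<^esub> = \<zero>\<^bsub>L\<^esub>"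
proof -
  assume y: "y \<in> carrier M"
  obtain x w where x: "R x y" "R w \<zero>\<^bsub>M\<^esub>" using R_onto y m.lie.M.zero_closed by metis
  then show ?thesis using beta_eq[OF x] l.center_right[OF R_zero[OF x(2)]] R_carrier by metis
qed

text \<open>The Jacobi identity of lifts: the term with \<open>[x, x'']\<close> vanishes because this bracket lifts zero and so is central.\<close>

lemma beta_assoc:
  assumes h: "y \<in> hcomp M p" "y' \<in> hcomp M q" "y'' \<in> hcomp M r" and 0: "y \<bullet> y'' = \<zero>\<^bsub>M\<^esub>"
  shows "\<beta> y (y' \<bullet> y'') = \<beta> (y \<bullet> y') y''"
proof -
  obtain x x' x'' where x: "x \<in> hcomp L p" "R x y" "x' \<in> hcomp L q" "R x' y'" "x'' \<in> hcomp L r" "R x'' y''"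
    using R_hom_onto h by metis
  note c = R_carrier(1)[OF x(2)] R_carrier(1)[OF x(4)] R_carrier(1)[OF x(6)]
  have "R (x \<diamondop> x'') \<zero>\<^bsub>M\<^esub>" using R_mult[OF x(2,6)] 0 by simp
  then have "x' \<diamondop> (x \<diamondop> x'') = \<zero>\<^bsub>L\<^esub>" using l.center_right R_zero c by blast
  then have "x \<diamondop> (x' \<diamondop> x'') = (x \<diamondop> x') \<diamondop> x''"
    using l.super_jacobi[OF x(1,3,5)] c by simp
  then show ?thesis using beta_eq[OF x(2) R_mult[OF x(4,6)]] beta_eq[OF R_mult[OF x(2,4)] x(6)] by simp
qed

lemma beta_commute:
  assumes h: "y \<in> hcomp M p" "y' \<in> hcomp M q" "y'' \<in> hcomp M r" and 0: "y \<bullet> y'' = \<zero>\<^bsub>M\<^esub>" "y' \<bullet> y'' = \<zero>\<^bsub>M\<^esub>"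
  shows "\<beta> (y \<bullet> y') y'' = \<zero>\<^bsub>L\<^esub>"
  using beta_assoc[OF h 0(1)] 0(2) beta_zero m.lie.hc_carrier[OF h(1)] by simp

lemmas psi_one = m.phi_hom[OF _ m.coef.one_even]

text \<open>The lift of a matrix unit as a bracket does not depend on the intermediate index.\<close>

lemma beta_unit_shift:
  assumes d: "distinct [i, j, k, l]" and a: "a \<in> hcomp A p" and b: "b \<in> hcomp A q"
  shows "\<beta> (\<psi> i k a) (\<psi> k j b) = \<beta> (\<psi> i l a) (\<psi> l j b)"
proof -
  have c: "a \<in> carrier A" "b \<in> carrier A" using a b m.coef.hc_carrier by auto
  have n: "i \<noteq> k" "i \<noteq> l" "l \<noteq> k" "k \<noteq> j" "l \<noteq> j" "i \<noteq> j" using d by auto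
  have "\<beta> (\<psi> i l a) (\<psi> l k \<one>\<^bsub>A\<^esub> \<bullet> \<psi> k j b) = \<beta> (\<psi> i l a \<bullet> \<psi> l k \<one>\<^bsub>A\<^esub>) (\<psi> k j b)"
    by (rule beta_assoc[OF m.phi_hom[OF n(2) a] psi_one[OF n(3)] m.phi_hom[OF n(4) b]]) (use n c in \<open>simp add: m.phi_comm\<close>)
  then show ?thesis using n c by (simp add: m.phi_mult m.coef.one_left m.coef.one_right)
qed

lemma beta_unit_mult:
  assumes d: "distinct [i, j, k, l]" and a: "a \<in> hcomp A p" and b: "b \<in> hcomp A q"
  shows "\<beta> (\<psi> i k a) (\<psi> k j b) = \<beta> (\<psi> i l (a \<otimes>\<^bsub>A\<^esub> b)) (\<psi> l j \<one>\<^bsub>A\<^esub>)"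
proof -
  have c: "a \<in> carrier A" "b \<in> carrier A" using a b m.coef.hc_carrier by auto
  have n: "i \<noteq> k" "i \<noteq> l" "k \<noteq> l" "k \<noteq> j" "l \<noteq> j" "i \<noteq> j" using d by auto
  have "\<beta> (\<psi> i k a) (\<psi> k l b \<bullet> \<psi> l j \<one>\<^bsub>A\<^esub>) = \<beta> (\<psi> i k a \<bullet> \<psi> k l b) (\<psi> l j \<one>\<^bsub>A\<^esub>)"
    by (rule beta_assoc[OF m.phi_hom[OF n(1) a] m.phi_hom[OF n(3) b] psi_one[OF n(5)]]) (use n c in \<open>simp add: m.phi_comm\<close>)
  then show ?thesis using n c by (simp add: m.phi_mult m.coef.one_right)
qed

definition "mid i j = (SOME k. k \<noteq> i \<and> k \<noteq> (j :: 'n + 'n))"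

lemma mid: "mid i j \<noteq> i" "mid i j \<noteq> j"
proof -
  obtain k where "k \<notin> {i, j, i, j, j}" by (rule m.fresh)
  then have "\<exists>k. k \<noteq> i \<and> k \<noteq> j" by auto
  from someI_ex[OF this] show "mid i j \<noteq> i" "mid i j \<noteq> j" by (simp_all add: mid_def)
qed

definition "\<phi> i j a = \<beta> (\<psi> i (mid i j) a) (\<psi> (mid i j) j \<one>\<^bsub>A\<^esub>)"

lemma phi_add: "\<lbrakk>i \<noteq> j; a \<in> carrier A; b \<in> carrier A\<rbrakk> \<Longrightarrow> \<phi> i j (a \<oplus>\<^bsub>A\<^esub> b) = \<phi> i j a \<oplus>\<^bsub>L\<^esub> \<phi> i j b"
  using mid[of i j] mid[of i j, symmetric] by (simp add: \<phi>_def m.phi_add beta_add)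

lemma phi_smult: "\<lbrakk>i \<noteq> j; a \<in> carrier A\<rbrakk> \<Longrightarrow> \<phi> i j (c \<odot>\<^bsub>A\<^esub> a) = c \<odot>\<^bsub>L\<^esub> \<phi> i j a"
  using mid[of i j] mid[of i j, symmetric] by (simp add: \<phi>_def m.phi_smult beta_smult)

lemma phi_R: assumes "i \<noteq> j" "a \<in> carrier A" shows "R (\<phi> i j a) (\<psi> i j a)"
proof -
  have n: "i \<noteq> mid i j" "mid i j \<noteq> j" using mid[of i j] by auto
  have "R (\<phi> i j a) (\<psi> i (mid i j) a \<bullet> \<psi> (mid i j) j \<one>\<^bsub>A\<^esub>)"
    unfolding \<phi>_def by (rule beta_R) (use n assms in auto)
  then show ?thesis using n assms by (simp add: m.phi_mult m.coef.one_right)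
qed

lemma beta_unit:
  assumes d: "distinct [i, j, k]" and a: "a \<in> hcomp A p" and b: "b \<in> hcomp A q"
  shows "\<beta> (\<psi> i j a) (\<psi> j k b) = \<phi> i k (a \<otimes>\<^bsub>A\<^esub> b)"
proof -
  let ?h = "mid i k"
  have h: "?h \<noteq> i" "?h \<noteq> k" using mid[of i k] by auto
  obtain l where l: "l \<notin> {i, j, k, ?h, ?h}" by (rule m.fresh)
  have ab: "a \<otimes>\<^bsub>A\<^esub> b \<in> hcomp A (p + q)" by (rule m.coef.mult_graded[OF a b])
  have "\<beta> (\<psi> i j a) (\<psi> j k b) = \<beta> (\<psi> i l (a \<otimes>\<^bsub>A\<^esub> b)) (\<psi> l k \<one>\<^bsub>A\<^esub>)"
    by (rule beta_unit_mult[OF _ a b]) (use d l in auto)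
  also have "\<dots> = \<phi> i k (a \<otimes>\<^bsub>A\<^esub> b)"
    unfolding \<phi>_def by (rule beta_unit_shift[OF _ ab m.coef.one_even]) (use d l h in auto)
  finally show ?thesis .
qed

lemma lift_steinberg: "steinberg L A \<phi>"
proof unfold_locales
  show "3 \<le> CARD('n)" by (rule m.card3)
next
  fix i j :: "'n + 'n" and a p assume ij: "i \<noteq> j" and a: "a \<in> hcomp A p"
  have n: "i \<noteq> mid i j" "mid i j \<noteq> j" using mid[of i j] by auto
  have "\<phi> i j a \<in> hcomp L ((p + ipar i + ipar (mid i j)) + (0 + ipar (mid i j) + ipar j))"
    unfolding \<phi>_def by (rule beta_hom[OF m.phi_hom[OF n(1) a] psi_one[OF n(2)]])
  moreover have "(p + ipar i + ipar (mid i j)) + (0 + ipar (mid i j) + ipar j) = p + ipar i + ipar j"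
    by (cases "ipar i"; cases "ipar j"; cases "ipar (mid i j)"; cases p) simp_all
  ultimately show "\<phi> i j a \<in> hcomp L (p + ipar i + ipar j)" by (simp only:)
next
  fix i j k :: "'n + 'n" and a b assume n: "i \<noteq> j" "j \<noteq> k" "i \<noteq> k" and a: "a \<in> carrier A" and b: "b \<in> carrier A"
  have pc: "\<phi> i j a \<in> carrier L" if "i \<noteq> j" "a \<in> carrier A" for i j a using R_carrier phi_R that by blast
  show "\<phi> i j a \<diamondop> \<phi> j k b = \<phi> i k (a \<otimes>\<^bsub>A\<^esub> b)" using a
  proof (induction a rule: m.coef.homogeneous_induct)
    case (hom p a)
    then have ac: "a \<in> carrier A" using m.coef.hc_carrier by blast
    show ?case using b
    proof (induction b rule: m.coef.homogeneous_induct)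
      case (hom q b)
      have bc: "b \<in> carrier A" using hom m.coef.hc_carrier by blast
      show ?case using beta_eq[OF phi_R[OF n(1) ac] phi_R[OF n(2) bc]] beta_unit[OF _ \<open>a \<in> hcomp A p\<close> hom, of i j k] n
        by simp
    next
      case (add b b') then show ?case using n ac pc
        by (simp add: phi_add l.mult_add_right m.coef.mult_add_right)
    qed
  next
    case (add a a') then show ?case using n b pc by (simp add: phi_add l.mult_add_left m.coef.mult_add_left)
  qed
next
  fix i j k l :: "'n + 'n" and a b assume n: "i \<noteq> j" "k \<noteq> l" "j \<noteq> k" "i \<noteq> l" and a: "a \<in> carrier A" and b: "b \<in> carrier A"
  have pc: "\<phi> i j a \<in> carrier L" if "i \<noteq> j" "a \<in> carrier A" for i j a using R_carrier phi_R that by blast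
  obtain p where p: "p \<notin> {i, j, k, l, l}" by (rule m.fresh)
  show "\<phi> i j a \<diamondop> \<phi> k l b = \<zero>\<^bsub>L\<^esub>" using a
  proof (induction a rule: m.coef.homogeneous_induct)
    case (hom r a)
    then have ac: "a \<in> carrier A" using m.coef.hc_carrier by blast
    show ?case using b
    proof (induction b rule: m.coef.homogeneous_induct)
      case (hom q b)
      have bc: "b \<in> carrier A" using hom m.coef.hc_carrier by blast
      have ip: "i \<noteq> p" "p \<noteq> j" "p \<noteq> k" "p \<noteq> l" using p by auto
      have "\<beta> (\<psi> i p a \<bullet> \<psi> p j \<one>\<^bsub>A\<^esub>) (\<psi> k l b) = \<zero>\<^bsub>L\<^esub>"
        by (rule beta_commute[OF m.phi_hom[OF ip(1) \<open>a \<in> hcomp A r\<close>] psi_one[OF ip(2)] m.phi_hom[OF n(2) hom]])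
          (use ip n ac bc in \<open>simp_all add: m.phi_comm\<close>)
      then show ?case using beta_eq[OF phi_R[OF n(1) ac] phi_R[OF n(2) bc]] ip n ac bc
        by (simp add: m.phi_mult m.coef.one_right)
    next
      case (add b b') then show ?case using n ac pc by (simp add: phi_add l.mult_add_right)
    qed
  next
    case (add a a') then show ?case using n b pc by (simp add: phi_add l.mult_add_left)
  qed
next
  fix i j :: "'n + 'n" and a assume ij: "i \<noteq> j" and a: "a \<in> carrier A" and 0: "\<phi> i j a = \<zero>\<^bsub>L\<^esub>"
  have z: "\<psi> i j a \<in> lie_center M" using phi_R[OF ij a] R_zero' 0 by simp
  obtain k where k: "k \<notin> {i, j, i, j, j}" by (rule m.fresh)
  then have n: "j \<noteq> k" "i \<noteq> k" by auto
  have "\<psi> i j a \<bullet> \<psi> j k \<one>\<^bsub>A\<^esub> = \<zero>\<^bsub>M\<^esub>" using m.lie.center_left[OF z] n by simp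
  then have "\<psi> i k a = \<zero>\<^bsub>M\<^esub>" using n ij a by (simp add: m.phi_mult m.coef.one_right)
  then show "a = \<zero>\<^bsub>A\<^esub>" using m.phi_inj n a by blast
qed (simp_all add: phi_add phi_smult)

sublocale s: steinberg L A \<phi> by (rule lift_steinberg)

text \<open>Modulo the centre, the lifted elements generate \<open>L\<close>; as \<open>L\<close> is perfect, they generate \<open>L\<close>.\<close>

lemma lift_generated: "s.generated"
proof -
  let ?N = "s.gen_span (\<lambda>_ _. True)"
  have nN: "\<exists>n\<in>?N. R n y" if y: "y \<in> carrier M" for y
  proof -
    have "y \<in> m.gen_span (\<lambda>_ _. True)" using y mgen by (simp add: m.generated_def)
    then show ?thesis unfolding m.gen_span_def using m.gens_carrier(1)
    proof (induction y rule: m.lie.lspan_induct)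
      case (base y)
      then consider i j a q where "i \<noteq> j" "a \<in> hcomp A q" "y = \<psi> i j a"
        | i j a b q r where "i \<noteq> j" "a \<in> hcomp A q" "b \<in> hcomp A r" "y = \<psi> i j a \<bullet> \<psi> j i b"
        by (auto simp: m.phi_gens_def m.diag_gens_def)
      then show ?case
      proof cases
        case 1
        then have a: "a \<in> carrier A" using m.coef.hc_carrier by blast
        then show ?thesis using 1 phi_R s.phi_in_gen[of i j "\<lambda>_ _. True" a] by auto
      next
        case 2
        then have ab: "a \<in> carrier A" "b \<in> carrier A" using m.coef.hc_carrier by blast+
        have "\<phi> i j a \<diamondop> \<phi> j i b \<in> ?N"
          by (rule s.gen_mult) (use 2 ab in \<open>auto intro!: s.phi_in_gen\<close>)
        then show ?thesis using 2 R_mult[OF phi_R[OF 2(1) ab(1)] phi_R[OF 2(1)[symmetric] ab(2)]] by auto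
      qed
    next
      case zero
      have "R \<zero>\<^bsub>L\<^esub> \<zero>\<^bsub>M\<^esub>" using hq(6) mi.coset_zero[of "\<zero>\<^bsub>M\<^esub>"] m.lie.sub_zero[OF mi.I] by (simp add: R_def)
      then show ?case using l.sub_zero[OF s.gen_sub] by blast
    next
      case (add x y) then show ?case using R_add l.sub_add[OF s.gen_sub] by meson
    next
      case (smult c x) then show ?case using R_smult l.sub_smult[OF s.gen_sub] by meson
    qed
  qed
  have br: "x \<diamondop> x' \<in> ?N" if x: "x \<in> carrier L" "x' \<in> carrier L" for x x'
  proof -
    obtain y y' where y: "R x y" "R x' y'" using R_total x by metis
    obtain n n' where n: "n \<in> ?N" "R n y" "n' \<in> ?N" "R n' y'" using nN y R_carrier by metis
    have "x \<diamondop> x' = n \<diamondop> n'" using beta_eq[OF y] beta_eq[OF n(2,4)] by simp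
    also have "\<dots> \<in> ?N" by (rule s.gen_mult) (use n in auto)
    finally show ?thesis .
  qed
  have "derived L \<subseteq> ?N" unfolding derived_def by (rule l.lspan_least[OF s.gen_sub]) (use br in auto)
  then show ?thesis using perf l.sub_carrier[OF s.gen_sub] unfolding s.generated_def perfect_def by auto
qed

end


section \<open>Coordinatised superalgebras are graded by the root system\<close>

lemma (in superalgebra) finsum_smult_const:
  assumes "finite S" "z \<in> carrier A"
  shows "(\<Oplus>k\<in>S. c k \<odot> z) = (\<Sum>k\<in>S. c k) \<odot> z"
  using assms(1)
proof (induction rule: finite_induct)
  case empty then show ?case using assms by simp
next
  case (insert x F)
  have "(\<lambda>k. c k \<odot> z) \<in> F \<rightarrow> carrier A" using assms by auto
  then show ?case using insert assms by (simp add: smult_add_l)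
qed

text \<open>A distinguished index in each block; any choice serves, and \<open>undefined\<close> is one.\<close>

definition base :: "'n + 'n \<Rightarrow> 'n + 'n" where
  "base i = (if ipar i = 0 then Inl undefined else Inr undefined)"

lemma ipar_base [simp]: "ipar (base i) = ipar i"
  by (cases "ipar i") (simp_all add: base_def)

lemma base_eq: "ipar i = ipar j \<Longrightarrow> base i = base j"
  by (simp add: base_def)

abbreviation "same_block i j \<equiv> ipar i = ipar j"

locale steinberg_char0 = steinberg L A \<phi>
  for L :: "('f :: field_char_0, 'v) superalgebra" and A :: "('f, 'a) superalgebra"
    and \<phi> :: "'n :: finite + 'n \<Rightarrow> 'n + 'n \<Rightarrow> 'a \<Rightarrow> 'v" +
  assumes gen: "generated"
begin

abbreviation "e i j \<equiv> \<phi> i j \<one>\<^bsub>A\<^esub>"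
definition "hh i j = e i j \<star> e j i"

lemma e_even: "i \<noteq> j \<Longrightarrow> same_block i j \<Longrightarrow> e i j \<in> hcomp L 0"
  using phi_one[of i j] by simp

lemma hh_hcomp: "i \<noteq> j \<Longrightarrow> hh i j \<in> hcomp L 0"
  using diag_graded[of i j "\<one>\<^bsub>A\<^esub>" 0 "\<one>\<^bsub>A\<^esub>" 0] coef.one_even by (simp add: hh_def)

lemma hh_carrier [simp]: "i \<noteq> j \<Longrightarrow> hh i j \<in> carrier L"
  using hh_hcomp lie.hc_carrier by blast

text \<open>One of the two nested brackets that make up the action of \<open>[e\<^sub>k\<^sub>l, e\<^sub>l\<^sub>k]\<close>. Exchanging \<open>k\<close> and \<open>l\<close> gives the other.\<close>

lemma hh_act_half:
  assumes kl: "k \<noteq> l" "same_block k l" and ij: "i \<noteq> j" and a: "a \<in> carrier A"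
    and n: "\<not> (i = k \<and> j = l)" "\<not> (i = l \<and> j = k)"
  shows "e k l \<star> (e l k \<star> \<phi> i j a) = of_int (ind i k + ind j l) \<odot>\<^bsub>L\<^esub> \<phi> i j a"
proof -
  have flip: "e l k \<star> \<phi> i l a = \<ominus>\<^bsub>L\<^esub> \<phi> i k a" if "i \<noteq> l" "i \<noteq> k"
  proof -
    have "\<phi> i l a \<star> e l k = \<ominus>\<^bsub>L\<^esub> (e l k \<star> \<phi> i l a)"
      by (rule lie.skew_even[OF e_even]) (use kl that a in auto)
    moreover have "\<phi> i l a \<star> e l k = \<phi> i k a" using kl that a by (simp add: phi_mult coef.one_right)
    ultimately show ?thesis using kl that a by simp
  qed
  have flip': "e k l \<star> \<phi> i k a = \<ominus>\<^bsub>L\<^esub> \<phi> i l a" if "i \<noteq> l" "i \<noteq> k"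
  proof -
    have "\<phi> i k a \<star> e k l = \<ominus>\<^bsub>L\<^esub> (e k l \<star> \<phi> i k a)"
      by (rule lie.skew_even[OF e_even]) (use kl that a in auto)
    moreover have "\<phi> i k a \<star> e k l = \<phi> i l a" using kl that a by (simp add: phi_mult coef.one_right)
    ultimately show ?thesis using kl that a by simp
  qed
  consider "i = k" | "i \<noteq> k" "j = l" | "i \<noteq> k" "j \<noteq> l" by auto
  then show ?thesis
  proof cases
    case 1
    then show ?thesis using kl ij n a by (simp add: phi_mult coef.one_left ind_def)
  next
    case 2
    then have "i \<noteq> l" using ij by simp
    then show ?thesis using 2 kl a flip flip' by (simp add: lie.mult_minus ind_def)
  next
    case 3
    then show ?thesis using kl ij a by (simp add: phi_comm ind_def)
  qed
qed

text \<open>For \<open>\<phi>\<^sub>k\<^sub>l(a)\<close> and \<open>\<phi>\<^sub>l\<^sub>k(a)\<close> themselves, on which the nested brackets are not determined by the relations, a third index is used.\<close>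

lemma hh_act:
  assumes kl: "k \<noteq> l" "same_block k l" and ij: "i \<noteq> j" and a: "a \<in> carrier A"
  shows "hh k l \<star> \<phi> i j a = of_int (ind i k - ind j k - ind i l + ind j l) \<odot>\<^bsub>L\<^esub> \<phi> i j a"
proof -
  have main: "hh k l \<star> \<phi> i j a = of_int (ind i k - ind j k - ind i l + ind j l) \<odot>\<^bsub>L\<^esub> \<phi> i j a"
    if ij: "i \<noteq> j" and a: "a \<in> carrier A" and n: "\<not> (i = k \<and> j = l)" "\<not> (i = l \<and> j = k)" for i j a
  proof -
    have c: "e k l \<in> carrier L" "e l k \<in> carrier L" "\<phi> i j a \<in> carrier L" using kl ij a by auto
    have "e k l \<star> (e l k \<star> \<phi> i j a) = hh k l \<star> \<phi> i j a \<oplus>\<^bsub>L\<^esub> e l k \<star> (e k l \<star> \<phi> i j a)"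
      unfolding hh_def by (rule lie.jacobi_even[OF e_even]) (use kl c in auto)
    then have "hh k l \<star> \<phi> i j a = e k l \<star> (e l k \<star> \<phi> i j a) \<ominus>\<^bsub>L\<^esub> e l k \<star> (e k l \<star> \<phi> i j a)"
      using c kl by (simp add: a_minus_def lie.M.a_assoc lie.M.r_neg)
    also have "\<dots> = of_int (ind i k + ind j l) \<odot>\<^bsub>L\<^esub> \<phi> i j a \<ominus>\<^bsub>L\<^esub> of_int (ind i l + ind j k) \<odot>\<^bsub>L\<^esub> \<phi> i j a"
      using hh_act_half[OF kl ij a n] hh_act_half[OF kl(1)[symmetric] kl(2)[symmetric] ij a n(2,1)] by simp
    also have "\<dots> = (of_int (ind i k + ind j l) + - of_int (ind i l + ind j k)) \<odot>\<^bsub>L\<^esub> \<phi> i j a"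
      unfolding a_minus_def lie.smult_neg[OF c(3), symmetric] by (rule lie.smult_add_l[OF c(3), symmetric])
    finally show ?thesis by (simp add: algebra_simps)
  qed
  show ?thesis
  proof (cases "(i = k \<and> j = l) \<or> (i = l \<and> j = k)")
    case False then show ?thesis using main[OF ij a] by blast
  next
    case True
    obtain p where p: "p \<notin> {i, j, k, l, l}" by (rule fresh)
    then have n: "i \<noteq> p" "p \<noteq> j" "p \<noteq> k" "p \<noteq> l" by auto
    have e': "\<phi> i j a = \<phi> i p a \<star> e p j" using n ij a by (simp add: phi_mult coef.one_right)
    have "hh k l \<star> (\<phi> i p a \<star> e p j) = (hh k l \<star> \<phi> i p a) \<star> e p j \<oplus>\<^bsub>L\<^esub> \<phi> i p a \<star> (hh k l \<star> e p j)"
      by (rule lie.jacobi_even[OF hh_hcomp]) (use kl n a in auto)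
    also have "hh k l \<star> \<phi> i p a = of_int (ind i k - ind p k - ind i l + ind p l) \<odot>\<^bsub>L\<^esub> \<phi> i p a"
      by (rule main) (use n a in auto)
    also have "hh k l \<star> e p j = of_int (ind p k - ind j k - ind p l + ind j l) \<odot>\<^bsub>L\<^esub> e p j"
      by (rule main) (use n in auto)
    also have "(of_int (ind i k - ind p k - ind i l + ind p l) \<odot>\<^bsub>L\<^esub> \<phi> i p a) \<star> e p j \<oplus>\<^bsub>L\<^esub>
        \<phi> i p a \<star> (of_int (ind p k - ind j k - ind p l + ind j l) \<odot>\<^bsub>L\<^esub> e p j)
      = (of_int (ind i k - ind p k - ind i l + ind p l) + of_int (ind p k - ind j k - ind p l + ind j l)) \<odot>\<^bsub>L\<^esub> (\<phi> i p a \<star> e p j)"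
      using n a by (simp add: lie.mult_smult_left lie.mult_smult_right lie.smult_add_l del: of_int_diff of_int_add)
    finally show ?thesis unfolding e' by (simp add: algebra_simps)
  qed
qed

lemma hh_skew: "i \<noteq> j \<Longrightarrow> same_block i j \<Longrightarrow> hh j i = \<ominus>\<^bsub>L\<^esub> hh i j"
  using lie.skew_even[OF e_even, of i j "e j i"] by (simp add: hh_def)

lemma hh_add:
  assumes n: "i \<noteq> j" "j \<noteq> k" "i \<noteq> k" and b: "same_block i j" "same_block j k"
  shows "hh i j \<oplus>\<^bsub>L\<^esub> hh j k = hh i k"
proof -
  have c: "e i k \<in> carrier L" "e k j \<in> carrier L" "e j i \<in> carrier L" "e j k \<in> carrier L" using n by auto
  have "e i k \<star> (e k j \<star> e j i) = (e i k \<star> e k j) \<star> e j i \<oplus>\<^bsub>L\<^esub> e k j \<star> (e i k \<star> e j i)"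
    by (rule lie.jacobi_even[OF e_even]) (use n b c in auto)
  moreover have "e j i \<star> e i k = \<ominus>\<^bsub>L\<^esub> (e i k \<star> e j i)"
    by (rule lie.skew_even[OF e_even]) (use n b c in auto)
  then have "e i k \<star> e j i = \<ominus>\<^bsub>L\<^esub> e j k" using n c by (simp add: phi_mult coef.one_left)
  ultimately have "hh i k = hh i j \<oplus>\<^bsub>L\<^esub> \<ominus>\<^bsub>L\<^esub> hh k j"
    using n c phi_mult[of k j i "\<one>\<^bsub>A\<^esub>" "\<one>\<^bsub>A\<^esub>"] phi_mult[of i k j "\<one>\<^bsub>A\<^esub>" "\<one>\<^bsub>A\<^esub>"]
    by (auto simp: hh_def coef.one_left lie.mult_minus)
  then show ?thesis using hh_skew[of j k] n b by simp
qed

text \<open>\<open>h k\<close> stands for the difference of the diagonal units at \<open>k\<close> and at the distinguished index of its block. The entries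
  of an element \<open>d\<close> of the torus sum to zero in each block, so the second units cancel in \<open>Hd d\<close>, which therefore stands for the
  diagonal matrix with entries \<open>d\<close>.\<close>

definition "h k = (if k = base k then \<zero>\<^bsub>L\<^esub> else hh k (base k))"
definition "Hd d = (\<Oplus>\<^bsub>L\<^esub>k\<in>UNIV. d k \<odot>\<^bsub>L\<^esub> h k)"

lemma h_carrier [simp]: "h k \<in> carrier L"
  by (simp add: h_def)

lemma hh_h: assumes "i \<noteq> j" "same_block i j" shows "hh i j = h i \<ominus>\<^bsub>L\<^esub> h j"
proof -
  have b: "base i = base j" by (rule base_eq[OF assms(2)])
  consider "i = base j" | "j = base j" | "i \<noteq> base j" "j \<noteq> base j" by auto
  then show ?thesis
  proof cases
    case 1
    then have "j \<noteq> base j" using assms by auto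
    moreover have "hh i j = \<ominus>\<^bsub>L\<^esub> hh j i" using hh_skew[of j i] assms by simp
    ultimately show ?thesis using 1 b assms by (simp add: h_def a_minus_def)
  next
    case 2
    then have "i \<noteq> base i" using assms b by auto
    then show ?thesis using 2 b assms by (simp add: h_def a_minus_def)
  next
    case 3
    have s: "hh i j \<oplus>\<^bsub>L\<^esub> hh j (base j) = hh i (base j)" by (rule hh_add) (use assms 3 in auto)
    have "hh i j \<in> carrier L" "hh j (base j) \<in> carrier L" using assms 3 by auto
    then have "hh i (base j) \<ominus>\<^bsub>L\<^esub> hh j (base j) = hh i j"
      unfolding s[symmetric]
      by (simp add: a_minus_def lie.M.a_assoc lie.M.r_neg)
    then show ?thesis using 3 b by (simp add: h_def)
  qed
qed

lemma h_act: 
  assumes ij: "i \<noteq> j" and a: "a \<in> carrier A"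
  shows "h k \<star> \<phi> i j a = of_int (ind i k - ind j k - ind i (base k) + ind j (base k)) \<odot>\<^bsub>L\<^esub> \<phi> i j a"
proof (cases "k = base k")
  case True
  then have "ind i k - ind j k - ind i (base k) + ind j (base k) = 0" by simp
  then show ?thesis using True assms by (simp add: h_def)
next
  case False then show ?thesis using hh_act[OF False _ ij a] by (simp add: h_def)
qed

lemma Hd_carrier [simp]: "Hd d \<in> carrier L"
  unfolding Hd_def by (rule lie.M.finsum_closed) auto

text \<open>The correction by the distinguished indices in \<open>h\<close> contributes nothing on the torus.\<close>

lemma torus_sum_base:
  fixes d :: "'n + 'n \<Rightarrow> 'f"
  assumes "d \<in> torus" shows "(\<Sum>k\<in>UNIV. d k * of_int (ind i (base k))) = (0 :: 'f)"
proof -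
  have U: "(UNIV :: ('n + 'n) set) = range Inl \<union> range Inr" by (auto simp: UNIV_sum)
  have "(\<Sum>k\<in>UNIV. d k * of_int (ind i (base k))) = (\<Sum>k\<in>range Inl. d k * of_int (ind i (base k)))
     + (\<Sum>k\<in>range Inr. d k * of_int (ind i (base k)))"
    unfolding U by (rule sum.union_disjoint) auto
  also have "\<dots> = (\<Sum>k\<in>UNIV. d (Inl k) * of_int (ind i (Inl undefined))) + (\<Sum>k\<in>UNIV. d (Inr k) * of_int (ind i (Inr undefined)))"
    by (simp add: sum.reindex base_def)
  also have "\<dots> = 0" using assms by (simp add: torus_def sum_distrib_right[symmetric])
  finally show ?thesis .
qed

lemma Hd_act:
  assumes d: "d \<in> torus" and ij: "i \<noteq> j" and a: "a \<in> carrier A"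
  shows "Hd d \<star> \<phi> i j a = (d i - d j) \<odot>\<^bsub>L\<^esub> \<phi> i j a"
proof -
  let ?w = "\<lambda>k. d k * of_int (ind i k - ind j k - ind i (base k) + ind j (base k))"
  have c: "\<phi> i j a \<in> carrier L" using ij a by simp
  have "Hd d \<star> \<phi> i j a = (\<Oplus>\<^bsub>L\<^esub>k\<in>UNIV. (d k \<odot>\<^bsub>L\<^esub> h k) \<star> \<phi> i j a)"
    unfolding Hd_def by (rule lie.mult_finsum(2)) (use c in auto)
  also have "\<dots> = (\<Oplus>\<^bsub>L\<^esub>k\<in>UNIV. ?w k \<odot>\<^bsub>L\<^esub> \<phi> i j a)"
    by (rule lie.M.finsum_cong') (use c in \<open>auto simp: lie.mult_smult_left h_act[OF ij a] lie.smult_smult\<close>)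
  also have "\<dots> = (\<Sum>k\<in>UNIV. ?w k) \<odot>\<^bsub>L\<^esub> \<phi> i j a" by (rule lie.finsum_smult_const) (use c in auto)
  also have "(\<Sum>k\<in>UNIV. ?w k) = (\<Sum>k\<in>UNIV. d k * of_int (ind i k)) - (\<Sum>k\<in>UNIV. d k * of_int (ind j k))
      - (\<Sum>k\<in>UNIV. d k * of_int (ind i (base k))) + (\<Sum>k\<in>UNIV. d k * of_int (ind j (base k)))"
    by (simp add: algebra_simps sum.distrib sum_subtractf)
  also have "\<dots> = d i - d j"
  proof -
    have "(\<Sum>k\<in>UNIV. d k * of_int (ind i k)) = d i" for i
    proof -
      have "(\<Sum>k\<in>UNIV. d k * of_int (ind i k)) = (\<Sum>k\<in>UNIV. if k = i then d i else 0)"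
        by (rule sum.cong) (auto simp: ind_def)
      then show ?thesis by simp
    qed
    then show ?thesis using torus_sum_base[OF d] by simp
  qed
  finally show ?thesis .
qed

lemma Hd_hcomp: "Hd d \<in> hcomp L 0"
  unfolding Hd_def by (rule lie.sub_finsum[OF lie.hcomp_submodule])
    (auto simp: h_def intro!: lie.hc_smult hh_hcomp)

lemma Hd_diag: assumes d: "d \<in> torus" and x: "x \<in> diag_span E" shows "Hd d \<star> x = \<zero>\<^bsub>L\<^esub>"
  using x[unfolded diag_span_def] gens_carrier(2)
proof (induction x rule: lie.lspan_induct)
  case (base x)
  then obtain i j a b p q where ij: "i \<noteq> j" and ab: "a \<in> hcomp A p" "b \<in> hcomp A q"
    and x: "x = \<phi> i j a \<star> \<phi> j i b" by (auto simp: diag_gens_def)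
  have c: "a \<in> carrier A" "b \<in> carrier A" using ab coef.hc_carrier by blast+
  have pc: "\<phi> i j a \<in> carrier L" "\<phi> j i b \<in> carrier L" using ij c by auto
  have "Hd d \<star> x = (Hd d \<star> \<phi> i j a) \<star> \<phi> j i b \<oplus>\<^bsub>L\<^esub> \<phi> i j a \<star> (Hd d \<star> \<phi> j i b)"
    unfolding x by (rule lie.jacobi_even[OF Hd_hcomp pc])
  also have "\<dots> = (d i - d j) \<odot>\<^bsub>L\<^esub> x \<oplus>\<^bsub>L\<^esub> (d j - d i) \<odot>\<^bsub>L\<^esub> x"
    unfolding Hd_act[OF d ij c(1)] Hd_act[OF d ij[symmetric] c(2)] x using pc
    by (simp add: lie.mult_smult_left lie.mult_smult_right)
  also have "\<dots> = ((d i - d j) + (d j - d i)) \<odot>\<^bsub>L\<^esub> x"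
    unfolding x by (rule lie.smult_add_l[symmetric]) (use pc in auto)
  finally show ?case using pc x by simp
qed (auto simp: lie.mult_add_right lie.mult_smult_right)

lemma phi_sum_cong: "(\<And>i j. i \<noteq> j \<Longrightarrow> E i j \<Longrightarrow> f (i, j) = g (i, j)) \<Longrightarrow> (\<And>ij. g ij \<in> carrier A) \<Longrightarrow> phi_sum E f = phi_sum E g"
  unfolding phi_sum_def using phi_sum_Pi[of g E] by (intro lie.M.finsum_cong') (auto simp: offdiag_def)

lemma Hd_phi_sum:
  assumes d: "d \<in> torus" and f: "\<And>ij. f ij \<in> carrier A"
  shows "Hd d \<star> phi_sum E f = phi_sum E (\<lambda>ij. (d (fst ij) - d (snd ij)) \<odot>\<^bsub>A\<^esub> f ij)"
proof -
  have "Hd d \<star> phi_sum E f = (\<Oplus>\<^bsub>L\<^esub>ij\<in>offdiag E. Hd d \<star> \<phi> (fst ij) (snd ij) (f ij))"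
    unfolding phi_sum_def using phi_sum_Pi[of f E, OF f] by (intro lie.mult_finsum(1)) (auto simp: Pi_iff)
  also have "\<dots> = phi_sum E (\<lambda>ij. (d (fst ij) - d (snd ij)) \<odot>\<^bsub>A\<^esub> f ij)"
    unfolding phi_sum_def
  proof (rule lie.M.finsum_cong')
    show "(\<lambda>ij. \<phi> (fst ij) (snd ij) ((d (fst ij) - d (snd ij)) \<odot>\<^bsub>A\<^esub> f ij)) \<in> offdiag E \<rightarrow> carrier L"
      by (rule phi_sum_Pi) (use f in auto)
    fix ij assume "ij \<in> offdiag E"
    then have "fst ij \<noteq> snd ij" by (rule offdiag_neq)
    then show "Hd d \<star> \<phi> (fst ij) (snd ij) (f ij) = \<phi> (fst ij) (snd ij) ((d (fst ij) - d (snd ij)) \<odot>\<^bsub>A\<^esub> f ij)"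
      using Hd_act[OF d _ f] f by (simp add: phi_smult)
  qed simp
  finally show ?thesis .
qed

subsection \<open>Weight spaces\<close>

abbreviation "T \<equiv> (\<lambda>(_ :: 'n + 'n) (_ :: 'n + 'n). True)"
abbreviation "J \<equiv> insert zero_weight roots :: (('n, 'f) smat set \<Rightarrow> 'f) set"

lemma decomp: 
  assumes "x \<in> carrier L"
  obtains d f where "d \<in> diag_span T" "\<And>ij. f ij \<in> carrier A" "x = d \<oplus>\<^bsub>L\<^esub> phi_sum T f"
  using gen_decomp[of x T] assms gen by (auto simp: generated_def)

lemma decomp_unique:
  assumes d: "d \<in> diag_span T" "d' \<in> diag_span T" and f: "\<And>ij. f ij \<in> carrier A" "\<And>ij. f' ij \<in> carrier A"
    and eq: "d \<oplus>\<^bsub>L\<^esub> phi_sum T f = d' \<oplus>\<^bsub>L\<^esub> phi_sum T f'"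
  shows "d = d'" "i \<noteq> j \<Longrightarrow> f (i, j) = f' (i, j)"
proof -
  have c: "d \<in> carrier L" "d' \<in> carrier L" using d lie.sub_carrier[OF diag_sub] by auto
  let ?g = "\<lambda>ij. f ij \<oplus>\<^bsub>A\<^esub> (- 1) \<odot>\<^bsub>A\<^esub> f' ij"
  have g: "?g ij \<in> carrier A" for ij using f by simp
  have fc: "phi_sum T f \<in> carrier L" "phi_sum T f' \<in> carrier L" using f by auto
  have m: "phi_sum T ?g = phi_sum T f \<oplus>\<^bsub>L\<^esub> (- 1) \<odot>\<^bsub>L\<^esub> phi_sum T f'"
    using phi_sum_add[of f "\<lambda>ij. (- 1) \<odot>\<^bsub>A\<^esub> f' ij" T] phi_sum_smult[of f' T "- 1"] f by simp
  have "(d \<ominus>\<^bsub>L\<^esub> d') \<oplus>\<^bsub>L\<^esub> phi_sum T ?g = (d \<oplus>\<^bsub>L\<^esub> phi_sum T f) \<ominus>\<^bsub>L\<^esub> (d' \<oplus>\<^bsub>L\<^esub> phi_sum T f')"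
    unfolding m using c fc by (simp add: a_minus_def lie.M.minus_add lie.M.a_ac)
  also have "\<dots> = \<zero>\<^bsub>L\<^esub>" unfolding eq using c fc lie.diff_eq_0 by simp
  finally have z: "(d \<ominus>\<^bsub>L\<^esub> d') \<oplus>\<^bsub>L\<^esub> phi_sum T ?g = \<zero>\<^bsub>L\<^esub>" .
  have g0: "?g (i, j) = \<zero>\<^bsub>A\<^esub>" if "i \<noteq> j" for i j
    by (rule gen_decomp_zero[OF lie.sub_diff[OF diag_sub d] g z that]) simp
  show ff: "f (i, j) = f' (i, j)" if "i \<noteq> j" for i j
    using g0[OF that] f[of "(i, j)"] coef.diff_eq_0[of "f (i, j)" "f' (i, j)"] f(2)[of "(i, j)"] by (simp add: a_minus_def)
  have "phi_sum T f = phi_sum T f'" by (rule phi_sum_cong) (use ff f in auto)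
  then show "d = d'" using eq c fc by simp
qed

lemma torus_separates:
  assumes "i \<noteq> (j :: 'n + 'n)"
  obtains d :: "'n + 'n \<Rightarrow> 'f" where "d \<in> torus" "d i \<noteq> d j"
proof -
  have "\<exists>d \<in> torus. d i - d j \<noteq> (d i - d i :: 'f)"
    using root_relation_two[where 'f='f, OF card3 assms, of i i] assms by blast
  then show thesis using that by auto
qed

lemma torus_separates_roots:
  assumes "i \<noteq> (j :: 'n + 'n)" "(r, s) \<noteq> (i, j)"
  obtains d :: "'n + 'n \<Rightarrow> 'f" where "d \<in> torus" "d r - d s \<noteq> d i - d j"
proof -
  have "\<exists>d \<in> torus. d i - d j \<noteq> (d r - d s :: 'f)"
    using root_relation_two[where 'f='f, OF card3 assms(1), of r s] assms by blast
  then show thesis using that by metis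
qed

text \<open>The weight spaces for the action of the elements \<open>Hd d\<close>: a weight vector has only the
  coordinates of that weight.\<close>

definition "wspace \<alpha> = {x \<in> carrier L. \<forall>d\<in>torus. Hd d \<star> x = \<alpha> (cls (dg d)) \<odot>\<^bsub>L\<^esub> x}"

lemma wspace_decomp:
  assumes d: "d \<in> diag_span T" and f: "\<And>ij. f ij \<in> carrier A" and x: "d \<oplus>\<^bsub>L\<^esub> phi_sum T f \<in> wspace \<alpha>"
    and t: "t \<in> torus"
  shows "\<alpha> (cls (dg t)) \<odot>\<^bsub>L\<^esub> d = \<zero>\<^bsub>L\<^esub>"
    and "i \<noteq> j \<Longrightarrow> f (i, j) = \<zero>\<^bsub>A\<^esub> \<or> \<alpha> (cls (dg t)) = t i - t j"
proof -
  let ?a = "\<alpha> (cls (dg t))"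
  have dc: "d \<in> carrier L" using d lie.sub_carrier[OF diag_sub] by auto
  have "Hd t \<star> (d \<oplus>\<^bsub>L\<^esub> phi_sum T f) = \<zero>\<^bsub>L\<^esub> \<oplus>\<^bsub>L\<^esub> phi_sum T (\<lambda>ij. (t (fst ij) - t (snd ij)) \<odot>\<^bsub>A\<^esub> f ij)"
    using dc f Hd_diag[OF t d] Hd_phi_sum[of t f T, OF t f] by (simp add: lie.mult_add_right)
  moreover have "?a \<odot>\<^bsub>L\<^esub> (d \<oplus>\<^bsub>L\<^esub> phi_sum T f) = ?a \<odot>\<^bsub>L\<^esub> d \<oplus>\<^bsub>L\<^esub> phi_sum T (\<lambda>ij. ?a \<odot>\<^bsub>A\<^esub> f ij)"
    using dc f phi_sum_smult[of f T ?a, OF f] by (simp add: lie.smult_add_r)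
  ultimately have eq: "\<zero>\<^bsub>L\<^esub> \<oplus>\<^bsub>L\<^esub> phi_sum T (\<lambda>ij. (t (fst ij) - t (snd ij)) \<odot>\<^bsub>A\<^esub> f ij)
      = ?a \<odot>\<^bsub>L\<^esub> d \<oplus>\<^bsub>L\<^esub> phi_sum T (\<lambda>ij. ?a \<odot>\<^bsub>A\<^esub> f ij)"
    using x t by (simp add: wspace_def)
  note u = decomp_unique[OF lie.sub_zero[OF diag_sub] lie.sub_smult[OF diag_sub d] _ _ eq]
  show "?a \<odot>\<^bsub>L\<^esub> d = \<zero>\<^bsub>L\<^esub>" by (rule u(1)[symmetric]) (use f in auto)
  show "f (i, j) = \<zero>\<^bsub>A\<^esub> \<or> ?a = t i - t j" if ij: "i \<noteq> j"
  proof -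
    have e: "(t (fst (i, j)) - t (snd (i, j))) \<odot>\<^bsub>A\<^esub> f (i, j) = ?a \<odot>\<^bsub>A\<^esub> f (i, j)"
      by (rule u(2)) (use f ij in auto)
    have "(t i - t j - ?a) \<odot>\<^bsub>A\<^esub> f (i, j) = (t i - t j) \<odot>\<^bsub>A\<^esub> f (i, j) \<oplus>\<^bsub>A\<^esub> (- ?a) \<odot>\<^bsub>A\<^esub> f (i, j)"
      using coef.smult_add_l[OF f, of "t i - t j" "- ?a" "(i, j)"] by simp
    also have "\<dots> = \<zero>\<^bsub>A\<^esub>" using e f by (simp add: coef.smult_neg coef.M.r_neg)
    finally show ?thesis using coef.smult_eq_0[OF f] by fastforce
  qed
qed

lemma wspace_root: assumes ij: "i \<noteq> j" shows "wspace (rt i j) = \<Phi> i j"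
proof (intro equalityI subsetI)
  fix x assume "x \<in> \<Phi> i j"
  then show "x \<in> wspace (rt i j)" using ij Hd_act by (auto simp: \<Phi>_def wspace_def rt_cls)
next
  fix x assume x: "x \<in> wspace (rt i j)"
  then have "x \<in> carrier L" by (simp add: wspace_def)
  then obtain d f where d: "d \<in> diag_span T" and f: "\<And>ij. f ij \<in> carrier A" and xe: "x = d \<oplus>\<^bsub>L\<^esub> phi_sum T f"
    using decomp by metis
  have dc: "d \<in> carrier L" using d lie.sub_carrier[OF diag_sub] by auto
  note w = wspace_decomp[OF d f x[unfolded xe]]
  obtain t :: "'n + 'n \<Rightarrow> 'f" where t: "t \<in> torus" "t i \<noteq> t j" by (rule torus_separates[OF ij])
  have "(t i - t j) \<odot>\<^bsub>L\<^esub> d = \<zero>\<^bsub>L\<^esub>" using w(1)[OF t(1)] rt_cls[OF t(1)] by simp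
  then have d0: "d = \<zero>\<^bsub>L\<^esub>" using lie.smult_eq_0[OF dc] t by fastforce
  have "f (r, s) = \<zero>\<^bsub>A\<^esub>" if rs: "r \<noteq> s" "(r, s) \<noteq> (i, j)" for r s
  proof -
    obtain t :: "'n + 'n \<Rightarrow> 'f" where t: "t \<in> torus" "t r - t s \<noteq> t i - t j" by (rule torus_separates_roots[OF ij rs(2)])
    then show ?thesis using w(2)[OF t(1) rs(1)] rt_cls[OF t(1)] by auto
  qed
  then have "phi_sum T f = phi_sum T (\<lambda>rs. if rs = (i, j) then f (i, j) else \<zero>\<^bsub>A\<^esub>)"
    by (intro phi_sum_cong) (use f in auto)
  also have "\<dots> = \<phi> i j (f (i, j))" by (rule phi_sum_single[OF ij]) (use f in auto)
  finally show "x \<in> \<Phi> i j" using xe d0 ij f by (simp add: PhiI)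
qed

lemma wspace_zero: "wspace zero_weight = diag_span T"
proof (intro equalityI subsetI)
  fix x assume x: "x \<in> diag_span T"
  then have "x \<in> carrier L" using lie.sub_carrier[OF diag_sub] by auto
  then show "x \<in> wspace zero_weight" using Hd_diag[OF _ x] by (simp add: wspace_def zero_weight_cls)
next
  fix x assume x: "x \<in> wspace zero_weight"
  then have "x \<in> carrier L" by (simp add: wspace_def)
  then obtain d f where d: "d \<in> diag_span T" and f: "\<And>ij. f ij \<in> carrier A" and xe: "x = d \<oplus>\<^bsub>L\<^esub> phi_sum T f"
    using decomp by metis
  have dc: "d \<in> carrier L" using d lie.sub_carrier[OF diag_sub] by auto
  note w = wspace_decomp[OF d f x[unfolded xe]]
  have "f (r, s) = \<zero>\<^bsub>A\<^esub>" if rs: "r \<noteq> s" for r s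
  proof -
    obtain t :: "'n + 'n \<Rightarrow> 'f" where t: "t \<in> torus" "t r \<noteq> t s" by (rule torus_separates[OF rs])
    then show ?thesis using w(2)[OF t(1) rs] zero_weight_cls[OF t(1)] by auto
  qed
  then have "phi_sum T f = phi_sum T (\<lambda>rs. \<zero>\<^bsub>A\<^esub>)" by (intro phi_sum_cong) auto
  also have "\<dots> = \<zero>\<^bsub>L\<^esub>" unfolding phi_sum_def using phi_zero[OF offdiag_neq] by (intro lie.M.add.finprod_one_eqI) simp
  finally show "x \<in> diag_span T" using xe d dc by simp
qed

text \<open>Choosing a vector in each weight space is the same as choosing a diagonal part and
  coordinates.\<close>

lemma weight_family:
  assumes g: "g \<in> Pi\<^sub>E J wspace"
  obtains f where "\<And>ij. f ij \<in> carrier A" "\<And>i j. i \<noteq> j \<Longrightarrow> g (rt i j) = \<phi> i j (f (i, j))"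
    "g zero_weight \<in> diag_span T" "(\<Oplus>\<^bsub>L\<^esub>\<alpha>\<in>J. g \<alpha>) = g zero_weight \<oplus>\<^bsub>L\<^esub> phi_sum T f"
proof -
  have ex: "\<exists>a. a \<in> carrier A \<and> (i \<noteq> j \<longrightarrow> g (rt i j) = \<phi> i j a)" for i j
  proof (cases "i = j")
    case False
    then have "rt i j \<in> J" by (auto simp: roots_eq)
    then have "g (rt i j) \<in> \<Phi> i j" using g wspace_root[OF False] by (auto simp: PiE_iff)
    then show ?thesis by (auto elim: PhiE)
  qed (use coef.M.zero_closed in auto)
  define f where "f ij = (SOME a. a \<in> carrier A \<and> (fst ij \<noteq> snd ij \<longrightarrow> g (rt (fst ij) (snd ij)) = \<phi> (fst ij) (snd ij) a))" for ij
  have f: "f ij \<in> carrier A" "fst ij \<noteq> snd ij \<Longrightarrow> g (rt (fst ij) (snd ij)) = \<phi> (fst ij) (snd ij) (f ij)" for ij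
    using someI_ex[OF ex[of "fst ij" "snd ij"]] unfolding f_def by auto
  have z: "g zero_weight \<in> diag_span T" using g wspace_zero by (auto simp: PiE_iff)
  have zc: "g zero_weight \<in> carrier L" using z lie.sub_carrier[OF diag_sub] by auto
  have nz: "zero_weight \<notin> (roots :: (('n, 'f) smat set \<Rightarrow> 'f) set)"
  proof
    assume "zero_weight \<in> (roots :: (('n, 'f) smat set \<Rightarrow> 'f) set)"
    then obtain i j where "i \<noteq> j" "(zero_weight :: ('n, 'f) smat set \<Rightarrow> 'f) = rt i j" by (auto simp: roots_eq)
    then show False using rt_nonzero[OF card3, where 'f='f] by metis
  qed
  have im: "(roots :: (('n, 'f) smat set \<Rightarrow> 'f) set) = (\<lambda>ij. rt (fst ij) (snd ij)) ` offdiag T"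
    by (force simp: roots_eq offdiag_def image_def)
  have inj: "inj_on (\<lambda>ij. rt (fst ij) (snd ij) :: ('n, 'f) smat set \<Rightarrow> 'f) (offdiag T)"
  proof (rule inj_onI)
    fix x y assume "x \<in> offdiag T"
      and "(rt (fst x) (snd x) :: ('n, 'f) smat set \<Rightarrow> 'f) = rt (fst y) (snd y)"
    then have "fst y = fst x \<and> snd y = snd x" by (intro rt_inj[OF card3 offdiag_neq])
    then show "x = y" by (simp add: prod_eq_iff)
  qed
  have gc: "g \<in> roots \<rightarrow> carrier L"
  proof
    fix \<alpha> :: "('n, 'f) smat set \<Rightarrow> 'f" assume "\<alpha> \<in> roots"
    then have "g \<alpha> \<in> wspace \<alpha>" using g by (auto simp: PiE_iff)
    then show "g \<alpha> \<in> carrier L" by (simp add: wspace_def)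
  qed
  have "(\<Oplus>\<^bsub>L\<^esub>\<alpha>\<in>J. g \<alpha>) = g zero_weight \<oplus>\<^bsub>L\<^esub> (\<Oplus>\<^bsub>L\<^esub>\<alpha>\<in>roots. g \<alpha>)"
    by (rule lie.M.finsum_insert) (use nz gc zc in auto)
  also have "(\<Oplus>\<^bsub>L\<^esub>\<alpha>\<in>roots. g \<alpha>) = (\<Oplus>\<^bsub>L\<^esub>ij\<in>offdiag T. g (rt (fst ij) (snd ij)))"
    unfolding im by (rule lie.M.finsum_reindex) (use gc inj im in auto)
  also have "\<dots> = phi_sum T f"
    unfolding phi_sum_def using f offdiag_neq phi_sum_Pi[of f T, OF f(1)] by (intro lie.M.finsum_cong') auto
  finally show thesis using that[of f] f z by auto
qed

lemma weights_direct_sum: "direct_sum L J wspace"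
  unfolding direct_sum_def
proof (intro conjI ballI)
  show "finite J" by simp
  show "wspace \<alpha> \<subseteq> carrier L" for \<alpha> by (auto simp: wspace_def)
  fix x assume x: "x \<in> carrier L"
  obtain d f where d: "d \<in> diag_span T" and f: "\<And>ij. f ij \<in> carrier A" and xe: "x = d \<oplus>\<^bsub>L\<^esub> phi_sum T f"
    using x decomp by metis
  define g where "g = (\<lambda>\<alpha>\<in>J. if \<alpha> = zero_weight then d else
      (let ij = (SOME ij. fst ij \<noteq> snd ij \<and> \<alpha> = rt (fst ij) (snd ij)) in \<phi> (fst ij) (snd ij) (f ij)))"
  have grt: "g (rt i j) = \<phi> i j (f (i, j))" if ij: "i \<noteq> j" for i j
  proof -
    let ?P = "\<lambda>rs. fst rs \<noteq> snd rs \<and> (rt i j :: ('n, 'f) smat set \<Rightarrow> 'f) = rt (fst rs) (snd rs)"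
    have "?P (SOME rs. ?P rs)" by (rule someI[of ?P "(i, j)"]) (use ij in simp)
    then have "(SOME rs. ?P rs) = (i, j)" using rt_inj[OF card3 ij, where 'f='f] by (auto simp: prod_eq_iff)
    moreover have "rt i j \<in> J" using ij by (auto simp: roots_eq)
    ultimately show ?thesis using rt_nonzero[OF card3 ij, where 'f='f] by (simp add: g_def Let_def)
  qed
  have g0: "g zero_weight = d" by (simp add: g_def)
  have gP: "g \<in> Pi\<^sub>E J wspace"
  proof
    fix \<alpha> assume "\<alpha> \<in> J"
    then consider "\<alpha> = zero_weight" | i j where "i \<noteq> j" "\<alpha> = rt i j" by (auto simp: roots_eq)
    then show "g \<alpha> \<in> wspace \<alpha>"
      by cases (use g0 d wspace_zero grt wspace_root f PhiI in auto)
  qed (simp add: g_def)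
  show "\<exists>!g. g \<in> Pi\<^sub>E J wspace \<and> x = (\<Oplus>\<^bsub>L\<^esub>\<alpha>\<in>J. g \<alpha>)"
  proof (rule ex1I[of _ g], intro conjI gP)
    obtain f' where f': "\<And>ij. f' ij \<in> carrier A" "\<And>i j. i \<noteq> j \<Longrightarrow> g (rt i j) = \<phi> i j (f' (i, j))"
      "(\<Oplus>\<^bsub>L\<^esub>\<alpha>\<in>J. g \<alpha>) = g zero_weight \<oplus>\<^bsub>L\<^esub> phi_sum T f'" using weight_family[OF gP] by metis
    have "phi_sum T f = phi_sum T f'"
      unfolding phi_sum_def
    proof (rule lie.M.finsum_cong')
      fix ij assume "ij \<in> offdiag T"
      then have "fst ij \<noteq> snd ij" by (rule offdiag_neq)
      then show "\<phi> (fst ij) (snd ij) (f ij) = \<phi> (fst ij) (snd ij) (f' ij)"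
        using grt[of "fst ij" "snd ij"] f'(2)[of "fst ij" "snd ij"] by simp
    qed (use phi_sum_Pi[of f' T, OF f'(1)] in auto)
    then show "x = (\<Oplus>\<^bsub>L\<^esub>\<alpha>\<in>J. g \<alpha>)" using xe f'(3) g0 by simp
  next
    fix k assume k: "k \<in> Pi\<^sub>E J wspace \<and> x = (\<Oplus>\<^bsub>L\<^esub>\<alpha>\<in>J. k \<alpha>)"
    then have kP: "k \<in> Pi\<^sub>E J wspace" by simp
    obtain f' where f': "\<And>ij. f' ij \<in> carrier A" "\<And>i j. i \<noteq> j \<Longrightarrow> k (rt i j) = \<phi> i j (f' (i, j))"
      "k zero_weight \<in> diag_span T" "(\<Oplus>\<^bsub>L\<^esub>\<alpha>\<in>J. k \<alpha>) = k zero_weight \<oplus>\<^bsub>L\<^esub> phi_sum T f'" using weight_family[OF kP] by metis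
    have eq: "k zero_weight \<oplus>\<^bsub>L\<^esub> phi_sum T f' = d \<oplus>\<^bsub>L\<^esub> phi_sum T f" using f'(4) k xe by simp
    note u = decomp_unique[OF f'(3) d _ _ eq]
    have kd: "k zero_weight = d" by (rule u(1)) (use f f' in auto)
    have kf: "f' (i, j) = f (i, j)" if "i \<noteq> j" for i j by (rule u(2)) (use f f' that in auto)
    show "k = g"
    proof (rule PiE_ext[OF kP gP])
      fix \<alpha> assume "\<alpha> \<in> J"
      then consider "\<alpha> = zero_weight" | i j where "i \<noteq> j" "\<alpha> = rt i j" by (auto simp: roots_eq)
      then show "k \<alpha> = g \<alpha>" by cases (use kd g0 kf f'(2) grt in auto)
    qed
  qed
qed

text \<open>Both sides are the diagonal part, which is by definition the span of the brackets of opposite coordinate spaces.\<close>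

lemma zero_weight_generated:
  "wspace zero_weight = lspan L (\<Union>\<alpha>\<in>roots. {x \<star> y | x y. x \<in> wspace \<alpha> \<and> y \<in> wspace (neg_weight \<alpha>)})"
    (is "_ = lspan L ?U")
proof -
  have U: "?U = {\<phi> i j a \<star> \<phi> j i b | i j a b. i \<noteq> j \<and> a \<in> carrier A \<and> b \<in> carrier A}" (is "_ = ?V")
  proof (intro equalityI subsetI)
    fix z assume "z \<in> ?U"
    then obtain i j x y where ij: "i \<noteq> j" "z = x \<star> y" "x \<in> wspace (rt i j)" "y \<in> wspace (neg_weight (rt i j))"
      by (auto simp: roots_eq)
    then have "x \<in> \<Phi> i j" "y \<in> \<Phi> j i" using wspace_root[OF ij(1)] wspace_root[OF ij(1)[symmetric]] by (simp_all add: neg_weight_rt)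
    then show "z \<in> ?V" using ij by (auto simp: \<Phi>_def)
  next
    fix z assume "z \<in> ?V"
    then obtain i j a b where ij: "i \<noteq> j" "a \<in> carrier A" "b \<in> carrier A" "z = \<phi> i j a \<star> \<phi> j i b" by auto
    have "\<phi> i j a \<in> wspace (rt i j)" "\<phi> j i b \<in> wspace (neg_weight (rt i j))"
      using ij wspace_root[OF ij(1)] wspace_root[OF ij(1)[symmetric]] PhiI by (simp_all add: neg_weight_rt)
    moreover have "rt i j \<in> (roots :: (('n, 'f) smat set \<Rightarrow> 'f) set)" using ij by (auto simp: roots_eq)
    ultimately show "z \<in> ?U" using ij by blast
  qed
  have "diag_span T \<subseteq> lspan L ?V"
    unfolding diag_span_def
  proof (rule lie.lspan_mono, rule subsetI)
    fix x assume "x \<in> diag_gens T"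
    then obtain i j a b p q where "i \<noteq> j" "a \<in> hcomp A p" "b \<in> hcomp A q" "x = \<phi> i j a \<star> \<phi> j i b"
      by (auto simp: diag_gens_def)
    then show "x \<in> ?V" using coef.hc_carrier by blast
  qed
  moreover have "lspan L ?V \<subseteq> diag_span T"
    by (rule lie.lspan_least[OF diag_sub]) (auto intro: diag_in)
  ultimately show ?thesis unfolding U wspace_zero by auto
qed

end


subsection \<open>The grading subsuperalgebra\<close>

text \<open>The general even matrix, given by its diagonal and its off-diagonal entries.\<close>

definition block_mat :: "('n + 'n \<Rightarrow> 'f :: field) \<Rightarrow> (('n + 'n) \<times> ('n + 'n) \<Rightarrow> 'f) \<Rightarrow> ('n :: finite, 'f) smat" where
  "block_mat d f = (\<lambda>r s. if r = s then d r else if same_block r s then f (r, s) else 0)"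

context steinberg_char0
begin

definition "\<phi>1 i j c = \<phi> i j (c \<odot>\<^bsub>A\<^esub> \<one>\<^bsub>A\<^esub>)"

lemma phi1_steinberg: "steinberg L ground \<phi>1"
proof unfold_locales
  show "3 \<le> CARD('n)" by (rule card3)
next
  fix i j :: "'n + 'n" and a :: 'f and p assume ij: "i \<noteq> j" and a: "a \<in> hcomp ground p"
  show "\<phi>1 i j a \<in> hcomp L (p + ipar i + ipar j)"
  proof (cases p)
    case zero
    then show ?thesis unfolding \<phi>1_def using phi_hom[OF ij coef.hc_smult[OF coef.one_even]] by simp
  next
    case one
    then have "a = 0" using a by simp
    then show ?thesis unfolding \<phi>1_def using ij by simp
  qed
next
  fix i j k :: "'n + 'n" and a b :: 'f assume "i \<noteq> j" "j \<noteq> k" "i \<noteq> k"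
  then show "\<phi>1 i j a \<otimes>\<^bsub>L\<^esub> \<phi>1 j k b = \<phi>1 i k (a \<otimes>\<^bsub>ground\<^esub> b)"
    by (simp add: \<phi>1_def phi_mult coef.mult_smult_left coef.mult_smult_right coef.one_left coef.smult_smult mult.commute)
next
  fix i j :: "'n + 'n" and a :: 'f assume ij: "i \<noteq> j" and 0: "\<phi>1 i j a = \<zero>\<^bsub>L\<^esub>"
  have "a \<odot>\<^bsub>A\<^esub> \<one>\<^bsub>A\<^esub> = \<zero>\<^bsub>A\<^esub>" using phi_inj[OF ij _ 0[unfolded \<phi>1_def]] by simp
  then show "a = \<zero>\<^bsub>ground\<^esub>" using coef.smult_eq_0[of "\<one>\<^bsub>A\<^esub>" a] coef.one_neq_zero by auto
qed (simp_all add: \<phi>1_def phi_add phi_smult phi_comm lie.mult_smult_left lie.mult_smult_right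
    coef.smult_add_l coef.smult_smult[symmetric])

end

text \<open>Restricting the coefficients to the multiples of the unit gives coordinates over the ground field. They generate
  a subsuperalgebra \<open>G\<close> that shares its coordinates with \<open>sl\<close>, so the correspondence between the two is a
  central cover of \<open>psl\<close>; \<open>ge\<close> lifts the even part.\<close>

locale grading_sub = steinberg_char0 L A \<phi> + g: steinberg L ground "steinberg_char0.\<phi>1 A \<phi>"
  for L :: "('f :: field_char_0, 'v) superalgebra" and A :: "('f, 'a) superalgebra"
    and \<phi> :: "'n :: finite + 'n \<Rightarrow> 'n + 'n \<Rightarrow> 'a \<Rightarrow> 'v"
begin

definition "G = g.gen_span (\<lambda>_ _. True)"
definition "ge = g.gen_span same_block"

lemmas G_facts = g.restrict_generated[folded G_def]

lemma G_sub: "submodule G scalars L"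
  using G_facts(1) by (simp add: subsuperalgebra_def)

lemma pair: "steinberg_pair (super_restrict L G) sl ground \<phi>1 (munit ground)"
  using G_facts(2,3) sl_steinberg[OF card3, where 'f='f]
  by (simp add: steinberg_pair_def steinberg_pair_axioms_def)

sublocale pr: steinberg_pair "super_restrict L G" sl ground \<phi>1 "munit ground"
  by (rule pair)

lemma ge_sub: "submodule ge scalars L" unfolding ge_def by (rule g.gen_sub)

lemma ge_le_G: "ge \<subseteq> G"
  unfolding ge_def G_def g.gen_span_def
  by (rule lie.lspan_mono) (unfold g.phi_gens_def g.diag_gens_def, blast)

lemma ge_mult: "x \<in> ge \<Longrightarrow> y \<in> ge \<Longrightarrow> x \<otimes>\<^bsub>L\<^esub> y \<in> ge"
  unfolding ge_def by (rule g.gen_mult) auto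

lemma ge_even: "ge \<subseteq> hcomp L 0"
  unfolding ge_def g.gen_span_def
proof (rule lie.lspan_least[OF lie.hcomp_submodule], rule subsetI)
  fix x assume "x \<in> g.phi_gens same_block \<union> g.diag_gens same_block"
  then consider i j a where "i \<noteq> j" "same_block i j" "x = \<phi>1 i j a"
    | i j a b where "i \<noteq> j" "same_block i j" "x = \<phi>1 i j a \<otimes>\<^bsub>L\<^esub> \<phi>1 j i b"
    by (auto simp: g.phi_gens_def g.diag_gens_def)
  then show "x \<in> hcomp L 0"
  proof cases
    case 1 then show ?thesis using g.phi_hom[of i j a 0] by simp
  next
    case 2 then show ?thesis using g.diag_graded[of i j a 0 b 0] by simp
  qed
qed

text \<open>The correspondence \<open>pr.N\<close> is what defines the cover map, so the image of an element of
  the subsuperalgebra is computed by finding a matrix that corresponds to it.\<close>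

lemma hh_phi1: "i \<noteq> j \<Longrightarrow> \<phi>1 i j a \<otimes>\<^bsub>L\<^esub> \<phi>1 j i b = (a * b) \<odot>\<^bsub>L\<^esub> hh i j"
  by (simp add: \<phi>1_def hh_def phi_smult lie.mult_smult_left lie.mult_smult_right lie.smult_smult mult.commute)

lemma hh_phi1_one: "i \<noteq> j \<Longrightarrow> hh i j = \<phi>1 i j 1 \<otimes>\<^bsub>L\<^esub> \<phi>1 j i 1"
  using hh_phi1[of i j 1 1] by simp

lemma h_N: "(h k, \<lambda>r s. munit ground k k 1 r s - munit ground (base k) (base k) 1 r s) \<in> pr.N"
proof (cases "k = base k")
  case True
  then have "(\<lambda>r s. munit ground k k 1 r s - munit ground (base k) (base k) 1 r s) = (\<lambda>r s. 0 :: 'f)" by simp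
  then show ?thesis using True pr.N_zero by (simp add: h_def)
next
  case False
  have "(\<phi>1 k (base k) 1 \<otimes>\<^bsub>L\<^esub> \<phi>1 (base k) k 1,
      supercommutator (mat_superalgebra ground) (munit ground k (base k) 1) (munit ground (base k) k 1)) \<in> pr.N"
    using pr.N_diag[OF False, of 1 1] by simp
  then show ?thesis using False hh_phi1_one[OF False] by (simp add: h_def ground_diag[OF False])
qed

lemma Hd_N: assumes d: "d \<in> torus" shows "(Hd d, dg d) \<in> pr.N"
proof -
  let ?m = "\<lambda>k r s. munit ground k k 1 r s - munit ground (base k) (base k) (1 :: 'f) r s"
  have "((\<Oplus>\<^bsub>L\<^esub>k\<in>S. d k \<odot>\<^bsub>L\<^esub> h k), \<lambda>r s. \<Sum>k\<in>S. d k * ?m k r s) \<in> pr.N" if "finite S" for S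
    using that
  proof (induction rule: finite_induct)
    case empty then show ?case using pr.N_zero by simp
  next
    case (insert x F)
    have c: "(\<lambda>k. d k \<odot>\<^bsub>L\<^esub> h k) \<in> F \<rightarrow> carrier L" by auto
    show ?case using pr.N_add[OF pr.N_smult[OF h_N[of x], of "d x"] insert.IH] insert.hyps c by simp
  qed
  from this[of UNIV] have 1: "(Hd d, \<lambda>r s. \<Sum>k\<in>UNIV. d k * ?m k r s) \<in> pr.N" by (simp add: Hd_def)
  have "(\<Sum>k\<in>UNIV. d k * ?m k r s) = dg d r s" for r s
  proof (cases "r = s")
    case False
    then have "(\<Sum>k\<in>UNIV. d k * ?m k r s) = 0" by (intro sum.neutral) (auto simp: munit_ground)
    then show ?thesis using False by (simp add: dg_def)
  next
    case True
    have "d k * ?m k r s = (if k = r then d r else 0) - d k * of_int (ind r (base k))" for k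
      using True by (auto simp: munit_ground ind_def)
    then have "(\<Sum>k\<in>UNIV. d k * ?m k r s) = (\<Sum>k\<in>UNIV. (if k = r then d r else 0) - d k * of_int (ind r (base k)))"
      by (rule sum.cong[OF refl])
    also have "\<dots> = d r" using torus_sum_base[OF d, of r] by (simp add: sum_subtractf)
    finally show ?thesis using True by (simp add: dg_def)
  qed
  then show ?thesis using 1 by simp
qed

lemma phi_sum_N: "(g.phi_sum same_block f, \<lambda>r s. if r \<noteq> s \<and> same_block r s then f (r, s) else 0) \<in> pr.N"
proof -
  have "((\<Oplus>\<^bsub>L\<^esub>ij\<in>S. \<phi>1 (fst ij) (snd ij) (f ij)), \<lambda>r s. if (r, s) \<in> S then f (r, s) else 0) \<in> pr.N"
    if "finite S" "S \<subseteq> g.offdiag same_block" for S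
    using that
  proof (induction rule: finite_induct)
    case empty then show ?case using pr.N_zero by simp
  next
    case (insert x F)
    have xn: "fst x \<noteq> snd x" using insert.prems g.offdiag_neq by blast
    have c: "(\<lambda>ij. \<phi>1 (fst ij) (snd ij) (f ij)) \<in> F \<rightarrow> carrier L"
      using g.phi_sum_Pi[of f same_block] insert.prems by (auto simp: Pi_iff)
    have "(\<phi>1 (fst x) (snd x) (f x) \<oplus>\<^bsub>L\<^esub> (\<Oplus>\<^bsub>L\<^esub>ij\<in>F. \<phi>1 (fst ij) (snd ij) (f ij)),
        \<lambda>r s. munit ground (fst x) (snd x) (f x) r s + (if (r, s) \<in> F then f (r, s) else 0)) \<in> pr.N"
      using pr.N_add[OF pr.N_chi[OF xn, of "f x"] insert.IH] insert.prems by simp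
    moreover have "(\<lambda>r s. munit ground (fst x) (snd x) (f x) r s + (if (r, s) \<in> F then f (r, s) else 0))
        = (\<lambda>r s. if (r, s) \<in> insert x F then f (r, s) else 0)"
      using insert.hyps(2) by (cases x) (auto simp: munit_ground fun_eq_iff)
    ultimately show ?case using insert.hyps c g.phi_carrier[OF xn, of "f x"] by simp
  qed
  from this[of "g.offdiag same_block"] show ?thesis by (simp add: g.phi_sum_def g.offdiag_def)
qed

lemma block_N: assumes d: "d \<in> torus"
  shows "(Hd d \<oplus>\<^bsub>L\<^esub> g.phi_sum same_block f, block_mat d f) \<in> pr.N"
proof -
  have "block_mat d f = (\<lambda>r s. dg d r s + (if r \<noteq> s \<and> same_block r s then f (r, s) else 0))"
    by (auto simp: block_mat_def dg_def fun_eq_iff)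
  then show ?thesis using pr.N_add[OF Hd_N[OF d] phi_sum_N[of f]] by simp
qed

lemma Hd_add: "Hd (\<lambda>k. d k + d' k) = Hd d \<oplus>\<^bsub>L\<^esub> Hd d'"
  unfolding Hd_def by (subst lie.M.finsum_addf[symmetric]) (auto simp: lie.smult_add_l)

lemma Hd_smult: "Hd (\<lambda>k. c * d k) = c \<odot>\<^bsub>L\<^esub> Hd d"
  unfolding Hd_def by (subst lie.finsum_smult_ldistr) (auto simp: lie.smult_smult)

lemma Hd_single: "Hd (\<lambda>k. of_int (ind i k)) = h i"
  unfolding Hd_def by (rule lie.finsum_single[of _ i]) (auto simp: ind_def)

text \<open>The diagonal element \<open>[e\<^sub>i\<^sub>j, e\<^sub>j\<^sub>i]\<close> is \<open>h i - h j\<close>, the value of \<open>Hd\<close> at a difference of coordinate functions, which is in the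
  torus when \<open>i\<close> and \<open>j\<close> have equal parity.\<close>

lemma diag_block: "g.diag_span same_block = Hd ` torus"
proof (intro equalityI subsetI)
  fix x assume "x \<in> g.diag_span same_block"
  then show "x \<in> Hd ` torus"
    unfolding g.diag_span_def using g.gens_carrier(2)
  proof (induction x rule: lie.lspan_induct)
    case (base x)
    then obtain i j a b where ij: "i \<noteq> j" "same_block i j" "x = \<phi>1 i j a \<otimes>\<^bsub>L\<^esub> \<phi>1 j i b"
      by (auto simp: g.diag_gens_def)
    have "x = Hd (\<lambda>k. a * b * (of_int (ind i k) + (- 1) * of_int (ind j k)))"
      unfolding Hd_smult Hd_add Hd_single ij(3) hh_phi1[OF ij(1)] hh_h[OF ij(1,2)] by (simp add: a_minus_def)
    moreover have "(\<lambda>k. a * b * (of_int (ind i k) + (- 1) * of_int (ind j k))) \<in> torus"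
      using torus_diff[OF ij(2), where 'f='f] by (simp add: torus_def sum_distrib_left[symmetric])
    ultimately show ?case by blast
  next
    case zero
    have "Hd (\<lambda>_. 0) = \<zero>\<^bsub>L\<^esub>" using Hd_smult[of 0 "\<lambda>_. 0"] by simp
    moreover have "(\<lambda>_. 0) \<in> (torus :: ('n + 'n \<Rightarrow> 'f) set)" by (simp add: torus_def)
    ultimately show ?case using imageI[of "\<lambda>_. 0" torus Hd] by simp
  next
    case (add x y)
    then obtain d d' where d: "d \<in> torus" "x = Hd d" "d' \<in> torus" "y = Hd d'" by blast
    then have "(\<lambda>k. d k + d' k) \<in> torus" by (simp add: torus_def sum.distrib)
    then show ?case unfolding d(2,4) Hd_add[symmetric] by (rule imageI)
  next
    case (smult c x)
    then obtain d where d: "d \<in> torus" "x = Hd d" by blast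
    then have "(\<lambda>k. c * d k) \<in> torus" by (simp add: torus_def sum_distrib_left[symmetric])
    then show ?case unfolding d(2) Hd_smult[symmetric] by (rule imageI)
  qed
next
  fix x assume "x \<in> Hd ` torus"
  then obtain d where d: "x = Hd d" by blast
  have "h k \<in> g.diag_span same_block" for k
  proof (cases "k = base k")
    case True then show ?thesis using lie.sub_zero[OF g.diag_sub] by (simp add: h_def)
  next
    case False
    then show ?thesis using g.diag_in[OF False, of same_block 1 1] hh_phi1_one[OF False] by (simp add: h_def)
  qed
  then show "x \<in> g.diag_span same_block"
    unfolding d Hd_def by (intro lie.sub_finsum[OF g.diag_sub] lie.sub_smult[OF g.diag_sub]) auto
qed

lemma ge_elem:
  assumes "x \<in> ge" shows "\<exists>d\<in>torus. \<exists>f. x = Hd d \<oplus>\<^bsub>L\<^esub> g.phi_sum same_block f"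
proof -
  obtain x0 f where x: "x0 \<in> g.diag_span same_block" "x = x0 \<oplus>\<^bsub>L\<^esub> g.phi_sum same_block f"
    by (rule g.gen_decomp[OF assms[unfolded ge_def]])
  obtain d where "d \<in> torus" "x0 = Hd d" using x(1) unfolding diag_block by blast
  then show ?thesis using x(2) by blast
qed

lemma elem_ge: assumes "d \<in> torus" shows "Hd d \<oplus>\<^bsub>L\<^esub> g.phi_sum same_block f \<in> ge"
proof -
  have "Hd d \<in> ge" unfolding ge_def using g.diag_le_gen[of same_block] diag_block assms by blast
  moreover have "g.phi_sum same_block f \<in> ge"
    unfolding g.phi_sum_def ge_def
    by (rule lie.sub_finsum[OF g.gen_sub]) (auto simp: g.offdiag_def intro: g.phi_in_gen)
  ultimately show ?thesis using lie.sub_add[OF ge_sub] by simp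
qed

text \<open>The normalisation of the diagonal makes the even part embed into \<open>psl\<close>; this is why the lift of the even part is
  mapped isomorphically.\<close>

lemma block_mat_cls:
  fixes d d' :: "'n + 'n \<Rightarrow> 'f"
  assumes d: "d \<in> torus" "d' \<in> torus" and eq: "cls (block_mat d f) = cls (block_mat d' f')"
  shows "d = d'" "r \<noteq> s \<Longrightarrow> same_block r s \<Longrightarrow> f (r, s) = f' (r, s)"
proof -
  have "block_mat d f \<in> cls (block_mat d f)" unfolding cls_eq by (auto intro!: exI[of _ 0] simp: dg_def fun_eq_iff)
  then have "block_mat d f \<in> cls (block_mat d' f')" unfolding eq .
  then obtain c where c: "block_mat d f = (\<lambda>i j. dg (\<lambda>_. c) i j + block_mat d' f' i j)" unfolding cls_eq by blast
  then have e: "block_mat d f i j = dg (\<lambda>_. c) i j + block_mat d' f' i j" for i j by (rule fun_cong[OF fun_cong])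
  have "d i = c + d' i" for i using e[of i i] by (simp add: block_mat_def dg_def)
  then have "dg d = (\<lambda>i j. dg (\<lambda>_. c) i j + dg d' i j)" by (auto simp: dg_def fun_eq_iff)
  then have "dg d \<in> cls (dg d')" unfolding cls_eq by blast
  then show "d = d'" by (rule cls_torus_inj[OF d(2,1)])
  show "r \<noteq> s \<Longrightarrow> same_block r s \<Longrightarrow> f (r, s) = f' (r, s)" using e[of r s] by (simp add: block_mat_def dg_def)
qed

lemma g_phi_sum_cong: "(\<And>r s. r \<noteq> s \<Longrightarrow> same_block r s \<Longrightarrow> f (r, s) = f' (r, s)) \<Longrightarrow> g.phi_sum same_block f = g.phi_sum same_block f'"
  unfolding g.phi_sum_def using g.phi_sum_Pi[of f' same_block] by (intro lie.M.finsum_cong') (auto simp: g.offdiag_def)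

text \<open>The cover map and the direct sum decomposition come from the uniqueness of coordinates. What remains is to match the lift \<open>ge\<close> with the even part of
  \<open>psl\<close> through \<open>block_mat\<close>, and the weight spaces with \<open>wspace\<close>.\<close>

theorem graded: "A_graded TYPE('n) L"
proof -
  obtain \<pi> where quot: "central_quotient_map (super_restrict L G) sl \<pi>"
    and pi_N: "\<And>x y. (x, y) \<in> pr.N \<Longrightarrow> \<pi> x = cls y"
    using steinberg_central_quotient[OF pair] unfolding cls_def center_sl[OF card3] by blast
  define hc where "hc = {t \<in> ge. \<pi> t \<in> cartan}"
  have psl: "(psl :: ('f, ('n, 'f) smat set) superalgebra) = super_quot sl (lie_center sl)" by (rule psl_eq[OF card3])
  have cover: "central_cover (super_restrict L G) psl \<pi>"
    unfolding central_cover_def central_extension_def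
  proof (intro conjI)
    show "\<pi> \<in> super_hom (super_restrict L G) psl" "\<pi> ` carrier (super_restrict L G) = carrier psl"
      using quot unfolding central_quotient_map_def psl by blast+
    show "a_kernel (super_restrict L G) psl \<pi> \<subseteq> lie_center (super_restrict L G)"
      using quot unfolding central_quotient_map_def a_kernel_def kernel_def psl by auto
    show "perfect (super_restrict L G)" by (rule steinberg.generated_perfect[OF G_facts(2,3)])
  qed
  have pi_block: "\<pi> (Hd d \<oplus>\<^bsub>L\<^esub> g.phi_sum same_block f) = cls (block_mat d f)" if "d \<in> torus" for d f
    by (rule pi_N[OF block_N[OF that]])
  have pi_Hd: "\<pi> (Hd d) = cls (dg d)" if "d \<in> torus" for d by (rule pi_N[OF Hd_N[OF that]])
  have bij: "bij_betw \<pi> ge (hcomp psl 0)"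
    unfolding bij_betw_def
  proof
    show "inj_on \<pi> ge"
    proof (rule inj_onI)
      fix x y assume xy: "x \<in> ge" "y \<in> ge" and e: "\<pi> x = \<pi> y"
      obtain d f where d: "d \<in> torus" "x = Hd d \<oplus>\<^bsub>L\<^esub> g.phi_sum same_block f" using ge_elem[OF xy(1)] by blast
      obtain d' f' where d': "d' \<in> torus" "y = Hd d' \<oplus>\<^bsub>L\<^esub> g.phi_sum same_block f'" using ge_elem[OF xy(2)] by blast
      have eq: "cls (block_mat d f) = cls (block_mat d' f')" using e pi_block d d' by simp
      have "d = d'" by (rule block_mat_cls(1)[OF d(1) d'(1) eq])
      moreover have "g.phi_sum same_block f = g.phi_sum same_block f'"
        by (rule g_phi_sum_cong) (rule block_mat_cls(2)[OF d(1) d'(1) eq])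
      ultimately show "x = y" using d d' by simp
    qed
    show "\<pi> ` ge = hcomp psl 0"
    proof (intro equalityI subsetI)
      fix C assume "C \<in> \<pi> ` ge"
      then obtain d f where d: "d \<in> torus" "C = cls (block_mat d f)" using ge_elem pi_block by blast
      have "supertrace (block_mat d f) = 0" using d(1) by (simp add: supertrace_def block_mat_def torus_def)
      then have "block_mat d f \<in> hcomp sl 0" by (auto simp: block_mat_def)
      then show "C \<in> hcomp psl 0" unfolding hcomp_psl d(2) by (rule imageI)
    next
      fix C :: "('n, 'f) smat set" assume "C \<in> hcomp psl 0"
      then obtain Y where Y: "Y \<in> hcomp sl 0" "C = cls Y" unfolding hcomp_psl by blast
      then have "supertrace Y = 0" by simp
      then obtain N where N: "cls N = cls Y" "(\<lambda>i. N i i) \<in> torus" "\<And>i j. i \<noteq> j \<Longrightarrow> N i j = Y i j"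
        using normalise_traces by metis
      have even: "N i j = 0" if "\<not> same_block i j" for i j
      proof -
        have "ipar i + ipar j = 1" using that by (cases "ipar i"; cases "ipar j") auto
        then show ?thesis using Y(1) N(3)[of i j] that by auto
      qed
      have "block_mat (\<lambda>i. N i i) (\<lambda>ij. N (fst ij) (snd ij)) = N"
        using even by (auto simp: block_mat_def fun_eq_iff)
      then have "C = \<pi> (Hd (\<lambda>i. N i i) \<oplus>\<^bsub>L\<^esub> g.phi_sum same_block (\<lambda>ij. N (fst ij) (snd ij)))"
        using pi_block[OF N(2)] N(1) Y(2) by simp
      then show "C \<in> \<pi> ` ge" using elem_ge[OF N(2)] by blast
    qed
  qed
  have lift: "even_lift (super_restrict L G) psl \<pi> ge"
    unfolding even_lift_def
  proof (intro conjI ballI)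
    show "submodule ge scalars (super_restrict L G)"
      unfolding lie.restrict_facts(5)[OF G_facts(1)] using ge_sub ge_le_G by simp
    show "ge \<subseteq> hcomp (super_restrict L G) 0" using ge_even ge_le_G by simp
    show "bij_betw \<pi> ge (hcomp psl 0)" by (rule bij)
  qed (simp add: ge_mult)
  have hc: "hc = Hd ` torus"
  proof (intro equalityI subsetI)
    fix t assume "t \<in> hc"
    then have t: "t \<in> ge" "\<pi> t \<in> cartan" by (auto simp: hc_def)
    obtain d f where d: "d \<in> torus" "t = Hd d \<oplus>\<^bsub>L\<^esub> g.phi_sum same_block f" using ge_elem[OF t(1)] by blast
    obtain b where b: "b \<in> torus" "cls (block_mat d f) = cls (dg b)" using t(2) pi_block d unfolding cartan_eq by auto
    have "dg b = block_mat b (\<lambda>_. 0)" by (auto simp: dg_def block_mat_def fun_eq_iff)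
    then have eq: "cls (block_mat d f) = cls (block_mat b (\<lambda>_. 0))" using b by simp
    have "g.phi_sum same_block f = g.phi_sum same_block (\<lambda>_. 0)"
      by (rule g_phi_sum_cong) (rule block_mat_cls(2)[OF d(1) b(1) eq])
    also have "\<dots> = \<zero>\<^bsub>L\<^esub>" unfolding g.phi_sum_def
      using g.phi_zero[OF g.offdiag_neq] by (intro lie.M.add.finprod_one_eqI) simp
    finally have "t = Hd d" using d by simp
    then show "t \<in> Hd ` torus" using d by blast
  next
    fix t assume "t \<in> Hd ` torus"
    then obtain d where d: "d \<in> torus" "t = Hd d" by blast
    have "t \<in> ge" unfolding ge_def using g.diag_le_gen[of same_block] diag_block d by blast
    moreover have "\<pi> t \<in> cartan" unfolding d(2) pi_Hd[OF d(1)] cartan_eq using d(1) by blast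
    ultimately show "t \<in> hc" by (simp add: hc_def)
  qed
  have ws: "weight_space L \<pi> hc = wspace"
    unfolding weight_space_def[abs_def] wspace_def[abs_def] hc using pi_Hd by auto
  show ?thesis
    unfolding A_graded_def
  proof (intro exI conjI)
    show "subsuperalgebra G L" by (rule G_facts(1))
    show "central_cover (super_restrict L G) psl \<pi>" by (rule cover)
    show "even_lift (super_restrict L G) psl \<pi> ge" by (rule lift)
    show "hc = {t \<in> ge. \<pi> t \<in> cartan}" by (rule hc_def)
    show "direct_sum L J (weight_space L \<pi> hc)" unfolding ws by (rule weights_direct_sum)
    show "weight_space L \<pi> hc zero_weight = lspan L (\<Union>\<alpha>\<in>roots. {x \<otimes>\<^bsub>L\<^esub> y | x y.
        x \<in> weight_space L \<pi> hc \<alpha> \<and> y \<in> weight_space L \<pi> hc (neg_weight \<alpha>)})"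
      unfolding ws by (rule zero_weight_generated)
  qed
qed

end

lemma (in steinberg_char0) A_graded: "A_graded TYPE('n) L"
proof -
  interpret grading_sub L A \<phi>
    by (intro grading_sub.intro steinberg_char0_axioms phi1_steinberg)
  show ?thesis by (rule graded)
qed

text \<open>A superalgebra isogenous to the matrix superalgebra inherits its coordinates, and coordinates give a grading.\<close>

theorem centrally_isogenous_imp_graded:
  fixes L :: "('f :: field_char_0, 'v) superalgebra" and A :: "('f, 'a) superalgebra"
  assumes card: "3 \<le> CARD('n :: finite)" and A: "unital_assoc_superalgebra A" and L: "lie_superalgebra L"
    and iso: "centrally_isogenous L (sl_over TYPE('n) A)"
  shows "A_graded TYPE('n) L"
proof -
  interpret A: unital_assoc_superalgebra A by fact
  interpret m: steinberg "sl_over TYPE('n) A" A "munit A" by (rule A.sl_over_steinberg[OF card])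
  have "perfect L" "\<exists>\<pi>. central_quotient_map L (sl_over TYPE('n) A) \<pi>"
    using iso isomorphic_quotients_iff[OF L m.lie.lie_superalgebra_axioms] by (auto simp: centrally_isogenous_def)
  then obtain \<pi> where \<pi>: "central_quotient_map L (sl_over TYPE('n) A) \<pi>" by blast
  interpret c: central_lift L "sl_over TYPE('n) A" A "munit A" \<pi>
    by (intro central_lift.intro L m.steinberg_axioms central_lift_axioms.intro A.sl_over_steinberg(2)[OF card] \<open>perfect L\<close> \<pi>)
  interpret s: steinberg_char0 L A c.\<phi>
    by (intro steinberg_char0.intro steinberg_char0_axioms.intro c.lift_steinberg c.lift_generated)
  show ?thesis by (rule s.A_graded)
qed


section \<open>Coordinates from matrix units\<close>

text \<open>Vectors \<open>e\<^sub>i\<^sub>j\<close> in spaces \<open>V\<^sub>i\<^sub>j\<close> that act on them like matrix units. By \<open>e_left\<close> and \<open>e_right\<close> they identify all the spaces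
  with one another. The indices \<open>o1\<close> and \<open>o2\<close> have parity \<open>0\<close>, so that the coordinate algebra \<open>V\<close> at this place carries the
  parity of \<open>L\<close> unchanged.\<close>

locale matrix_units = lie: lie_superalgebra L for L :: "('f :: field, 'v) superalgebra" +
  fixes V :: "'n :: finite + 'n \<Rightarrow> 'n + 'n \<Rightarrow> 'v set" and e :: "'n + 'n \<Rightarrow> 'n + 'n \<Rightarrow> 'v"
    and o1 o2 :: "'n + 'n"
  assumes card3: "3 \<le> CARD('n)"
    and o12: "o1 \<noteq> o2" "ipar o1 = 0" "ipar o2 = 0"
    and V_sub: "i \<noteq> j \<Longrightarrow> submodule (V i j) scalars L"
    and V_graded: "\<lbrakk>i \<noteq> j; x \<in> V i j\<rbrakk> \<Longrightarrow> hpart L p x \<in> V i j"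
    and V_mult: "\<lbrakk>i \<noteq> j; j \<noteq> k; i \<noteq> k; x \<in> V i j; y \<in> V j k\<rbrakk> \<Longrightarrow> x \<otimes>\<^bsub>L\<^esub> y \<in> V i k"
    and V_comm: "\<lbrakk>i \<noteq> j; k \<noteq> l; j \<noteq> k; i \<noteq> l; x \<in> V i j; y \<in> V k l\<rbrakk> \<Longrightarrow> x \<otimes>\<^bsub>L\<^esub> y = \<zero>\<^bsub>L\<^esub>"
    and e_V: "i \<noteq> j \<Longrightarrow> e i j \<in> V i j"
    and e_hom: "i \<noteq> j \<Longrightarrow> e i j \<in> hcomp L (ipar i + ipar j)"
    and e_mult: "\<lbrakk>i \<noteq> j; j \<noteq> k; i \<noteq> k\<rbrakk> \<Longrightarrow> e i j \<otimes>\<^bsub>L\<^esub> e j k = e i k"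
    and e_left: "\<lbrakk>i \<noteq> j; j \<noteq> k; i \<noteq> k; x \<in> V j k\<rbrakk> \<Longrightarrow> e j i \<otimes>\<^bsub>L\<^esub> (e i j \<otimes>\<^bsub>L\<^esub> x) = x"
    and e_right: "\<lbrakk>i \<noteq> j; k \<noteq> j; k \<noteq> i; x \<in> V k i\<rbrakk> \<Longrightarrow> (x \<otimes>\<^bsub>L\<^esub> e i j) \<otimes>\<^bsub>L\<^esub> e j i = x"
    and e_nonzero: "e o1 o2 \<noteq> \<zero>\<^bsub>L\<^esub>"
begin

abbreviation lbr (infixl \<open>\<star>\<close> 70) where "x \<star> y \<equiv> x \<otimes>\<^bsub>L\<^esub> y"

lemma fresh: obtains p :: "'n + 'n" where "p \<notin> {a, b, c, d, d'}"
  using ex_fresh_index[OF card3] by blast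

lemma V_carrier: "i \<noteq> j \<Longrightarrow> x \<in> V i j \<Longrightarrow> x \<in> carrier L"
  using lie.sub_carrier[OF V_sub] by blast

lemma e_carrier [simp]: "i \<noteq> j \<Longrightarrow> e i j \<in> carrier L"
  using V_carrier e_V by blast

text \<open>Spaces with unrelated indices commute, so the bracket is associative on a chain of three vectors with such ends.\<close>

lemma V_assoc:
  assumes "i \<noteq> j" "k \<noteq> l" "j \<noteq> k" "i \<noteq> l" "x \<in> V i j" "y \<in> carrier L" "z \<in> V k l"
  shows "(x \<star> y) \<star> z = x \<star> (y \<star> z)"
proof (rule lie.jacobi_assoc[symmetric])
  show "lie.gcomm x z" unfolding lie.gcomm_def using V_comm[OF assms(1-4)] V_graded assms by blast
qed (use assms V_carrier in blast)+

text \<open>An element of the coordinate algebra is a family of vectors, one in each space, that the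
  matrix units permute. A family is determined by any of its members.\<close>

definition "unit_compat x \<longleftrightarrow> (\<forall>i j. i \<noteq> j \<longrightarrow> x i j \<in> V i j)
  \<and> (\<forall>i j k. distinct [i, j, k] \<longrightarrow> e k i \<star> x i j = x k j \<and> x i j \<star> e j k = x i k)"

lemma compatD:
  assumes "unit_compat x"
  shows "i \<noteq> j \<Longrightarrow> x i j \<in> V i j" "distinct [i, j, k] \<Longrightarrow> e k i \<star> x i j = x k j"
    "distinct [i, j, k] \<Longrightarrow> x i j \<star> e j k = x i k" "i \<noteq> j \<Longrightarrow> x i j \<in> carrier L"
  using assms V_carrier[of i j "x i j"] by (auto simp: unit_compat_def)

lemma compat_unique:
  assumes x: "unit_compat x" and y: "unit_compat y" and e: "x o1 o2 = y o1 o2" and ij: "i \<noteq> j"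
  shows "x i j = y i j"
proof -
  have 1: "x o1 j = y o1 j" if "j \<noteq> o1" for j
    using compatD(3)[OF x, of o1 o2 j] compatD(3)[OF y, of o1 o2 j] e o12 that by (cases "j = o2") auto
  have 2: "x i j = y i j" if "i \<noteq> j" "j \<noteq> o1" for i j
    using compatD(2)[OF x, of o1 j i] compatD(2)[OF y, of o1 j i] 1[of j] that by (cases "i = o1") auto
  show ?thesis
  proof (cases "j = o1")
    case True
    obtain k where k: "k \<notin> {i, j, i, j, j}" by (rule fresh)
    then show ?thesis using compatD(3)[OF x, of i k j] compatD(3)[OF y, of i k j] 2[of i k] ij True by auto
  qed (use 2 ij in auto)
qed

text \<open>The first row is obtained from \<open>a\<close> by multiplication on the right, the other entries outside the first column from the
  first row by multiplication on the left, and the first column from the rest by multiplication on the right; the last step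
  passes through an intermediate index, of which it is independent. Associativity then gives the compatibility with all matrix units.\<close>

lemma compat_exists:
  assumes a: "a \<in> V o1 o2" shows "\<exists>x. unit_compat x \<and> x o1 o2 = a"
proof -
  have n12: "o2 \<noteq> o1" using o12 by simp
  \<comment> \<open>The row of \<open>o1\<close>.\<close>
  define r where "r j = (if j = o2 then a else a \<star> e o2 j)" for j
  \<comment> \<open>The places outside the row and the column of \<open>o1\<close>.\<close>
  define q where "q i j = e i o1 \<star> r j" for i j
  have rV: "r j \<in> V o1 j" if "j \<noteq> o1" for j
    using V_mult[OF o12(1), of j a "e o2 j"] e_V[of o2 j] a that by (simp add: r_def)
  have rc: "r j \<in> carrier L" if "j \<noteq> o1" for j using V_carrier rV that by metis
  have ac: "a \<in> carrier L" using V_carrier[OF o12(1) a] .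
  have rr: "r j \<star> e j l = r l" if "j \<noteq> o1" "l \<noteq> o1" "j \<noteq> l" for j l
  proof -
    consider "j = o2" | "l = o2" | "j \<noteq> o2" "l \<noteq> o2" by auto
    then show ?thesis
    proof cases
      case 1 then show ?thesis using that by (simp add: r_def)
    next
      case 2 then show ?thesis using that e_right[of o2 j o1 a] a o12 by (simp add: r_def)
    next
      case 3
      have "(a \<star> e o2 j) \<star> e j l = a \<star> (e o2 j \<star> e j l)"
        by (rule V_assoc[OF o12(1) _ _ _ a e_carrier e_V]) (use 3 that o12 in auto)
      then show ?thesis using 3 that e_mult[of o2 j l] by (simp add: r_def)
    qed
  qed
  have qV: "q i j \<in> V i j" if "i \<noteq> o1" "j \<noteq> o1" "i \<noteq> j" for i j
    unfolding q_def by (rule V_mult[OF _ _ _ e_V rV]) (use that in auto)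
  have qc: "q i j \<in> carrier L" if "i \<noteq> o1" "j \<noteq> o1" "i \<noteq> j" for i j using qV V_carrier that by metis
  have qr: "q i j \<star> e j l = q i l" if "i \<noteq> o1" "j \<noteq> o1" "l \<noteq> o1" "distinct [i, j, l]" for i j l
  proof -
    have "(e i o1 \<star> r j) \<star> e j l = e i o1 \<star> (r j \<star> e j l)"
      by (rule V_assoc[OF _ _ _ _ e_V rc e_V]) (use that in auto)
    then show ?thesis using rr that by (simp add: q_def)
  qed
  have ql: "e k i \<star> q i j = q k j" if "i \<noteq> o1" "j \<noteq> o1" "k \<noteq> o1" "distinct [i, j, k]" for i j k
  proof -
    have "(e k i \<star> e i o1) \<star> r j = e k i \<star> (e i o1 \<star> r j)"
      by (rule V_assoc[OF _ _ _ _ e_V e_carrier rV]) (use that in auto)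
    then show ?thesis using e_mult[of k i o1] that by (auto simp: q_def)
  qed
  have indep: "q i k \<star> e k o1 = q i l \<star> e l o1" if "distinct [i, k, l, o1]" for i k l
  proof -
    have "(q i l \<star> e l k) \<star> e k o1 = q i l \<star> (e l k \<star> e k o1)"
      by (rule V_assoc[OF _ _ _ _ qV e_carrier e_V]) (use that in auto)
    then show ?thesis using qr[of i l k] e_mult[of l k o1] that by auto
  qed
  define m where "m i = (SOME k. k \<noteq> i \<and> k \<noteq> o1)" for i
  have m: "m i \<noteq> i" "m i \<noteq> o1" for i
  proof -
    obtain k where "k \<notin> {i, o1, i, i, i}" by (rule fresh)
    then have "\<exists>k. k \<noteq> i \<and> k \<noteq> o1" by auto
    from someI_ex[OF this] show "m i \<noteq> i" "m i \<noteq> o1" by (simp_all add: m_def)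
  qed
  \<comment> \<open>The column of \<open>o1\<close>.\<close>
  define s where "s i = q i (m i) \<star> e (m i) o1" for i
  have s: "s i = q i k \<star> e k o1" if "i \<noteq> o1" "k \<noteq> i" "k \<noteq> o1" for i k
    using indep[of i "m i" k] m[of i] that by (cases "k = m i") (auto simp: s_def)
  have sV: "s i \<in> V i o1" if "i \<noteq> o1" for i
    unfolding s_def by (rule V_mult[OF _ _ _ qV e_V]) (use m[of i] that in auto)
  define x where "x i j = (if i = o1 then r j else if j = o1 then s i else q i j)" for i j
  have "unit_compat x"
    unfolding unit_compat_def
  proof (intro conjI allI impI)
    fix i j :: "'n + 'n" assume "i \<noteq> j"
    then show "x i j \<in> V i j" using rV[of j] sV[of i] qV[of i j] by (auto simp: x_def)
  next
    fix i j k :: "'n + 'n" assume d: "distinct [i, j, k]"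
    show "e k i \<star> x i j = x k j"
    proof (cases "j = o1")
      case False
      consider "i = o1" | "k = o1" | "i \<noteq> o1" "k \<noteq> o1" by auto
      then show ?thesis
      proof cases
        case 1 then show ?thesis using d False by (auto simp: x_def q_def)
      next
        case 2 then show ?thesis using d False e_left[of i o1 j "r j"] rV[of j] by (auto simp: x_def q_def)
      next
        case 3 then show ?thesis using d False ql[of i j k] by (auto simp: x_def)
      qed
    next
      case True
      then have n: "i \<noteq> o1" "k \<noteq> o1" "i \<noteq> k" using d by auto
      obtain h where h: "h \<notin> {i, k, o1, i, i}" by (rule fresh)
      have "(e k i \<star> q i h) \<star> e h o1 = e k i \<star> (q i h \<star> e h o1)"
        by (rule V_assoc[OF _ _ _ _ e_V qc e_V]) (use n h in auto)
      then show ?thesis using ql[of i h k] s[of i h] s[of k h] n h True by (auto simp: x_def)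
    qed
    show "x i j \<star> e j k = x i k"
    proof (cases "i = o1")
      case True then show ?thesis using rr[of j k] d by (auto simp: x_def)
    next
      case False
      consider "k = o1" | "j = o1" | "j \<noteq> o1" "k \<noteq> o1" by auto
      then show ?thesis
      proof cases
        case 1 then show ?thesis using False s[of i j] d by (auto simp: x_def)
      next
        case 2 then show ?thesis using False s[of i k] d e_right[of k o1 i "q i k"] qV[of i k] by (auto simp: x_def)
      next
        case 3 then show ?thesis using False qr[of i j k] d by (auto simp: x_def)
      qed
    qed
  qed
  moreover have "x o1 o2 = a" by (simp add: x_def r_def)
  ultimately show ?thesis by blast
qed

definition "fam a = (SOME x. unit_compat x \<and> x o1 o2 = a)"
definition "\<phi> i j a = fam a i j"

lemma fam: "a \<in> V o1 o2 \<Longrightarrow> unit_compat (fam a)" "a \<in> V o1 o2 \<Longrightarrow> \<phi> o1 o2 a = a"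
  using someI_ex[OF compat_exists[of a]] by (simp_all add: fam_def \<phi>_def)

lemma phi_eqI: "a \<in> V o1 o2 \<Longrightarrow> unit_compat x \<Longrightarrow> x o1 o2 = a \<Longrightarrow> i \<noteq> j \<Longrightarrow> \<phi> i j a = x i j"
  using compat_unique[of "fam a" x i j] fam[of a] by (simp add: \<phi>_def)

lemma phi_facts:
  assumes "a \<in> V o1 o2"
  shows "i \<noteq> j \<Longrightarrow> \<phi> i j a \<in> V i j" "distinct [i, j, k] \<Longrightarrow> e k i \<star> \<phi> i j a = \<phi> k j a"
    "distinct [i, j, k] \<Longrightarrow> \<phi> i j a \<star> e j k = \<phi> i k a" "i \<noteq> j \<Longrightarrow> \<phi> i j a \<in> carrier L"
  unfolding \<phi>_def using compatD[OF fam(1)[OF assms]] by blast+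

lemma V12: "submodule (V o1 o2) scalars L"
  by (rule V_sub[OF o12(1)])

lemma phi_add:
  assumes a: "a \<in> V o1 o2" "b \<in> V o1 o2" and ij: "i \<noteq> j"
  shows "\<phi> i j (a \<oplus>\<^bsub>L\<^esub> b) = \<phi> i j a \<oplus>\<^bsub>L\<^esub> \<phi> i j b"
proof (rule phi_eqI[OF lie.sub_add[OF V12 a] _ _ ij])
  show "unit_compat (\<lambda>i j. \<phi> i j a \<oplus>\<^bsub>L\<^esub> \<phi> i j b)"
    unfolding unit_compat_def
  proof (intro conjI allI impI)
    fix i j :: "'n + 'n" assume ij: "i \<noteq> j"
    then show "\<phi> i j a \<oplus>\<^bsub>L\<^esub> \<phi> i j b \<in> V i j" using lie.sub_add[OF V_sub[OF ij]] phi_facts(1) a by simp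
  next
    fix i j k :: "'n + 'n" assume d: "distinct [i, j, k]"
    then have n: "i \<noteq> j" "k \<noteq> i" "j \<noteq> k" by auto
    note c = phi_facts(4)[OF a(1) n(1)] phi_facts(4)[OF a(2) n(1)] e_carrier[OF n(2)] e_carrier[OF n(3)]
    show "e k i \<star> (\<phi> i j a \<oplus>\<^bsub>L\<^esub> \<phi> i j b) = \<phi> k j a \<oplus>\<^bsub>L\<^esub> \<phi> k j b"
      "(\<phi> i j a \<oplus>\<^bsub>L\<^esub> \<phi> i j b) \<star> e j k = \<phi> i k a \<oplus>\<^bsub>L\<^esub> \<phi> i k b"
      using phi_facts(2,3)[OF a(1) d] phi_facts(2,3)[OF a(2) d] c by (simp_all add: lie.mult_add_right lie.mult_add_left)
  qed
qed (use fam a in simp)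

lemma phi_smult:
  assumes a: "a \<in> V o1 o2" and ij: "i \<noteq> j"
  shows "\<phi> i j (c \<odot>\<^bsub>L\<^esub> a) = c \<odot>\<^bsub>L\<^esub> \<phi> i j a"
proof (rule phi_eqI[OF lie.sub_smult[OF V12 a] _ _ ij])
  show "unit_compat (\<lambda>i j. c \<odot>\<^bsub>L\<^esub> \<phi> i j a)"
    unfolding unit_compat_def
  proof (intro conjI allI impI)
    fix i j :: "'n + 'n" assume ij: "i \<noteq> j"
    then show "c \<odot>\<^bsub>L\<^esub> \<phi> i j a \<in> V i j" using lie.sub_smult[OF V_sub[OF ij]] phi_facts(1) a by simp
  next
    fix i j k :: "'n + 'n" assume d: "distinct [i, j, k]"
    then have n: "i \<noteq> j" "k \<noteq> i" "j \<noteq> k" by auto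
    note c = phi_facts(4)[OF a n(1)] e_carrier[OF n(2)] e_carrier[OF n(3)]
    show "e k i \<star> (c \<odot>\<^bsub>L\<^esub> \<phi> i j a) = c \<odot>\<^bsub>L\<^esub> \<phi> k j a" "(c \<odot>\<^bsub>L\<^esub> \<phi> i j a) \<star> e j k = c \<odot>\<^bsub>L\<^esub> \<phi> i k a"
      using phi_facts(2,3)[OF a d] c by (simp_all add: lie.mult_smult_right lie.mult_smult_left)
  qed
qed (use fam a in simp)

lemma phi_unit: assumes "i \<noteq> j" shows "\<phi> i j (e o1 o2) = e i j"
proof -
  have "unit_compat e"
    unfolding unit_compat_def by (auto intro!: e_V e_mult)
  then show ?thesis using phi_eqI[of "e o1 o2" e i j] e_V[OF o12(1)] assms by simp
qed

lemma phi_hom: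
  assumes a: "a \<in> V o1 o2" "a \<in> hcomp L p" and ij: "i \<noteq> j"
  shows "\<phi> i j a \<in> hcomp L (p + ipar i + ipar j)"
proof -
  have 1: "\<phi> o1 j a \<in> hcomp L (p + ipar j)" if "j \<noteq> o1" for j
  proof (cases "j = o2")
    case True then show ?thesis using fam(2)[OF a(1)] a o12 by simp
  next
    case False
    then have "a \<star> e o2 j = \<phi> o1 j a" using phi_facts(3)[OF a(1), of o1 o2 j] fam(2)[OF a(1)] o12 that by auto
    moreover have "a \<star> e o2 j \<in> hcomp L (p + (ipar o2 + ipar j))" by (rule lie.mult_graded[OF a(2) e_hom]) (use False in simp)
    ultimately show ?thesis using o12 by simp
  qed
  have 2: "\<phi> i j a \<in> hcomp L (p + ipar i + ipar j)" if "i \<noteq> j" "j \<noteq> o1" for i j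
  proof (cases "i = o1")
    case True then show ?thesis using 1[OF that(2)] o12 by simp
  next
    case False
    then have "e i o1 \<star> \<phi> o1 j a = \<phi> i j a" using phi_facts(2)[OF a(1), of o1 j i] that by auto
    moreover have "e i o1 \<star> \<phi> o1 j a \<in> hcomp L ((ipar i + ipar o1) + (p + ipar j))"
      by (rule lie.mult_graded[OF e_hom[OF False] 1[OF that(2)]])
    moreover have "(ipar i + ipar o1) + (p + ipar j) = p + ipar i + ipar j" using o12 by (simp add: add_ac)
    ultimately show ?thesis by simp
  qed
  show ?thesis
  proof (cases "j = o1")
    case False then show ?thesis using 2 ij by blast
  next
    case True
    obtain k where k: "k \<notin> {i, o1, i, i, i}" by (rule fresh)
    then have "\<phi> i k a \<star> e k o1 = \<phi> i j a" using phi_facts(3)[OF a(1), of i k o1] ij True by auto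
    moreover have "\<phi> i k a \<star> e k o1 \<in> hcomp L ((p + ipar i + ipar k) + (ipar k + ipar o1))"
      by (rule lie.mult_graded[OF 2 e_hom]) (use k in auto)
    moreover have "(p + ipar i + ipar k) + (ipar k + ipar o1) = p + ipar i + ipar j"
      using True by (cases "ipar i"; cases "ipar k"; cases p; cases "ipar o1") simp_all
    ultimately show ?thesis by (simp only:)
  qed
qed

lemma phi_onto: assumes ij: "i \<noteq> j" and y: "y \<in> V i j" shows "\<exists>a\<in>V o1 o2. \<phi> i j a = y"
proof -
  have 1: "\<exists>a\<in>V o1 o2. \<phi> o1 j a = y" if "j \<noteq> o1" "y \<in> V o1 j" for j y
  proof (cases "j = o2")
    case True then show ?thesis using that fam(2) by auto
  next
    case False
    let ?a = "y \<star> e j o2"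
    have a: "?a \<in> V o1 o2" by (rule V_mult[OF _ False _ that(2) e_V[OF False]]) (use that o12 in auto)
    have "\<phi> o1 j ?a = ?a \<star> e o2 j" using phi_facts(3)[OF a, of o1 o2 j] fam(2)[OF a] o12 that False by auto
    also have "\<dots> = y" by (rule e_right) (use that False o12 in auto)
    finally show ?thesis using a by blast
  qed
  have 2: "\<exists>a\<in>V o1 o2. \<phi> i j a = y" if "i \<noteq> j" "j \<noteq> o1" "y \<in> V i j" for i j y
  proof (cases "i = o1")
    case True then show ?thesis using 1 that by simp
  next
    case False
    have "e o1 i \<star> y \<in> V o1 j" by (rule V_mult[OF _ that(1) _ e_V that(3)]) (use False that in auto)
    from 1[OF that(2) this] obtain a where a: "a \<in> V o1 o2" "\<phi> o1 j a = e o1 i \<star> y" by blast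
    have "\<phi> i j a = e i o1 \<star> (e o1 i \<star> y)" using phi_facts(2)[OF a(1), of o1 j i] a(2) that False by auto
    also have "\<dots> = y" by (rule e_left) (use that False in auto)
    finally show ?thesis using a by blast
  qed
  show ?thesis
  proof (cases "j = o1")
    case False then show ?thesis using 2 ij y by blast
  next
    case True
    obtain k where k: "k \<notin> {i, o1, i, i, i}" by (rule fresh)
    have "y \<star> e o1 k \<in> V i k" by (rule V_mult[OF _ _ _ y[unfolded True] e_V]) (use k ij True in auto)
    then obtain a where a: "a \<in> V o1 o2" "\<phi> i k a = y \<star> e o1 k" using 2[of i k] k by auto
    have "\<phi> i j a = (y \<star> e o1 k) \<star> e k o1" using phi_facts(3)[OF a(1), of i k o1] a(2) k ij True by auto
    also have "\<dots> = y" by (rule e_right) (use k ij y True in auto)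
    finally show ?thesis using a by blast
  qed
qed

lemma phi_inj: assumes a: "a \<in> V o1 o2" and ij: "i \<noteq> j" and 0: "\<phi> i j a = \<zero>\<^bsub>L\<^esub>" shows "a = \<zero>\<^bsub>L\<^esub>"
proof -
  have 1: "a = \<zero>\<^bsub>L\<^esub>" if "j \<noteq> o1" "\<phi> o1 j a = \<zero>\<^bsub>L\<^esub>" for j
    using phi_facts(3)[OF a, of o1 j o2] fam(2)[OF a] that o12 by (cases "j = o2") auto
  have 2: "a = \<zero>\<^bsub>L\<^esub>" if "i \<noteq> j" "j \<noteq> o1" "\<phi> i j a = \<zero>\<^bsub>L\<^esub>" for i j
    using phi_facts(2)[OF a, of i j o1] 1[of j] that by (cases "i = o1") auto
  show ?thesis
  proof (cases "j = o1")
    case False then show ?thesis using 2 ij 0 by blast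
  next
    case True
    obtain k where k: "k \<notin> {i, o1, i, i, i}" by (rule fresh)
    then have "\<phi> i k a = \<zero>\<^bsub>L\<^esub>" using phi_facts(3)[OF a, of i o1 k] 0 True ij by auto
    then show ?thesis using 2[of i k] k by auto
  qed
qed

subsection \<open>The coordinate algebra\<close>

definition "o3 = (SOME k. k \<noteq> o1 \<and> k \<noteq> o2)"

lemma o3: "o3 \<noteq> o1" "o3 \<noteq> o2"
proof -
  obtain k where "k \<notin> {o1, o2, o1, o1, o1}" by (rule fresh)
  then have "\<exists>k. k \<noteq> o1 \<and> k \<noteq> o2" by auto
  from someI_ex[OF this] show "o3 \<noteq> o1" "o3 \<noteq> o2" by (simp_all add: o3_def)
qed

definition "cmult a b = \<phi> o1 o3 a \<star> \<phi> o3 o2 b"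

lemma prod_shift:
  assumes a: "a \<in> V o1 o2" and b: "b \<in> V o1 o2" and d: "distinct [i, j, k, l]"
  shows "\<phi> i j a \<star> \<phi> j k b = \<phi> i l a \<star> \<phi> l k b"
proof -
  have "(\<phi> i l a \<star> e l j) \<star> \<phi> j k b = \<phi> i l a \<star> (e l j \<star> \<phi> j k b)"
    by (rule V_assoc[OF _ _ _ _ phi_facts(1)[OF a] e_carrier phi_facts(1)[OF b]]) (use d in auto)
  then show ?thesis using phi_facts(3)[OF a, of i l j] phi_facts(2)[OF b, of j k l] d by auto
qed

text \<open>For each \<open>a\<close> and \<open>b\<close> the brackets \<open>[\<phi>\<^sub>i\<^sub>j(a), \<phi>\<^sub>j\<^sub>k(b)]\<close> form a compatible family, and such a family is
  determined by its value at \<open>(o1, o2)\<close>, which is the product.\<close>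

lemma phi_mult:
  assumes a: "a \<in> V o1 o2" and b: "b \<in> V o1 o2"
  shows "cmult a b \<in> V o1 o2" "distinct [i, j, k] \<Longrightarrow> \<phi> i j a \<star> \<phi> j k b = \<phi> i k (cmult a b)"
proof -
  show m: "cmult a b \<in> V o1 o2"
    unfolding cmult_def by (rule V_mult[OF _ _ _ phi_facts(1)[OF a] phi_facts(1)[OF b]]) (use o3 o12 in auto)
  define t where "t i k = (SOME j. j \<noteq> i \<and> j \<noteq> (k :: 'n + 'n))" for i k
  have t: "t i k \<noteq> i" "t i k \<noteq> k" for i k
  proof -
    obtain j where "j \<notin> {i, k, i, i, i}" by (rule fresh)
    then have "\<exists>j. j \<noteq> i \<and> j \<noteq> k" by auto
    from someI_ex[OF this] show "t i k \<noteq> i" "t i k \<noteq> k" by (simp_all add: t_def)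
  qed
  define y where "y i k = \<phi> i (t i k) a \<star> \<phi> (t i k) k b" for i k
  have y: "y i k = \<phi> i j a \<star> \<phi> j k b" if "distinct [i, j, k]" for i j k
    using prod_shift[OF a b, of i "t i k" k j] t[of i k] that by (cases "t i k = j") (auto simp: y_def)
  have c: "unit_compat y"
    unfolding unit_compat_def
  proof (intro conjI allI impI)
    fix i j :: "'n + 'n" assume "i \<noteq> j"
    then show "y i j \<in> V i j"
      unfolding y_def by (intro V_mult[OF _ _ _ phi_facts(1)[OF a] phi_facts(1)[OF b]]) (use t[of i j] in auto)
  next
    fix i j k :: "'n + 'n" assume d: "distinct [i, j, k]"
    obtain h where h: "h \<notin> {i, j, k, k, k}" by (rule fresh)
    have "(e k i \<star> \<phi> i h a) \<star> \<phi> h j b = e k i \<star> (\<phi> i h a \<star> \<phi> h j b)"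
      by (rule V_assoc[OF _ _ _ _ e_V phi_facts(4)[OF a] phi_facts(1)[OF b]]) (use d h in auto)
    then show "e k i \<star> y i j = y k j"
      using y[of i h j] y[of k h j] phi_facts(2)[OF a, of i h k] d h by auto
    have "(\<phi> i h a \<star> \<phi> h j b) \<star> e j k = \<phi> i h a \<star> (\<phi> h j b \<star> e j k)"
      by (rule V_assoc[OF _ _ _ _ phi_facts(1)[OF a] phi_facts(4)[OF b] e_V]) (use d h in auto)
    then show "y i j \<star> e j k = y i k"
      using y[of i h j] y[of i h k] phi_facts(3)[OF b, of h j k] d h by auto
  qed
  show "\<phi> i j a \<star> \<phi> j k b = \<phi> i k (cmult a b)" if d: "distinct [i, j, k]"
    using phi_eqI[OF m c, of i k] y[of o1 o3 o2] y[OF d] o3 o12 d by (simp add: cmult_def)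
qed

definition coord :: "('f, 'v) superalgebra" where
  "coord = \<lparr>carrier = V o1 o2, monoid.mult = cmult, one = e o1 o2, zero = \<zero>\<^bsub>L\<^esub>, add = add L,
     smult = smult L, hcomp = (\<lambda>p. hcomp L p \<inter> V o1 o2)\<rparr>"

lemma coord_simps [simp]:
  "carrier coord = V o1 o2" "monoid.mult coord = cmult" "\<one>\<^bsub>coord\<^esub> = e o1 o2" "\<zero>\<^bsub>coord\<^esub> = \<zero>\<^bsub>L\<^esub>"
  "add coord = add L" "smult coord = smult L" "hcomp coord p = hcomp L p \<inter> V o1 o2"
  by (simp_all add: coord_def)

lemma coord_unital_assoc: "unital_assoc_superalgebra coord"
proof -
  note S = V12
  note c = lie.sub_carrier[OF S]
  have d12: "distinct [o1, o3, o2]" using o12 o3 by auto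
  have mo: "module scalars coord"
  proof (rule moduleI)
    show "cring (scalars :: 'f ring)" by (rule cring_scalars)
    show "abelian_group coord"
    proof (rule abelian_groupI)
      fix x assume x: "x \<in> carrier coord"
      show "\<exists>y\<in>carrier coord. y \<oplus>\<^bsub>coord\<^esub> x = \<zero>\<^bsub>coord\<^esub>"
        using x c lie.sub_minus[OF S] by (intro bexI[of _ "\<ominus>\<^bsub>L\<^esub> x"]) (auto simp: lie.M.l_neg)
    qed (use c in \<open>auto simp: lie.sub_add[OF S] lie.sub_zero[OF S] lie.M.a_ac\<close>)
  qed (use c in \<open>auto simp: lie.sub_smult[OF S] lie.smult_add_l lie.smult_add_r lie.smult_smult\<close>)
  interpret r: module scalars coord by (rule mo)
  have "superalgebra coord"
  proof (intro superalgebra.intro mo superalgebra_axioms.intro)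
    fix p show "submodule (hcomp coord p) scalars coord"
    proof (rule r.submoduleI)
      fix a assume "a \<in> hcomp coord p"
      then have a: "a \<in> hcomp L p" "a \<in> V o1 o2" by auto
      then have "\<ominus>\<^bsub>coord\<^esub> a = \<ominus>\<^bsub>L\<^esub> a"
        using r.M.minus_equality[of "\<ominus>\<^bsub>L\<^esub> a" a] c lie.sub_minus[OF S] by (simp add: lie.M.l_neg)
      then show "\<ominus>\<^bsub>coord\<^esub> a \<in> hcomp coord p" using a lie.hc_minus lie.sub_minus[OF S] by simp
    qed (auto simp: lie.sub_zero[OF S] lie.sub_add[OF S] lie.hc_add lie.hc_smult lie.sub_smult[OF S])
  next
    show "hcomp coord 0 \<inter> hcomp coord 1 = {\<zero>\<^bsub>coord\<^esub>}"
      using lie.hcomp_disjoint lie.sub_zero[OF S] by auto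
  next
    show "hcomp coord 0 <+>\<^bsub>coord\<^esub> hcomp coord 1 = carrier coord"
    proof (intro equalityI subsetI)
      fix x assume "x \<in> hcomp coord 0 <+>\<^bsub>coord\<^esub> hcomp coord 1"
      then show "x \<in> carrier coord" by (auto simp: set_add_eq lie.sub_add[OF S])
    next
      fix x assume "x \<in> carrier coord"
      then have x: "x \<in> V o1 o2" "x \<in> carrier L" using c by auto
      have "x = hpart L 0 x \<oplus>\<^bsub>coord\<^esub> hpart L 1 x" using lie.hpart_split(2)[OF x(2), of 0] by simp
      moreover have "hpart L p x \<in> hcomp coord p" for p using V_graded[OF o12(1) x(1)] x(2) by simp
      ultimately show "x \<in> hcomp coord 0 <+>\<^bsub>coord\<^esub> hcomp coord 1" unfolding set_add_eq by blast
    qed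
  next
    fix x y p q assume "x \<in> hcomp coord p" "y \<in> hcomp coord q"
    then have xy: "x \<in> V o1 o2" "x \<in> hcomp L p" "y \<in> V o1 o2" "y \<in> hcomp L q" by auto
    have "cmult x y \<in> hcomp L ((p + ipar o1 + ipar o3) + (q + ipar o3 + ipar o2))"
      unfolding cmult_def by (rule lie.mult_graded[OF phi_hom[OF xy(1,2)] phi_hom[OF xy(3,4)]]) (use o3 in auto)
    moreover have "(p + ipar o1 + ipar o3) + (q + ipar o3 + ipar o2) = p + q"
      unfolding o12 by (cases p; cases q; cases "ipar o3") simp_all
    ultimately show "x \<otimes>\<^bsub>coord\<^esub> y \<in> hcomp coord (p + q)" using phi_mult(1)[OF xy(1,3)] by simp
  next
    show "x \<otimes>\<^bsub>coord\<^esub> y \<in> carrier coord" if "x \<in> carrier coord" "y \<in> carrier coord" for x y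
      using that phi_mult(1) by simp
  qed (use o3 o3[symmetric] c in \<open>simp_all add: cmult_def phi_add phi_smult phi_facts(4) lie.mult_add_left
      lie.mult_add_right lie.mult_smult_left lie.mult_smult_right\<close>)
  then interpret s: superalgebra coord .
  show ?thesis
  proof unfold_locales
    fix x y z assume "x \<in> carrier coord" "y \<in> carrier coord" "z \<in> carrier coord"
    then have xyz: "x \<in> V o1 o2" "y \<in> V o1 o2" "z \<in> V o1 o2" by auto
    note xy = phi_mult(1)[OF xyz(1,2)] and yz = phi_mult(1)[OF xyz(2,3)]
    obtain h where h: "h \<notin> {o1, o2, o3, o3, o3}" by (rule fresh)
    have n: "o1 \<noteq> o3" "o3 \<noteq> h" "h \<noteq> o2" "o1 \<noteq> h" "o3 \<noteq> o2" using o3 h by auto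
    have "(\<phi> o1 o3 x \<star> \<phi> o3 h y) \<star> \<phi> h o2 z = \<phi> o1 o3 x \<star> (\<phi> o3 h y \<star> \<phi> h o2 z)"
      by (rule V_assoc[OF n(1,3,2) o12(1) phi_facts(1)[OF xyz(1) n(1)] phi_facts(4)[OF xyz(2) n(2)] phi_facts(1)[OF xyz(3) n(3)]])
    then have "\<phi> o1 h (cmult x y) \<star> \<phi> h o2 z = \<phi> o1 o3 x \<star> \<phi> o3 o2 (cmult y z)"
      using phi_mult(2)[OF xyz(1,2), of o1 o3 h] phi_mult(2)[OF xyz(2,3), of o3 h o2] n by auto
    then have "\<phi> o1 o2 (cmult (cmult x y) z) = \<phi> o1 o2 (cmult x (cmult y z))"
      using phi_mult(2)[OF xy xyz(3), of o1 h o2] phi_mult(2)[OF xyz(1) yz, of o1 o3 o2] n o12 by auto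
    then show "x \<otimes>\<^bsub>coord\<^esub> y \<otimes>\<^bsub>coord\<^esub> z = x \<otimes>\<^bsub>coord\<^esub> (y \<otimes>\<^bsub>coord\<^esub> z)"
      using fam(2)[OF phi_mult(1)[OF xy xyz(3)]] fam(2)[OF phi_mult(1)[OF xyz(1) yz]] by simp
  next
    show "\<one>\<^bsub>coord\<^esub> \<in> carrier coord" using e_V[OF o12(1)] by simp
    show "\<one>\<^bsub>coord\<^esub> \<noteq> \<zero>\<^bsub>coord\<^esub>" using e_nonzero by simp
    fix x assume "x \<in> carrier coord"
    then have x: "x \<in> V o1 o2" by simp
    show "\<one>\<^bsub>coord\<^esub> \<otimes>\<^bsub>coord\<^esub> x = x"
      using phi_unit[of o1 o3] phi_facts(2)[OF x, of o3 o2 o1] fam(2)[OF x] o3 o12 by (auto simp: cmult_def)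
    show "x \<otimes>\<^bsub>coord\<^esub> \<one>\<^bsub>coord\<^esub> = x"
      using phi_unit[of o3 o2] phi_facts(3)[OF x, of o1 o3 o2] fam(2)[OF x] o3 o12 by (auto simp: cmult_def)
  qed
qed

lemma coord_steinberg: "steinberg L coord \<phi>"
proof -
  interpret A: unital_assoc_superalgebra coord by (rule coord_unital_assoc)
  show ?thesis
  proof unfold_locales
    show "3 \<le> CARD('n)" by (rule card3)
    fix i j k l :: "'n + 'n" and a b assume "i \<noteq> j" "k \<noteq> l" "j \<noteq> k" "i \<noteq> l" "a \<in> carrier coord" "b \<in> carrier coord"
    then show "\<phi> i j a \<star> \<phi> k l b = \<zero>\<^bsub>L\<^esub>" using V_comm[of i j k l] phi_facts(1) by simp
  next
    fix i j :: "'n + 'n" and a assume "i \<noteq> j" "a \<in> carrier coord" "\<phi> i j a = \<zero>\<^bsub>L\<^esub>"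
    then show "a = \<zero>\<^bsub>coord\<^esub>" using phi_inj by simp
  qed (simp_all add: phi_hom phi_add phi_smult phi_mult(2))
qed

lemma phi_image: "i \<noteq> j \<Longrightarrow> \<phi> i j ` carrier coord = V i j"
  using phi_onto phi_facts(1) by (auto simp: image_iff) (metis phi_onto)

end


section \<open>Matrix units from a grading\<close>

text \<open>What the construction of coordinates uses of a grading: \<open>t d\<close> is the lift of the diagonal matrix \<open>d\<close>, \<open>e i j\<close> a lift of a matrix unit, and \<open>gap\<close>
  says that only roots and zero occur as weights.\<close>

locale graded_units = lie: lie_superalgebra L for L :: "('f :: field_char_0, 'v) superalgebra" +
  fixes t :: "('n :: finite + 'n \<Rightarrow> 'f) \<Rightarrow> 'v" and e :: "'n + 'n \<Rightarrow> 'n + 'n \<Rightarrow> 'v"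
  assumes card3: "3 \<le> CARD('n)"
    and t_even: "d \<in> torus \<Longrightarrow> t d \<in> hcomp L 0"
    and gap: "\<lbrakk>x \<in> carrier L; \<And>d. d \<in> torus \<Longrightarrow> t d \<otimes>\<^bsub>L\<^esub> x = \<beta> d \<odot>\<^bsub>L\<^esub> x;
        \<And>r s. \<exists>d\<in>torus. \<beta> d \<noteq> d r - d s\<rbrakk> \<Longrightarrow> x = \<zero>\<^bsub>L\<^esub>"
    and e_hom: "i \<noteq> j \<Longrightarrow> e i j \<in> hcomp L (ipar i + ipar j)"
    and e_weight: "\<lbrakk>d \<in> torus; i \<noteq> j\<rbrakk> \<Longrightarrow> t d \<otimes>\<^bsub>L\<^esub> e i j = (d i - d j) \<odot>\<^bsub>L\<^esub> e i j"
    and e_mult: "\<lbrakk>i \<noteq> j; j \<noteq> k; i \<noteq> k\<rbrakk> \<Longrightarrow> e i j \<otimes>\<^bsub>L\<^esub> e j k = e i k"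
    and e_comm: "\<lbrakk>i \<noteq> j; k \<noteq> l; j \<noteq> k; i \<noteq> l\<rbrakk> \<Longrightarrow> e i j \<otimes>\<^bsub>L\<^esub> e k l = \<zero>\<^bsub>L\<^esub>"
    and e_coroot: "\<lbrakk>i \<noteq> j; same_block i j\<rbrakk>
        \<Longrightarrow> e i j \<otimes>\<^bsub>L\<^esub> e j i = t (\<lambda>k. of_int (ind i k - ind j k))"
    and e_nonzero: "i \<noteq> j \<Longrightarrow> e i j \<noteq> \<zero>\<^bsub>L\<^esub>"
begin

abbreviation lbr (infixl \<open>\<star>\<close> 70) where "x \<star> y \<equiv> x \<otimes>\<^bsub>L\<^esub> y"

definition "V i j = {x \<in> carrier L. \<forall>d\<in>torus. t d \<star> x = (d i - d j) \<odot>\<^bsub>L\<^esub> x}"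

lemma V_carrier: "x \<in> V i j \<Longrightarrow> x \<in> carrier L"
  by (simp add: V_def)

lemma V_act: "x \<in> V i j \<Longrightarrow> d \<in> torus \<Longrightarrow> t d \<star> x = (d i - d j) \<odot>\<^bsub>L\<^esub> x"
  by (simp add: V_def)

lemma t_carrier [simp]: "d \<in> torus \<Longrightarrow> t d \<in> carrier L"
  using lie.hc_carrier[OF t_even] by blast

lemma e_carrier [simp]: "i \<noteq> j \<Longrightarrow> e i j \<in> carrier L"
  using lie.hc_carrier[OF e_hom] by blast

lemma e_V: "i \<noteq> j \<Longrightarrow> e i j \<in> V i j"
  by (simp add: V_def e_weight)

lemma e_even: "i \<noteq> j \<Longrightarrow> same_block i j \<Longrightarrow> e i j \<in> hcomp L 0"
  using e_hom[of i j] by simp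

lemma e_odd: "\<not> same_block i j \<Longrightarrow> e i j \<in> hcomp L 1"
proof -
  assume "\<not> same_block i j"
  then have "i \<noteq> j" "ipar i + ipar j = 1" by (auto) (cases "ipar i"; cases "ipar j"; simp)
  then show ?thesis using e_hom[of i j] by simp
qed

lemma V_sub: "submodule (V i j) scalars L"
  by (rule lie.submoduleI')
    (auto simp: V_def lie.mult_add_right lie.smult_add_r lie.mult_smult_right lie.smult_smult mult.commute)

lemma V_graded:
  assumes x: "x \<in> V i j" shows "hpart L p x \<in> V i j"
proof -
  note xc = V_carrier[OF x]
  have "t d \<star> hpart L p x = (d i - d j) \<odot>\<^bsub>L\<^esub> hpart L p x" if d: "d \<in> torus" for d
  proof -
    let ?a = "hpart L p x" and ?b = "hpart L (p + 1) x"
    have h: "?a \<in> hcomp L p" "?b \<in> hcomp L (p + 1)" using xc by auto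
    have "x = ?a \<oplus>\<^bsub>L\<^esub> ?b" using lie.hpart_split(2)[OF xc] .
    then have "t d \<star> ?a \<oplus>\<^bsub>L\<^esub> t d \<star> ?b = (d i - d j) \<odot>\<^bsub>L\<^esub> ?a \<oplus>\<^bsub>L\<^esub> (d i - d j) \<odot>\<^bsub>L\<^esub> ?b"
      using V_act[OF x d] lie.mult_add_right[of ?a ?b "t d"] lie.smult_add_r[of ?a ?b] d xc by simp
    then show ?thesis
      using lie.hcomp_decomp_eq(1)[of "t d \<star> ?a" p "t d \<star> ?b" "(d i - d j) \<odot>\<^bsub>L\<^esub> ?a" "(d i - d j) \<odot>\<^bsub>L\<^esub> ?b"]
        lie.mult_graded[OF t_even[OF d] h(1)] lie.mult_graded[OF t_even[OF d] h(2)]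
        lie.hc_smult[OF h(1)] lie.hc_smult[OF h(2)] by simp
  qed
  then show ?thesis using xc by (simp add: V_def)
qed

lemma weights_add:
  assumes x: "x \<in> V i j" and y: "y \<in> V k l" and d: "d \<in> torus"
  shows "t d \<star> (x \<star> y) = (d i - d j + d k - d l) \<odot>\<^bsub>L\<^esub> (x \<star> y)"
proof -
  note c = V_carrier[OF x] V_carrier[OF y]
  have "t d \<star> (x \<star> y) = (t d \<star> x) \<star> y \<oplus>\<^bsub>L\<^esub> x \<star> (t d \<star> y)"
    by (rule lie.jacobi_even[OF t_even[OF d] c])
  also have "\<dots> = (d i - d j) \<odot>\<^bsub>L\<^esub> (x \<star> y) \<oplus>\<^bsub>L\<^esub> (d k - d l) \<odot>\<^bsub>L\<^esub> (x \<star> y)"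
    using V_act[OF x d] V_act[OF y d] c by (simp add: lie.mult_smult_left lie.mult_smult_right)
  also have "\<dots> = (d i - d j + d k - d l) \<odot>\<^bsub>L\<^esub> (x \<star> y)"
    using lie.smult_add_l[of "x \<star> y" "d i - d j" "d k - d l"] c by (simp add: add_diff_eq)
  finally show ?thesis .
qed

lemma V_mult:
  assumes x: "x \<in> V i j" and y: "y \<in> V j k" shows "x \<star> y \<in> V i k"
  using weights_add[OF x y] V_carrier[OF x] V_carrier[OF y] by (simp add: V_def)

lemma V_mult_flip:
  assumes x: "x \<in> V j k" and y: "y \<in> V i j" shows "x \<star> y \<in> V i k"
  using weights_add[OF x y] V_carrier[OF x] V_carrier[OF y] by (simp add: V_def algebra_simps)

abbreviation "exceptional i j k l \<equiv>
  i \<noteq> k \<and> j \<noteq> l \<and> same_block i k \<and> same_block j l \<and> \<not> same_block i j"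

text \<open>Unless the four indices are exceptional, the sum of the two roots is neither a root nor zero.\<close>

lemma V_comm_regular:
  assumes n: "i \<noteq> j" "k \<noteq> l" "j \<noteq> k" "i \<noteq> l" and ex: "\<not> exceptional i j k l"
    and x: "x \<in> V i j" and y: "y \<in> V k l"
  shows "x \<star> y = \<zero>\<^bsub>L\<^esub>"
proof (rule gap)
  show "x \<star> y \<in> carrier L" using V_carrier[OF x] V_carrier[OF y] by simp
  show "t d \<star> (x \<star> y) = (d i - d j + d k - d l) \<odot>\<^bsub>L\<^esub> (x \<star> y)" if "d \<in> torus" for d
    using weights_add[OF x y that] .
  show "\<exists>d\<in>torus. d i - d j + d k - d l \<noteq> d r - (d s :: 'f)" for r s
    using root_relation_four[OF card3 n, of r s, where 'f = 'f] ex by blast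
qed

lemma gcommI:
  assumes x: "x \<in> V i j" and y: "y \<in> V k l"
    and z: "\<And>x y. x \<in> V i j \<Longrightarrow> y \<in> V k l \<Longrightarrow> x \<star> y = \<zero>\<^bsub>L\<^esub>"
  shows "lie.gcomm x y"
  unfolding lie.gcomm_def using z V_graded x y by blast

subsection \<open>The action of the coroots\<close>

text \<open>For indices of equal parity this is an element of the lifted Cartan subalgebra, and its action is known. For indices of different
  parity it is known only modulo the centre of the grading subsuperalgebra.\<close>

definition "H i j = e i j \<star> e j i"

lemma H_even: "i \<noteq> j \<Longrightarrow> H i j \<in> hcomp L 0"
  using lie.mult_graded[OF e_hom[of i j] e_hom[of j i]] by (cases "ipar i"; cases "ipar j") (auto simp: H_def)

lemma H_carrier [simp]: "i \<noteq> j \<Longrightarrow> H i j \<in> carrier L"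
  by (simp add: H_def)

lemma H_sym: assumes "\<not> same_block i j" shows "H i j = H j i"
proof -
  have "i \<noteq> j" using assms by auto
  then show ?thesis using lie.skew[OF e_odd[of i j] e_odd[of j i]] assms by (auto simp: H_def)
qed

text \<open>Replacing an index by another one of the same parity changes \<open>H\<close> by an element whose action is known. So the
  unknown part of the action is the same for all pairs of different parity.\<close>

lemma H_shift:
  assumes ik: "i \<noteq> k" "same_block i k" and j: "\<not> same_block i j"
  shows "H i j = H i k \<oplus>\<^bsub>L\<^esub> H k j"
proof -
  have n: "i \<noteq> j" "k \<noteq> j" "j \<noteq> k" "j \<noteq> i" "k \<noteq> i" using assms by auto
  have s: "e i k \<star> e j i = \<ominus>\<^bsub>L\<^esub> e j k"
    using lie.skew_even[OF e_even[OF ik], of "e j i"] e_mult[of j i k] ik n by simp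
  have "e i k \<star> (e k j \<star> e j i) = (e i k \<star> e k j) \<star> e j i \<oplus>\<^bsub>L\<^esub> e k j \<star> (e i k \<star> e j i)"
    using ik n by (intro lie.jacobi_even e_even) auto
  then have "H i k = H i j \<oplus>\<^bsub>L\<^esub> e k j \<star> (\<ominus>\<^bsub>L\<^esub> e j k)"
    using ik n e_mult[of k j i] e_mult[of i k j] s by (simp add: H_def)
  then have "H i k = H i j \<ominus>\<^bsub>L\<^esub> H k j" using n by (simp add: lie.mult_minus a_minus_def H_def)
  then show ?thesis using ik n by (simp add: a_minus_def lie.a_assoc lie.l_neg)
qed

lemma H_torus:
  assumes ij: "i \<noteq> j" "same_block i j" and x: "x \<in> V k l"
  shows "H i j \<star> x = of_int (ind i k - ind j k - ind i l + ind j l) \<odot>\<^bsub>L\<^esub> x"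
  using V_act[OF x torus_diff[OF ij(2)]] e_coroot[OF ij] by (simp add: H_def algebra_simps)

text \<open>Both brackets with the matrix units vanish on \<open>V k l\<close>, as no sum of the roots is a root.\<close>

lemma H_far:
  assumes kl: "k \<noteq> l" "same_block k l" and n: "i \<notin> {k, l}" "j \<notin> {k, l}" "\<not> same_block i j"
    and x: "x \<in> V k l"
  shows "H i j \<star> x = \<zero>\<^bsub>L\<^esub>"
proof -
  have ij: "i \<noteq> j" "j \<noteq> i" using n by auto
  have 1: "e i j \<star> x = \<zero>\<^bsub>L\<^esub>" by (rule V_comm_regular[OF _ _ _ _ _ e_V x]) (use ij kl n in auto)
  have 2: "e j i \<star> x = \<zero>\<^bsub>L\<^esub>" by (rule V_comm_regular[OF _ _ _ _ _ e_V x]) (use ij kl n in auto)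
  show ?thesis
    using lie.jacobi_assoc_left[OF e_hom[OF ij(1)] e_carrier[OF ij(2)] V_carrier[OF x] 1] 2 ij by (simp add: H_def)
qed


text \<open>Passing to an index \<open>p\<close> different from \<open>j\<close> and \<open>k\<close> in the same block reduces this to the previous lemma.\<close>

lemma H_left_same:
  assumes jk: "j \<noteq> k" "same_block j k" and i: "\<not> same_block i j" and x: "x \<in> V j k"
  shows "H j i \<star> x = x"
proof -
  obtain p where p: "p \<noteq> j" "p \<noteq> k" "ipar p = ipar j" by (rule ex_same_block[OF card3])
  have n: "j \<noteq> p" "p \<noteq> i" "j \<noteq> i" using p i by auto
  have "H j i \<star> x = H j p \<star> x \<oplus>\<^bsub>L\<^esub> H p i \<star> x"
    using H_shift[of j p i] n p i V_carrier[OF x] by (auto simp: lie.mult_add_left)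
  moreover have "H p i \<star> x = \<zero>\<^bsub>L\<^esub>" by (rule H_far[OF jk _ _ _ x]) (use p i jk in auto)
  moreover have "H j p \<star> x = x" using H_torus[of j p, OF n(1) _ x] p jk V_carrier[OF x] by (auto simp: ind_def)
  ultimately show ?thesis using V_carrier[OF x] by simp
qed

lemma H_right_same:
  assumes ki: "k \<noteq> i" "same_block k i" and j: "\<not> same_block i j" and x: "x \<in> V k i"
  shows "H i j \<star> x = \<ominus>\<^bsub>L\<^esub> x"
proof -
  obtain p where p: "p \<noteq> i" "p \<noteq> k" "ipar p = ipar i" by (rule ex_same_block[OF card3])
  have n: "i \<noteq> p" "p \<noteq> j" "i \<noteq> j" using p j by auto
  have "H i j \<star> x = H i p \<star> x \<oplus>\<^bsub>L\<^esub> H p j \<star> x"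
    using H_shift[of i p j] n p j V_carrier[OF x] by (auto simp: lie.mult_add_left)
  moreover have "H p j \<star> x = \<zero>\<^bsub>L\<^esub>" by (rule H_far[OF ki _ _ _ x]) (use p j ki in auto)
  moreover have "H i p \<star> x = \<ominus>\<^bsub>L\<^esub> x" using H_torus[of i p, OF n(1) _ x] p ki V_carrier[OF x] by (auto simp: ind_def)
  ultimately show ?thesis using V_carrier[OF x] by simp
qed

lemma H_V:
  assumes ij: "i \<noteq> j" and x: "x \<in> V k l" shows "H i j \<star> x \<in> V k l"
proof -
  note e = e_V[OF ij] e_V[OF ij[symmetric]]
  have "H i j \<in> V i i" unfolding H_def by (rule V_mult[OF e])
  then show ?thesis using weights_add[of "H i j" i i x k l] x V_carrier[OF x] ij by (simp add: V_def)
qed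

lemma add_self_zero: "a \<in> carrier L \<Longrightarrow> b \<in> carrier L \<Longrightarrow> a = a \<oplus>\<^bsub>L\<^esub> b \<Longrightarrow> b = \<zero>\<^bsub>L\<^esub>"
  using lie.add.l_cancel_one[of a b] by metis

text \<open>Let \<open>z = [H k l, x]\<close>. Moving \<open>x\<close> with \<open>e l k'\<close> to a space with indices of equal parity, where the action of \<open>H k l\<close> is known, shows
  that \<open>e l k'\<close> annihilates \<open>z\<close>, and then so does \<open>H k' l\<close>. Comparing this with the action of \<open>H k' k\<close> gives \<open>[H k l, z] = z\<close>. The same argument in the
  second index gives \<open>[H k l, z] = -z\<close>. Hence \<open>2z = 0\<close>.\<close>

lemma H_own:
  assumes kl: "\<not> same_block k l" and x: "x \<in> V k l" shows "H k l \<star> x = \<zero>\<^bsub>L\<^esub>"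
proof -
  have kl': "k \<noteq> l" "l \<noteq> k" using kl by auto
  define z where "z = H k l \<star> x"
  have z: "z \<in> V k l" unfolding z_def by (rule H_V[OF kl'(1) x])
  obtain k' where k': "k' \<noteq> k" "k' \<noteq> k" "ipar k' = ipar k" by (rule ex_same_block[OF card3])
  obtain l' where l': "l' \<noteq> l" "l' \<noteq> l" "ipar l' = ipar l" by (rule ex_same_block[OF card3])
  have n: "k' \<noteq> l" "l \<noteq> k'" "k \<noteq> k'" "l' \<noteq> k" "k \<noteq> l'" "l \<noteq> l'" using k' l' kl by auto
  note nn = n kl' k'(1) l'(1)
  note c = V_carrier[OF x] V_carrier[OF z]
  note E = nn[THEN e_carrier]
  have opp: "psign (1 * 1) \<odot>\<^bsub>L\<^esub> y = \<ominus>\<^bsub>L\<^esub> y" if "y \<in> carrier L" for y using that by simp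
  have od: "e k l \<in> hcomp L 1" "e l k \<in> hcomp L 1" "e l k' \<in> hcomp L 1" "e l' k \<in> hcomp L 1"
    by (rule e_odd; use kl k' l' in auto)+
  have H1: "H k l \<star> e l k' = e l k'"
  proof -
    have "e k l \<star> (e l k \<star> e l k') = H k l \<star> e l k' \<oplus>\<^bsub>L\<^esub> psign (1 * 1) \<odot>\<^bsub>L\<^esub> (e l k \<star> (e k l \<star> e l k'))"
      unfolding H_def by (rule lie.super_jacobi[OF od(1) od(2) od(3)])
    moreover have "e l k \<star> e l k' = \<zero>\<^bsub>L\<^esub>" by (rule e_comm) (use nn in auto)
    moreover have "e l k \<star> (e k l \<star> e l k') = e l k'" using e_mult[of k l k'] e_mult[of l k k'] nn by simp
    ultimately have "H k l \<star> e l k' \<ominus>\<^bsub>L\<^esub> e l k' = \<zero>\<^bsub>L\<^esub>" using E nn by (simp add: a_minus_def)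
    then show ?thesis using lie.diff_eq_0[of "H k l \<star> e l k'" "e l k'"] E nn by simp
  qed
  have H2: "H k l \<star> e l' k = \<ominus>\<^bsub>L\<^esub> e l' k"
  proof -
    have "e k l \<star> (e l k \<star> e l' k) = H k l \<star> e l' k \<oplus>\<^bsub>L\<^esub> psign (1 * 1) \<odot>\<^bsub>L\<^esub> (e l k \<star> (e k l \<star> e l' k))"
      unfolding H_def by (rule lie.super_jacobi[OF od(1) od(2) od(4)])
    moreover have "e l k \<star> e l' k = \<zero>\<^bsub>L\<^esub>" by (rule e_comm) (use nn in auto)
    moreover have "e k l \<star> e l' k = e l' l"
      using lie.skew[OF od(1) od(4)] e_mult[of l' k l] nn E by simp
    moreover have "e l k \<star> e l' l = \<ominus>\<^bsub>L\<^esub> e l' k"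
      using lie.skew_even[OF e_even[of l' l], of "e l k"] e_mult[of l' l k] nn E l' by simp
    ultimately have "H k l \<star> e l' k \<ominus>\<^bsub>L\<^esub> (\<ominus>\<^bsub>L\<^esub> e l' k) = \<zero>\<^bsub>L\<^esub>" using E nn by (simp add: a_minus_def)
    then show ?thesis using lie.diff_eq_0[of "H k l \<star> e l' k" "\<ominus>\<^bsub>L\<^esub> e l' k"] E nn by simp
  qed
  note cancel = lie.diff_eq_0
  have zero_left: "e l k' \<star> z = \<zero>\<^bsub>L\<^esub>"
  proof -
    have y: "e l k' \<star> x \<in> V k k'" by (rule V_mult_flip[OF e_V x]) (use nn in auto)
    have "e l k' \<star> x = H k l \<star> (e l k' \<star> x)"
      using H_left_same[OF n(3) _ _ y, of l] k' kl by simp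
    also have "\<dots> = e l k' \<star> x \<oplus>\<^bsub>L\<^esub> e l k' \<star> z"
      using lie.jacobi_even[OF H_even[OF kl'(1)], of "e l k'" x] E nn c H1 by (simp add: z_def)
    finally show ?thesis using add_self_zero[of "e l k' \<star> x" "e l k' \<star> z"] c E nn by simp
  qed
  have zero_right: "e l' k \<star> z = \<zero>\<^bsub>L\<^esub>"
  proof -
    have y: "e l' k \<star> x \<in> V l' l" by (rule V_mult[OF e_V x]) (use nn in auto)
    have "H k l \<star> (e l' k \<star> x) = \<ominus>\<^bsub>L\<^esub> (e l' k \<star> x)"
      using H_right_same[OF l'(1) _ _ y, of k] l' kl H_sym[OF kl] by auto
    moreover have "H k l \<star> (e l' k \<star> x) = \<ominus>\<^bsub>L\<^esub> (e l' k \<star> x) \<oplus>\<^bsub>L\<^esub> e l' k \<star> z"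
      using lie.jacobi_even[OF H_even[OF kl'(1)], of "e l' k" x] E nn c H2 by (simp add: z_def lie.mult_minus)
    ultimately have "\<ominus>\<^bsub>L\<^esub> (e l' k \<star> x) = \<ominus>\<^bsub>L\<^esub> (e l' k \<star> x) \<oplus>\<^bsub>L\<^esub> e l' k \<star> z" by simp
    then show ?thesis using add_self_zero[of "\<ominus>\<^bsub>L\<^esub> (e l' k \<star> x)" "e l' k \<star> z"] c E nn by simp
  qed
  have Hz1: "H k l \<star> z = z"
  proof -
    have "e k' l \<star> z = \<zero>\<^bsub>L\<^esub>" by (rule V_comm_regular[OF _ _ _ _ _ e_V z]) (use nn in auto)
    then have "H k' l \<star> z = \<zero>\<^bsub>L\<^esub>"
      using lie.jacobi_assoc_left[OF e_hom[OF n(1)] E(2) c(2)] zero_left E n(1) by (simp add: H_def)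
    moreover have "H k' l \<star> z = H k' k \<star> z \<oplus>\<^bsub>L\<^esub> H k l \<star> z"
      using H_shift[of k' k l] k' kl kl' c by (simp add: lie.mult_add_left)
    moreover have "H k' k \<star> z = \<ominus>\<^bsub>L\<^esub> z" using H_torus[of k' k, OF _ _ z] k' nn c by (simp add: ind_def)
    ultimately have "H k l \<star> z \<ominus>\<^bsub>L\<^esub> z = \<zero>\<^bsub>L\<^esub>" using c nn by (simp add: a_minus_def lie.a_comm)
    then show ?thesis using cancel[of "H k l \<star> z" z] c nn by simp
  qed
  have Hz2: "H k l \<star> z = \<ominus>\<^bsub>L\<^esub> z"
  proof -
    have "e k l' \<star> z = \<zero>\<^bsub>L\<^esub>" by (rule V_comm_regular[OF _ _ _ _ _ e_V z]) (use nn in auto)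
    then have "H k l' \<star> z = \<zero>\<^bsub>L\<^esub>"
      using lie.jacobi_assoc_left[OF e_hom[OF n(5)] E(4) c(2)] zero_right E n(5) by (simp add: H_def)
    moreover have "H k l' = H l' k" "H k l = H l k" using H_sym[of k l'] H_sym[OF kl] l' kl by auto
    moreover have "H l' k \<star> z = H l' l \<star> z \<oplus>\<^bsub>L\<^esub> H l k \<star> z"
      using H_shift[of l' l k] l' kl kl' c by (simp add: lie.mult_add_left)
    moreover have "H l' l \<star> z = z" using H_torus[of l' l, OF _ _ z] l' nn c by (simp add: ind_def)
    ultimately have "H k l \<star> z \<ominus>\<^bsub>L\<^esub> (\<ominus>\<^bsub>L\<^esub> z) = \<zero>\<^bsub>L\<^esub>" using c nn by (simp add: a_minus_def lie.a_comm)
    then show ?thesis using cancel[of "H k l \<star> z" "\<ominus>\<^bsub>L\<^esub> z"] c nn by simp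
  qed
  have "z \<oplus>\<^bsub>L\<^esub> z = \<zero>\<^bsub>L\<^esub>" using Hz1 Hz2 c lie.r_neg[of z] by simp
  then have "(1 + 1) \<odot>\<^bsub>L\<^esub> z = \<zero>\<^bsub>L\<^esub>" using lie.smult_add_l[of z 1 1] c by simp
  then show ?thesis using lie.smult_eq_0[of z "1 + 1"] c by (simp add: z_def)
qed

text \<open>Of three indices two have equal parity; each case reduces by \<open>H_shift\<close> to one that is settled.\<close>

lemma H_left:
  assumes n: "i \<noteq> j" "j \<noteq> k" "i \<noteq> k" and x: "x \<in> V j k" shows "H j i \<star> x = x"
proof (cases "same_block i j")
  case True
  then show ?thesis using H_torus[of j i, OF _ _ x] n V_carrier[OF x] by (simp add: ind_def)
next
  case ij: False
  show ?thesis
  proof (cases "same_block j k")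
    case False
    then have ik: "same_block i k" using ij by (cases "ipar i"; cases "ipar j"; cases "ipar k") auto
    have "H j i = H i k \<oplus>\<^bsub>L\<^esub> H j k" using H_shift[OF n(3) ik ij] H_sym[of i j] H_sym[of j k] ij False by auto
    moreover have "H j k \<star> x = \<zero>\<^bsub>L\<^esub>" by (rule H_own[OF False x])
    moreover have "H i k \<star> x = x" using H_torus[OF n(3) ik x] n V_carrier[OF x] by (auto simp: ind_def)
    ultimately show ?thesis using n V_carrier[OF x] by (simp add: lie.mult_add_left)
  qed (use H_left_same n ij x in auto)
qed

lemma H_right:
  assumes n: "i \<noteq> j" "k \<noteq> j" "k \<noteq> i" and x: "x \<in> V k i" shows "H i j \<star> x = \<ominus>\<^bsub>L\<^esub> x"
proof (cases "same_block i j")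
  case True
  then show ?thesis using H_torus[of i j, OF _ _ x] n V_carrier[OF x] by (auto simp: ind_def)
next
  case ij: False
  show ?thesis
  proof (cases "same_block k i")
    case False
    then have jk: "same_block j k" using ij by (cases "ipar i"; cases "ipar j"; cases "ipar k") auto
    have "H i j = H j k \<oplus>\<^bsub>L\<^esub> H k i" using H_shift[of j k i] H_sym[of i j] jk n ij by auto
    moreover have "H k i \<star> x = \<zero>\<^bsub>L\<^esub>" by (rule H_own[OF False x])
    moreover have "H j k \<star> x = \<ominus>\<^bsub>L\<^esub> x" using H_torus[OF _ jk x] n V_carrier[OF x] by (auto simp: ind_def)
    ultimately show ?thesis using n V_carrier[OF x] by (auto simp: lie.mult_add_left)
  qed (use H_right_same n ij x in auto)
qed

text \<open>A vector of \<open>V b l\<close> is recovered from its image in \<open>V d l\<close>, as \<open>[e b d, [e d b, x]] = [H b d, x] = x\<close>. If \<open>d\<close> has the parity of \<open>l\<close>, this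
  factors a vector of an odd root space through an even one.\<close>

lemma exceptional_factor:
  assumes x: "x \<in> V b l" and n: "b \<noteq> d" "d \<noteq> l" "b \<noteq> l"
  shows "e d b \<star> x \<in> V d l" "e b d \<star> (e d b \<star> x) = x"
proof -
  show "e d b \<star> x \<in> V d l" by (rule V_mult[OF e_V x]) (use n in auto)
  have "e b d \<star> x = \<zero>\<^bsub>L\<^esub>" by (rule V_comm_regular[OF _ _ _ _ _ e_V x]) (use n in auto)
  then have "e b d \<star> (e d b \<star> x) = H b d \<star> x"
    using lie.jacobi_assoc_left[OF e_hom[OF n(1)], of "e d b" x] n V_carrier[OF x] by (simp add: H_def)
  then show "e b d \<star> (e d b \<star> x) = x" using H_left[of d b l x] n x by simp
qed

text \<open>In the exceptional case \<open>y = [e k d, y']\<close> with \<open>y'\<close> in the even root space \<open>V d l\<close>. All of \<open>V i j\<close> commutes with \<open>V d l\<close>, and it commutes with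
  the matrix unit \<open>e k d\<close> by the same argument applied to its own elements, because matrix units commute with one another.\<close>

lemma V_comm:
  assumes n: "i \<noteq> j" "k \<noteq> l" "j \<noteq> k" "i \<noteq> l" and x: "x \<in> V i j" and y: "y \<in> V k l"
  shows "x \<star> y = \<zero>\<^bsub>L\<^esub>"
proof (cases "exceptional i j k l")
  case True
  obtain d where d: "d \<noteq> j" "d \<noteq> l" "ipar d = ipar j" by (rule ex_same_block[OF card3])
  have dn: "k \<noteq> d" "i \<noteq> d" "d \<noteq> k" using d True by auto
  note f = exceptional_factor[OF y dn(1) d(2) n(2)]
  note fc = V_carrier[OF f(1)]
  have reg: "u \<star> v = \<zero>\<^bsub>L\<^esub>" if "u \<in> V i j" "v \<in> V d l" for u v
    by (rule V_comm_regular[OF _ _ _ _ _ that]) (use d dn n True in auto)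
  have unit: "e k d \<star> x = \<zero>\<^bsub>L\<^esub>"
  proof -
    obtain c where c: "c \<noteq> j" "c \<noteq> d" "ipar c = ipar j" by (rule ex_same_block[OF card3])
    have cn: "i \<noteq> c" "c \<noteq> i" "k \<noteq> c" using c True by auto
    note g = exceptional_factor[OF x cn(1) c(1) n(1)]
    have "e k d \<star> (e c i \<star> x) = \<zero>\<^bsub>L\<^esub>"
      by (rule V_comm_regular[OF _ _ _ _ _ e_V g(1)]) (use c cn d dn n True in auto)
    moreover have "e k d \<star> e i c = \<zero>\<^bsub>L\<^esub>" by (rule e_comm) (use c cn d dn n True in auto)
    ultimately show ?thesis
      using lie.jacobi_assoc_left[OF e_hom[OF dn(1)], of "e i c" "e c i \<star> x"] g(2) V_carrier[OF g(1)] cn dn by simp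
  qed
  have "x \<star> e k d = \<zero>\<^bsub>L\<^esub>"
    by (rule lie.gcomm_0[OF V_carrier[OF x] e_carrier[OF dn(1)]], rule lie.gcomm_sym[OF lie.gcomm_hom_left[OF e_hom[OF dn(1)]]])
      (use unit V_carrier[OF x] dn in auto)
  then have "x \<star> (e k d \<star> (e d k \<star> y)) = \<zero>\<^bsub>L\<^esub>"
    using lie.jacobi_assoc[OF V_carrier[OF x] e_carrier[OF dn(1)] fc gcommI[OF x f(1) reg]] fc by simp
  then show ?thesis using f(2) by simp
qed (use V_comm_regular n x y in blast)

lemma e_left:
  assumes n: "i \<noteq> j" "j \<noteq> k" "i \<noteq> k" and x: "x \<in> V j k" shows "e j i \<star> (e i j \<star> x) = x"
proof -
  have "e j i \<star> x = \<zero>\<^bsub>L\<^esub>" by (rule V_comm[OF _ _ _ _ e_V x]) (use n in auto)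
  then show ?thesis
    using lie.jacobi_assoc_left[OF e_hom[OF n(1)[symmetric]], of "e i j" x] H_left[OF n x] V_carrier[OF x] n
    by (simp add: H_def)
qed

lemma e_right:
  assumes n: "i \<noteq> j" "k \<noteq> j" "k \<noteq> i" and x: "x \<in> V k i" shows "(x \<star> e i j) \<star> e j i = x"
proof -
  have "x \<star> e j i = \<zero>\<^bsub>L\<^esub>" by (rule V_comm[OF _ _ _ _ x e_V]) (use n in auto)
  then have "(x \<star> e i j) \<star> e j i = x \<star> H i j"
    using lie.jacobi_assoc_right[OF e_hom[OF n(1)[symmetric]], of "e i j" x] V_carrier[OF x] n by (simp add: H_def)
  also have "\<dots> = x" using lie.skew_even[OF H_even[OF n(1)] V_carrier[OF x]] H_right[OF n x] V_carrier[OF x] by simp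
  finally show ?thesis .
qed

lemma matrix_units:
  assumes "o1 \<noteq> o2" "ipar o1 = 0" "ipar o2 = 0" shows "matrix_units L V e o1 o2"
  by (intro matrix_units.intro lie.lie_superalgebra_axioms matrix_units_axioms.intro card3 assms V_sub)
    ((rule V_graded V_mult V_comm e_V e_hom e_mult e_left e_right e_nonzero[OF assms(1)]; assumption)+)

end


subsection \<open>The lift of the diagonal matrices and of the matrix units\<close>

lemma (in lie_superalgebra) weight_add:
  assumes "t \<in> hcomp A 0" "x \<in> carrier A" "y \<in> carrier A" "t \<otimes> x = a \<odot> x" "t \<otimes> y = b \<odot> y"
  shows "t \<otimes> (x \<otimes> y) = (a + b) \<odot> (x \<otimes> y)"
  using jacobi_even[OF assms(1-3)] assms(2-) by (simp add: mult_smult_left mult_smult_right smult_add_l)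

lemma sl_center_ideal:
  assumes "3 \<le> CARD('n :: finite)"
  shows "super_ideal (sl :: ('f :: field, ('n, 'f) smat) superalgebra) scalar_matrices"
  using lie_superalgebra.center_ideal[OF steinberg.axioms(1)[OF sl_steinberg(1)[OF assms]]] center_sl[OF assms]
  by (metis (no_types))

locale A_grading = lie: lie_superalgebra L for L :: "('f :: field_char_0, 'v) superalgebra" +
  fixes G :: "'v set" and \<pi> :: "'v \<Rightarrow> ('n :: finite, 'f) smat set" and g h :: "'v set"
  assumes card3: "3 \<le> CARD('n)"
    and subalg: "subsuperalgebra G L"
    and cover: "central_cover (super_restrict L G) psl \<pi>"
    and lift: "even_lift (super_restrict L G) psl \<pi> g"
    and h: "h = {t \<in> g. \<pi> t \<in> cartan}"
    and weights: "direct_sum L (insert zero_weight roots) (weight_space L \<pi> h)"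
    and zero_gen: "weight_space L \<pi> h zero_weight
          = lspan L (\<Union>\<alpha>\<in>roots. {x \<otimes>\<^bsub>L\<^esub> y | x y.
              x \<in> weight_space L \<pi> h \<alpha> \<and> y \<in> weight_space L \<pi> h (neg_weight \<alpha>)})"
begin

abbreviation lbr (infixl \<open>\<star>\<close> 70) where "x \<star> y \<equiv> x \<otimes>\<^bsub>L\<^esub> y"
abbreviation "E (i :: 'n + 'n) j \<equiv> munit ground i j (1 :: 'f)"
abbreviation "W \<equiv> weight_space L \<pi> h"
abbreviation "J \<equiv> insert zero_weight roots :: (('n, 'f) smat set \<Rightarrow> 'f) set"

sublocale sl: steinberg "sl :: ('f, ('n, 'f) smat) superalgebra" ground "munit ground"
  by (rule sl_steinberg(1)[OF card3])

sublocale ctr: super_ideal "sl :: ('f, ('n, 'f) smat) superalgebra" scalar_matrices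
  by (rule sl_center_ideal[OF card3])

lemma G_sub: "submodule G scalars L" and G_mult: "x \<in> G \<Longrightarrow> y \<in> G \<Longrightarrow> x \<star> y \<in> G"
  using subalg by (auto simp: subsuperalgebra_def)

lemmas G_carrier = lie.sub_carrier[OF G_sub]

lemma pi_hom: "\<pi> \<in> super_hom (super_restrict L G) (super_quot sl scalar_matrices)"
  using cover by (simp add: central_cover_def central_extension_def psl_def)

lemmas pi_rules = hom_quot[OF lie.superalgebra_restrict[OF subalg] sl_center_ideal[OF card3] pi_hom, folded cls_def,
    unfolded super_restrict_simps sl_simps]

lemma pi_ex: "x \<in> G \<Longrightarrow> \<exists>X. supertrace X = 0 \<and> \<pi> x = cls X"
  using pi_rules(1)[of x] by auto

lemma pi_ex_hom: "x \<in> G \<Longrightarrow> x \<in> hcomp L p \<Longrightarrow> \<exists>X\<in>hcomp sl p. \<pi> x = cls X"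
  using pi_rules(2)[of x p] by auto

lemma pi_add: "\<lbrakk>x \<in> G; y \<in> G; supertrace X = 0; supertrace Y = 0; \<pi> x = cls X; \<pi> y = cls Y\<rbrakk>
    \<Longrightarrow> \<pi> (x \<oplus>\<^bsub>L\<^esub> y) = cls (\<lambda>i j. X i j + Y i j)"
  using pi_rules(3)[of x y X Y] by simp

lemma pi_mult: "\<lbrakk>x \<in> G; y \<in> G; supertrace X = 0; supertrace Y = 0; \<pi> x = cls X; \<pi> y = cls Y\<rbrakk>
    \<Longrightarrow> \<pi> (x \<star> y) = cls (supercommutator (mat_superalgebra ground) X Y)"
  using pi_rules(4)[of x y X Y] by simp

lemma pi_smult: "\<lbrakk>x \<in> G; supertrace X = 0; \<pi> x = cls X\<rbrakk> \<Longrightarrow> \<pi> (c \<odot>\<^bsub>L\<^esub> x) = cls (\<lambda>i j. c * X i j)"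
  using pi_rules(5)[of x X c] by simp

lemma pi_zero: "\<pi> \<zero>\<^bsub>L\<^esub> = cls (\<lambda>i j. 0)"
proof -
  have "(\<lambda>i j. 0) \<in> (scalar_matrices :: ('n, 'f) smat set)"
    unfolding scalar_matrices_eq by (rule image_eqI[of _ _ 0]) (auto simp: dg_def fun_eq_iff)
  then show ?thesis using pi_rules(6) ctr.coset_zero[of "\<lambda>i j. 0"] by (simp add: cls_def supertrace_def)
qed

lemma pi_diff:
  assumes "x \<in> G" "y \<in> G" "supertrace X = 0" "supertrace Y = 0" "\<pi> x = cls X" "\<pi> y = cls Y"
  shows "\<pi> (x \<ominus>\<^bsub>L\<^esub> y) = cls (\<lambda>i j. X i j - Y i j)"
proof -
  have "\<pi> (x \<oplus>\<^bsub>L\<^esub> (- 1) \<odot>\<^bsub>L\<^esub> y) = cls (\<lambda>i j. X i j + - 1 * Y i j)"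
    by (rule pi_add) (use assms pi_smult[OF assms(2,4,6), of "- 1"] lie.sub_smult[OF G_sub] in
        \<open>auto simp: supertrace_smult[of "- 1", simplified]\<close>)
  then show ?thesis using G_carrier[OF assms(2)] by (simp add: a_minus_def)
qed

lemma pi_eq_diff:
  assumes "x \<in> G" "y \<in> G" "\<pi> x = \<pi> y" shows "\<pi> (x \<ominus>\<^bsub>L\<^esub> y) = \<pi> \<zero>\<^bsub>L\<^esub>"
proof -
  obtain X where "supertrace X = 0" "\<pi> x = cls X" using pi_ex[OF assms(1)] by blast
  then show ?thesis using pi_diff[of x y X X] assms pi_zero by simp
qed

text \<open>The kernel is central in \<open>G\<close>, but nothing is known so far about its action on the rest of \<open>L\<close>.\<close>

lemma kernel_central:
  assumes "x \<in> G" "\<pi> x = \<pi> \<zero>\<^bsub>L\<^esub>" "y \<in> G" shows "x \<star> y = \<zero>\<^bsub>L\<^esub>"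
proof -
  have "\<pi> x = \<zero>\<^bsub>psl\<^esub>" using assms(2) pi_rules(6) by (simp add: zero_psl)
  then have "x \<in> a_kernel (super_restrict L G) psl \<pi>" using assms(1) by (simp add: a_kernel_def kernel_def)
  then have "x \<in> lie_center (super_restrict L G)"
    using cover unfolding central_cover_def central_extension_def by blast
  then show ?thesis using assms(3) by (simp add: lie_center_def)
qed

lemma g_facts:
  "submodule g scalars L" "x \<in> g \<Longrightarrow> x \<in> G" "x \<in> g \<Longrightarrow> x \<in> hcomp L 0"
  "x \<in> g \<Longrightarrow> y \<in> g \<Longrightarrow> x \<star> y \<in> g" "bij_betw \<pi> g (hcomp psl 0)"
proof -
  have "submodule g scalars (super_restrict L G)" "g \<subseteq> hcomp L 0 \<inter> G" "\<forall>x\<in>g. \<forall>y\<in>g. x \<star> y \<in> g"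
    and b: "bij_betw \<pi> g (hcomp psl 0)"
    using lift by (auto simp: even_lift_def)
  then show "submodule g scalars L" "x \<in> g \<Longrightarrow> x \<in> G" "x \<in> g \<Longrightarrow> x \<in> hcomp L 0"
    "x \<in> g \<Longrightarrow> y \<in> g \<Longrightarrow> x \<star> y \<in> g" "bij_betw \<pi> g (hcomp psl 0)"
    using lie.restrict_facts(5)[OF subalg, of g] by auto
qed

lemma g_inj: "x \<in> g \<Longrightarrow> y \<in> g \<Longrightarrow> \<pi> x = \<pi> y \<Longrightarrow> x = y"
  using g_facts(5) by (auto simp: bij_betw_def inj_on_def)

definition "lft X = inv_into g \<pi> (cls X)"

lemma lft:
  assumes "X \<in> hcomp sl 0" shows "lft X \<in> g" "\<pi> (lft X) = cls X"
proof -
  have "cls X \<in> \<pi> ` g" using g_facts(5) assms by (simp add: bij_betw_def hcomp_psl)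
  then show "lft X \<in> g" "\<pi> (lft X) = cls X" unfolding lft_def by (rule inv_into_into, rule f_inv_into_f)
qed

definition "t d = lft (dg d)"

lemma dg_hcomp: "d \<in> torus \<Longrightarrow> dg d \<in> hcomp sl 0"
  using torus_sl[of d] by (auto simp: dg_def)

lemma t: assumes "d \<in> torus" shows "t d \<in> g" "\<pi> (t d) = cls (dg d)"
  using lft[OF dg_hcomp[OF assms]] by (simp_all add: t_def)

lemma t_even: "d \<in> torus \<Longrightarrow> t d \<in> hcomp L 0" and t_G: "d \<in> torus \<Longrightarrow> t d \<in> G"
  and t_carrier: "d \<in> torus \<Longrightarrow> t d \<in> carrier L"
  using t(1) g_facts(2,3) G_carrier by blast+

text \<open>The projection is injective on \<open>g\<close>, so each element of the lifted Cartan subalgebra is determined by its diagonal.\<close>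

lemma h_eq: "h = t ` torus"
proof
  show "t ` torus \<subseteq> h" using t by (auto simp: h cartan_eq)
  show "h \<subseteq> t ` torus"
  proof
    fix x assume "x \<in> h"
    then obtain d where d: "x \<in> g" "d \<in> torus" "\<pi> x = cls (dg d)" by (auto simp: h cartan_eq)
    then have "x = t d" using g_inj[of x "t d"] t[OF d(2)] by simp
    then show "x \<in> t ` torus" using d(2) by (rule image_eqI)
  qed
qed

lemma W_iff: "x \<in> W \<alpha> \<longleftrightarrow> x \<in> carrier L \<and> (\<forall>d\<in>torus. t d \<star> x = \<alpha> (cls (dg d)) \<odot>\<^bsub>L\<^esub> x)"
  by (auto simp: weight_space_def h_eq t(2))

lemma W_sub: "submodule (W \<alpha>) scalars L"
  by (rule lie.submoduleI')
    (auto simp: W_iff t_carrier lie.mult_add_right lie.smult_add_r lie.mult_smult_right lie.smult_smult mult.commute)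

text \<open>Both \<open>t d\<close> and the scalar \<open>\<beta> d\<close> act on the components of \<open>x\<close> in the weight spaces, and components are unique. For each weight, some
  \<open>d\<close> tells it apart from \<open>\<beta>\<close>, so that the component vanishes.\<close>

lemma gap:
  assumes x: "x \<in> carrier L" and act: "\<And>d. d \<in> torus \<Longrightarrow> t d \<star> x = \<beta> d \<odot>\<^bsub>L\<^esub> x"
    and sep: "\<And>r s. \<exists>d\<in>torus. \<beta> d \<noteq> d r - d s"
  shows "x = \<zero>\<^bsub>L\<^esub>"
proof -
  have uniq: "f \<in> Pi\<^sub>E J W \<Longrightarrow> f' \<in> Pi\<^sub>E J W \<Longrightarrow> y \<in> carrier L \<Longrightarrow> y = (\<Oplus>\<^bsub>L\<^esub>j\<in>J. f j)
      \<Longrightarrow> y = (\<Oplus>\<^bsub>L\<^esub>j\<in>J. f' j) \<Longrightarrow> f = f'" for f f' y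
    using weights unfolding direct_sum_def by metis
  obtain f where f: "f \<in> Pi\<^sub>E J W" "x = (\<Oplus>\<^bsub>L\<^esub>j\<in>J. f j)"
    using weights x unfolding direct_sum_def by metis
  have fW: "f \<alpha> \<in> W \<alpha>" if "\<alpha> \<in> J" for \<alpha> using f(1) that by blast
  then have fc: "f \<alpha> \<in> carrier L" if "\<alpha> \<in> J" for \<alpha> using lie.sub_carrier[OF W_sub] that by blast
  have "f \<alpha> = \<zero>\<^bsub>L\<^esub>" if a: "\<alpha> \<in> J" for \<alpha>
  proof -
    have "\<exists>r s. \<forall>d\<in>torus. \<alpha> (cls (dg d)) = d r - d s"
    proof (cases "\<alpha> = zero_weight")
      case True
      then show ?thesis using zero_weight_cls by (metis diff_self)
    next
      case False
      then obtain r s where "\<alpha> = rt r s" using a by (auto simp: roots_eq)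
      then show ?thesis using rt_cls by metis
    qed
    then obtain d where d: "d \<in> torus" "\<alpha> (cls (dg d)) \<noteq> \<beta> d" using sep by metis
    define F where "F = restrict (\<lambda>\<alpha>. \<alpha> (cls (dg d)) \<odot>\<^bsub>L\<^esub> f \<alpha>) J"
    define F' where "F' = restrict (\<lambda>\<alpha>. \<beta> d \<odot>\<^bsub>L\<^esub> f \<alpha>) J"
    have "F = F'"
    proof (rule uniq)
      show "F \<in> Pi\<^sub>E J W" "F' \<in> Pi\<^sub>E J W" using lie.sub_smult[OF W_sub] fW by (auto simp: F_def F'_def)
      show "t d \<star> x \<in> carrier L" using t_carrier[OF d(1)] x by simp
      have "t d \<star> x = (\<Oplus>\<^bsub>L\<^esub>j\<in>J. t d \<star> f j)"
        unfolding f(2) by (rule lie.mult_finsum(1)) (use fc t_carrier[OF d(1)] in auto)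
      also have "\<dots> = (\<Oplus>\<^bsub>L\<^esub>j\<in>J. F j)"
        by (rule lie.M.finsum_cong') (use fW fc d W_iff in \<open>auto simp: F_def Pi_def\<close>)
      finally show "t d \<star> x = (\<Oplus>\<^bsub>L\<^esub>j\<in>J. F j)" .
      have "t d \<star> x = \<beta> d \<odot>\<^bsub>L\<^esub> (\<Oplus>\<^bsub>L\<^esub>j\<in>J. f j)" using act[OF d(1)] f(2) by simp
      also have "\<dots> = (\<Oplus>\<^bsub>L\<^esub>j\<in>J. \<beta> d \<odot>\<^bsub>L\<^esub> f j)"
        by (rule lie.additive_finsum) (use fc lie.smult_add_r in auto)
      also have "\<dots> = (\<Oplus>\<^bsub>L\<^esub>j\<in>J. F' j)"
        by (rule lie.M.finsum_cong') (use fc in \<open>auto simp: F'_def Pi_def\<close>)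
      finally show "t d \<star> x = (\<Oplus>\<^bsub>L\<^esub>j\<in>J. F' j)" .
    qed
    from fun_cong[OF this, of \<alpha>] have "\<alpha> (cls (dg d)) \<odot>\<^bsub>L\<^esub> f \<alpha> = \<beta> d \<odot>\<^bsub>L\<^esub> f \<alpha>" using a by (simp add: F_def F'_def)
    then have "(\<alpha> (cls (dg d)) - \<beta> d) \<odot>\<^bsub>L\<^esub> f \<alpha> = \<zero>\<^bsub>L\<^esub>"
      using lie.smult_add_l[of "f \<alpha>" "\<alpha> (cls (dg d))" "- \<beta> d"] lie.smult_neg[of "f \<alpha>" "\<beta> d"] fc[OF a] 
      by (simp add: lie.r_neg)
    then show ?thesis using lie.smult_eq_0[OF fc[OF a]] d(2) by fastforce
  qed
  then have "(\<Oplus>\<^bsub>L\<^esub>j\<in>J. f j) = (\<Oplus>\<^bsub>L\<^esub>j\<in>J. \<zero>\<^bsub>L\<^esub>)" by (intro lie.M.finsum_cong') auto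
  then show ?thesis using f(2) by simp
qed

lemma munit_sl: "i \<noteq> j \<Longrightarrow> supertrace (E i j) = 0"
  by (simp add: supertrace_munit)

lemma munit_hcomp: "i \<noteq> j \<Longrightarrow> E i j \<in> hcomp sl (ipar i + ipar j)"
  using sl.phi_hom[of i j 1 0] by simp

lemma dg_munit: "supercommutator (mat_superalgebra ground) (dg d) (E i j) = (\<lambda>r s. (d i - d j) * E i j r s)"
  unfolding dg_supercommutator by (auto simp: munit_ground fun_eq_iff)

lemma pi_t_act:
  assumes d: "d \<in> torus" and x: "x \<in> G" "\<pi> x = cls (E i j)" and ij: "i \<noteq> j"
  shows "\<pi> (t d \<star> x) = \<pi> ((d i - d j) \<odot>\<^bsub>L\<^esub> x)"
  using pi_mult[OF t_G[OF d] x(1) _ munit_sl[OF ij] t(2)[OF d] x(2)] torus_sl[OF d]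
    pi_smult[OF x(1) munit_sl[OF ij] x(2)] by (simp add: dg_munit)

lemma torus_sep: 
  assumes "i \<noteq> (j :: 'n + 'n)" obtains d :: "'n + 'n \<Rightarrow> 'f" where "d \<in> torus" "d i - d j = 1"
proof -
  obtain p where p: "p \<noteq> i" "p \<noteq> j" "ipar p = ipar i" by (rule ex_same_block[OF card3])
  from torus_diff[of i p, where 'f = 'f] show thesis by (rule that) (use p assms in \<open>auto simp: ind_def\<close>)
qed

lemma cls_self: "X \<in> cls X"
  unfolding cls_eq by (auto intro!: exI[of _ 0] simp: dg_def fun_eq_iff)

lemma odd_lift:
  assumes "X \<in> hcomp sl 1" obtains x where "x \<in> G" "x \<in> hcomp L 1" "\<pi> x = cls X"
proof -
  have X: "supertrace X = 0" using assms by simp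
  have "\<pi> ` G = carrier psl" using cover by (simp add: central_cover_def central_extension_def)
  then have "cls X \<in> \<pi> ` G" using X by (auto simp: carrier_psl)
  then obtain y where y: "y \<in> G" "\<pi> y = cls X" by auto
  note yc = G_carrier[OF y(1)]
  have hG: "hpart L p y \<in> G" for p using lie.restrict_facts(4)[OF subalg y(1)] .
  obtain Y where Y: "Y \<in> hcomp sl 0" "\<pi> (hpart L 0 y) = cls Y"
    using pi_ex_hom[OF hG lie.hpart_hcomp[OF yc, of 0]] by blast
  obtain Z where Z: "Z \<in> hcomp sl 1" "\<pi> (hpart L 1 y) = cls Z"
    using pi_ex_hom[OF hG lie.hpart_hcomp[OF yc, of 1]] by blast
  have "\<pi> y = cls (\<lambda>i j. Y i j + Z i j)"
    using pi_add[OF hG hG _ _ Y(2) Z(2)] Y(1) Z(1) lie.hpart_split(2)[OF yc, of 0] by simp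
  then have "X \<in> cls (\<lambda>i j. Y i j + Z i j)"
    using y(2) cls_self[of X] by simp
  then obtain c where c: "X = (\<lambda>i j. dg (\<lambda>_. c) i j + (Y i j + Z i j))" unfolding cls_eq by blast
  have "X i j = Z i j" for i j
  proof (cases "ipar i = ipar j")
    case True then show ?thesis using assms Z(1) by simp
  next
    case False
    then have "ipar i + ipar j = 1" "i \<noteq> j" by (cases "ipar i"; cases "ipar j"; auto)+
    then show ?thesis using fun_cong[OF fun_cong[OF c, of i], of j] Y(1) by (simp add: dg_def)
  qed
  then have "X = Z" by blast
  then show thesis using that[of "hpart L 1 y"] hG lie.hpart_hcomp[OF yc, of 1] Z(2) by simp
qed

text \<open>Within a block the lift lies in \<open>g\<close>, where elements are determined by their image. Between blocks, any odd lift is a weight vector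
  up to a central error; a bracket with an element of the torus on which the root takes the value \<open>1\<close> removes the error.\<close>

lemma unit_ex:
  assumes ij: "i \<noteq> j"
  shows "\<exists>x. x \<in> G \<and> x \<in> hcomp L (ipar i + ipar j) \<and> \<pi> x = cls (E i j) \<and> (same_block i j \<longrightarrow> x \<in> g)
    \<and> (\<forall>d\<in>torus. t d \<star> x = (d i - d j) \<odot>\<^bsub>L\<^esub> x)"
proof (cases "same_block i j")
  case True
  then have l: "lft (E i j) \<in> g" "\<pi> (lft (E i j)) = cls (E i j)" using lft[of "E i j"] munit_hcomp[OF ij] by auto
  have "t d \<star> lft (E i j) = (d i - d j) \<odot>\<^bsub>L\<^esub> lft (E i j)" if d: "d \<in> torus" for d
    by (rule g_inj[OF g_facts(4)[OF t(1)[OF d] l(1)] lie.sub_smult[OF g_facts(1) l(1)] pi_t_act[OF d g_facts(2)[OF l(1)] l(2) ij]])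
  then show ?thesis using l g_facts(2,3)[OF l(1)] True by (intro exI[of _ "lft (E i j)"]) simp
next
  case False
  then have "ipar i + ipar j = 1" by (cases "ipar i"; cases "ipar j") auto
  note p = this
  obtain x where x: "x \<in> G" "x \<in> hcomp L 1" "\<pi> x = cls (E i j)" using odd_lift munit_hcomp[OF ij] p by metis
  note xc = G_carrier[OF x(1)]
  obtain d0 :: "'n + 'n \<Rightarrow> 'f" where d0: "d0 \<in> torus" "d0 i - d0 j = 1" by (rule torus_sep[OF ij])
  have "\<pi> (t d0 \<star> x) = cls (E i j)" using pi_t_act[OF d0(1) x(1,3) ij] d0(2) xc x(3) by simp
  moreover have "t d \<star> (t d0 \<star> x) = (d i - d j) \<odot>\<^bsub>L\<^esub> (t d0 \<star> x)" if d: "d \<in> torus" for d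
  proof -
    let ?u = "t d \<star> x" and ?v = "(d i - d j) \<odot>\<^bsub>L\<^esub> x"
    have uv: "?u \<in> G" "?v \<in> G" using G_mult[OF t_G[OF d] x(1)] lie.sub_smult[OF G_sub x(1)] .
    note uvc = G_carrier[OF uv(1)] G_carrier[OF uv(2)]
    have "t d \<star> t d0 = \<zero>\<^bsub>L\<^esub>"
    proof (rule g_inj[OF g_facts(4)[OF t(1)[OF d] t(1)[OF d0(1)]] lie.sub_zero[OF g_facts(1)]])
      have "supercommutator (mat_superalgebra ground) (dg d) (dg d0) = (\<lambda>i j. 0)"
        unfolding dg_supercommutator by (auto simp: dg_def fun_eq_iff)
      then show "\<pi> (t d \<star> t d0) = \<pi> \<zero>\<^bsub>L\<^esub>"
        using pi_mult[OF t_G[OF d] t_G[OF d0(1)] _ _ t(2)[OF d] t(2)[OF d0(1)]] torus_sl[OF d] torus_sl[OF d0(1)] pi_zero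
        by simp
    qed
    moreover have "t d0 \<star> ?u = (d i - d j) \<odot>\<^bsub>L\<^esub> (t d0 \<star> x)"
    proof -
      \<comment> \<open>The error of the lift is in the kernel, which commutes with the torus.\<close>
      have "(?u \<ominus>\<^bsub>L\<^esub> ?v) \<star> t d0 = \<zero>\<^bsub>L\<^esub>"
        by (rule kernel_central[OF lie.sub_diff[OF G_sub uv] pi_eq_diff[OF uv pi_t_act[OF d x(1,3) ij]] t_G[OF d0(1)]])
      then have "t d0 \<star> (?u \<ominus>\<^bsub>L\<^esub> ?v) = \<zero>\<^bsub>L\<^esub>"
        using lie.skew_even[OF t_even[OF d0(1)], of "?u \<ominus>\<^bsub>L\<^esub> ?v"] uvc t_carrier[OF d0(1)]
          lie.minus_minus[of "t d0 \<star> (?u \<ominus>\<^bsub>L\<^esub> ?v)"] by simp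
      then have "t d0 \<star> ?u \<ominus>\<^bsub>L\<^esub> t d0 \<star> ?v = \<zero>\<^bsub>L\<^esub>"
        using lie.mult_diff(1)[OF t_carrier[OF d0(1)] uvc] by simp
      then show ?thesis
        using lie.diff_eq_0[of "t d0 \<star> ?u" "t d0 \<star> ?v"] uvc t_carrier[OF d0(1)] xc
        by (simp add: lie.mult_smult_right)
    qed
    ultimately show ?thesis
      using lie.jacobi_even[OF t_even[OF d] t_carrier[OF d0(1)] xc] xc t_carrier[OF d0(1)] by simp
  qed
  moreover have "t d0 \<star> x \<in> hcomp L 1" using lie.mult_graded[OF t_even[OF d0(1)] x(2)] by simp
  ultimately show ?thesis using G_mult[OF t_G[OF d0(1)] x(1)] p False by (intro exI[of _ "t d0 \<star> x"]) simp
qed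

definition "e i j = (SOME x. x \<in> G \<and> x \<in> hcomp L (ipar i + ipar j) \<and> \<pi> x = cls (E i j) \<and> (same_block i j \<longrightarrow> x \<in> g)
    \<and> (\<forall>d\<in>torus. t d \<star> x = (d i - d j) \<odot>\<^bsub>L\<^esub> x))"

lemma e:
  assumes "i \<noteq> j"
  shows "e i j \<in> G" "e i j \<in> hcomp L (ipar i + ipar j)" "\<pi> (e i j) = cls (E i j)" "same_block i j \<Longrightarrow> e i j \<in> g"
    "d \<in> torus \<Longrightarrow> t d \<star> e i j = (d i - d j) \<odot>\<^bsub>L\<^esub> e i j" "e i j \<in> carrier L"
  using someI_ex[OF unit_ex[OF assms]] G_carrier unfolding e_def[symmetric] by auto

text \<open>Identities between the lifted units hold modulo the kernel, which has weight zero, while both sides have a nonzero weight. So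
  they hold exactly.\<close>

lemma kernel_weight_zero:
  assumes u: "u \<in> G" "\<pi> u = \<pi> \<zero>\<^bsub>L\<^esub>" and d: "d \<in> torus" "t d \<star> u = c \<odot>\<^bsub>L\<^esub> u" "c \<noteq> 0"
  shows "u = \<zero>\<^bsub>L\<^esub>"
proof -
  note uc = G_carrier[OF u(1)]
  have "\<ominus>\<^bsub>L\<^esub> (t d \<star> u) = \<zero>\<^bsub>L\<^esub>"
    using kernel_central[OF u t_G[OF d(1)]] lie.skew_even[OF t_even[OF d(1)] uc] by simp
  then have "c \<odot>\<^bsub>L\<^esub> u = \<zero>\<^bsub>L\<^esub>"
    using d(2) uc lie.minus_minus[of "c \<odot>\<^bsub>L\<^esub> u"] by simp
  then show ?thesis using lie.smult_eq_0[OF uc] d(3) by blast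
qed

lemma pi_e_mult:
  assumes "i \<noteq> j" "k \<noteq> l"
  shows "\<pi> (e i j \<star> e k l) = cls (supercommutator (mat_superalgebra ground) (E i j) (E k l))"
  using pi_mult[OF e(1)[OF assms(1)] e(1)[OF assms(2)] munit_sl[OF assms(1)] munit_sl[OF assms(2)] e(3)[OF assms(1)] e(3)[OF assms(2)]] .

lemma e_weight_mult:
  assumes "i \<noteq> j" "k \<noteq> l" "d \<in> torus"
  shows "t d \<star> (e i j \<star> e k l) = ((d i - d j) + (d k - d l)) \<odot>\<^bsub>L\<^esub> (e i j \<star> e k l)"
  using lie.weight_add[OF t_even[OF assms(3)] e(6)[OF assms(1)] e(6)[OF assms(2)] e(5)[OF assms(1,3)] e(5)[OF assms(2,3)]] .

lemma e_mult:
  assumes n: "i \<noteq> j" "j \<noteq> k" "i \<noteq> k" shows "e i j \<star> e j k = e i k"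
proof -
  let ?u = "e i j \<star> e j k" and ?v = "e i k"
  have G: "?u \<in> G" "?v \<in> G" using G_mult[OF e(1)[OF n(1)] e(1)[OF n(2)]] e(1)[OF n(3)] .
  note c = G_carrier[OF G(1)] G_carrier[OF G(2)]
  obtain d :: "'n + 'n \<Rightarrow> 'f" where d: "d \<in> torus" "d i - d k = 1" by (rule torus_sep[OF n(3)])
  have "\<pi> ?u = \<pi> ?v" using pi_e_mult[OF n(1,2)] sl.phi_mult[OF n, of 1 1] e(3)[OF n(3)] by simp
  from pi_eq_diff[OF G this] have k: "\<pi> (?u \<ominus>\<^bsub>L\<^esub> ?v) = \<pi> \<zero>\<^bsub>L\<^esub>" .
  have w: "t d \<star> ?u = ?u"
    using e_weight_mult[OF n(1,2) d(1)] d(2) c by (simp add: algebra_simps)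
  have "t d \<star> ?v = ?v" using e(5)[OF n(3) d(1)] d(2) c by simp
  then have "t d \<star> (?u \<ominus>\<^bsub>L\<^esub> ?v) = 1 \<odot>\<^bsub>L\<^esub> (?u \<ominus>\<^bsub>L\<^esub> ?v)"
    using lie.mult_diff(1)[OF t_carrier[OF d(1)] c] w c by simp
  from kernel_weight_zero[OF lie.sub_diff[OF G_sub G] k d(1) this] have "?u \<ominus>\<^bsub>L\<^esub> ?v = \<zero>\<^bsub>L\<^esub>" by simp
  then show ?thesis using lie.diff_eq_0[OF c] by blast
qed

lemma e_comm:
  assumes n: "i \<noteq> j" "k \<noteq> l" "j \<noteq> k" "i \<noteq> l" shows "e i j \<star> e k l = \<zero>\<^bsub>L\<^esub>"
proof -
  let ?u = "e i j \<star> e k l"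
  have "\<exists>d\<in>torus. (d i - d j) + (d k - d l) \<noteq> (0 :: 'f)"
  proof (cases "i \<noteq> k \<and> j \<noteq> l \<and> same_block i k \<and> same_block j l \<and> \<not> same_block i j")
    case True
    obtain p where p: "p \<noteq> i" "p \<noteq> k" "ipar p = ipar i" by (rule ex_same_block[OF card3])
    show ?thesis
      by (rule bexI[OF _ torus_diff[of i p, where 'f = 'f]]) (use p True n in \<open>auto simp: ind_def\<close>)
  next
    case False
    then show ?thesis using root_relation_four[OF card3 n, of i i, where 'f = 'f] by (force simp: add_diff_eq)
  qed
  then obtain d :: "'n + 'n \<Rightarrow> 'f" where d: "d \<in> torus" "(d i - d j) + (d k - d l) \<noteq> 0" by blast
  have k: "\<pi> ?u = \<pi> \<zero>\<^bsub>L\<^esub>" using pi_e_mult[OF n(1,2)] sl.phi_comm[OF n, of 1 1] pi_zero by simp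
  show ?thesis
    by (rule kernel_weight_zero[OF G_mult[OF e(1)[OF n(1)] e(1)[OF n(2)]] k d(1) e_weight_mult[OF n(1,2) d(1)] d(2)])
qed

lemma e_coroot:
  assumes ij: "i \<noteq> j" "same_block i j" shows "e i j \<star> e j i = t (\<lambda>k. of_int (ind i k - ind j k))"
proof (rule g_inj)
  note d = torus_diff[OF ij(2), where 'f = 'f]
  show "e i j \<star> e j i \<in> g" using g_facts(4) e(4) ij by auto
  show "t (\<lambda>k. of_int (ind i k - ind j k)) \<in> g" by (rule t(1)[OF d])
  have "supercommutator (mat_superalgebra ground) (E i j) (E j i) = dg (\<lambda>k. of_int (ind i k - ind j k))"
    using ij unfolding ground_diag[OF ij(1)] by (auto simp: fun_eq_iff munit_ground dg_def ind_def)
  then show "\<pi> (e i j \<star> e j i) = \<pi> (t (\<lambda>k. of_int (ind i k - ind j k)))"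
    using pi_e_mult[OF ij(1) ij(1)[symmetric]] t(2)[OF d] by simp
qed

lemma e_nonzero: assumes ij: "i \<noteq> j" shows "e i j \<noteq> \<zero>\<^bsub>L\<^esub>"
proof
  assume "e i j = \<zero>\<^bsub>L\<^esub>"
  then have "E i j \<in> cls (\<lambda>i j. 0)"
    using e(3)[OF ij] pi_zero cls_self[of "E i j"] by simp
  then obtain c where "E i j = (\<lambda>i j. dg (\<lambda>_. c) i j + 0)" unfolding cls_eq by blast
  from fun_cong[OF fun_cong[OF this, of i], of j] show False using ij by (simp add: munit_ground dg_def)
qed

lemma graded_units: "graded_units L t e"
  by (intro graded_units.intro lie.lie_superalgebra_axioms graded_units_axioms.intro card3 t_even e e_mult e_comm
      e_coroot e_nonzero) (assumption | (rule gap; assumption))+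

lemma V_eq: "graded_units.V L t i j = W (rt i j)"
  unfolding graded_units.V_def[OF graded_units] by (auto simp: W_iff rt_cls)

text \<open>The root spaces are spanned by the coordinates, and the weight space of zero by their brackets; so the coordinates on \<open>L\<close> generate,
  as those on the matrix superalgebra do.\<close>

theorem isogenous_matrix_algebra:
  "\<exists>A :: ('f, 'v) superalgebra. unital_assoc_superalgebra A \<and> centrally_isogenous L (sl_over TYPE('n) A)"
proof -
  obtain o1 :: "'n + 'n" where o1: "ipar o1 = 0" using ex_same_block[OF card3] by metis
  obtain o2 :: "'n + 'n" where o2: "o2 \<noteq> o1" "o2 \<noteq> o1" "ipar o2 = 0" by (rule ex_same_block[OF card3])
  interpret mu: matrix_units L "graded_units.V L t" e o1 o2
    by (rule graded_units.matrix_units[OF graded_units]) (use o1 o2 in auto)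
  interpret A: unital_assoc_superalgebra mu.coord by (rule mu.coord_unital_assoc)
  interpret s: steinberg L mu.coord mu.\<phi> by (rule mu.coord_steinberg)
  interpret m: steinberg "sl_over TYPE('n) mu.coord" mu.coord "munit mu.coord"
    by (rule A.sl_over_steinberg(1)[OF card3])
  let ?T = "\<lambda>(_ :: 'n + 'n) (_ :: 'n + 'n). True"
  have img: "x \<in> W (rt i j) \<Longrightarrow> \<exists>a\<in>carrier mu.coord. x = mu.\<phi> i j a" if "i \<noteq> j" for i j x
    using mu.phi_image[OF that] unfolding V_eq by blast
  have root: "W (rt i j) \<subseteq> s.gen_span ?T" if ij: "i \<noteq> j" for i j
  proof
    fix x assume "x \<in> W (rt i j)"
    then obtain a where a: "a \<in> carrier mu.coord" "x = mu.\<phi> i j a" using img[OF ij] by blast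
    show "x \<in> s.gen_span ?T" unfolding a(2) by (rule s.phi_in_gen[OF ij _ a(1)]) simp
  qed
  have zero: "W zero_weight \<subseteq> s.gen_span ?T"
    unfolding zero_gen
  proof (rule lie.lspan_least[OF s.gen_sub], safe)
    fix \<alpha> x y assume "\<alpha> \<in> roots" and xy: "x \<in> W \<alpha>" "y \<in> W (neg_weight \<alpha>)"
    then obtain i j where ij: "i \<noteq> j" "\<alpha> = rt i j" by (auto simp: roots_eq)
    obtain a where a: "a \<in> carrier mu.coord" "x = mu.\<phi> i j a" using img[OF ij(1)] xy(1) ij(2) by blast
    obtain b where b: "b \<in> carrier mu.coord" "y = mu.\<phi> j i b"
      using img[OF ij(1)[symmetric]] xy(2) unfolding ij(2) neg_weight_rt by blast
    show "x \<otimes>\<^bsub>L\<^esub> y \<in> s.gen_span ?T"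
      unfolding a(2) b(2) by (rule subsetD[OF s.diag_le_gen s.diag_in[OF ij(1) _ a(1) b(1)]]) simp
  qed
  have sgen: "s.generated"
    unfolding s.generated_def
  proof
    show "s.gen_span ?T \<subseteq> carrier L" using lie.sub_carrier[OF s.gen_sub] by blast
    show "carrier L \<subseteq> s.gen_span ?T"
    proof
      fix x assume "x \<in> carrier L"
      then obtain f where f: "f \<in> Pi\<^sub>E J W" "x = (\<Oplus>\<^bsub>L\<^esub>j\<in>J. f j)"
        using weights unfolding direct_sum_def by metis
      have "f \<alpha> \<in> s.gen_span ?T" if "\<alpha> \<in> J" for \<alpha>
      proof (cases "\<alpha> = zero_weight")
        case True then show ?thesis using f(1) zero by auto
      next
        case False
        then obtain i j where ij: "i \<noteq> j" "\<alpha> = rt i j" using \<open>\<alpha> \<in> J\<close> by (auto simp: roots_eq)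
        have "f \<alpha> \<in> W \<alpha>" using f(1) that by blast
        then show ?thesis using root[OF ij(1)] ij(2) by auto
      qed
      then show "x \<in> s.gen_span ?T" unfolding f(2) by (intro lie.sub_finsum[OF s.gen_sub]) auto
    qed
  qed
  note mgen = A.sl_over_steinberg(2)[OF card3]
  have "steinberg_pair L (sl_over TYPE('n) mu.coord) mu.coord mu.\<phi> (munit mu.coord)"
    by (intro steinberg_pair.intro steinberg_pair_axioms.intro s.steinberg_axioms m.steinberg_axioms sgen mgen)
  from steinberg_central_quotient[OF this]
  have "super_isomorphic (super_quot L (lie_center L))
      (super_quot (sl_over TYPE('n) mu.coord) (lie_center (sl_over TYPE('n) mu.coord)))"
    using isomorphic_quotients_iff[OF lie.lie_superalgebra_axioms m.lie.lie_superalgebra_axioms] by blast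
  then have "centrally_isogenous L (sl_over TYPE('n) mu.coord)"
    unfolding centrally_isogenous_def using s.generated_perfect[OF sgen] m.generated_perfect[OF mgen] by blast
  then show ?thesis using A.unital_assoc_superalgebra_axioms by blast
qed

end

theorem graded_imp_centrally_isogenous:
  fixes L :: "('f :: field_char_0, 'v) superalgebra"
  assumes card: "3 \<le> CARD('n :: finite)" and L: "lie_superalgebra L" and graded: "A_graded TYPE('n) L"
  shows "\<exists>A :: ('f, 'v) superalgebra. unital_assoc_superalgebra A \<and> centrally_isogenous L (sl_over TYPE('n) A)"
  using graded unfolding A_graded_def
  by (elim exE conjE, intro A_grading.isogenous_matrix_algebra A_grading.intro A_grading_axioms.intro)
    (rule L card | assumption)+

section \<open>Recognition of the graded Lie superalgebras\<close>

theorem theorem4p7: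
  fixes n :: nat
  assumes "CARD('n :: finite) = n + 1" and "n \<ge> 2"
  shows "(\<forall>L :: ('f :: field_char_0, 'v) superalgebra.
           lie_superalgebra L \<and> A_graded TYPE('n) L \<longrightarrow>
             (\<exists>A :: ('f, 'v) superalgebra.
                unital_assoc_superalgebra A \<and> centrally_isogenous L (sl_over TYPE('n) A)))
         \<and> (\<forall>(A :: ('f, 'a) superalgebra) (L :: ('f, 'w) superalgebra).
           unital_assoc_superalgebra A \<and> lie_superalgebra L
             \<and> centrally_isogenous L (sl_over TYPE('n) A) \<longrightarrow>
             A_graded TYPE('n) L)"
proof -
  have card: "3 \<le> CARD('n)" using assms by simp
  show ?thesis
    using graded_imp_centrally_isogenous[OF card] centrally_isogenous_imp_graded[OF card] by blast
qed

end
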